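(* Let $u$ be an infinite Blaschke product, let $(A_n)\in\mathcal S(\mathcal T_u(C))$ and let $A=\operatorname{s-lim}A_nP_{u_n}$. Then (a) $(A_n)$ is a Fredholm sequence if and only if $A$ is a Fredholm operator on $K^2_u$; (b) if $A$ is Fredholm and $\dim\ker A=k$, then $\liminf_{n\to\infty}\sigma_{k+1}(A_n)>0$ and, if $k\ge1$, $\lim_{n\to\infty}\sigma_k(A_n)=0$.
   Context: $\mathbb T$ is the unit circle, $H^2\subset L^2(\mathbb T)$ the Hardy space, $P$ the orthogonal projection onto $H^2$, $M_a$ multiplication by $a$. For an inner function $v$, $K^2_v:=H^2\ominus vH^2$ and $P_v=P-M_vPM_{\bar v}$ is the orthogonal projection onto $K^2_v$. For $a\in L^\infty(\mathbb T)$, $T_u(a):=P_uM_a|_{K^2_u}$. Blaschke factors: $b_0(z)=z$, $b_\lambda(z)=\frac{\lambda-z}{1-\bar\lambda z}\frac{|\lambda|}{\lambda}$ for $\lambda\ne0$. An infinite Blaschke product is $u=\prod_{k\ge1}b_{\lambda_k}$ with $|\lambda_k|\le|\lambda_{k+1}|$ and $\sum_k(1-|\lambda_k|)<\infty$; $u_n:=\prod_{k=1}^nb_{\lambda_k}$, and $P_{u_n}$ is the orthogonal projection onto $K^2_{u_n}\subseteq K^2_u$. $\mathcal F^{\mathcal P_u}$ is the $C^*$-algebra (entrywise operations, supremum norm) of sequences $(A_n)$, $A_n:\operatorname{im}P_{u_n}\to\operatorname{im}P_{u_n}$, with $A_nP_{u_n}$ $^*$-strongly convergent; $\mathcal G^{\mathcal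 P_u}$ is its ideal of sequences with $\|A_n\|\to0$. $\mathcal S(\mathcal T_u(C))$ is the smallest closed subalgebra of $\mathcal F^{\mathcal P_u}$ containing all $(P_{u_n}(T_u(a)+K)P_{u_n})$ with $a\in C(\mathbb T)$, $K$ compact on $K^2_u$. Let $\mathcal J:=\{(P_{u_n}KP_{u_n}+G_n):K\text{ compact on }K^2_u,\ (G_n)\in\mathcal G^{\mathcal P_u}\}$, a closed ideal of $\mathcal S(\mathcal T_u(C))$. A sequence $(A_n)\in\mathcal S(\mathcal T_u(C))$ is a Fredholm sequence if its coset $(A_n)+\mathcal J$ is invertible in $\mathcal S(\mathcal T_u(C))/\mathcal J$. For a linear operator $B$ on a space of finite dimension $d$, $\sigma_1(B)\le\sigma_2(B)\le\dots\le\sigma_d(B)=\|B\|$ are its singular values (nonnegative square roots of the eigenvalues of $B^*B$, with multiplicity). *)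

theory Defs
  imports "HOL-Analysis.Analysis" "HOL-Library.Function_Algebras" "HOL-Library.Multiset"
begin

section \<open>L^2(T) realised via Fourier coefficients: sequences indexed by the integers\<close>

type_synonym seqv = "int \<Rightarrow> complex"
type_synonym lop = "seqv \<Rightarrow> seqv"

definition cscale :: "complex \<Rightarrow> seqv \<Rightarrow> seqv" where
  "cscale c f = (\<lambda>n. c * f n)"

lemma vector_space_cscale: "vector_space cscale"
  by unfold_locales (auto simp: cscale_def fun_eq_iff algebra_simps)

definition cdim :: "seqv set \<Rightarrow> nat" where
  "cdim S = vector_space.dim cscale S"

definition findim :: "seqv set \<Rightarrow> bool" where
  "findim S \<longleftrightarrow> (\<exists>B. finite B \<and> S \<subseteq> module.span cscale B)"

definition l2 :: "seqv \<Rightarrow> bool" where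
  "l2 f \<longleftrightarrow> (\<lambda>n. (cmod (f n))\<^sup>2) summable_on UNIV"

definition l2norm :: "seqv \<Rightarrow> real" where
  "l2norm f = sqrt (infsum (\<lambda>n. (cmod (f n))\<^sup>2) UNIV)"

definition l2inner :: "seqv \<Rightarrow> seqv \<Rightarrow> complex" where
  "l2inner f g = infsum (\<lambda>n. f n * cnj (g n)) UNIV"

definition l2conv :: "(nat \<Rightarrow> seqv) \<Rightarrow> seqv \<Rightarrow> bool" where
  "l2conv x y \<longleftrightarrow> l2 y \<and> (\<lambda>n. l2norm (x n - y)) \<longlonglongrightarrow> 0"

text \<open>Multiplication operators act on Fourier coefficients by convolution.\<close>
definition conv :: "seqv \<Rightarrow> lop" where
  "conv c f = (\<lambda>n. infsum (\<lambda>k. c (n - k) * f k) UNIV)"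

definition hproj :: lop where
  "hproj f = (\<lambda>n. if 0 \<le> n then f n else 0)"

definition hardy :: "seqv set" where
  "hardy = {f. l2 f \<and> (\<forall>n<0. f n = 0)}"

definition fourier :: "(complex \<Rightarrow> complex) \<Rightarrow> seqv" where
  "fourier a k = integral {0..2*pi} (\<lambda>t. a (cis t) * cis (- (of_int k * t))) / complex_of_real (2*pi)"

text \<open>Fourier coefficients of the boundary function of a bounded analytic function
  on the disc = its Taylor coefficients at 0\<close>
definition taylor :: "(complex \<Rightarrow> complex) \<Rightarrow> seqv" where
  "taylor v k = (if k < 0 then 0 else (deriv ^^ nat k) v 0 / of_nat (fact (nat k)))"

definition mult_op :: "(complex \<Rightarrow> complex) \<Rightarrow> lop" where
  "mult_op a = conv (fourier a)"

definition mult_inner :: "(complex \<Rightarrow> complex) \<Rightarrow> lop" where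
  "mult_inner v = conv (taylor v)"

definition mult_inner_conj :: "(complex \<Rightarrow> complex) \<Rightarrow> lop" where
  "mult_inner_conj v = conv (\<lambda>k. cnj (taylor v (- k)))"

definition model_proj :: "(complex \<Rightarrow> complex) \<Rightarrow> lop" where
  "model_proj v f = hproj f - mult_inner v (hproj (mult_inner_conj v f))"

definition K2 :: "(complex \<Rightarrow> complex) \<Rightarrow> seqv set" where
  "K2 v = {f \<in> hardy. \<forall>g\<in>hardy. l2inner f (mult_inner v g) = 0}"

definition toeplitz :: "(complex \<Rightarrow> complex) \<Rightarrow> (complex \<Rightarrow> complex) \<Rightarrow> lop" where
  "toeplitz u a f = model_proj u (mult_op a f)"

definition blaschke_factor :: "complex \<Rightarrow> complex \<Rightarrow> complex" where
  "blaschke_factor l z = (if l = 0 then z else (l - z) / (1 - cnj l * z) * (complex_of_real (cmod l) / l))"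

text \<open>lam k is the zero lambda_{k+1} of the paper (0-based indexing)\<close>
definition blaschke_seq :: "(nat \<Rightarrow> complex) \<Rightarrow> bool" where
  "blaschke_seq lam \<longleftrightarrow> (\<forall>k. cmod (lam k) < 1) \<and> (\<forall>k. cmod (lam k) \<le> cmod (lam (Suc k)))
      \<and> summable (\<lambda>k. 1 - cmod (lam k))"

definition bprod :: "(nat \<Rightarrow> complex) \<Rightarrow> complex \<Rightarrow> complex" where
  "bprod lam z = prodinf (\<lambda>k. blaschke_factor (lam k) z)"

definition bpartial :: "(nat \<Rightarrow> complex) \<Rightarrow> nat \<Rightarrow> complex \<Rightarrow> complex" where
  "bpartial lam n z = (\<Prod>k<n. blaschke_factor (lam k) z)"

definition is_bop :: "seqv set \<Rightarrow> lop \<Rightarrow> bool" where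
  "is_bop V A \<longleftrightarrow> (\<forall>x\<in>V. A x \<in> V) \<and> (\<forall>x\<in>V. \<forall>y\<in>V. A (x + y) = A x + A y)
     \<and> (\<forall>c. \<forall>x\<in>V. A (cscale c x) = cscale c (A x))
     \<and> (\<exists>C. \<forall>x\<in>V. l2norm (A x) \<le> C * l2norm x)"

definition opnorm :: "seqv set \<Rightarrow> lop \<Rightarrow> real" where
  "opnorm V A = Sup ((\<lambda>x. l2norm (A x)) ` {x\<in>V. l2norm x \<le> 1})"

definition compact_op :: "seqv set \<Rightarrow> lop \<Rightarrow> bool" where
  "compact_op V K \<longleftrightarrow> is_bop V K \<and>
     (\<forall>x::nat \<Rightarrow> seqv. (\<forall>n. x n \<in> V) \<and> (\<exists>B. \<forall>n. l2norm (x n) \<le> B) \<longrightarrow>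
        (\<exists>r y. strict_mono r \<and> l2conv (\<lambda>n. K (x (r n))) y))"

definition adjoint :: "seqv set \<Rightarrow> lop \<Rightarrow> lop" where
  "adjoint V A y = (THE z. z \<in> V \<and> (\<forall>x\<in>V. l2inner (A x) y = l2inner x z))"

definition fredholm_op :: "seqv set \<Rightarrow> lop \<Rightarrow> bool" where
  "fredholm_op V A \<longleftrightarrow> is_bop V A \<and> findim {x\<in>V. A x = 0}
     \<and> (\<forall>x y. (\<forall>n. x n \<in> A ` V) \<and> l2conv x y \<longrightarrow> y \<in> A ` V)
     \<and> findim {y\<in>V. \<forall>x\<in>V. l2inner (A x) y = 0}"

type_synonym opseq = "nat \<Rightarrow> lop"

definition Fseq :: "(nat \<Rightarrow> complex) \<Rightarrow> opseq set" where
  "Fseq lam = {As. (\<forall>n. is_bop (K2 (bpartial lam n)) (As n)) \<and>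
     (\<forall>x\<in>K2 (bprod lam).
        (\<exists>y. l2conv (\<lambda>n. As n (model_proj (bpartial lam n) x)) y) \<and>
        (\<exists>y. l2conv (\<lambda>n. adjoint (K2 (bpartial lam n)) (As n) (model_proj (bpartial lam n) x)) y))}"

definition seqdist :: "(nat \<Rightarrow> complex) \<Rightarrow> opseq \<Rightarrow> opseq \<Rightarrow> real" where
  "seqdist lam A B = (SUP n. opnorm (K2 (bpartial lam n)) (\<lambda>x. A n x - B n x))"

definition sadd :: "opseq \<Rightarrow> opseq \<Rightarrow> opseq" where "sadd A B = (\<lambda>n x. A n x + B n x)"
definition sminus :: "opseq \<Rightarrow> opseq \<Rightarrow> opseq" where "sminus A B = (\<lambda>n x. A n x - B n x)"
definition ssmult :: "complex \<Rightarrow> opseq \<Rightarrow> opseq" where "ssmult c A = (\<lambda>n x. cscale c (A n x))"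
definition scomp :: "opseq \<Rightarrow> opseq \<Rightarrow> opseq" where "scomp A B = (\<lambda>n x. A n (B n x))"
definition sid :: opseq where "sid = (\<lambda>n x. x)"

definition gens :: "(nat \<Rightarrow> complex) \<Rightarrow> opseq set" where
  "gens lam = {As. \<exists>a K. continuous_on (sphere 0 1) a \<and> compact_op (K2 (bprod lam)) K \<and>
      As = (\<lambda>n x. model_proj (bpartial lam n) (toeplitz (bprod lam) a x + K x))}"

definition closed_subalg :: "(nat \<Rightarrow> complex) \<Rightarrow> opseq set \<Rightarrow> bool" where
  "closed_subalg lam X \<longleftrightarrow> X \<subseteq> Fseq lam
     \<and> (\<forall>A\<in>X. \<forall>B\<in>X. sadd A B \<in> X \<and> scomp A B \<in> X)
     \<and> (\<forall>c. \<forall>A\<in>X. ssmult c A \<in> X)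
     \<and> (\<forall>A\<in>Fseq lam. (\<forall>e>0. \<exists>B\<in>X. seqdist lam A B < e) \<longrightarrow> A \<in> X)"

definition Salg :: "(nat \<Rightarrow> complex) \<Rightarrow> opseq set" where
  "Salg lam = \<Inter>{X. closed_subalg lam X \<and> gens lam \<subseteq> X}"

definition Jideal :: "(nat \<Rightarrow> complex) \<Rightarrow> opseq set" where
  "Jideal lam = {As. \<exists>K G. compact_op (K2 (bprod lam)) K
      \<and> (\<forall>n. is_bop (K2 (bpartial lam n)) (G n))
      \<and> (\<lambda>n. opnorm (K2 (bpartial lam n)) (G n)) \<longlonglongrightarrow> 0
      \<and> (\<forall>n. \<forall>x\<in>K2 (bpartial lam n). As n x = model_proj (bpartial lam n) (K x) + G n x)}"

definition fred_seq :: "(nat \<Rightarrow> complex) \<Rightarrow> opseq \<Rightarrow> bool" where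
  "fred_seq lam A \<longleftrightarrow> A \<in> Salg lam \<and>
     (\<exists>B\<in>Salg lam. sminus (scomp A B) sid \<in> Jideal lam \<and> sminus (scomp B A) sid \<in> Jideal lam)"

definition slim :: "(nat \<Rightarrow> complex) \<Rightarrow> opseq \<Rightarrow> lop" where
  "slim lam As x = (THE y. l2conv (\<lambda>n. As n (model_proj (bpartial lam n) x)) y)"

text \<open>eigenspace of B^*B for eigenvalue mu, on the space V: B^*B x = mu x written out\<close>
definition eig_space :: "seqv set \<Rightarrow> lop \<Rightarrow> real \<Rightarrow> seqv set" where
  "eig_space V B mu = {x\<in>V. \<forall>y\<in>V. l2inner (B x) (B y) = complex_of_real mu * l2inner x y}"

definition eig_mset :: "seqv set \<Rightarrow> lop \<Rightarrow> real multiset" where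
  "eig_mset V B = (\<Sum>mu\<in>{mu. 0 < cdim (eig_space V B mu)}. replicate_mset (cdim (eig_space V B mu)) mu)"

text \<open>sval V B j = sigma_j(B), j = 1..dim V, increasing order\<close>
definition sval :: "seqv set \<Rightarrow> lop \<Rightarrow> nat \<Rightarrow> real" where
  "sval V B j = sqrt (sorted_list_of_multiset (eig_mset V B) ! (j - 1))"

end

theory Submission
  imports Defs "HOL-Complex_Analysis.Complex_Analysis"
begin

text \<open>
  Let \<open>P\<^sub>n\<close> and \<open>P\<close> be the orthogonal projections onto the model spaces of the partial products
  \<open>u\<^sub>n\<close> and of \<open>u\<close>. The compressed shift \<open>S\<close> satisfies \<open>P\<^sub>n S (P - P\<^sub>n) = 0\<close>, since model spaces
  are invariant under the backward shift, while \<open>(P - P\<^sub>n) S P\<^sub>n\<close> has rank one and norm at most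
  \<open>\<parallel>P u\<^sub>n\<parallel>\<close>, which tends to \<open>\<parallel>P u\<parallel> = 0\<close> because \<open>u\<^sub>n\<close> converges to \<open>u\<close> in \<open>L\<^sup>2\<close>. So \<open>S\<close>, its
  adjoint and the compact operators, and hence all \<open>T\<^sub>u(a) + K\<close>, commute with \<open>P\<^sub>n\<close> up to norm-null
  sequences, and every sequence of the algebra is \<open>A\<^sub>n = P\<^sub>n A P\<^sub>n + G\<^sub>n\<close> with \<open>\<parallel>G\<^sub>n\<parallel> \<rightarrow> 0\<close>. Conversely the
  algebra contains all null sequences. Modulo \<open>J\<close> the sequence is therefore determined by \<open>A\<close> modulo
  compact operators, and a Fredholm operator \<open>A\<close> has a regularizer in the closed algebra generated by
  \<open>A\<close>, its adjoint and the compact operators; this is (a).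

  For (b), a Fredholm \<open>A\<close> is bounded below on the complement of its kernel, and the commutators
  \<open>[A, P\<^sub>n]\<close> tend to 0, so for large \<open>n\<close> the \<open>A\<^sub>n\<close> are uniformly bounded below on the vectors orthogonal
  to the \<open>k\<close>-dimensional kernel of \<open>A\<close>, whereas \<open>A\<^sub>n P\<^sub>n e \<rightarrow> A e = 0\<close> for \<open>e\<close> in that kernel. The min-max
  principle turns this into the statements on singular values.
\<close>

section \<open>Hilbert space preliminaries\<close>

text \<open>The inverse of a coset has to be found inside \<open>Salg\<close>, the smallest closed
  algebra, whose generation uses no adjoints. The generators are stable under adjoints, so it is
  enough to treat operators \<open>A\<close> such that the compressions of both \<open>A\<close> and
  \<open>adj A\<close> lie in the algebra (\<open>TTs\<close>). A regularizer is
  \<open>adj A\<close> times the inverse of a positive operator, and that inverse is a fixed point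
  of a contraction of the closed set \<open>TTs\<close>, so it stays in the algebra by construction.
  Compression is multiplicative only up to null sequences; hence \<open>TTs\<close> is known to be
  an algebra only after all null sequences have been produced in \<open>Salg\<close>, and these are
  obtained from the compact generators. A second obstacle is that \<open>u\<close> need not be
  continuous on the circle: multiplication by \<open>u\<close> is the strong limit of the
  multiplications by the partial products and is recognised through Taylor coefficients at 0.
  Operators on the varying model spaces are extended by 0 to one fixed Hilbert space, where they can
  be compared in norm.\<close>

lemma orthogonal_projection_exists:
  fixes S :: "'a::{real_inner,complete_space} set"
  assumes "closed S" "subspace S"
  obtains y where "y \<in> S" "\<And>z. z \<in> S \<Longrightarrow> (x - y) \<bullet> z = 0"
proof -
  define D where "D = (\<lambda>z. (norm (x - z))\<^sup>2) ` S"
  define \<delta> where "\<delta> = Inf D"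
  have S0: "0 \<in> S" using assms(2) by (simp add: subspace_0)
  have Dne: "D \<noteq> {}" using S0 by (auto simp: D_def)
  have Dbdd: "bdd_below D" by (rule bdd_belowI[of _ 0]) (auto simp: D_def)
  have \<delta>le: "\<delta> \<le> (norm (x - z))\<^sup>2" if "z \<in> S" for z
    unfolding \<delta>_def using that by (intro cInf_lower Dbdd) (auto simp: D_def)
  have "\<exists>z\<in>S. (norm (x - z))\<^sup>2 < \<delta> + inverse (real (Suc n))" for n
  proof -
    have "Inf D < \<delta> + inverse (real (Suc n))" by (simp add: \<delta>_def)
    then show ?thesis using cInf_less_iff[OF Dne Dbdd] by (auto simp: D_def)
  qed
  then obtain y where y: "\<And>n. y n \<in> S" "\<And>n. (norm (x - y n))\<^sup>2 < \<delta> + inverse (real (Suc n))"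
    by metis
  \<comment> \<open>Parallelogram law: the midpoint of \<open>y m\<close> and \<open>y n\<close>
    lies in \<open>S\<close>, so its squared distance from \<open>x\<close> is at least
    \<open>\<delta>\<close>, and only the two excesses over \<open>\<delta>\<close> remain for the
    difference.\<close>
  have par: "(norm (y m - y n))\<^sup>2 \<le> 2 * inverse (real (Suc m)) + 2 * inverse (real (Suc n))" for m n
  proof -
    have "(1/2) *\<^sub>R (y m + y n) \<in> S" using y assms(2) by (simp add: subspace_add subspace_scale)
    from \<delta>le[OF this] have 1: "4 * \<delta> \<le> (norm (2 *\<^sub>R (x - (1/2) *\<^sub>R (y m + y n))))\<^sup>2"
      by (simp add: power_mult_distrib)
    have "2 *\<^sub>R (x - (1/2) *\<^sub>R (y m + y n)) = (x - y m) + (x - y n)"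
      by (simp add: algebra_simps scaleR_2)
    with 1 have 2: "4 * \<delta> \<le> (norm ((x - y m) + (x - y n)))\<^sup>2" by simp
    have 3: "y m - y n = (x - y n) - (x - y m)" by simp
    have "(norm (y m - y n))\<^sup>2 + (norm ((x - y m) + (x - y n)))\<^sup>2 =
        2 * (norm (x - y m))\<^sup>2 + 2 * (norm (x - y n))\<^sup>2"
      unfolding 3 power2_norm_eq_inner by (simp add: inner_simps inner_commute)
    then show ?thesis using 2 y(2)[of m] y(2)[of n] by linarith
  qed
  have "Cauchy y"
  proof (rule CauchyI)
    fix e :: real assume e: "e > 0"
    obtain N where N: "inverse (real (Suc N)) < e\<^sup>2 / 4"
      using reals_Archimedean[of "e\<^sup>2 / 4"] e by auto
    show "\<exists>M. \<forall>m\<ge>M. \<forall>n\<ge>M. norm (y m - y n) < e"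
    proof (intro exI allI impI)
      fix m n assume mn: "N \<le> m" "N \<le> n"
      have "inverse (real (Suc m)) \<le> inverse (real (Suc N))" "inverse (real (Suc n)) \<le> inverse (real (Suc N))"
        using mn by (auto simp: le_imp_inverse_le)
      then have "(norm (y m - y n))\<^sup>2 < e\<^sup>2" using par[of m n] N by linarith
      then show "norm (y m - y n) < e" using e by (simp add: power2_less_imp_less)
    qed
  qed
  then obtain l where l: "y \<longlonglongrightarrow> l" using Cauchy_convergent_iff convergent_def by blast
  have lS: "l \<in> S" using closed_sequentially[OF assms(1)] y(1) l by blast
  have "(\<lambda>n. (norm (x - y n))\<^sup>2) \<longlonglongrightarrow> (norm (x - l))\<^sup>2" using l by (intro tendsto_intros)
  moreover have "(\<lambda>n. \<delta> + inverse (real (Suc n))) \<longlonglongrightarrow> \<delta> + 0"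
    by (intro tendsto_intros LIMSEQ_inverse_real_of_nat)
  ultimately have ld: "(norm (x - l))\<^sup>2 \<le> \<delta>"
    using LIMSEQ_le[of "\<lambda>n. (norm (x - y n))\<^sup>2" _ "\<lambda>n. \<delta> + inverse (real (Suc n))" "\<delta> + 0"] y(2)
    by (simp add: less_imp_le)
  show thesis
  proof (rule that[OF lS])
    fix z assume z: "z \<in> S"
    show "(x - l) \<bullet> z = 0"
    proof (cases "z = 0")
      case False
      \<comment> \<open>\<open>t *\<^sub>R z\<close> is the projection of \<open>x - l\<close> onto
        the line of \<open>z\<close>; adding it to \<open>l\<close> would shorten the distance
        unless it vanishes.\<close>
      define t where "t = ((x - l) \<bullet> z) / (z \<bullet> z)"
      have zz: "z \<bullet> z > 0" using False by simp
      have "l + t *\<^sub>R z \<in> S" using lS z assms(2) by (simp add: subspace_add subspace_scale)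
      then have "(norm (x - l))\<^sup>2 \<le> (norm (x - (l + t *\<^sub>R z)))\<^sup>2" using \<delta>le ld order_trans by blast
      also have "x - (l + t *\<^sub>R z) = (x - l) - t *\<^sub>R z" by simp
      also have "(norm ((x - l) - t *\<^sub>R z))\<^sup>2 = (norm (x - l))\<^sup>2 - 2 * t * ((x - l) \<bullet> z) + t * t * (z \<bullet> z)"
        unfolding power2_norm_eq_inner by (simp add: inner_simps inner_commute algebra_simps)
      also have "t * t * (z \<bullet> z) = t * ((x - l) \<bullet> z)" using zz by (simp add: t_def)
      finally have "t * ((x - l) \<bullet> z) \<le> 0" by simp
      then have "((x - l) \<bullet> z) * ((x - l) \<bullet> z) \<le> 0" using zz
        by (simp add: t_def divide_le_0_iff)
      then show ?thesis by (auto simp: mult_le_0_iff)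
    qed simp
  qed
qed

lemma riesz_representation:
  fixes f :: "'a::{real_inner,complete_space} \<Rightarrow> real"
  assumes "bounded_linear f"
  obtains z where "\<And>x. f x = x \<bullet> z"
proof (cases "\<forall>x. f x = 0")
  case True
  then show ?thesis using that[of 0] by simp
next
  case False
  then obtain x0 where x0: "f x0 \<noteq> 0" by blast
  interpret bounded_linear f by fact
  define S where "S = {x. f x = 0}"
  have "subspace S" by (auto simp: S_def subspace_def add scaleR zero)
  moreover have "closed S" unfolding S_def
    by (intro closed_Collect_eq continuous_on_const linear_continuous_on assms)
  ultimately obtain y where y: "y \<in> S" "\<And>z. z \<in> S \<Longrightarrow> (x0 - y) \<bullet> z = 0"
    using orthogonal_projection_exists by blast
  define w where "w = x0 - y"
  have fw: "f w = f x0" using y(1) by (simp add: w_def S_def diff)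
  have w0: "w \<bullet> w \<noteq> 0" using fw x0 zero by auto
  show ?thesis
  proof (rule that[of "(f w / (w \<bullet> w)) *\<^sub>R w"])
    fix x
    have "x - (f x / f w) *\<^sub>R w \<in> S" using fw x0 by (simp add: S_def diff scaleR)
    then have "w \<bullet> (x - (f x / f w) *\<^sub>R w) = 0" using y(2) by (simp add: w_def)
    then have "x \<bullet> w = (f x / f w) * (w \<bullet> w)" by (simp add: inner_simps inner_commute)
    then show "f x = x \<bullet> ((f w / (w \<bullet> w)) *\<^sub>R w)" using w0 fw x0 by (simp add: field_simps)
  qed
qed

text \<open>Cancels one factor \<open>norm z\<close> after Cauchy-Schwarz; the bounds for adjoints
  and projections all arise in this form.\<close>

lemma norm_le_of_inner_le:
  fixes z :: "'a::real_inner"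
  assumes "0 \<le> C" "z \<bullet> z \<le> C * norm z"
  shows "norm z \<le> C"
proof (cases "z = 0")
  case False
  then have "norm z * norm z \<le> C * norm z" using assms by (simp add: power2_norm_eq_inner[symmetric] power2_eq_square)
  then show ?thesis using False by simp
qed (use assms in simp)

definition adj :: "('a::{real_inner,complete_space} \<Rightarrow>\<^sub>L 'a) \<Rightarrow> ('a \<Rightarrow>\<^sub>L 'a)" where
  "adj A = Blinfun (\<lambda>y. SOME z. \<forall>x. A x \<bullet> y = x \<bullet> z)"

lemma inner_adj:
  fixes A :: "'a::{real_inner,complete_space} \<Rightarrow>\<^sub>L 'a"
  shows "A x \<bullet> y = x \<bullet> adj A y"
proof -
  define g where "g = (\<lambda>y. SOME z. \<forall>x. A x \<bullet> y = x \<bullet> z)"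
  have g: "A x \<bullet> y = x \<bullet> g y" for x y
  proof -
    have "bounded_linear (\<lambda>x. A x \<bullet> y)"
      by (rule bounded_linear_compose[OF bounded_linear_inner_left blinfun.bounded_linear_right])
    then obtain z where "\<And>x. A x \<bullet> y = x \<bullet> z" using riesz_representation by blast
    then have "\<exists>z. \<forall>x. A x \<bullet> y = x \<bullet> z" by blast
    from someI_ex[OF this] show ?thesis unfolding g_def by blast
  qed
  have eqI: "u = v" if "\<And>x. x \<bullet> u = x \<bullet> v" for u v :: 'a
    using that by (metis inner_commute vector_eq_rdot)
  have "bounded_linear g"
  proof (rule bounded_linear_intro)
    show "g (a + b) = g a + g b" for a b
      by (rule eqI) (simp add: g[symmetric] inner_add_right)
    show "g (r *\<^sub>R a) = r *\<^sub>R g a" for r a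
      by (rule eqI) (simp add: g[symmetric])
    show "norm (g a) \<le> norm a * norm A" for a
    proof (rule norm_le_of_inner_le)
      have "g a \<bullet> g a = A (g a) \<bullet> a" by (simp add: g)
      also have "\<dots> \<le> norm (A (g a)) * norm a" by (rule norm_cauchy_schwarz)
      also have "\<dots> \<le> (norm A * norm (g a)) * norm a" by (intro mult_right_mono norm_blinfun) auto
      finally show "g a \<bullet> g a \<le> norm a * norm A * norm (g a)" by (simp add: mult_ac)
    qed auto
  qed
  then have "adj A y = g y" by (simp add: adj_def g_def bounded_linear_Blinfun_apply)
  then show ?thesis by (simp add: g)
qed

lemma inner_adj': "adj A x \<bullet> y = x \<bullet> A y"
  by (metis inner_adj inner_commute)

lemma adj_eqI:
  fixes A B :: "'a::{real_inner,complete_space} \<Rightarrow>\<^sub>L 'a"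
  assumes "\<And>x y. A x \<bullet> y = x \<bullet> B y" shows "adj A = B"
proof (rule blinfun_eqI)
  fix y
  have "x \<bullet> adj A y = x \<bullet> B y" for x using assms inner_adj by metis
  then show "adj A y = B y" by (metis inner_commute vector_eq_rdot)
qed

lemma adj_adj [simp]: "adj (adj A) = A"
  by (rule adj_eqI) (rule inner_adj')

lemma adj_compose: "adj (A o\<^sub>L B) = adj B o\<^sub>L adj A"
  by (rule adj_eqI) (simp add: inner_adj)

lemma adj_add: "adj (A + B) = adj A + adj B"
  by (rule adj_eqI) (simp add: inner_adj blinfun.add_left inner_simps)

lemma adj_diff: "adj (A - B) = adj A - adj B"
  by (rule adj_eqI) (simp add: inner_adj blinfun.diff_left inner_simps)

lemma adj_zero [simp]: "adj 0 = 0"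
  by (rule adj_eqI) simp

lemma norm_adj [simp]: "norm (adj A) = norm A"
proof -
  have le: "norm (adj B) \<le> norm B" for B :: "'a \<Rightarrow>\<^sub>L 'a"
  proof (rule norm_blinfun_bound)
    fix a
    show "norm (adj B a) \<le> norm B * norm a"
    proof (rule norm_le_of_inner_le)
      have "adj B a \<bullet> adj B a = B (adj B a) \<bullet> a" by (simp add: inner_adj)
      also have "\<dots> \<le> norm (B (adj B a)) * norm a" by (rule norm_cauchy_schwarz)
      also have "\<dots> \<le> (norm B * norm (adj B a)) * norm a" by (intro mult_right_mono norm_blinfun) auto
      finally show "adj B a \<bullet> adj B a \<le> norm B * norm a * norm (adj B a)" by (simp add: mult_ac)
    qed auto
  qed auto
  show ?thesis using le[of A] le[of "adj A"] by simp
qed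

lemma tendsto_adj:
  assumes "(f \<longlongrightarrow> l) F" shows "((\<lambda>n. adj (f n)) \<longlongrightarrow> adj l) F"
proof -
  have "((\<lambda>n. norm (f n - l)) \<longlongrightarrow> 0) F" using assms by (simp add: LIM_zero tendsto_norm_zero)
  then have "((\<lambda>n. norm (adj (f n) - adj l)) \<longlongrightarrow> 0) F" by (simp add: adj_diff[symmetric])
  then show ?thesis using Lim_null tendsto_norm_zero_iff by blast
qed

text \<open>Some \<open>\<eta>\<close> of norm \<open>r\<close> has \<open>norm (T \<eta>)\<close>
  at least \<open>c * r\<close>. Since \<open>T (x + \<eta>)\<close> and
  \<open>T (x - \<eta>)\<close> differ by twice \<open>T \<eta>\<close>, one of the two is as large,
  wherever the centre \<open>x\<close> lies.\<close>

lemma blinfun_large_on_ball: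
  fixes T :: "'a::real_normed_vector \<Rightarrow>\<^sub>L 'b::real_normed_vector"
  assumes "0 \<le> c" "c < norm T" "0 < r"
  obtains y where "norm (y - x) \<le> r" "c * r \<le> norm (T y)"
proof -
  obtain \<xi> where \<xi>: "norm (T \<xi>) > c * norm \<xi>"
    using norm_blinfun_bound[of c T] assms by (metis linorder_not_le)
  then have \<xi>0: "\<xi> \<noteq> 0" by auto
  define \<eta> where "\<eta> = (r / norm \<xi>) *\<^sub>R \<xi>"
  have n\<eta>: "norm \<eta> = r" using \<xi>0 assms by (simp add: \<eta>_def)
  have "norm (T \<eta>) = (r / norm \<xi>) * norm (T \<xi>)" using assms by (simp add: \<eta>_def blinfun.scaleR_right)
  also have "\<dots> \<ge> (r / norm \<xi>) * (c * norm \<xi>)" using \<xi> assms by (intro mult_left_mono) auto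
  finally have big: "norm (T \<eta>) \<ge> c * r" using \<xi>0 by (simp add: mult_ac)
  have "2 *\<^sub>R T \<eta> = T (x + \<eta>) - T (x - \<eta>)" by (simp add: blinfun.add_right blinfun.diff_right scaleR_2)
  then have "2 * norm (T \<eta>) \<le> norm (T (x + \<eta>)) + norm (T (x - \<eta>))"
    using norm_triangle_ineq4[of "T (x + \<eta>)" "T (x - \<eta>)"] norm_scaleR[of 2 "T \<eta>"] by simp
  then consider "c * r \<le> norm (T (x + \<eta>))" | "c * r \<le> norm (T (x - \<eta>))" using big by linarith
  then show ?thesis
  proof cases
    case 1 then show ?thesis using that[of "x + \<eta>"] n\<eta> by simp
  next
    case 2 then show ?thesis using that[of "x - \<eta>"] n\<eta> by simp
  qed
qed

text \<open>Sokal's gliding hump argument, which avoids the Baire category theorem.\<close>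

theorem uniform_boundedness:
  fixes A :: "'i \<Rightarrow> 'a::banach \<Rightarrow>\<^sub>L 'b::real_normed_vector"
  assumes "\<And>x. \<exists>C. \<forall>i. norm (A i x) \<le> C"
  shows "\<exists>C. \<forall>i. norm (A i) \<le> C"
proof (rule ccontr)
  assume "\<not> ?thesis"
  then have "\<forall>n::nat. \<exists>i. norm (A i) > 4 ^ n" by (meson not_le)
  then obtain i where i: "\<And>n::nat. norm (A (i n)) > 4 ^ n" by metis
  have ipos: "norm (A (i n)) > 0" for n using i[of n] by (meson less_trans zero_less_numeral zero_less_power)
  \<comment> \<open>Steps of size \<open>(1/3)^n\<close> against norms above \<open>4^n\<close>: the
    later steps move the limit away from \<open>f (Suc n)\<close> by at most half of
    \<open>(1/3)^n\<close>, so of the fraction 3/4 a quarter survives at the limit, and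
    \<open>(1/4) * (4/3)^n\<close> is unbounded.\<close>
  have "\<exists>f. \<forall>n. True \<and> (norm (f (Suc n) - f n) \<le> (1/3)^n \<and>
      (3/4) * norm (A (i n)) * (1/3)^n \<le> norm (A (i n) (f (Suc n))))"
  proof (rule dependent_nat_choice)
    fix x :: 'a and n :: nat
    obtain y where "norm (y - x) \<le> (1/3)^n" "(3/4) * norm (A (i n)) * (1/3)^n \<le> norm (A (i n) y)"
      by (rule blinfun_large_on_ball[of "(3/4) * norm (A (i n))" "A (i n)" "(1/3)^n" x]) (use ipos[of n] in auto)
    then show "\<exists>y. True \<and> norm (y - x) \<le> (1/3)^n \<and> (3/4) * norm (A (i n)) * (1/3)^n \<le> norm (A (i n) y)"
      by blast
  qed auto
  then obtain f where f: "\<And>n. norm (f (Suc n) - f n) \<le> (1/3)^n"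
      "\<And>n. (3/4) * norm (A (i n)) * (1/3)^n \<le> norm (A (i n) (f (Suc n)))" by blast
  have tail: "norm (f (n + k) - f n) \<le> (3/2) * (1/3)^n * (1 - (1/3)^k)" for n k
  proof (induction k)
    case (Suc k)
    have "norm (f (n + Suc k) - f n) \<le> norm (f (Suc (n + k)) - f (n + k)) + norm (f (n + k) - f n)"
      using norm_triangle_ineq[of "f (Suc (n + k)) - f (n + k)" "f (n + k) - f n"] by simp
    also have "\<dots> \<le> (1/3)^(n+k) + (3/2) * (1/3)^n * (1 - (1/3)^k)" using f(1)[of "n + k"] Suc by linarith
    also have "\<dots> = (3/2) * (1/3)^n * (1 - (1/3)^Suc k)" by (simp add: power_add field_simps)
    finally show ?case .
  qed simp
  have tail': "norm (f m - f n) \<le> (3/2) * (1/3)^n" if "n \<le> m" for m n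
  proof -
    have "norm (f m - f n) \<le> (3/2) * (1/3)^n * (1 - (1/3)^(m - n))" using tail[of n "m - n"] that by simp
    also have "\<dots> \<le> (3/2) * (1/3)^n * 1" by (intro mult_left_mono) auto
    finally show ?thesis by simp
  qed
  have "Cauchy f"
  proof (rule CauchyI)
    fix e :: real assume e: "e > 0"
    obtain N where N: "(1/3::real)^N < e / 3" using real_arch_pow_inv[of "e/3" "1/3"] e by auto
    have "norm (f m - f n) < e" if "N \<le> m" "N \<le> n" for m n
    proof -
      have "norm (f m - f n) \<le> norm (f m - f N) + norm (f n - f N)"
        using norm_triangle_ineq4[of "f m - f N" "f n - f N"] by simp
      then show ?thesis using tail'[OF that(1)] tail'[OF that(2)] N by linarith
    qed
    then show "\<exists>M. \<forall>m\<ge>M. \<forall>n\<ge>M. norm (f m - f n) < e" by blast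
  qed
  then obtain x where x: "f \<longlonglongrightarrow> x" using Cauchy_convergent_iff convergent_def by blast
  obtain C where C: "\<And>j. norm (A j x) \<le> C" using assms by blast
  have "(1/4) * (4/3)^n \<le> C" for n
  proof -
    have "norm (x - f (Suc n)) \<le> (3/2) * (1/3)^(Suc n)"
    proof (rule LIMSEQ_le_const2)
      show "(\<lambda>m. norm (f m - f (Suc n))) \<longlonglongrightarrow> norm (x - f (Suc n))" using x by (intro tendsto_intros)
      show "\<exists>N. \<forall>m\<ge>N. norm (f m - f (Suc n)) \<le> (3/2) * (1/3)^(Suc n)" using tail' by blast
    qed
    then have "norm (A (i n) (x - f (Suc n))) \<le> norm (A (i n)) * ((1/2) * (1/3)^n)"
      by (intro order_trans[OF norm_blinfun] mult_left_mono) auto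
    moreover have "norm (A (i n) (f (Suc n))) \<le> norm (A (i n) x) + norm (A (i n) (x - f (Suc n)))"
      using norm_triangle_ineq4[of "A (i n) x" "A (i n) (x - f (Suc n))"] by (simp add: blinfun.diff_right)
    ultimately have "(1/4) * norm (A (i n)) * (1/3)^n \<le> C"
      using f(2)[of n] C[of "i n"] by (simp add: algebra_simps)
    moreover have "(1/4) * 4^n * (1/3)^n \<le> (1/4) * norm (A (i n)) * (1/3)^n"
      using i[of n] by (intro mult_right_mono mult_left_mono) auto
    ultimately show ?thesis by (simp add: power_divide)
  qed
  moreover obtain n where "(4/3::real)^n > 4 * C" using real_arch_pow[of "4/3" "4 * C"] by auto
  ultimately show False using not_le[of "(1/4) * (4/3::real)^n" C] by simp
qed

section \<open>The Hilbert space of square-summable two-sided sequences\<close>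

lemma l2I:
  assumes "\<And>F. finite F \<Longrightarrow> (\<Sum>k\<in>F. (cmod (f k))\<^sup>2) \<le> C"
  shows "l2 f"
  unfolding l2_def
  by (rule nonneg_bdd_above_summable_on) (use assms in \<open>auto intro!: bdd_aboveI[of _ C]\<close>)

lemma l2norm_nonneg [simp]: "0 \<le> l2norm f"
  by (simp add: l2norm_def infsum_nonneg)

lemma l2norm_squared: "(l2norm f)\<^sup>2 = infsum (\<lambda>n. (cmod (f n))\<^sup>2) UNIV"
  by (simp add: l2norm_def infsum_nonneg)

lemma sum_le_l2norm:
  assumes "l2 f" "finite F" shows "(\<Sum>k\<in>F. (cmod (f k))\<^sup>2) \<le> (l2norm f)\<^sup>2"
  unfolding l2norm_squared
  by (rule finite_sum_le_infsum) (use assms in \<open>auto simp: l2_def\<close>)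

lemma l2norm_le:
  assumes "0 \<le> C" "\<And>F. finite F \<Longrightarrow> (\<Sum>k\<in>F. (cmod (f k))\<^sup>2) \<le> C\<^sup>2"
  shows "l2norm f \<le> C"
proof -
  have "l2 f" using assms(2) by (rule l2I)
  then have "(l2norm f)\<^sup>2 \<le> C\<^sup>2" unfolding l2norm_squared
    by (intro infsum_le_finite_sums) (use assms in \<open>auto simp: l2_def\<close>)
  then show ?thesis using assms(1) by (simp add: power2_le_iff_abs_le)
qed

lemma cmod_add_squared_le: "(cmod (a + b))\<^sup>2 \<le> 2 * (cmod a)\<^sup>2 + 2 * (cmod b)\<^sup>2"
proof -
  have "(cmod (a + b))\<^sup>2 \<le> (cmod a + cmod b)\<^sup>2" by (simp add: power_mono norm_triangle_ineq)
  also have "\<dots> \<le> 2 * (cmod a)\<^sup>2 + 2 * (cmod b)\<^sup>2"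
    using sum_squares_bound[of "cmod a" "cmod b"] by (simp add: power2_sum)
  finally show ?thesis .
qed

lemma l2_zero: "l2 (\<lambda>_. 0)"
  by (simp add: l2_def)

lemma l2_add:
  assumes "l2 f" "l2 g" shows "l2 (f + g)"
proof (rule l2I)
  fix F :: "int set" assume F: "finite F"
  have "(\<Sum>k\<in>F. (cmod ((f + g) k))\<^sup>2) \<le> (\<Sum>k\<in>F. 2 * (cmod (f k))\<^sup>2 + 2 * (cmod (g k))\<^sup>2)"
    by (intro sum_mono) (simp add: cmod_add_squared_le)
  also have "\<dots> = 2 * (\<Sum>k\<in>F. (cmod (f k))\<^sup>2) + 2 * (\<Sum>k\<in>F. (cmod (g k))\<^sup>2)"
    by (simp add: sum.distrib sum_distrib_left)
  also have "\<dots> \<le> 2 * (l2norm f)\<^sup>2 + 2 * (l2norm g)\<^sup>2"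
    using sum_le_l2norm[OF assms(1) F] sum_le_l2norm[OF assms(2) F] by simp
  finally show "(\<Sum>k\<in>F. (cmod ((f + g) k))\<^sup>2) \<le> 2 * (l2norm f)\<^sup>2 + 2 * (l2norm g)\<^sup>2" .
qed

lemma l2_cscale: "l2 f \<Longrightarrow> l2 (cscale c f)"
  by (simp add: l2_def cscale_def norm_mult power_mult_distrib summable_on_cmult_right)

lemma l2_uminus: "l2 f \<Longrightarrow> l2 (- f)"
  by (simp add: l2_def)

lemma l2_diff: "l2 f \<Longrightarrow> l2 g \<Longrightarrow> l2 (f - g)"
  using l2_add[of f "- g"] l2_uminus[of g] by simp

lemma l2_product_abs_summable:
  assumes "l2 f" "l2 g" shows "(\<lambda>n. norm (f n * cnj (g n))) summable_on UNIV"
proof (rule Infinite_Sum.abs_summable_on_comparison_test)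
  show "(\<lambda>n. norm ((cmod (f n))\<^sup>2 + (cmod (g n))\<^sup>2)) summable_on UNIV"
    using assms by (simp add: l2_def summable_on_add)
  show "norm (f n * cnj (g n)) \<le> norm ((cmod (f n))\<^sup>2 + (cmod (g n))\<^sup>2)" for n
  proof -
    have "2 * (cmod (f n) * cmod (g n)) \<le> (cmod (f n))\<^sup>2 + (cmod (g n))\<^sup>2"
      using sum_squares_bound[of "cmod (f n)" "cmod (g n)"] by (simp add: mult.assoc)
    moreover have "0 \<le> cmod (f n) * cmod (g n)" by simp
    ultimately have "cmod (f n) * cmod (g n) \<le> (cmod (f n))\<^sup>2 + (cmod (g n))\<^sup>2" by linarith
    then show ?thesis by (simp add: norm_mult)
  qed
qed

lemma l2_product_summable:
  assumes "l2 f" "l2 g" shows "(\<lambda>n. f n * cnj (g n)) summable_on UNIV"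
  by (rule abs_summable_summable[OF l2_product_abs_summable[OF assms]])

lemma l2inner_self: "l2 f \<Longrightarrow> l2inner f f = complex_of_real ((l2norm f)\<^sup>2)"
proof -
  assume "l2 f"
  then have "((\<lambda>n. (cmod (f n))\<^sup>2) has_sum (l2norm f)\<^sup>2) UNIV"
    unfolding l2norm_squared l2_def by (rule has_sum_infsum)
  then have "((\<lambda>n. complex_of_real ((cmod (f n))\<^sup>2)) has_sum complex_of_real ((l2norm f)\<^sup>2)) UNIV"
    by (rule has_sum_of_real)
  then show ?thesis unfolding l2inner_def complex_norm_square by (rule infsumI)
qed

lemma l2inner_commute: "l2inner g f = cnj (l2inner f g)"
  unfolding l2inner_def infsum_cnj[symmetric] by (simp add: mult.commute)

lemma l2inner_add_left:
  "l2 f \<Longrightarrow> l2 g \<Longrightarrow> l2 h \<Longrightarrow> l2inner (f + g) h = l2inner f h + l2inner g h"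
  unfolding l2inner_def
  by (simp add: distrib_right infsum_add l2_product_summable)

lemma l2inner_cscale_left: "l2inner (cscale c f) g = c * l2inner f g"
  by (simp add: l2inner_def cscale_def mult.assoc infsum_cmult_right')

text \<open>A type of its own allows the class instances for real Hilbert spaces, and thereby the
  Banach space of bounded operators on it.\<close>

typedef ell2 = "{f. l2 f}" morphisms seq Ell2
  using l2_zero by blast

setup_lifting type_definition_ell2

lemma l2_seq [simp]: "l2 (seq x)"
  using seq by simp

lemma seq_Ell2 [simp]: "l2 f \<Longrightarrow> seq (Ell2 f) = f"
  by (simp add: Ell2_inverse)

lemma ell2_eqI: "(\<And>k. seq x k = seq y k) \<Longrightarrow> x = y"
  using seq_inject by blast

text \<open>The type classes carry real scalars only. The complex structure is kept separately in
  \<open>cs\<close> and in the form \<open>cin\<close>, which is linear in its first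
  argument.\<close>

lift_definition cs :: "complex \<Rightarrow> ell2 \<Rightarrow> ell2" is cscale
  by (simp add: l2_cscale)

definition cin :: "ell2 \<Rightarrow> ell2 \<Rightarrow> complex" where
  "cin x y = l2inner (seq x) (seq y)"

instantiation ell2 :: real_inner
begin

lift_definition zero_ell2 :: ell2 is 0
  using l2_zero by (simp add: zero_fun_def)

lift_definition plus_ell2 :: "ell2 \<Rightarrow> ell2 \<Rightarrow> ell2" is "(+)"
  by (simp add: l2_add)

lift_definition minus_ell2 :: "ell2 \<Rightarrow> ell2 \<Rightarrow> ell2" is "(-)"
  by (simp add: l2_diff)

lift_definition uminus_ell2 :: "ell2 \<Rightarrow> ell2" is uminus
  by (simp add: l2_uminus)

definition scaleR_ell2 :: "real \<Rightarrow> ell2 \<Rightarrow> ell2" where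
  "scaleR_ell2 r = cs (complex_of_real r)"

definition inner_ell2 :: "ell2 \<Rightarrow> ell2 \<Rightarrow> real" where
  "inner_ell2 x y = Re (cin x y)"

definition norm_ell2 :: "ell2 \<Rightarrow> real" where
  "norm_ell2 x = l2norm (seq x)"

definition dist_ell2 :: "ell2 \<Rightarrow> ell2 \<Rightarrow> real" where
  "dist_ell2 x y = norm (x - y)"

definition sgn_ell2 :: "ell2 \<Rightarrow> ell2" where
  "sgn_ell2 x = inverse (norm x) *\<^sub>R x"

definition uniformity_ell2 :: "(ell2 \<times> ell2) filter" where
  "uniformity_ell2 = (INF e\<in>{0<..}. principal {(x, y). dist x y < e})"

definition open_ell2 :: "ell2 set \<Rightarrow> bool" where
  "open_ell2 U = (\<forall>x\<in>U. eventually (\<lambda>(x', y). x' = x \<longrightarrow> y \<in> U) uniformity)"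

instance
proof
  fix x y z :: ell2 and r s :: real
  show "x + y + z = x + (y + z)" by transfer (simp add: add.assoc)
  show "x + y = y + x" by transfer (simp add: add.commute)
  show "0 + x = x" by transfer simp
  show "- x + x = 0" by transfer simp
  show "x - y = x + - y" by transfer simp
  show "r *\<^sub>R (x + y) = r *\<^sub>R x + r *\<^sub>R y" unfolding scaleR_ell2_def
    by transfer (auto simp: cscale_def fun_eq_iff algebra_simps)
  show "(r + s) *\<^sub>R x = r *\<^sub>R x + s *\<^sub>R x" unfolding scaleR_ell2_def
    by transfer (auto simp: cscale_def fun_eq_iff algebra_simps)
  show "r *\<^sub>R s *\<^sub>R x = (r * s) *\<^sub>R x" unfolding scaleR_ell2_def
    by transfer (auto simp: cscale_def fun_eq_iff algebra_simps)
  show "1 *\<^sub>R x = x" unfolding scaleR_ell2_def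
    by transfer (auto simp: cscale_def fun_eq_iff)
  show "dist x y = norm (x - y)" by (rule dist_ell2_def)
  show "sgn x = inverse (norm x) *\<^sub>R x" by (rule sgn_ell2_def)
  show "uniformity = (INF e\<in>{0<..}. principal {(x::ell2, y). dist x y < e})" by (rule uniformity_ell2_def)
  show "open U = (\<forall>x\<in>U. eventually (\<lambda>(x', y). x' = x \<longrightarrow> y \<in> U) uniformity)" for U :: "ell2 set"
    by (rule open_ell2_def)
  show "inner x y = inner y x"
    by (simp add: inner_ell2_def cin_def l2inner_commute[of "seq y"])
  show "inner (x + y) z = inner x z + inner y z"
    by (simp add: inner_ell2_def cin_def plus_ell2.rep_eq l2inner_add_left)
  show "inner (r *\<^sub>R x) y = r * inner x y"
    by (simp add: inner_ell2_def cin_def scaleR_ell2_def cs.rep_eq l2inner_cscale_left)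
  have self: "inner x x = (norm x)\<^sup>2"
    by (simp add: inner_ell2_def cin_def norm_ell2_def l2inner_self)
  show "0 \<le> inner x x" by (simp add: self)
  show "norm x = sqrt (inner x x)" unfolding self by (simp add: norm_ell2_def)
  show "(inner x x = 0) = (x = 0)"
  proof
    assume "inner x x = 0"
    then have "infsum (\<lambda>n. (cmod (seq x n))\<^sup>2) UNIV \<le> 0"
      unfolding self norm_ell2_def l2norm_squared by simp
    then have "(cmod (seq x n))\<^sup>2 = 0" for n
      using l2_seq[of x] unfolding l2_def by (rule nonneg_infsum_le_0D) auto
    then show "x = 0" by (intro ell2_eqI) (simp add: zero_ell2.rep_eq)
  next
    assume "x = 0"
    then have "(norm x)\<^sup>2 = 0" by (simp add: norm_ell2_def l2norm_def zero_ell2.rep_eq)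
    then show "inner x x = 0" unfolding self .
  qed
qed

end

lemma seq_add [simp]: "seq (x + y) = seq x + seq y"
  and seq_diff [simp]: "seq (x - y) = seq x - seq y"
  and seq_uminus [simp]: "seq (- x) = - seq x"
  and seq_zero [simp]: "seq 0 = 0"
  and seq_cs [simp]: "seq (cs c x) = cscale c (seq x)"
  by (simp_all add: plus_ell2.rep_eq minus_ell2.rep_eq uminus_ell2.rep_eq zero_ell2.rep_eq cs.rep_eq)

lemma Ell2_add: "l2 f \<Longrightarrow> l2 g \<Longrightarrow> Ell2 (f + g) = Ell2 f + Ell2 g"
  by (rule ell2_eqI) (simp add: l2_add)

lemma Ell2_cscale: "l2 f \<Longrightarrow> Ell2 (cscale c f) = cs c (Ell2 f)"
  by (rule ell2_eqI) (simp add: l2_cscale)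

lemma Ell2_seq [simp]: "Ell2 (seq x) = x"
  by (rule seq_inverse)

lemma l2norm_seq [simp]: "l2norm (seq x) = norm x"
  by (simp add: norm_ell2_def)

lemma l2norm_Ell2: "l2 f \<Longrightarrow> norm (Ell2 f) = l2norm f"
  by (simp add: l2norm_seq[symmetric] del: l2norm_seq)

lemma l2inner_seq: "l2inner (seq x) (seq y) = cin x y"
  by (simp add: cin_def)

lemma Re_cin: "Re (cin x y) = x \<bullet> y"
  by (simp add: inner_ell2_def)

lemma scaleR_cs: "r *\<^sub>R x = cs (complex_of_real r) x"
  by (simp add: scaleR_ell2_def)

lemma cin_commute: "cin y x = cnj (cin x y)"
  unfolding cin_def by (rule l2inner_commute)

lemma cin_self: "cin x x = complex_of_real ((norm x)\<^sup>2)"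
  by (simp add: cin_def l2inner_self)

lemma cin_add_left: "cin (x + y) z = cin x z + cin y z"
  by (simp add: cin_def l2inner_add_left)

lemma cin_cs_left: "cin (cs c x) y = c * cin x y"
  by (simp add: cin_def l2inner_cscale_left)

lemma cin_add_right: "cin z (x + y) = cin z x + cin z y"
  by (simp add: cin_commute[of z] cin_add_left)

lemma cin_cs_right: "cin x (cs c y) = cnj c * cin x y"
  by (simp add: cin_commute[of x] cin_cs_left)

lemma cs_minus_one: "cs (-1) x = - x"
  by (rule ell2_eqI) (simp add: cscale_def)

lemma cin_uminus_left: "cin (- x) y = - cin x y"
  using cin_cs_left[of "-1" x y] by (simp add: cs_minus_one)

lemma cin_uminus_right: "cin x (- y) = - cin x y"
  using cin_cs_right[of x "-1" y] by (simp add: cs_minus_one)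

lemma cin_diff_left: "cin (x - y) z = cin x z - cin y z"
  using cin_add_left[of x "- y" z] by (simp add: cin_uminus_left)

lemma cin_diff_right: "cin z (x - y) = cin z x - cin z y"
  using cin_add_right[of z x "- y"] by (simp add: cin_uminus_right)

lemma cin_zero [simp]: "cin 0 x = 0" "cin x 0 = 0"
  using cin_diff_left[of 0 0 x] cin_diff_right[of x 0 0] by auto

lemma cin_sum_left: "cin (\<Sum>i\<in>I. f i) y = (\<Sum>i\<in>I. cin (f i) y)"
  by (induction I rule: infinite_finite_induct) (auto simp: cin_add_left)

lemma cin_sum_right: "cin y (\<Sum>i\<in>I. f i) = (\<Sum>i\<in>I. cin y (f i))"
  by (induction I rule: infinite_finite_induct) (auto simp: cin_add_right)

lemmas cin_simps = cin_add_left cin_add_right cin_diff_left cin_diff_right cin_cs_left cin_cs_right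
  cin_uminus_left cin_uminus_right cin_sum_left cin_sum_right

lemma cs_simps [simp]: "cs 0 x = 0" "cs 1 x = x" "cs c 0 = 0" "cs a (cs b x) = cs (a * b) x"
  by (rule ell2_eqI; simp add: cscale_def)+

lemma cs_add_right: "cs c (x + y) = cs c x + cs c y"
  and cs_add_left: "cs (a + b) x = cs a x + cs b x"
  and cs_diff_right: "cs c (x - y) = cs c x - cs c y"
  by (rule ell2_eqI; simp add: cscale_def algebra_simps)+

lemma norm_cs [simp]: "norm (cs c x) = cmod c * norm x"
proof -
  have "complex_of_real ((norm (cs c x))\<^sup>2) = complex_of_real ((cmod c * norm x)\<^sup>2)"
  proof -
    have "cin (cs c x) (cs c x) = (c * cnj c) * cin x x" by (simp add: cin_cs_left cin_cs_right)
    then show ?thesis unfolding cin_self power_mult_distrib of_real_mult complex_norm_square by simp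
  qed
  then have "(norm (cs c x))\<^sup>2 = (cmod c * norm x)\<^sup>2" using of_real_eq_iff by blast
  then show ?thesis by (simp add: power2_eq_iff_nonneg)
qed

text \<open>The imaginary part of the form is its real part after rotating \<open>y\<close> by
  \<open>\<i>\<close>. Real orthogonality and real adjoints become complex ones through this
  identity.\<close>

lemma cin_eq_inner: "cin x y = Complex (x \<bullet> y) (x \<bullet> cs \<i> y)"
  by (rule complex_eqI) (simp_all add: Re_cin[symmetric] cin_cs_right)

lemma norm_cin_le: "cmod (cin x y) \<le> norm x * norm y"
proof (cases "cin x y = 0")
  case False
  \<comment> \<open>The phase that rotates \<open>cin x y\<close> to its modulus, so that the real
    Cauchy-Schwarz inequality applies.\<close>
  define c where "c = cnj (cin x y) / cmod (cin x y)"
  have c: "cmod c = 1" using False by (simp add: c_def norm_divide)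
  have "complex_of_real (cmod (cin x y)) = cin (cs c x) y"
    using False by (simp add: cin_cs_left c_def complex_norm_square[symmetric] mult.commute power2_eq_square)
  then have "cmod (cin x y) = cs c x \<bullet> y" by (metis Re_cin Re_complex_of_real)
  also have "\<dots> \<le> norm (cs c x) * norm y" by (rule norm_cauchy_schwarz)
  finally show ?thesis by (simp add: c)
qed simp

lemma bounded_linear_cs: "bounded_linear (cs c)"
  by (rule bounded_linear_intro[where K = "cmod c"])
    (simp_all add: cs_add_right scaleR_cs mult.commute)

lemma bounded_linear_cin_left: "bounded_linear (\<lambda>x. cin x y)"
  by (rule bounded_linear_intro[where K = "norm y"])
    (simp_all add: cin_simps scaleR_cs scaleR_conv_of_real norm_cin_le)

lemmas tendsto_cs [tendsto_intros] = bounded_linear.tendsto[OF bounded_linear_cs]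

lemma norm_coord_le: "cmod (seq x k) \<le> norm x"
proof -
  have "(cmod (seq x k))\<^sup>2 \<le> (norm x)\<^sup>2" using sum_le_l2norm[OF l2_seq[of x], of "{k}"] by simp
  then show ?thesis by (simp add: power2_le_iff_abs_le)
qed

lemma bounded_linear_coord: "bounded_linear (\<lambda>x. seq x k)"
  by (rule bounded_linear_intro[where K = 1])
    (simp_all add: norm_coord_le scaleR_cs cscale_def scaleR_conv_of_real)

lemmas tendsto_coord [tendsto_intros] = bounded_linear.tendsto[OF bounded_linear_coord]

text \<open>Each coordinate converges. Bounds for finite sums of squared differences pass to the
  limit; they give both square-summability of the coordinatewise limit and convergence in
  norm.\<close>

instance ell2 :: complete_space
proof
  fix X :: "nat \<Rightarrow> ell2" assume C: "Cauchy X"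
  have "Cauchy (\<lambda>n. seq (X n) k)" for k
    by (rule bounded_linear.Cauchy[OF bounded_linear_coord C])
  then have "\<forall>k. \<exists>l. (\<lambda>n. seq (X n) k) \<longlonglongrightarrow> l"
    by (simp add: Cauchy_convergent_iff convergent_def)
  from choice[OF this] obtain g where g: "\<And>k. (\<lambda>n. seq (X n) k) \<longlonglongrightarrow> g k" by blast
  have bnd: "(\<Sum>k\<in>F. (cmod (g k - seq (X n) k))\<^sup>2) \<le> e\<^sup>2"
    if N: "\<And>m. m \<ge> N \<Longrightarrow> norm (X m - X n) \<le> e" and F: "finite F" for N n e F
  proof (rule LIMSEQ_le_const2)
    show "(\<lambda>m. \<Sum>k\<in>F. (cmod (seq (X m) k - seq (X n) k))\<^sup>2) \<longlonglongrightarrow> (\<Sum>k\<in>F. (cmod (g k - seq (X n) k))\<^sup>2)"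
      by (intro tendsto_intros g)
    show "\<exists>N. \<forall>m\<ge>N. (\<Sum>k\<in>F. (cmod (seq (X m) k - seq (X n) k))\<^sup>2) \<le> e\<^sup>2"
    proof (intro exI allI impI)
      fix m assume "m \<ge> N"
      have "(\<Sum>k\<in>F. (cmod (seq (X m) k - seq (X n) k))\<^sup>2) \<le> (norm (X m - X n))\<^sup>2"
        using sum_le_l2norm[OF l2_seq[of "X m - X n"] F] unfolding l2norm_seq by simp
      also have "\<dots> \<le> e\<^sup>2" using N[OF \<open>m \<ge> N\<close>] by (simp add: power_mono)
      finally show "(\<Sum>k\<in>F. (cmod (seq (X m) k - seq (X n) k))\<^sup>2) \<le> e\<^sup>2" .
    qed
  qed
  obtain N0 where N0: "\<And>m. m \<ge> N0 \<Longrightarrow> norm (X m - X N0) \<le> 1"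
    using C unfolding Cauchy_iff by (metis zero_less_one order_refl less_imp_le)
  have "l2 (g - seq (X N0))" by (rule l2I) (use bnd[of N0 N0 1, OF N0] in auto)
  then have g2: "l2 g" using l2_add[OF _ l2_seq[of "X N0"]] by fastforce
  have "X \<longlonglongrightarrow> Ell2 g"
  proof (rule LIMSEQ_I)
    fix r :: real assume r: "0 < r"
    obtain N where N: "\<And>m n. m \<ge> N \<Longrightarrow> n \<ge> N \<Longrightarrow> norm (X m - X n) < r / 2"
      using C r unfolding Cauchy_iff by (meson half_gt_zero)
    have "norm (X n - Ell2 g) < r" if n: "n \<ge> N" for n
    proof -
      have "l2norm (g - seq (X n)) \<le> r / 2"
      proof (rule l2norm_le)
        show "(\<Sum>k\<in>F. (cmod ((g - seq (X n)) k))\<^sup>2) \<le> (r / 2)\<^sup>2" if "finite F" for F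
          using bnd[of N n "r/2" F] N n that by (auto simp: less_imp_le)
      qed (use r in auto)
      moreover have "l2norm (g - seq (X n)) = norm (Ell2 g - X n)"
        by (simp add: l2norm_seq[symmetric] g2 del: l2norm_seq)
      ultimately show ?thesis using r by (simp add: norm_minus_commute)
    qed
    then show "\<exists>N. \<forall>n\<ge>N. norm (X n - Ell2 g) < r" by blast
  qed
  then show "convergent X" by (auto simp: convergent_def)
qed

definition ebas :: "int \<Rightarrow> ell2" where
  "ebas k = Ell2 (\<lambda>n. if n = k then 1 else 0)"

lemma l2_finite_support:
  assumes "finite {n. f n \<noteq> 0}" shows "l2 f"
proof -
  have "(\<lambda>n. (cmod (f n))\<^sup>2) summable_on UNIV \<longleftrightarrow> (\<lambda>n. (cmod (f n))\<^sup>2) summable_on {n. f n \<noteq> 0}"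
    by (rule summable_on_cong_neutral) auto
  then show ?thesis using assms by (simp add: l2_def)
qed

lemma seq_ebas: "seq (ebas k) = (\<lambda>n. if n = k then 1 else 0)"
  unfolding ebas_def by (rule seq_Ell2) (rule l2_finite_support, simp)

lemma cin_ebas_right: "cin x (ebas k) = seq x k"
proof -
  have "cin x (ebas k) = infsum (\<lambda>n. seq x n * cnj (seq (ebas k) n)) UNIV" by (simp add: cin_def l2inner_def)
  also have "\<dots> = infsum (\<lambda>n. seq x n * cnj (seq (ebas k) n)) {k}"
    by (rule infsum_cong_neutral) (auto simp: seq_ebas)
  finally show ?thesis by (simp add: seq_ebas)
qed

lemma cin_ebas_left: "cin (ebas k) x = cnj (seq x k)"
  by (simp add: cin_commute[of "ebas k"] cin_ebas_right)

lemma norm_ebas [simp]: "norm (ebas k) = 1"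
proof -
  have "complex_of_real ((norm (ebas k))\<^sup>2) = 1" unfolding cin_self[symmetric] cin_ebas_right by (simp add: seq_ebas)
  then show ?thesis by (metis norm_ge_zero of_real_eq_1_iff power2_eq_1_iff neg_0_le_iff_le not_one_le_zero)
qed

text \<open>By Pythagoras the squared distance from \<open>x\<close> to a finite partial sum is
  \<open>(norm x)\<^sup>2\<close> minus the corresponding finite sum of squares.\<close>

lemma ell2_has_sum: "((\<lambda>k. cs (seq x k) (ebas k)) has_sum x) UNIV"
proof -
  define f where "f k = (cmod (seq x k))\<^sup>2" for k
  have "(f has_sum (norm x)\<^sup>2) UNIV"
    unfolding f_def norm_ell2_def l2norm_squared using l2_seq[of x] unfolding l2_def by (rule has_sum_infsum)
  then have lim: "((\<lambda>F. (norm x)\<^sup>2 - sum f F) \<longlongrightarrow> 0) (finite_subsets_at_top UNIV)"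
    unfolding has_sum_def by (simp add: LIM_zero[where l="(norm x)\<^sup>2"] tendsto_diff[where a="(norm x)\<^sup>2" and b="(norm x)\<^sup>2", simplified])
  have eq: "(norm (x - (\<Sum>k\<in>F. cs (seq x k) (ebas k))))\<^sup>2 = (norm x)\<^sup>2 - sum f F" if F: "finite F" for F
  proof -
    define s where "s = (\<Sum>k\<in>F. cs (seq x k) (ebas k))"
    have xs: "cin x s = complex_of_real (sum f F)"
      by (simp add: s_def cin_simps cin_ebas_right f_def complex_norm_square mult.commute del: of_real_power)
    have "cin s s = (\<Sum>k\<in>F. \<Sum>j\<in>F. if k = j then complex_of_real (f k) else 0)"
      unfolding s_def cin_sum_left cin_sum_right
      by (intro sum.cong) (auto simp: cin_simps cin_ebas_right seq_ebas cscale_def f_def complex_norm_square simp del: of_real_power)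
    also have "\<dots> = complex_of_real (sum f F)" using F by simp
    finally have ss: "cin s s = complex_of_real (sum f F)" .
    have "complex_of_real ((norm (x - s))\<^sup>2) = complex_of_real ((norm x)\<^sup>2 - sum f F)"
    proof -
      have sx: "cin s x = complex_of_real (sum f F)" unfolding cin_commute[of s x] xs by simp
      have "cin (x - s) (x - s) = cin x x - cin x s - (cin s x - cin s s)"
        by (simp add: cin_diff_left cin_diff_right)
      then show ?thesis unfolding xs ss sx cin_self[of x] cin_self[of "x - s"] by simp
    qed
    then show ?thesis unfolding s_def using of_real_eq_iff by blast
  qed
  have "((\<lambda>F. (norm (x - (\<Sum>k\<in>F. cs (seq x k) (ebas k))))\<^sup>2) \<longlongrightarrow> 0) (finite_subsets_at_top UNIV)"
    by (rule Lim_transform_eventually[OF lim]) (use eq in \<open>auto intro!: eventually_finite_subsets_at_top_weakI\<close>)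
  from tendsto_real_sqrt[OF this]
  have "((\<lambda>F. norm (x - (\<Sum>k\<in>F. cs (seq x k) (ebas k)))) \<longlongrightarrow> 0) (finite_subsets_at_top UNIV)"
    by simp
  then have "((\<lambda>F. x - (\<Sum>k\<in>F. cs (seq x k) (ebas k))) \<longlongrightarrow> 0) (finite_subsets_at_top UNIV)"
    by (rule tendsto_norm_zero_cancel)
  then have "((\<lambda>F. x - (x - (\<Sum>k\<in>F. cs (seq x k) (ebas k)))) \<longlongrightarrow> x - 0) (finite_subsets_at_top UNIV)"
    by (intro tendsto_intros)
  then show ?thesis unfolding has_sum_def by simp
qed

text \<open>Reduces strong convergence of the partial Blaschke products to the basis
  vectors.\<close>

lemma ell2_dense:
  assumes "closed S" "0 \<in> S" "\<And>x y. x \<in> S \<Longrightarrow> y \<in> S \<Longrightarrow> x + y \<in> S" "\<And>k c. cs c (ebas k) \<in> S"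
  shows "x \<in> S"
proof -
  have "(\<Sum>k\<in>F. cs (seq x k) (ebas k)) \<in> S" if "finite F" for F
    using that by (induction F rule: finite_induct) (auto simp: assms)
  then show ?thesis
    by (intro Lim_in_closed_set[OF assms(1) _ _ ell2_has_sum[unfolded has_sum_def]])
      (auto intro!: eventually_finite_subsets_at_top_weakI)
qed

section \<open>Complex-linear operators\<close>

text \<open>Operators are bounded real-linear maps commuting with complex scalars, and \<^const>\<open>adj\<close> is taken
  for the real inner product \<open>Re \<langle>x, y\<rangle>\<close>; by \<open>cin_adj\<close> below it is the complex adjoint.\<close>

definition clin :: "(ell2 \<Rightarrow>\<^sub>L ell2) \<Rightarrow> bool" where
  "clin A \<longleftrightarrow> (\<forall>c x. A (cs c x) = cs c (A x))"

lemma inner_cs_right: "x \<bullet> cs c y = cs (cnj c) x \<bullet> y"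
  by (simp add: Re_cin[symmetric] cin_cs_left cin_cs_right)

lemma clin_cs: "clin A \<Longrightarrow> A (cs c x) = cs c (A x)"
  by (simp add: clin_def)

lemma clin_id [simp]: "clin id_blinfun"
  by (simp add: clin_def)

lemma clin_zero [simp]: "clin 0"
  by (simp add: clin_def)

lemma clin_add: "clin A \<Longrightarrow> clin B \<Longrightarrow> clin (A + B)"
  by (simp add: clin_def blinfun.add_left cs_add_right)

lemma clin_diff: "clin A \<Longrightarrow> clin B \<Longrightarrow> clin (A - B)"
  by (simp add: clin_def blinfun.diff_left cs_diff_right)

lemma clin_compose: "clin A \<Longrightarrow> clin B \<Longrightarrow> clin (A o\<^sub>L B)"
  by (simp add: clin_def)

lemma clin_adj: "clin A \<Longrightarrow> clin (adj A)"
  unfolding clin_def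
proof (intro allI)
  fix c y assume A: "\<forall>c x. A (cs c x) = cs c (A x)"
  have "x \<bullet> adj A (cs c y) = x \<bullet> cs c (adj A y)" for x
    by (simp add: inner_adj[symmetric] inner_cs_right A)
  then show "adj A (cs c y) = cs c (adj A y)" by (metis inner_commute vector_eq_rdot)
qed

lemma cin_adj: "clin A \<Longrightarrow> cin (A x) y = cin x (adj A y)"
  using clin_cs[OF clin_adj] by (simp add: cin_eq_inner inner_adj)

lemma cin_adj': "clin A \<Longrightarrow> cin (adj A x) y = cin x (A y)"
  using cin_adj[OF clin_adj, of A x y] by simp

lemma clin_limit:
  assumes "\<And>n. clin (A n)" "A \<longlonglongrightarrow> B" shows "clin B"
  unfolding clin_def
proof (intro allI)
  fix c x
  have lim: "(\<lambda>n. A n y) \<longlonglongrightarrow> B y" for y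
    by (intro blinfun.tendsto assms tendsto_const)
  have "(\<lambda>n. cs c (A n x)) \<longlonglongrightarrow> B (cs c x)" using lim[of "cs c x"] assms(1) by (simp add: clin_def)
  moreover have "(\<lambda>n. cs c (A n x)) \<longlonglongrightarrow> cs c (B x)" by (intro tendsto_cs lim)
  ultimately show "B (cs c x) = cs c (B x)" using LIMSEQ_unique by blast
qed

definition Cs :: "complex \<Rightarrow> ell2 \<Rightarrow>\<^sub>L ell2" where
  "Cs c = Blinfun (cs c)"

lemma Cs_apply [simp]: "Cs c x = cs c x"
  by (simp add: Cs_def bounded_linear_Blinfun_apply bounded_linear_cs)

lemma clin_Cs [simp]: "clin (Cs c)"
  by (simp add: clin_def mult.commute)

lemma adj_Cs [simp]: "adj (Cs c) = Cs (cnj c)"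
  by (rule adj_eqI) (simp add: inner_cs_right)

text \<open>A coordinate of \<open>A x\<close> is a continuous functional of \<open>x\<close>, so
  the basis expansion passes through it. Operators can then be compared by matrix entries
  (\<open>clin_eqI\<close>), and convolutions are recognised by entries depending on
  \<open>m - k\<close> only (\<open>conv_clin\<close>).\<close>

lemma clin_coord:
  assumes "clin A"
  shows "seq (A x) m = infsum (\<lambda>k. seq (A (ebas k)) m * seq x k) UNIV"
proof -
  have "bounded_linear (\<lambda>y. seq (A y) m)"
    by (rule bounded_linear_compose[OF bounded_linear_coord blinfun.bounded_linear_right])
  from has_sum_bounded_linear[OF this ell2_has_sum[of x]]
  have "((\<lambda>k. seq (A (cs (seq x k) (ebas k))) m) has_sum seq (A x) m) UNIV" by (simp add: o_def)
  then have "((\<lambda>k. seq (A (ebas k)) m * seq x k) has_sum seq (A x) m) UNIV"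
    using assms by (simp add: clin_cs cscale_def mult.commute)
  then show ?thesis by (simp add: infsumI)
qed

lemma clin_eqI:
  assumes "clin A" "clin B" "\<And>k m. seq (A (ebas k)) m = seq (B (ebas k)) m"
  shows "A = B"
  by (rule blinfun_eqI, rule ell2_eqI, subst clin_coord[OF assms(1)], subst clin_coord[OF assms(2)])
    (simp only: assms(3))

lemma conv_clin:
  assumes "clin A" "\<And>k m. seq (A (ebas k)) m = c (m - k)"
  shows "conv c (seq x) = seq (A x)"
  by (rule ext) (subst clin_coord[OF assms(1)], simp add: conv_def assms(2))

lemma seq_adj_ebas: "clin A \<Longrightarrow> seq (adj A (ebas k)) m = cnj (seq (A (ebas m)) k)"
  by (simp add: cin_ebas_right[symmetric] cin_adj' cin_ebas_left)

text \<open>Reflecting and conjugating the coefficients is conjugate transposition of the matrix;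
  this is the form in which \<open>mult_inner_conj\<close> is given.\<close>

lemma conv_adj:
  assumes "clin A" "\<And>k m. seq (A (ebas k)) m = c (m - k)"
  shows "conv (\<lambda>k. cnj (c (- k))) (seq x) = seq (adj A x)"
  by (rule conv_clin) (simp_all add: assms clin_adj seq_adj_ebas)

lemma clin_sum: "clin A \<Longrightarrow> A (\<Sum>i\<in>I. cs (c i) (f i)) = (\<Sum>i\<in>I. cs (c i) (A (f i)))"
  by (simp add: blinfun.sum_right clin_cs)

section \<open>Orthonormal bases of finite-dimensional subspaces\<close>

definition csub :: "ell2 set \<Rightarrow> bool" where
  "csub S \<longleftrightarrow> 0 \<in> S \<and> (\<forall>x\<in>S. \<forall>y\<in>S. x + y \<in> S) \<and> (\<forall>c. \<forall>x\<in>S. cs c x \<in> S)"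

lemma csubD:
  assumes "csub S"
  shows "0 \<in> S" "x \<in> S \<Longrightarrow> y \<in> S \<Longrightarrow> x + y \<in> S" "x \<in> S \<Longrightarrow> cs c x \<in> S"
    "x \<in> S \<Longrightarrow> y \<in> S \<Longrightarrow> x - y \<in> S"
proof -
  show *: "0 \<in> S" "x \<in> S \<Longrightarrow> y \<in> S \<Longrightarrow> x + y \<in> S" "x \<in> S \<Longrightarrow> cs c x \<in> S" for x y c
    using assms by (auto simp: csub_def)
  show "x \<in> S \<Longrightarrow> y \<in> S \<Longrightarrow> x - y \<in> S"
    using *(2)[of x "- y"] *(3)[of y "-1"] by (simp add: cs_minus_one)
qed

lemma csub_sum: "csub S \<Longrightarrow> (\<And>i. i \<in> I \<Longrightarrow> f i \<in> S) \<Longrightarrow> (\<Sum>i\<in>I. cs (c i) (f i)) \<in> S"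
  by (induction I rule: infinite_finite_induct) (auto intro!: csubD)

lemma csub_subspace: "csub S \<Longrightarrow> subspace S"
  by (auto simp: subspace_def csub_def scaleR_cs)

definition orthonormal :: "(nat \<Rightarrow> ell2) \<Rightarrow> nat \<Rightarrow> bool" where
  "orthonormal v n \<longleftrightarrow> (\<forall>i<n. \<forall>j<n. cin (v i) (v j) = (if i = j then 1 else 0))"

definition onb :: "ell2 set \<Rightarrow> (nat \<Rightarrow> ell2) \<Rightarrow> nat \<Rightarrow> bool" where
  "onb S v n \<longleftrightarrow> orthonormal v n \<and> (\<forall>i<n. v i \<in> S) \<and> (\<forall>x\<in>S. x = (\<Sum>i<n. cs (cin x (v i)) (v i)))"

lemma orthonormalD: "orthonormal v n \<Longrightarrow> i < n \<Longrightarrow> j < n \<Longrightarrow> cin (v i) (v j) = (if i = j then 1 else 0)"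
  by (simp add: orthonormal_def)

lemma orthonormal_norm:
  assumes "orthonormal v n" "i < n" shows "norm (v i) = 1"
proof -
  have "complex_of_real ((norm (v i))\<^sup>2) = 1"
    unfolding cin_self[symmetric] using orthonormalD[OF assms(1,2,2)] by simp
  then have "(norm (v i))\<^sup>2 = 1" using of_real_eq_1_iff by blast
  then show ?thesis using norm_ge_zero[of "v i"] by (auto simp: power2_eq_1_iff)
qed

lemma onbD:
  assumes "onb S v n"
  shows "orthonormal v n" "i < n \<Longrightarrow> v i \<in> S" "x \<in> S \<Longrightarrow> (\<Sum>i<n. cs (cin x (v i)) (v i)) = x"
  using assms by (auto simp: onb_def)

lemma orthonormal_coeff:
  assumes "orthonormal v n" "i < n" shows "cin (\<Sum>j<n. cs (c j) (v j)) (v i) = c i"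
proof -
  have "cin (\<Sum>j<n. cs (c j) (v j)) (v i) = (\<Sum>j<n. if j = i then c j else 0)"
    unfolding cin_sum_left using orthonormalD[OF assms(1) _ assms(2)] by (intro sum.cong) (auto simp: cin_cs_left)
  then show ?thesis using assms(2) by simp
qed

lemma orthonormal_norm_sum:
  assumes "orthonormal v n"
  shows "(norm (\<Sum>j<n. cs (c j) (v j)))\<^sup>2 = (\<Sum>j<n. (cmod (c j))\<^sup>2)"
proof -
  have "complex_of_real ((norm (\<Sum>j<n. cs (c j) (v j)))\<^sup>2) = (\<Sum>i<n. cnj (c i) * c i)"
    unfolding cin_self[symmetric] cin_sum_right[of "(\<Sum>j<n. cs (c j) (v j))"]
    using orthonormal_coeff[OF assms, of _ c] by (intro sum.cong) (auto simp: cin_cs_right)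
  also have "\<dots> = complex_of_real (\<Sum>j<n. (cmod (c j))\<^sup>2)"
    by (simp add: complex_norm_square mult.commute del: of_real_power)
  finally show ?thesis using of_real_eq_iff by blast
qed

lemma orthonormal_extend:
  assumes S: "csub S" and v: "orthonormal v n" "\<forall>i<n. v i \<in> S" and not: "\<not> onb S v n"
  shows "\<exists>w. orthonormal (v(n := w)) (Suc n) \<and> w \<in> S"
proof -
  obtain x where x: "x \<in> S" "x \<noteq> (\<Sum>i<n. cs (cin x (v i)) (v i))" using not v by (auto simp: onb_def)
  define y where "y = x - (\<Sum>i<n. cs (cin x (v i)) (v i))"
  have y0: "norm y \<noteq> 0" using x(2) by (simp add: y_def)
  have yS: "y \<in> S" unfolding y_def by (intro csubD(4)[OF S] x csub_sum S) (use v in auto)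
  have orth: "cin y (v i) = 0" if "i < n" for i
    using orthonormal_coeff[OF v(1) that] by (simp add: y_def cin_diff_left)
  define w where "w = cs (complex_of_real (inverse (norm y))) y"
  have "cin w w = complex_of_real (inverse (norm y)) * (complex_of_real (inverse (norm y)) * complex_of_real ((norm y)\<^sup>2))"
    by (simp only: w_def cin_cs_left cin_cs_right cin_self[of y] complex_cnj_complex_of_real)
  also have "\<dots> = complex_of_real (inverse (norm y) * (inverse (norm y) * (norm y)\<^sup>2))" by simp
  also have "inverse (norm y) * (inverse (norm y) * (norm y)\<^sup>2) = 1" using y0 by (simp add: power2_eq_square field_simps)
  finally have 1: "cin w w = 1" by simp
  have 2: "cin w (v i) = 0" "cin (v i) w = 0" if "i < n" for i
    using orth[OF that] cin_commute[of "v i" y] by (auto simp: w_def cin_cs_left cin_cs_right)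
  have "orthonormal (v(n := w)) (Suc n)"
    unfolding orthonormal_def using orthonormalD[OF v(1)] 1 2 by (auto simp: less_Suc_eq)
  moreover have "w \<in> S" unfolding w_def by (rule csubD(3)[OF S yS])
  ultimately show ?thesis by blast
qed

text \<open>Gram-Schmidt either stops or runs forever. Finite dimension is later proved by refuting
  the second alternative, for instance by compactness.\<close>

lemma onb_or_infinite:
  assumes "csub S"
  obtains v n where "onb S v n" | v where "\<And>n. orthonormal v n" "\<And>i. v i \<in> S"
proof (cases "\<exists>v n. onb S v n")
  case False
  define P where "P = (\<lambda>n v. orthonormal v n \<and> (\<forall>i<n. v i \<in> S))"
  have "\<exists>V. \<forall>n. P n (V n) \<and> (\<forall>i<n. V (Suc n) i = V n i)"
  proof (rule dependent_nat_choice)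
    show "\<exists>v. P 0 v" by (simp add: P_def orthonormal_def)
  next
    fix v n assume "P n v"
    then obtain w where "orthonormal (v(n := w)) (Suc n)" "w \<in> S"
      using orthonormal_extend[OF assms, of v n] False by (auto simp: P_def)
    then show "\<exists>v'. P (Suc n) v' \<and> (\<forall>i<n. v' i = v i)"
      using \<open>P n v\<close> by (intro exI[of _ "v(n := w)"]) (auto simp: P_def less_Suc_eq)
  qed
  then obtain V where V: "\<And>n. P n (V n)" "\<And>n i. i < n \<Longrightarrow> V (Suc n) i = V n i" by blast
  \<comment> \<open>Entry \<open>i\<close> is present from stage \<open>Suc i\<close> on and never
    changes afterwards, so the diagonal collects all entries.\<close>
  define v where "v = (\<lambda>i. V (Suc i) i)"
  have Vv: "V n i = v i" if "i < n" for n i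
  proof -
    have "V (Suc i + k) i = V (Suc i) i" for k by (induction k) (auto simp: V(2))
    from this[of "n - Suc i"] that show ?thesis by (simp add: v_def)
  qed
  show ?thesis
  proof (rule that(2)[of v])
    show "orthonormal v n" for n using V(1)[of n] Vv[of _ n] by (auto simp: P_def orthonormal_def)
    show "v i \<in> S" for i using V(1)[of "Suc i"] by (auto simp: P_def v_def)
  qed
qed (use that in blast)

interpretation cv: vector_space cscale
  by (rule vector_space_cscale)

lemma seq_sum [simp]: "seq (\<Sum>i\<in>I. f i) = (\<Sum>i\<in>I. seq (f i))"
  by (induction I rule: infinite_finite_induct) auto

lemma orthonormal_inj:
  assumes "orthonormal v n" shows "inj_on (\<lambda>i. seq (v i)) {..<n}"
proof (rule inj_onI)
  fix i j assume ij: "i \<in> {..<n}" "j \<in> {..<n}" "seq (v i) = seq (v j)"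
  then have "v i = v j" by (simp add: seq_inject)
  then show "i = j" using orthonormalD[OF assms, of i j] orthonormalD[OF assms, of j j] ij by (auto split: if_splits)
qed

lemma orthonormal_independent:
  assumes "orthonormal v n" shows "cv.independent ((\<lambda>i. seq (v i)) ` {..<n})"
proof (rule cv.independent_if_scalars_zero)
  show "finite ((\<lambda>i. seq (v i)) ` {..<n})" by simp
next
  fix f x
  assume s: "(\<Sum>x\<in>(\<lambda>i. seq (v i)) ` {..<n}. cscale (f x) x) = 0" and x: "x \<in> (\<lambda>i. seq (v i)) ` {..<n}"
  obtain i where i: "i < n" "x = seq (v i)" using x by auto
  have "seq (\<Sum>j<n. cs (f (seq (v j))) (v j)) = seq 0"
    using s by (simp add: sum.reindex[OF orthonormal_inj[OF assms]])
  then have "(\<Sum>j<n. cs (f (seq (v j))) (v j)) = 0" by (simp only: seq_inject)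
  then show "f x = 0" using orthonormal_coeff[OF assms i(1), of "\<lambda>j. f (seq (v j))"] i by simp
qed

lemma onb_span:
  assumes "csub S" "onb S v n" shows "cv.span ((\<lambda>i. seq (v i)) ` {..<n}) = seq ` S"
proof
  have "cv.subspace (seq ` S)"
  proof (rule cv.subspaceI)
    show "0 \<in> seq ` S" using csubD(1)[OF assms(1)] by force
    show "x + y \<in> seq ` S" if "x \<in> seq ` S" "y \<in> seq ` S" for x y
      using that csubD(2)[OF assms(1)] by (force simp flip: seq_add)
    show "cscale c x \<in> seq ` S" if "x \<in> seq ` S" for c x
      using that csubD(3)[OF assms(1)] by (force simp flip: seq_cs)
  qed
  then show "cv.span ((\<lambda>i. seq (v i)) ` {..<n}) \<subseteq> seq ` S"
    by (rule cv.span_minimal[rotated]) (use onbD(2)[OF assms(2)] in auto)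
  show "seq ` S \<subseteq> cv.span ((\<lambda>i. seq (v i)) ` {..<n})"
  proof
    fix y assume "y \<in> seq ` S"
    then obtain x where x: "x \<in> S" "y = seq x" by blast
    have "y = (\<Sum>i<n. cscale (cin x (v i)) (seq (v i)))"
      using arg_cong[OF onbD(3)[OF assms(2) x(1)], of seq] x(2) by simp
    then show "y \<in> cv.span ((\<lambda>i. seq (v i)) ` {..<n})"
      by (auto intro!: cv.span_sum cv.span_scale intro: cv.span_base)
  qed
qed

text \<open>Links the span formulation in \<open>findim\<close> with orthonormal bases: an infinite
  orthonormal sequence would contain more independent vectors than any finite spanning set
  allows.\<close>

lemma findim_iff_onb:
  assumes "csub S" shows "findim (seq ` S) \<longleftrightarrow> (\<exists>v n. onb S v n)"
proof
  assume "\<exists>v n. onb S v n"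
  then show "findim (seq ` S)" unfolding findim_def using onb_span[OF assms] by (metis finite_imageI finite_lessThan order_refl)
next
  assume "findim (seq ` S)"
  then obtain B where B: "finite B" "seq ` S \<subseteq> cv.span B" by (auto simp: findim_def)
  show "\<exists>v n. onb S v n"
  proof (rule onb_or_infinite[OF assms])
    fix v assume v: "\<And>n. orthonormal v n" "\<And>i. v i \<in> S"
    have "card ((\<lambda>i. seq (v i)) ` {..<Suc (card B)}) \<le> card B"
      using cv.independent_span_bound[OF B(1) orthonormal_independent[OF v(1)[of "Suc (card B)"]]] B(2) v(2) by blast
    then show ?thesis using card_image[OF orthonormal_inj[OF v(1)[of "Suc (card B)"]]] by simp
  qed blast
qed

lemma cdim_onb:
  assumes "csub S" "onb S v n" shows "cdim (seq ` S) = n"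
proof -
  have "cv.dim (seq ` S) = card ((\<lambda>i. seq (v i)) ` {..<n})"
    unfolding onb_span[OF assms, symmetric]
    by (rule cv.dim_span_eq_card_independent[OF orthonormal_independent[OF onbD(1)[OF assms(2)]]])
  then show ?thesis by (simp add: cdim_def card_image[OF orthonormal_inj[OF onbD(1)[OF assms(2)]]])
qed

lemma common_convergent_subsequence:
  fixes c :: "nat \<Rightarrow> nat \<Rightarrow> complex"
  assumes "\<And>i k. i < n \<Longrightarrow> cmod (c k i) \<le> B"
  shows "\<exists>r. strict_mono r \<and> (\<forall>i<n. convergent (\<lambda>k. c (r k) i))"
  using assms
proof (induction n)
  case 0
  show ?case by (rule exI[of _ id]) (simp add: strict_mono_def)
next
  case (Suc n)
  then obtain r where r: "strict_mono r" "\<And>i. i < n \<Longrightarrow> convergent (\<lambda>k. c (r k) i)" by auto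
  have "bounded (range (\<lambda>k. c (r k) n))" using Suc.prems by (auto simp: bounded_iff)
  then obtain l s where s: "strict_mono s" "((\<lambda>k. c (r k) n) \<circ> s) \<longlonglongrightarrow> l"
    using bounded_imp_convergent_subsequence by blast
  have "convergent (\<lambda>k. c (r (s k)) i)" if "i < Suc n" for i
  proof (cases "i = n")
    case True
    then show ?thesis using s(2) by (auto simp: convergent_def o_def)
  next
    case False
    then have "convergent ((\<lambda>k. c (r k) i) \<circ> s)" using that r(2) s(1)
      by (intro convergent_subseq_convergent) auto
    then show ?thesis by (simp add: o_def)
  qed
  then show ?case using strict_mono_o[OF r(1) s(1)] by (intro exI[of _ "r \<circ> s"]) (auto simp: o_def)
qed

lemma onb_convergent_subsequence:
  fixes x :: "nat \<Rightarrow> ell2"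
  assumes "onb S v n" "\<And>k. x k \<in> S" "\<And>k. norm (x k) \<le> B"
  shows "\<exists>r. strict_mono r \<and> convergent (\<lambda>k. x (r k))"
proof -
  have "cmod (cin (x k) (v i)) \<le> B" if "i < n" for i k
    using norm_cin_le[of "x k" "v i"] assms(3)[of k] orthonormal_norm[OF onbD(1)[OF assms(1)] that] by simp
  then obtain r where r: "strict_mono r" "\<And>i. i < n \<Longrightarrow> convergent (\<lambda>k. cin (x (r k)) (v i))"
    using common_convergent_subsequence[of n "\<lambda>k i. cin (x k) (v i)" B] by auto
  define l where "l i = lim (\<lambda>k. cin (x (r k)) (v i))" for i
  have l: "(\<lambda>k. cin (x (r k)) (v i)) \<longlonglongrightarrow> l i" if "i < n" for i
    unfolding l_def using r(2)[OF that] by (rule convergent_LIMSEQ_iff[THEN iffD1])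
  have "(\<lambda>k. \<Sum>i<n. cs (cin (x (r k)) (v i)) (v i)) \<longlonglongrightarrow> (\<Sum>i<n. cs (l i) (v i))"
  proof (rule tendsto_sum)
    fix i assume "i \<in> {..<n}"
    have bl: "bounded_linear (\<lambda>c. cs c (v i))"
      by (rule bounded_linear_intro[where K = "norm (v i)"])
        (simp_all add: cs_add_left scaleR_cs scaleR_conv_of_real)
    show "(\<lambda>k. cs (cin (x (r k)) (v i)) (v i)) \<longlonglongrightarrow> cs (l i) (v i)"
      by (rule bounded_linear.tendsto[OF bl l]) (use \<open>i \<in> {..<n}\<close> in auto)
  qed
  then have "(\<lambda>k. x (r k)) \<longlonglongrightarrow> (\<Sum>i<n. cs (l i) (v i))"
    using onbD(3)[OF assms(1) assms(2)] by simp
  then show ?thesis using r(1) convergent_def by blast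
qed

section \<open>Compact operators\<close>

definition cpt :: "(ell2 \<Rightarrow>\<^sub>L ell2) \<Rightarrow> bool" where
  "cpt K \<longleftrightarrow> (\<forall>x::nat \<Rightarrow> ell2. (\<exists>B. \<forall>n. norm (x n) \<le> B) \<longrightarrow> (\<exists>r. strict_mono r \<and> convergent (\<lambda>n. K (x (r n)))))"

lemma cptE:
  fixes x :: "nat \<Rightarrow> ell2"
  assumes "cpt K" "\<And>n. norm (x n) \<le> B"
  obtains r l where "strict_mono r" "(\<lambda>n. K (x (r n))) \<longlonglongrightarrow> l"
  using assms unfolding cpt_def convergent_def by metis

lemma cpt_finite_rank:
  fixes K :: "ell2 \<Rightarrow>\<^sub>L ell2"
  assumes "onb S v n" "\<And>x. K x \<in> S" shows "cpt K"
  unfolding cpt_def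
proof (intro allI impI)
  fix x :: "nat \<Rightarrow> ell2" assume "\<exists>B. \<forall>n. norm (x n) \<le> B"
  then obtain B where B: "\<And>n. norm (x n) \<le> B" by blast
  have "norm (K (x k)) \<le> norm K * B" for k
    by (rule order_trans[OF norm_blinfun mult_left_mono]) (auto simp: B)
  then show "\<exists>r. strict_mono r \<and> convergent (\<lambda>n. K (x (r n)))"
    using onb_convergent_subsequence[OF assms(1), of "\<lambda>k. K (x k)" "norm K * B"] assms(2) by blast
qed

text \<open>Schauder's theorem in Hilbert space form. The squared norm of \<open>adj K z\<close> is
  the inner product of \<open>K (adj K z)\<close> with \<open>z\<close>, so along a bounded sequence
  the Cauchy property of \<open>K (adj K x)\<close> is inherited by \<open>adj K x\<close>.\<close>

lemma cpt_adj: assumes "cpt K" shows "cpt (adj K)"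
  unfolding cpt_def
proof (intro allI impI)
  fix x :: "nat \<Rightarrow> ell2" assume "\<exists>B. \<forall>n. norm (x n) \<le> B"
  then obtain B where B: "\<And>n. norm (x n) \<le> B" by blast
  have B0: "0 \<le> B" using B[of 0] norm_ge_zero order_trans by blast
  have adjB: "norm (adj K (x n)) \<le> norm K * B" for n
    by (rule order_trans[OF norm_blinfun]) (simp add: mult_left_mono B)
  obtain r l where r: "strict_mono r" "(\<lambda>n. K (adj K (x (r n)))) \<longlonglongrightarrow> l"
    by (rule cptE[OF assms adjB])
  have sq: "(norm (adj K (x i) - adj K (x j)))\<^sup>2 \<le> 2 * B * norm (K (adj K (x i)) - K (adj K (x j)))" for i j
  proof -
    have "(norm (adj K (x i) - adj K (x j)))\<^sup>2 = adj K (x i - x j) \<bullet> adj K (x i - x j)"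
      by (simp add: power2_norm_eq_inner blinfun.diff_right)
    also have "\<dots> = K (adj K (x i - x j)) \<bullet> (x i - x j)" by (simp add: inner_adj)
    also have "\<dots> \<le> norm (K (adj K (x i - x j))) * norm (x i - x j)" by (rule norm_cauchy_schwarz)
    also have "\<dots> \<le> norm (K (adj K (x i - x j))) * (2 * B)"
      using B[of i] B[of j] norm_triangle_ineq4[of "x i" "x j"] by (intro mult_left_mono) auto
    finally show ?thesis by (simp add: blinfun.diff_right mult.commute)
  qed
  have "Cauchy (\<lambda>n. K (adj K (x (r n))))" using r(2) LIMSEQ_imp_Cauchy by blast
  have "Cauchy (\<lambda>n. adj K (x (r n)))"
  proof (rule CauchyI)
    fix \<epsilon> :: real assume e: "\<epsilon> > 0"
    have "\<epsilon>\<^sup>2 / (2 * B + 1) > 0" using e B0 by simp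
    then obtain M where M: "\<And>m n. m \<ge> M \<Longrightarrow> n \<ge> M \<Longrightarrow>
        norm (K (adj K (x (r m))) - K (adj K (x (r n)))) < \<epsilon>\<^sup>2 / (2 * B + 1)"
      using \<open>Cauchy (\<lambda>n. K (adj K (x (r n))))\<close> unfolding Cauchy_iff by meson
    have "norm (adj K (x (r m)) - adj K (x (r n))) < \<epsilon>" if "m \<ge> M" "n \<ge> M" for m n
    proof -
      let ?d = "norm (K (adj K (x (r m))) - K (adj K (x (r n))))"
      have "(norm (adj K (x (r m)) - adj K (x (r n))))\<^sup>2 \<le> (2 * B + 1) * ?d"
        by (rule order_trans[OF sq]) (simp add: distrib_right)
      also have "\<dots> < \<epsilon>\<^sup>2" using M[OF that] B0 by (simp add: field_simps)
      finally show ?thesis using e by (simp add: power2_less_imp_less)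
    qed
    then show "\<exists>M. \<forall>m\<ge>M. \<forall>n\<ge>M. norm (adj K (x (r m)) - adj K (x (r n))) < \<epsilon>" by blast
  qed
  then show "\<exists>r. strict_mono r \<and> convergent (\<lambda>n. adj K (x (r n)))" using r(1) Cauchy_convergent_iff by blast
qed

lemma cpt_not_separated:
  fixes v :: "nat \<Rightarrow> ell2"
  assumes "cpt K" "\<And>i. norm (v i) \<le> 1" "\<And>i j. i \<noteq> j \<Longrightarrow> 1 \<le> norm (K (v i) - K (v j))"
  shows False
proof -
  obtain r l where r: "strict_mono r" "(\<lambda>n. K (v (r n))) \<longlonglongrightarrow> l" by (rule cptE[OF assms(1,2)])
  then have "Cauchy (\<lambda>n. K (v (r n)))" using LIMSEQ_imp_Cauchy by blast
  then obtain M where "\<And>m n. m \<ge> M \<Longrightarrow> n \<ge> M \<Longrightarrow> norm (K (v (r m)) - K (v (r n))) < 1"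
    unfolding Cauchy_iff by (meson zero_less_one)
  from this[of M "Suc M"] have "norm (K (v (r M)) - K (v (r (Suc M)))) < 1" by simp
  moreover have "r M \<noteq> r (Suc M)" using r(1) by (metis strict_mono_eq n_not_Suc_n)
  ultimately show False using assms(3) by fastforce
qed

section \<open>Operators on a subspace as operators on the whole space\<close>

definition cproj :: "(ell2 \<Rightarrow>\<^sub>L ell2) \<Rightarrow> bool" where
  "cproj \<Theta> \<longleftrightarrow> clin \<Theta> \<and> \<Theta> o\<^sub>L \<Theta> = \<Theta> \<and> adj \<Theta> = \<Theta>"

definition ran :: "(ell2 \<Rightarrow>\<^sub>L ell2) \<Rightarrow> ell2 set" where
  "ran \<Theta> = {x. \<Theta> x = x}"

lemma cprojD:
  assumes "cproj \<Theta>"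
  shows "clin \<Theta>" "\<Theta> o\<^sub>L \<Theta> = \<Theta>" "adj \<Theta> = \<Theta>" "\<Theta> (\<Theta> x) = \<Theta> x" "\<Theta> x \<in> ran \<Theta>"
    "\<Theta> x \<bullet> y = x \<bullet> \<Theta> y" "cin (\<Theta> x) y = cin x (\<Theta> y)"
proof -
  show *: "clin \<Theta>" "\<Theta> o\<^sub>L \<Theta> = \<Theta>" "adj \<Theta> = \<Theta>" using assms by (auto simp: cproj_def)
  show "\<Theta> (\<Theta> x) = \<Theta> x" using *(2) by (metis blinfun_apply_blinfun_compose)
  then show "\<Theta> x \<in> ran \<Theta>" by (simp add: ran_def)
  show "\<Theta> x \<bullet> y = x \<bullet> \<Theta> y" using inner_adj[of \<Theta>] *(3) by simp
  show "cin (\<Theta> x) y = cin x (\<Theta> y)" using cin_adj[OF *(1)] *(3) by simp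
qed

lemma cproj_norm_le: assumes "cproj \<Theta>" shows "norm (\<Theta> x) \<le> norm x"
proof (rule norm_le_of_inner_le)
  have "\<Theta> x \<bullet> \<Theta> x = x \<bullet> \<Theta> x" using cprojD[OF assms] by simp
  also have "\<dots> \<le> norm x * norm (\<Theta> x)" by (rule norm_cauchy_schwarz)
  finally show "\<Theta> x \<bullet> \<Theta> x \<le> norm x * norm (\<Theta> x)" .
qed simp

lemma cproj_norm: assumes "cproj \<Theta>" shows "norm \<Theta> \<le> 1"
  by (rule norm_blinfun_bound) (use cproj_norm_le[OF assms] in auto)

lemma csub_ran: "clin \<Theta> \<Longrightarrow> csub (ran \<Theta>)"
  by (simp add: csub_def ran_def blinfun.add_right clin_cs)

lemma closed_ran: "closed (ran \<Theta>)"
  unfolding ran_def by (intro closed_Collect_eq continuous_intros)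

lemma l2conv_seq: "l2conv (\<lambda>n. seq (x n)) (seq y) \<longleftrightarrow> x \<longlonglongrightarrow> y"
proof -
  have "l2conv (\<lambda>n. seq (x n)) (seq y) \<longleftrightarrow> (\<lambda>n. norm (x n - y)) \<longlonglongrightarrow> 0"
    by (simp add: l2conv_def flip: seq_diff)
  also have "\<dots> \<longleftrightarrow> x \<longlonglongrightarrow> y" by (simp add: tendsto_norm_zero_iff LIM_zero_iff)
  finally show ?thesis .
qed

text \<open>An operator on the range of \<open>\<Theta>\<close> is identified with its extension by 0 to the orthogonal
  complement; values of a \<^typ>\<open>lop\<close> outside that range are irrelevant.\<close>

definition ofop :: "(ell2 \<Rightarrow>\<^sub>L ell2) \<Rightarrow> lop \<Rightarrow> (ell2 \<Rightarrow>\<^sub>L ell2)" where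
  "ofop \<Theta> A = Blinfun (\<lambda>x. Ell2 (A (seq (\<Theta> x))))"

definition toop :: "(ell2 \<Rightarrow>\<^sub>L ell2) \<Rightarrow> lop" where
  "toop B = (\<lambda>f. seq (B (Ell2 f)))"

lemma toop_seq [simp]: "toop B (seq x) = seq (B x)"
  by (simp add: toop_def)

context
  fixes \<Theta> :: "ell2 \<Rightarrow>\<^sub>L ell2" and V :: "seqv set"
  assumes \<Theta>: "cproj \<Theta>" and V: "V = seq ` ran \<Theta>"
begin

lemma seq_proj_in: "seq (\<Theta> x) \<in> V"
  using cprojD(5)[OF \<Theta>] by (simp add: V)

lemma V_E: assumes "f \<in> V" obtains x where "f = seq x" "\<Theta> x = x"
  using assms by (auto simp: V ran_def)

lemma ofop_apply:
  assumes "is_bop V A" shows "seq (ofop \<Theta> A x) = A (seq (\<Theta> x))" "Ell2 (A (seq (\<Theta> x))) = ofop \<Theta> A x"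
proof -
  have AV: "A (seq (\<Theta> x)) \<in> V" for x using assms seq_proj_in unfolding is_bop_def by blast
  then have l2A: "l2 (A (seq (\<Theta> x)))" for x by (metis V_E l2_seq)
  obtain C where C: "\<And>f. f \<in> V \<Longrightarrow> l2norm (A f) \<le> C * l2norm f" using assms unfolding is_bop_def by blast
  have "bounded_linear (\<lambda>x. Ell2 (A (seq (\<Theta> x))))"
  proof (rule bounded_linear_intro[where K = "\<bar>C\<bar>"])
    fix x y :: ell2 and r :: real
    have "A (seq (\<Theta> x) + seq (\<Theta> y)) = A (seq (\<Theta> x)) + A (seq (\<Theta> y))"
      using assms seq_proj_in unfolding is_bop_def by blast
    then show "Ell2 (A (seq (\<Theta> (x + y)))) = Ell2 (A (seq (\<Theta> x))) + Ell2 (A (seq (\<Theta> y)))"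
      by (simp add: blinfun.add_right Ell2_add l2A)
    have "A (cscale (complex_of_real r) (seq (\<Theta> x))) = cscale (complex_of_real r) (A (seq (\<Theta> x)))"
      using assms seq_proj_in unfolding is_bop_def by blast
    then show "Ell2 (A (seq (\<Theta> (r *\<^sub>R x)))) = r *\<^sub>R Ell2 (A (seq (\<Theta> x)))"
      by (simp add: blinfun.scaleR_right scaleR_cs clin_cs[OF cprojD(1)[OF \<Theta>]] Ell2_cscale l2A)
    have "norm (Ell2 (A (seq (\<Theta> x)))) \<le> C * norm (\<Theta> x)"
      using C[OF seq_proj_in] by (simp add: l2norm_Ell2 l2A)
    also have "\<dots> \<le> \<bar>C\<bar> * norm x" by (intro mult_mono cproj_norm_le \<Theta>) auto
    finally show "norm (Ell2 (A (seq (\<Theta> x)))) \<le> norm x * \<bar>C\<bar>" by (simp add: mult.commute)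
  qed
  then show "Ell2 (A (seq (\<Theta> x))) = ofop \<Theta> A x" by (simp add: ofop_def bounded_linear_Blinfun_apply)
  then show "seq (ofop \<Theta> A x) = A (seq (\<Theta> x))" using l2A by (metis seq_Ell2)
qed

lemma ofop_seq: "is_bop V A \<Longrightarrow> x \<in> ran \<Theta> \<Longrightarrow> A (seq x) = seq (ofop \<Theta> A x)"
  by (simp add: ofop_apply(1) ran_def)

lemma clin_ofop: assumes "is_bop V A" shows "clin (ofop \<Theta> A)"
  unfolding clin_def
proof (intro allI)
  fix c x
  have "A (cscale c (seq (\<Theta> x))) = cscale c (A (seq (\<Theta> x)))"
    using assms seq_proj_in unfolding is_bop_def by blast
  then have "seq (ofop \<Theta> A (cs c x)) = seq (cs c (ofop \<Theta> A x))"
    by (simp add: ofop_apply(1)[OF assms] clin_cs[OF cprojD(1)[OF \<Theta>]])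
  then show "ofop \<Theta> A (cs c x) = cs c (ofop \<Theta> A x)" by (simp only: seq_inject)
qed

lemma ofop_ran: assumes "is_bop V A" shows "ofop \<Theta> A x \<in> ran \<Theta>"
proof -
  have "seq (ofop \<Theta> A x) \<in> V" unfolding ofop_apply(1)[OF assms]
    using assms seq_proj_in unfolding is_bop_def by blast
  then show ?thesis by (auto simp: V seq_inject)
qed

lemma ofop_corner:
  assumes "is_bop V A"
  shows "\<Theta> o\<^sub>L ofop \<Theta> A = ofop \<Theta> A" "ofop \<Theta> A o\<^sub>L \<Theta> = ofop \<Theta> A"
proof -
  show "\<Theta> o\<^sub>L ofop \<Theta> A = ofop \<Theta> A"
    by (rule blinfun_eqI) (use ofop_ran[OF assms] in \<open>simp add: ran_def\<close>)
  show "ofop \<Theta> A o\<^sub>L \<Theta> = ofop \<Theta> A"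
    by (rule blinfun_eqI, rule ell2_eqI) (simp add: ofop_apply(1)[OF assms] cprojD(4)[OF \<Theta>])
qed

lemma is_bop_toop:
  assumes "clin B" "\<And>x. \<Theta> x = x \<Longrightarrow> \<Theta> (B x) = B x" and A: "\<And>f. f \<in> V \<Longrightarrow> A f = toop B f"
  shows "is_bop V A"
  unfolding is_bop_def
proof (intro conjI ballI allI)
  have cV: "csub (ran \<Theta>)" by (rule csub_ran[OF cprojD(1)[OF \<Theta>]])
  fix f assume f: "f \<in> V"
  then obtain x where x: "f = seq x" "\<Theta> x = x" by (rule V_E)
  show "A f \<in> V" using A[OF f] assms(2) x by (auto simp: V ran_def)
  show "A (f + g) = A f + A g" if g: "g \<in> V" for g
  proof -
    obtain y where y: "g = seq y" "\<Theta> y = y" using g by (rule V_E)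
    have "f + g = seq (x + y)" using x y by simp
    moreover have "f + g \<in> V" unfolding V \<open>f + g = seq (x + y)\<close>
      by (rule imageI) (use x y in \<open>simp add: ran_def blinfun.add_right\<close>)
    ultimately show ?thesis using A[OF f] A[OF g] A[of "f + g"] x y by (simp add: blinfun.add_right flip: seq_add)
  qed
  show "A (cscale c f) = cscale c (A f)" for c
  proof -
    have "cscale c f = seq (cs c x)" using x by simp
    moreover have "cscale c f \<in> V" unfolding V \<open>cscale c f = seq (cs c x)\<close>
      by (rule imageI) (use x in \<open>simp add: ran_def clin_cs[OF cprojD(1)[OF \<Theta>]]\<close>)
    ultimately show ?thesis using A[OF f] A[of "cscale c f"] x clin_cs[OF assms(1)] by (simp flip: seq_cs)
  qed
next
  show "\<exists>C. \<forall>f\<in>V. l2norm (A f) \<le> C * l2norm f"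
  proof (intro exI ballI)
    fix f assume f: "f \<in> V"
    then obtain x where x: "f = seq x" "\<Theta> x = x" by (rule V_E)
    show "l2norm (A f) \<le> norm B * l2norm f" using A[OF f] x norm_blinfun[of B x] by simp
  qed
qed

lemma ofop_eqI:
  assumes "is_bop V A" "B o\<^sub>L \<Theta> = B" "\<And>x. \<Theta> x = x \<Longrightarrow> A (seq x) = seq (B x)"
  shows "ofop \<Theta> A = B"
proof (rule blinfun_eqI, rule ell2_eqI)
  fix x k
  have "seq (ofop \<Theta> A x) = seq (B (\<Theta> x))" using assms(3)[of "\<Theta> x"] by (simp add: ofop_apply(1)[OF assms(1)] cprojD(4)[OF \<Theta>])
  also have "B (\<Theta> x) = B x" using assms(2) by (metis blinfun_apply_blinfun_compose)
  finally show "seq (ofop \<Theta> A x) k = seq (B x) k" by simp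
qed

text \<open>Extension by 0 does not raise the norm because \<open>\<Theta>\<close> is a contraction
  onto the subspace.\<close>

lemma opnorm_ofop: assumes "is_bop V A" shows "opnorm V A = norm (ofop \<Theta> A)"
  unfolding opnorm_def
proof (rule cSup_eq_non_empty)
  let ?X = "(\<lambda>x. l2norm (A x)) ` {x \<in> V. l2norm x \<le> 1}"
  have "seq 0 \<in> V" unfolding V by (rule imageI) (simp add: ran_def)
  then have "seq 0 \<in> {x \<in> V. l2norm x \<le> 1}" by (simp del: seq_zero)
  then show "?X \<noteq> {}" by blast
  fix a assume "a \<in> ?X"
  then obtain f where f: "f \<in> V" "l2norm f \<le> 1" "a = l2norm (A f)" by blast
  obtain x where x: "f = seq x" "\<Theta> x = x" using f(1) by (rule V_E)
  have "a = norm (ofop \<Theta> A x)" using f x ofop_seq[OF assms, of x] by (simp add: ran_def)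
  also have "\<dots> \<le> norm (ofop \<Theta> A) * norm x" by (rule norm_blinfun)
  also have "\<dots> \<le> norm (ofop \<Theta> A) * 1" using f x by (intro mult_left_mono) auto
  finally show "a \<le> norm (ofop \<Theta> A)" by simp
next
  let ?X = "(\<lambda>x. l2norm (A x)) ` {x \<in> V. l2norm x \<le> 1}"
  fix b assume b: "\<And>a. a \<in> ?X \<Longrightarrow> a \<le> b"
  have bd: "norm (ofop \<Theta> A x) \<le> b" if "norm x \<le> 1" for x
  proof -
    have "l2norm (A (seq (\<Theta> x))) \<le> b"
      by (rule b, rule imageI) (use seq_proj_in order_trans[OF cproj_norm_le[OF \<Theta>] that] in simp)
    then show ?thesis by (simp flip: ofop_apply(1)[OF assms])
  qed
  show "norm (ofop \<Theta> A) \<le> b"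
  proof (rule norm_blinfun_bound)
    show "0 \<le> b" using bd[of 0] by simp
    fix x :: ell2
    show "norm (ofop \<Theta> A x) \<le> b * norm x"
    proof (cases "x = 0")
      case False
      then show ?thesis using bd[of "(inverse (norm x)) *\<^sub>R x"] by (simp add: blinfun.scaleR_right field_simps)
    qed simp
  qed
qed

text \<open>The adjoint of the extension maps into the range of \<open>\<Theta>\<close> again, so it
  is a candidate for the adjoint on the subspace; testing the difference of two candidates against
  itself gives uniqueness.\<close>

lemma adjoint_ofop:
  assumes "is_bop V A" "\<Theta> y = y" shows "adjoint V A (seq y) = seq (adj (ofop \<Theta> A) y)"
  unfolding adjoint_def
proof (rule the_equality)
  have corner: "\<Theta> o\<^sub>L adj (ofop \<Theta> A) = adj (ofop \<Theta> A)"
    using ofop_corner(2)[OF assms(1)] adj_compose[of "ofop \<Theta> A" \<Theta>] cprojD(3)[OF \<Theta>] by simp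
  then have "\<Theta> (adj (ofop \<Theta> A) y) = adj (ofop \<Theta> A) y" by (metis blinfun_apply_blinfun_compose)
  then have "seq (adj (ofop \<Theta> A) y) \<in> V" by (auto simp: V ran_def)
  moreover have "l2inner (A f) (seq y) = l2inner f (seq (adj (ofop \<Theta> A) y))" if f: "f \<in> V" for f
  proof -
    obtain x where x: "f = seq x" "\<Theta> x = x" using f by (rule V_E)
    show ?thesis using ofop_seq[OF assms(1), of x] x
      by (simp add: l2inner_seq ran_def cin_adj[OF clin_ofop[OF assms(1)]])
  qed
  ultimately show *: "seq (adj (ofop \<Theta> A) y) \<in> V \<and> (\<forall>f\<in>V. l2inner (A f) (seq y) = l2inner f (seq (adj (ofop \<Theta> A) y)))"
    by blast
  fix z assume z: "z \<in> V \<and> (\<forall>f\<in>V. l2inner (A f) (seq y) = l2inner f z)"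
  then obtain w where w: "z = seq w" "\<Theta> w = w" using V_E by blast
  let ?d = "w - adj (ofop \<Theta> A) y"
  have "\<Theta> ?d = ?d" using w corner by (simp add: blinfun.diff_right) (metis blinfun_apply_blinfun_compose)
  then have dV: "seq ?d \<in> V" unfolding V by (intro imageI) (simp add: ran_def)
  have "l2inner (seq ?d) (seq w) = l2inner (seq ?d) (seq (adj (ofop \<Theta> A) y))"
    using bspec[OF conjunct2[OF *] dV] bspec[OF conjunct2[OF z] dV] w(1) by (simp del: seq_diff)
  then have "cin ?d w = cin ?d (adj (ofop \<Theta> A) y)" unfolding l2inner_seq .
  then have "cin ?d ?d = 0" by (simp add: cin_diff_right)
  then have "?d = 0" by (simp add: cin_self)
  then show "z = seq (adj (ofop \<Theta> A) y)" using w by simp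
qed

lemma compact_op_ofop: "compact_op V K \<longleftrightarrow> is_bop V K \<and> cpt (ofop \<Theta> K)"
proof
  assume K: "compact_op V K"
  then have bop: "is_bop V K" by (simp add: compact_op_def)
  have "cpt (ofop \<Theta> K)" unfolding cpt_def
  proof (intro allI impI)
    fix x :: "nat \<Rightarrow> ell2" assume "\<exists>B. \<forall>n. norm (x n) \<le> B"
    then have "\<exists>B. \<forall>n. l2norm (seq (\<Theta> (x n))) \<le> B" using order_trans[OF cproj_norm_le[OF \<Theta>]] by (metis l2norm_seq)
    then obtain r y where r: "strict_mono r" "l2conv (\<lambda>n. K (seq (\<Theta> (x (r n))))) y"
      using K[unfolded compact_op_def, THEN conjunct2, THEN spec, of "\<lambda>n. seq (\<Theta> (x n))"] seq_proj_in by auto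
    have "l2 y" using r(2) by (simp add: l2conv_def)
    then have "(\<lambda>n. ofop \<Theta> K (x (r n))) \<longlonglongrightarrow> Ell2 y"
      using r(2) by (simp flip: l2conv_seq ofop_apply(1)[OF bop])
    then show "\<exists>r. strict_mono r \<and> convergent (\<lambda>n. ofop \<Theta> K (x (r n)))" using r(1) convergent_def by blast
  qed
  then show "is_bop V K \<and> cpt (ofop \<Theta> K)" using bop by blast
next
  assume K: "is_bop V K \<and> cpt (ofop \<Theta> K)"
  show "compact_op V K" unfolding compact_op_def
  proof (intro conjI allI impI)
    fix f :: "nat \<Rightarrow> seqv" assume f: "(\<forall>n. f n \<in> V) \<and> (\<exists>B. \<forall>n. l2norm (f n) \<le> B)"
    then have "\<forall>n. \<exists>x. f n = seq x \<and> \<Theta> x = x" using V_E by metis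
    from choice[OF this] obtain x where x: "\<And>n. f n = seq (x n)" "\<And>n. \<Theta> (x n) = x n" by blast
    obtain B where B: "\<And>n. norm (x n) \<le> B" using f x by auto
    obtain r l where r: "strict_mono r" "(\<lambda>n. ofop \<Theta> K (x (r n))) \<longlonglongrightarrow> l" using cptE[of "ofop \<Theta> K" x B] K B by blast
    have "l2conv (\<lambda>n. K (f (r n))) (seq l)" using r(2) x K by (simp add: ofop_seq ran_def l2conv_seq)
    then show "\<exists>r y. strict_mono r \<and> l2conv (\<lambda>n. K (f (r n))) y" using r(1) by blast
  qed (use K in blast)
qed

end

section \<open>Singular values on finite-dimensional subspaces\<close>

text \<open>Gaussian elimination with pivot \<open>M p n\<close>. It supplies the dimension count
  behind the min-max estimates: a combination of \<open>k + 1\<close> vectors can satisfy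
  \<open>k\<close> orthogonality conditions nontrivially.\<close>

lemma homogeneous_system_nontrivial:
  fixes M :: "'i \<Rightarrow> nat \<Rightarrow> complex"
  assumes "finite I" "n < card I"
  shows "\<exists>c. (\<exists>i\<in>I. c i \<noteq> 0) \<and> (\<forall>j<n. (\<Sum>i\<in>I. c i * M i j) = 0)"
  using assms
proof (induction n arbitrary: I M)
  case 0
  then have "I \<noteq> {}" by auto
  then show ?case by (intro exI[of _ "\<lambda>_. 1"]) auto
next
  case (Suc n)
  show ?case
  proof (cases "\<forall>i\<in>I. M i n = 0")
    case True
    obtain c where "\<exists>i\<in>I. c i \<noteq> 0" "\<forall>j<n. (\<Sum>i\<in>I. c i * M i j) = 0"
      using Suc.IH[of I M] Suc.prems by auto
    with True show ?thesis by (intro exI[of _ c]) (auto simp: less_Suc_eq)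
  next
    case False
    then obtain p where p: "p \<in> I" "M p n \<noteq> 0" by blast
    define M' where "M' i j = M i j - M i n / M p n * M p j" for i j
    have "n < card (I - {p})" using Suc.prems p by simp
    then obtain c where c: "\<exists>i\<in>I - {p}. c i \<noteq> 0" "\<And>j. j < n \<Longrightarrow> (\<Sum>i\<in>I - {p}. c i * M' i j) = 0"
      using Suc.IH[of "I - {p}" M'] Suc.prems by auto
    define s where "s = (\<Sum>i\<in>I - {p}. c i * M i n)"
    define c' where "c' = c(p := - s / M p n)"
    have sum: "(\<Sum>i\<in>I. c' i * M i j) = (\<Sum>i\<in>I - {p}. c i * M i j) - s / M p n * M p j" for j
    proof -
      have "(\<Sum>i\<in>I. c' i * M i j) = c' p * M p j + (\<Sum>i\<in>I - {p}. c' i * M i j)"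
        using Suc.prems(1) p(1) by (rule sum.remove)
      also have "(\<Sum>i\<in>I - {p}. c' i * M i j) = (\<Sum>i\<in>I - {p}. c i * M i j)"
        by (rule sum.cong) (auto simp: c'_def)
      finally show ?thesis by (simp add: c'_def)
    qed
    have "(\<Sum>i\<in>I. c' i * M i j) = 0" if "j < Suc n" for j
    proof (cases "j = n")
      case True
      then show ?thesis using p(2) by (simp add: sum) (simp add: s_def)
    next
      case False
      have "(\<Sum>i\<in>I - {p}. c i * M' i j) = (\<Sum>i\<in>I - {p}. c i * M i j) - s / M p n * M p j"
        by (simp add: M'_def right_diff_distrib sum_subtractf s_def sum_divide_distrib sum_distrib_right mult.assoc)
      then show ?thesis using c(2)[of j] False that by (simp add: sum)
    qed
    moreover have "\<exists>i\<in>I. c' i \<noteq> 0" using c(1) by (auto simp: c'_def)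
    ultimately show ?thesis by blast
  qed
qed

lemma norm_add_scaleR_squared:
  fixes x y :: "'a::real_inner"
  shows "(norm (x + t *\<^sub>R y))\<^sup>2 = (norm x)\<^sup>2 + 2 * t * (x \<bullet> y) + t\<^sup>2 * (norm y)\<^sup>2"
  unfolding power2_norm_eq_inner by (simp add: inner_simps inner_commute power2_eq_square algebra_simps)

text \<open>The quadratic form \<open>(norm (B x))\<^sup>2 - \<mu> * (norm x)\<^sup>2\<close> is
  nonnegative on \<open>T\<close> and vanishes at \<open>u\<close>, hence its first variation at
  \<open>u\<close> vanishes.\<close>

lemma minimizer_polar:
  fixes B :: "ell2 \<Rightarrow>\<^sub>L ell2"
  assumes T: "csub T" and min: "\<And>x. x \<in> T \<Longrightarrow> \<mu> * (norm x)\<^sup>2 \<le> (norm (B x))\<^sup>2"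
    and u: "u \<in> T" "(norm (B u))\<^sup>2 = \<mu> * (norm u)\<^sup>2" and y: "y \<in> T"
  shows "B u \<bullet> B y = \<mu> * (u \<bullet> y)"
proof -
  define b where "b = B u \<bullet> B y - \<mu> * (u \<bullet> y)"
  define q where "q = (norm (B y))\<^sup>2 - \<mu> * (norm y)\<^sup>2"
  have q: "0 \<le> q" using min[OF y] by (simp add: q_def)
  have "0 \<le> 2 * t * b + t\<^sup>2 * q" for t
  proof -
    have "u + t *\<^sub>R y \<in> T" unfolding scaleR_cs by (intro csubD(2,3)[OF T] u y)
    from min[OF this] show ?thesis
      unfolding blinfun.add_right blinfun.scaleR_right norm_add_scaleR_squared
      using u(2) by (simp add: b_def q_def algebra_simps)
  qed
  \<comment> \<open>Near the minimum \<open>- b / q\<close> of the polynomial; the denominator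
    \<open>q + 1\<close> also covers \<open>q = 0\<close>.\<close>
  from this[of "- b / (q + 1)"] have "2 * (b * b / (q + 1)) \<le> b * b / (q + 1) * (q / (q + 1))"
    by (simp add: power2_eq_square)
  also have "\<dots> \<le> b * b / (q + 1) * 1" using q by (intro mult_left_mono) auto
  finally have "b * b / (q + 1) \<le> 0" by simp
  then have "b * b \<le> 0" using q by (simp add: divide_le_0_iff)
  then have "b = 0" by (auto simp: mult_le_0_iff)
  then show ?thesis by (simp add: b_def)
qed

text \<open>Compactness of the unit sphere of the finite-dimensional space \<open>S\<close>, applied
  to a minimizing sequence in the closed subspace \<open>T\<close>.\<close>

lemma unit_minimizer:
  fixes B :: "ell2 \<Rightarrow>\<^sub>L ell2"
  assumes S: "onb S w d" and T: "csub T" "closed T" "T \<subseteq> S" and ne: "\<exists>x\<in>T. norm x = 1"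
  shows "\<exists>u\<in>T. norm u = 1 \<and> (\<forall>x\<in>T. (norm (B u))\<^sup>2 * (norm x)\<^sup>2 \<le> (norm (B x))\<^sup>2)"
proof -
  define D where "D = (\<lambda>x. norm (B x)) ` {x\<in>T. norm x = 1}"
  have D: "D \<noteq> {}" "bdd_below D" using ne by (auto simp: D_def intro!: bdd_belowI[of _ 0])
  have "\<exists>x\<in>T. norm x = 1 \<and> norm (B x) < Inf D + inverse (real (Suc n))" for n
    using cInf_less_iff[OF D, of "Inf D + inverse (real (Suc n))"] by (auto simp: D_def)
  then obtain x where x: "\<And>n. x n \<in> T" "\<And>n. norm (x n) = 1" "\<And>n. norm (B (x n)) < Inf D + inverse (real (Suc n))"
    by metis
  have xS: "x k \<in> S" for k using x(1) T(3) by blast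
  have "\<exists>r. strict_mono r \<and> convergent (\<lambda>n. x (r n))"
    by (rule onb_convergent_subsequence[OF S xS, where B = 1]) (simp add: x(2))
  then obtain r where r: "strict_mono r" "convergent (\<lambda>n. x (r n))" by blast
  then obtain u where u: "(\<lambda>n. x (r n)) \<longlonglongrightarrow> u" by (auto simp: convergent_def)
  have uT: "u \<in> T" using closed_sequentially[OF T(2) _ u] x(1) by blast
  have "(\<lambda>n. norm (x (r n))) \<longlonglongrightarrow> norm u" by (intro tendsto_intros u)
  then have nu: "norm u = 1" using x(2) LIMSEQ_unique[OF _ tendsto_const] by simp
  have "norm (B u) \<le> Inf D + 0"
  proof (rule LIMSEQ_le)
    show "(\<lambda>n. norm (B (x (r n)))) \<longlonglongrightarrow> norm (B u)" by (intro tendsto_intros blinfun.tendsto u)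
    show "(\<lambda>n. Inf D + inverse (real (Suc (r n)))) \<longlonglongrightarrow> Inf D + 0"
      using LIMSEQ_subseq_LIMSEQ[OF LIMSEQ_inverse_real_of_nat r(1)] by (intro tendsto_intros) (simp add: o_def)
    show "\<exists>N. \<forall>n\<ge>N. norm (B (x (r n))) \<le> Inf D + inverse (real (Suc (r n)))" using x(3) less_imp_le by blast
  qed
  moreover have "Inf D * norm y \<le> norm (B y)" if "y \<in> T" for y
  proof (cases "y = 0")
    case False
    have "inverse (norm y) *\<^sub>R y \<in> T" unfolding scaleR_cs by (rule csubD(3)[OF T(1) that])
    then have "norm (B (inverse (norm y) *\<^sub>R y)) \<in> D" unfolding D_def using False by (intro imageI) simp
    then have "Inf D \<le> norm (B (inverse (norm y) *\<^sub>R y))" by (rule cInf_lower[OF _ D(2)])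
    then show ?thesis using False by (simp add: blinfun.scaleR_right field_simps)
  qed simp
  ultimately have "norm (B u) * norm y \<le> norm (B y)" if "y \<in> T" for y
    using that mult_right_mono[of "norm (B u)" "Inf D" "norm y"] by fastforce
  then have "(norm (B u) * norm y)\<^sup>2 \<le> (norm (B y))\<^sup>2" if "y \<in> T" for y
    using that by (intro power_mono) auto
  then show ?thesis using uT nu by (auto simp: power_mult_distrib)
qed

text \<open>Successive minimization: \<open>v i\<close> minimizes \<open>norm (B x)\<close> on the
  unit sphere orthogonal to its predecessors, and the first variation makes it an eigenvector of the
  form attached to \<open>B\<close>. The last conjunct retains the minimality, on which one half of
  the min-max principle rests.\<close>

lemma singular_basis:
  assumes S: "csub S" "closed S" "onb S w d" and B: "clin B"
  shows "\<exists>v \<mu>. onb S v d \<and> (\<forall>i<d. \<forall>y\<in>S. cin (B (v i)) (B y) = complex_of_real (\<mu> i) * cin (v i) y)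
     \<and> (\<forall>i<d. \<forall>x\<in>S. (\<forall>j<i. cin x (v j) = 0) \<longrightarrow> \<mu> i * (norm x)\<^sup>2 \<le> (norm (B x))\<^sup>2)"
proof -
  have "\<exists>v \<mu>. orthonormal v m \<and> (\<forall>i<m. v i \<in> S \<and> (\<forall>y\<in>S. cin (B (v i)) (B y) = complex_of_real (\<mu> i) * cin (v i) y))
     \<and> (\<forall>i<m. \<forall>x\<in>S. (\<forall>j<i. cin x (v j) = 0) \<longrightarrow> \<mu> i * (norm x)\<^sup>2 \<le> (norm (B x))\<^sup>2)" if "m \<le> d" for m
    using that
  proof (induction m)
    case 0
    show ?case by (simp add: orthonormal_def)
  next
    case (Suc m)
    then have "m \<le> d" by simp
    from Suc.IH[OF this] obtain v \<mu> where "orthonormal v m"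
      "\<forall>i<m. v i \<in> S \<and> (\<forall>y\<in>S. cin (B (v i)) (B y) = complex_of_real (\<mu> i) * cin (v i) y)"
      "\<forall>i<m. \<forall>x\<in>S. (\<forall>j<i. cin x (v j) = 0) \<longrightarrow> \<mu> i * (norm x)\<^sup>2 \<le> (norm (B x))\<^sup>2" by (elim exE conjE)
    then have v: "orthonormal v m" "\<And>i. i < m \<Longrightarrow> v i \<in> S"
      "\<And>i y. i < m \<Longrightarrow> y \<in> S \<Longrightarrow> cin (B (v i)) (B y) = complex_of_real (\<mu> i) * cin (v i) y"
      "\<And>i x. i < m \<Longrightarrow> x \<in> S \<Longrightarrow> (\<And>j. j < i \<Longrightarrow> cin x (v j) = 0) \<Longrightarrow> \<mu> i * (norm x)\<^sup>2 \<le> (norm (B x))\<^sup>2"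
      by blast+
    define T where "T = {x\<in>S. \<forall>j<m. cin x (v j) = 0}"
    have Tsub: "csub T" using S(1) by (auto simp: T_def csub_def cin_add_left cin_cs_left)
    have "T = S \<inter> (\<Inter>j\<in>{..<m}. {x. cin x (v j) = 0})" by (auto simp: T_def)
    then have Tcl: "closed T"
      by (auto intro!: closed_Int closed_INT closed_Collect_eq S(2) linear_continuous_on bounded_linear_cin_left)
    have "\<not> onb S v m" using cdim_onb[OF S(1), of v m] cdim_onb[OF S(1,3)] Suc.prems by auto
    then obtain z where z: "orthonormal (v(m := z)) (Suc m)" "z \<in> S"
      using orthonormal_extend[OF S(1) v(1)] v(2) by blast
    have "cin z (v j) = 0" if "j < m" for j using orthonormalD[OF z(1), of m j] that by simp
    then have "z \<in> T" using z(2) by (simp add: T_def)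
    moreover have "norm z = 1" using orthonormal_norm[OF z(1), of m] by simp
    ultimately obtain u where u: "u \<in> T" "norm u = 1"
      "\<And>x. x \<in> T \<Longrightarrow> (norm (B u))\<^sup>2 * (norm x)\<^sup>2 \<le> (norm (B x))\<^sup>2"
      using unit_minimizer[OF S(3) Tsub Tcl, of B] by (auto simp: T_def)
    define \<nu> where "\<nu> = (norm (B u))\<^sup>2"
    have uS: "u \<in> S" and uv: "\<And>j. j < m \<Longrightarrow> cin u (v j) = 0" using u(1) by (auto simp: T_def)
    have vu: "cin (v j) u = 0" if "j < m" for j using uv[OF that] cin_commute[of "v j" u] by simp
    have polar: "B u \<bullet> B y = \<nu> * (u \<bullet> y)" if "y \<in> T" for y
      by (rule minimizer_polar[OF Tsub _ u(1) _ that]) (use u in \<open>auto simp: \<nu>_def\<close>)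
    \<comment> \<open>The variation in the direction \<open>cs \<i> y\<close> supplies the imaginary
      part.\<close>
    have eigT: "cin (B u) (B y) = complex_of_real \<nu> * cin u y" if "y \<in> T" for y
      using polar[OF that] polar[OF csubD(3)[OF Tsub that, of \<i>]]
      by (simp add: cin_eq_inner clin_cs[OF B] complex_eq_iff)
    \<comment> \<open>The component \<open>s\<close> of \<open>y\<close> along the earlier vectors
      contributes 0 to both sides, since these vectors already satisfy the eigenvalue identity
      against \<open>u\<close>.\<close>
    have eig: "cin (B u) (B y) = complex_of_real \<nu> * cin u y" if y: "y \<in> S" for y
    proof -
      define s where "s = (\<Sum>j<m. cs (cin y (v j)) (v j))"
      have "s \<in> S" unfolding s_def by (rule csub_sum[OF S(1)]) (use v(2) in auto)
      then have "y - s \<in> T" unfolding T_def using y csubD(4)[OF S(1)] orthonormal_coeff[OF v(1)]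
        by (simp add: s_def cin_diff_left)
      have "cin (B u) (B (v j)) = 0" if "j < m" for j
        using v(3)[OF that uS] vu[OF that] cin_commute[of "B u" "B (v j)"] by simp
      then have 1: "cin (B u) (B s) = 0" by (simp add: s_def clin_sum[OF B] cin_sum_right cin_cs_right)
      have 2: "cin u s = 0" by (simp add: s_def cin_sum_right cin_cs_right uv)
      show ?thesis using eigT[OF \<open>y - s \<in> T\<close>] 1 2 by (simp add: blinfun.diff_right cin_diff_right)
    qed
    have on: "orthonormal (v(m := u)) (Suc m)"
      unfolding orthonormal_def using orthonormalD[OF v(1)] uv vu u(2) by (auto simp: less_Suc_eq cin_self)
    show ?case
    proof (intro exI conjI)
      show "orthonormal (v(m := u)) (Suc m)" by (rule on)
      show "\<forall>i<Suc m. (v(m := u)) i \<in> S \<and>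
          (\<forall>y\<in>S. cin (B ((v(m := u)) i)) (B y) = complex_of_real ((\<mu>(m := \<nu>)) i) * cin ((v(m := u)) i) y)"
        using v(2,3) uS eig by (auto simp: less_Suc_eq)
      show "\<forall>i<Suc m. \<forall>x\<in>S. (\<forall>j<i. cin x ((v(m := u)) j) = 0) \<longrightarrow> (\<mu>(m := \<nu>)) i * (norm x)\<^sup>2 \<le> (norm (B x))\<^sup>2"
        using v(4) u(3) by (auto simp: less_Suc_eq T_def \<nu>_def)
    qed
  qed
  from this[of d] obtain v \<mu> where v: "orthonormal v d"
    "\<forall>i<d. v i \<in> S \<and> (\<forall>y\<in>S. cin (B (v i)) (B y) = complex_of_real (\<mu> i) * cin (v i) y)"
    "\<forall>i<d. \<forall>x\<in>S. (\<forall>j<i. cin x (v j) = 0) \<longrightarrow> \<mu> i * (norm x)\<^sup>2 \<le> (norm (B x))\<^sup>2" by auto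
  \<comment> \<open>A further orthonormal vector would make \<open>d + 1\<close> independent vectors
    inside a span of \<open>d\<close>.\<close>
  have "onb S v d"
  proof (rule ccontr)
    assume "\<not> onb S v d"
    then obtain z where z: "orthonormal (v(d := z)) (Suc d)" "z \<in> S"
      using orthonormal_extend[OF S(1) v(1)] v(2) by blast
    have "card ((\<lambda>i. seq ((v(d := z)) i)) ` {..<Suc d}) \<le> card ((\<lambda>i. seq (w i)) ` {..<d})"
      by (rule cv.independent_span_bound[THEN conjunct2])
        (use orthonormal_independent[OF z(1)] onb_span[OF S(1,3)] v(2) z(2) in \<open>auto simp: less_Suc_eq\<close>)
    then show False
      using card_image[OF orthonormal_inj[OF z(1)]] card_image_le[of "{..<d}" "\<lambda>i. seq (w i)"] by simp
  qed
  then show ?thesis using v by blast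
qed

text \<open>\<open>\<mu>\<close> holds the eigenvalues, that is the squared singular values, in
  increasing order and counted from 0, whereas \<open>sval\<close> counts from 1.\<close>

locale singular_system =
  fixes \<Theta> :: "ell2 \<Rightarrow>\<^sub>L ell2" and V :: "seqv set" and A :: lop and v :: "nat \<Rightarrow> ell2" and \<mu> :: "nat \<Rightarrow> real" and d :: nat
  assumes \<Theta>: "cproj \<Theta>" and V: "V = seq ` ran \<Theta>" and A: "is_bop V A" and onb: "onb (ran \<Theta>) v d"
    and eig: "\<And>i y. i < d \<Longrightarrow> y \<in> ran \<Theta> \<Longrightarrow> cin (ofop \<Theta> A (v i)) (ofop \<Theta> A y) = complex_of_real (\<mu> i) * cin (v i) y"
    and min: "\<And>i x. i < d \<Longrightarrow> x \<in> ran \<Theta> \<Longrightarrow> (\<And>j. j < i \<Longrightarrow> cin x (v j) = 0) \<Longrightarrow> \<mu> i * (norm x)\<^sup>2 \<le> (norm (ofop \<Theta> A x))\<^sup>2"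
begin

lemma on: "orthonormal v d" and vran: "i < d \<Longrightarrow> v i \<in> ran \<Theta>"
  using onbD[OF onb] by auto

lemma mu_eq: assumes "i < d" shows "\<mu> i = (norm (ofop \<Theta> A (v i)))\<^sup>2"
proof -
  have "complex_of_real ((norm (ofop \<Theta> A (v i)))\<^sup>2) = complex_of_real (\<mu> i)"
    unfolding cin_self[symmetric] using eig[OF assms vran[OF assms]] orthonormalD[OF on assms assms] by simp
  then show ?thesis using of_real_eq_iff by metis
qed

lemma mu_mono: assumes "i \<le> j" "j < d" shows "\<mu> i \<le> \<mu> j"
proof -
  have "\<mu> i * (norm (v j))\<^sup>2 \<le> (norm (ofop \<Theta> A (v j)))\<^sup>2"
    by (rule min) (use assms vran orthonormalD[OF on] in auto)
  then show ?thesis using mu_eq[OF assms(2)] orthonormal_norm[OF on assms(2)] by simp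
qed

text \<open>Testing against the basis alone, the eigenvalue equation for \<open>z\<close> says that
  the coefficient at \<open>v i\<close> vanishes unless \<open>\<mu> i = x\<close>. Multiplicities
  thus become numbers of indices.\<close>

lemma eig_space_eq: "eig_space V A x = cv.span ((\<lambda>i. seq (v i)) ` {i. i < d \<and> \<mu> i = x})"
proof
  have sub: "csub (ran \<Theta>)" by (rule csub_ran[OF cprojD(1)[OF \<Theta>]])
  have char: "seq z \<in> eig_space V A x \<longleftrightarrow> z \<in> ran \<Theta> \<and> (\<forall>i<d. cin z (v i) = 0 \<or> \<mu> i = x)" for z
  proof (cases "z \<in> ran \<Theta>")
    case z: True
    have "seq z \<in> eig_space V A x \<longleftrightarrow> (\<forall>y\<in>ran \<Theta>. cin (ofop \<Theta> A z) (ofop \<Theta> A y) = complex_of_real x * cin z y)"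
      using z unfolding eig_space_def V
      by (simp add: ofop_seq[OF \<Theta> V A] l2inner_seq inj_image_mem_iff[OF injI[of seq]] seq_inject)
    also have "\<dots> \<longleftrightarrow> (\<forall>i<d. cin (ofop \<Theta> A z) (ofop \<Theta> A (v i)) = complex_of_real x * cin z (v i))" (is "?L \<longleftrightarrow> ?R")
    proof
      assume R: ?R
      show ?L
      proof
        fix y assume y: "y \<in> ran \<Theta>"
        have y': "y = (\<Sum>i<d. cs (cin y (v i)) (v i))" using onbD(3)[OF onb y] by simp
        have "cin (ofop \<Theta> A z) (ofop \<Theta> A (\<Sum>i<d. cs (cin y (v i)) (v i))) = complex_of_real x * cin z (\<Sum>i<d. cs (cin y (v i)) (v i))"
          unfolding clin_sum[OF clin_ofop[OF \<Theta> V A]] cin_sum_right cin_cs_right sum_distrib_left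
          by (rule sum.cong) (use R in auto)
        then show "cin (ofop \<Theta> A z) (ofop \<Theta> A y) = complex_of_real x * cin z y" using y' by simp
      qed
    qed (use vran in blast)
    also have "\<dots> \<longleftrightarrow> (\<forall>i<d. cin z (v i) = 0 \<or> \<mu> i = x)"
    proof (intro all_cong)
      fix i assume i: "i < d"
      have "cin (ofop \<Theta> A z) (ofop \<Theta> A (v i)) = complex_of_real (\<mu> i) * cin z (v i)"
        using eig[OF i z] cin_commute[of "ofop \<Theta> A z"] cin_commute[of z "v i"] by simp
      then show "(cin (ofop \<Theta> A z) (ofop \<Theta> A (v i)) = complex_of_real x * cin z (v i)) = (cin z (v i) = 0 \<or> \<mu> i = x)"
        by auto
    qed
    finally show ?thesis using z by blast
  next
    case False
    then show ?thesis by (auto simp: eig_space_def V seq_inject)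
  qed
  show "cv.span ((\<lambda>i. seq (v i)) ` {i. i < d \<and> \<mu> i = x}) \<subseteq> eig_space V A x"
  proof (rule cv.span_minimal)
    show "(\<lambda>i. seq (v i)) ` {i. i < d \<and> \<mu> i = x} \<subseteq> eig_space V A x"
      using char vran orthonormalD[OF on] by auto
    have E: "f \<in> eig_space V A x \<longleftrightarrow> (\<exists>z. f = seq z \<and> z \<in> ran \<Theta> \<and> (\<forall>i<d. cin z (v i) = 0 \<or> \<mu> i = x))" for f
    proof -
      have "\<exists>z. f = seq z" if "f \<in> eig_space V A x" using that by (auto simp: eig_space_def V)
      then show ?thesis using char by blast
    qed
    show "cv.subspace (eig_space V A x)"
    proof (rule cv.subspaceI)
      show "0 \<in> eig_space V A x" unfolding E using csubD(1)[OF sub] by (intro exI[of _ 0]) simp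
    next
      fix f g assume "f \<in> eig_space V A x" "g \<in> eig_space V A x"
      then obtain a b where "f = seq a" "g = seq b" "a \<in> ran \<Theta>" "b \<in> ran \<Theta>"
         "\<forall>i<d. cin a (v i) = 0 \<or> \<mu> i = x" "\<forall>i<d. cin b (v i) = 0 \<or> \<mu> i = x" unfolding E by blast
      then show "f + g \<in> eig_space V A x" unfolding E
        by (intro exI[of _ "a + b"] conjI allI impI) (simp, simp add: csubD(2)[OF sub], metis add_0_left cin_add_left)
    next
      fix c f assume "f \<in> eig_space V A x"
      then obtain a where "f = seq a" "a \<in> ran \<Theta>" "\<forall>i<d. cin a (v i) = 0 \<or> \<mu> i = x" unfolding E by blast
      then show "cscale c f \<in> eig_space V A x" unfolding E using csubD(3)[OF sub]
        by (intro exI[of _ "cs c a"]) (auto simp: cin_cs_left)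
    qed
  qed
  show "eig_space V A x \<subseteq> cv.span ((\<lambda>i. seq (v i)) ` {i. i < d \<and> \<mu> i = x})"
  proof
    fix f assume f: "f \<in> eig_space V A x"
    then obtain z where z: "f = seq z" by (auto simp: eig_space_def V)
    with f char have z': "z \<in> ran \<Theta>" "\<And>i. i < d \<Longrightarrow> cin z (v i) = 0 \<or> \<mu> i = x" by auto
    have "z = (\<Sum>i<d. cs (cin z (v i)) (v i))" using onbD(3)[OF onb z'(1)] by simp
    also have "\<dots> = (\<Sum>i\<in>{i. i < d \<and> \<mu> i = x}. cs (cin z (v i)) (v i))"
      by (rule sum.mono_neutral_right) (use z'(2) in \<open>force+\<close>)
    finally have zz: "z = (\<Sum>i\<in>{i. i < d \<and> \<mu> i = x}. cs (cin z (v i)) (v i))" .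
    have "f = (\<Sum>i\<in>{i. i < d \<and> \<mu> i = x}. cscale (cin z (v i)) (seq (v i)))"
      using arg_cong[OF zz, of seq] z by simp
    then show "f \<in> cv.span ((\<lambda>i. seq (v i)) ` {i. i < d \<and> \<mu> i = x})"
      by (auto intro!: cv.span_sum cv.span_scale intro: cv.span_base)
  qed
qed

lemma cdim_eig_space: "cdim (eig_space V A x) = card {i. i < d \<and> \<mu> i = x}"
proof -
  let ?I = "{i. i < d \<and> \<mu> i = x}"
  have sub: "(\<lambda>i. seq (v i)) ` ?I \<subseteq> (\<lambda>i. seq (v i)) ` {..<d}" by auto
  have "cdim (eig_space V A x) = card ((\<lambda>i. seq (v i)) ` ?I)"
    unfolding eig_space_eq cdim_def
    by (rule cv.dim_span_eq_card_independent[OF cv.independent_mono[OF orthonormal_independent[OF on] sub]])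
  also have "\<dots> = card ?I"
    by (rule card_image[OF inj_on_subset[OF orthonormal_inj[OF on]]]) auto
  finally show ?thesis .
qed

lemma eig_mset_eq: "eig_mset V A = mset (map \<mu> [0..<d])"
proof (rule multiset_eqI)
  fix x
  let ?M = "{mu. 0 < cdim (eig_space V A mu)}"
  have "?M \<subseteq> \<mu> ` {..<d}" by (auto simp: cdim_eig_space card_gt_0_iff)
  then have fin: "finite ?M" by (rule finite_subset) auto
  have "count (eig_mset V A) x = (\<Sum>mu\<in>?M. if mu = x then cdim (eig_space V A mu) else 0)"
    unfolding eig_mset_def count_sum by (intro sum.cong) auto
  also have "\<dots> = cdim (eig_space V A x)" using fin by simp
  also have "\<dots> = card {i. i < d \<and> \<mu> i = x}" by (rule cdim_eig_space)
  also have "{i. i < d \<and> \<mu> i = x} = \<mu> -` {x} \<inter> {0..<d}" by auto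
  also have "card \<dots> = count (mset (map \<mu> [0..<d])) x"
    by (simp add: count_image_mset)
  finally show "count (eig_mset V A) x = count (mset (map \<mu> [0..<d])) x" .
qed

lemma sval_eq: assumes "i < d" shows "sval V A (Suc i) = sqrt (\<mu> i)"
proof -
  have "sorted (map \<mu> [0..<d])" using mu_mono by (auto simp: sorted_iff_nth_mono)
  then have "sorted_list_of_multiset (eig_mset V A) = map \<mu> [0..<d]"
    unfolding eig_mset_eq sorted_list_of_multiset_mset by (simp add: sorted_sort_id)
  then show ?thesis using assms by (simp add: sval_def)
qed

text \<open>One half of min-max: among the combinations of \<open>k + 1\<close> vectors, bounded
  below by \<open>\<delta>\<close> in terms of their coefficients, there is a nontrivial one
  orthogonal to the first \<open>k\<close> singular vectors, and the minimality of
  \<open>\<mu> k\<close> applies to it.\<close>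

lemma sval_le:
  assumes k: "k < d" and f: "\<And>i. i \<le> k \<Longrightarrow> f i \<in> ran \<Theta>" and \<delta>: "0 < \<delta>"
    and low: "\<And>c. \<delta> * (\<Sum>i\<le>k. (cmod (c i))\<^sup>2) \<le> (norm (\<Sum>i\<le>k. cs (c i) (f i)))\<^sup>2"
    and up: "\<And>c. (norm (ofop \<Theta> A (\<Sum>i\<le>k. cs (c i) (f i))))\<^sup>2 \<le> \<epsilon> * (\<Sum>i\<le>k. (cmod (c i))\<^sup>2)"
  shows "sval V A (Suc k) \<le> sqrt (\<epsilon> / \<delta>)"
proof -
  obtain c where c: "\<exists>i\<in>{..k}. c i \<noteq> 0" "\<forall>j<k. (\<Sum>i\<le>k. c i * cin (f i) (v j)) = 0"
    using homogeneous_system_nontrivial[of "{..k}" k "\<lambda>i j. cin (f i) (v j)"] by auto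
  define x where "x = (\<Sum>i\<le>k. cs (c i) (f i))"
  define s where "s = (\<Sum>i\<le>k. (cmod (c i))\<^sup>2)"
  have s: "s > 0" unfolding s_def using c(1) by (auto intro!: sum_pos2)
  have "x \<in> ran \<Theta>" unfolding x_def by (rule csub_sum[OF csub_ran[OF cprojD(1)[OF \<Theta>]]]) (use f in auto)
  then have "\<mu> k * (norm x)\<^sup>2 \<le> (norm (ofop \<Theta> A x))\<^sup>2"
    by (rule min[OF k]) (use c(2) in \<open>simp add: x_def cin_sum_left cin_cs_left\<close>)
  then have 1: "\<mu> k * (norm x)\<^sup>2 \<le> \<epsilon> * s" using up[of c] by (simp add: x_def s_def)
  have "\<mu> k * (\<delta> * s) \<le> \<mu> k * (norm x)\<^sup>2"
    using low[of c] mu_eq[OF k] by (intro mult_left_mono) (auto simp: x_def s_def)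
  then have "(\<mu> k * \<delta>) * s \<le> \<epsilon> * s" using 1 by (simp add: mult.assoc)
  then have "\<mu> k \<le> \<epsilon> / \<delta>" using s \<delta> by (simp add: field_simps)
  then show ?thesis using sval_eq[OF k] by simp
qed

text \<open>The other half of min-max: the span of the first \<open>k + 1\<close> singular vectors
  contains a nonzero vector orthogonal to all \<open>g i\<close> with \<open>i < k\<close>, and on
  that span \<open>\<mu> k\<close> bounds the form from above.\<close>

lemma sval_ge:
  assumes k: "k < d" and c: "0 \<le> c"
    and low: "\<And>x. x \<in> ran \<Theta> \<Longrightarrow> (\<And>i. i < k \<Longrightarrow> cin x (g i) = 0) \<Longrightarrow> c * norm x \<le> norm (ofop \<Theta> A x)"
  shows "c \<le> sval V A (Suc k)"
proof -
  obtain a where a: "\<exists>i\<in>{..<Suc k}. a i \<noteq> 0" "\<forall>j<k. (\<Sum>i<Suc k. a i * cin (v i) (g j)) = 0"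
    using homogeneous_system_nontrivial[of "{..<Suc k}" k "\<lambda>i j. cin (v i) (g j)"] by auto
  define x where "x = (\<Sum>i<Suc k. cs (a i) (v i))"
  have x: "x \<in> ran \<Theta>" unfolding x_def by (rule csub_sum[OF csub_ran[OF cprojD(1)[OF \<Theta>]]]) (use vran k in auto)
  have onk: "orthonormal v (Suc k)" using on k by (auto simp: orthonormal_def)
  have nx: "(norm x)\<^sup>2 = (\<Sum>i<Suc k. (cmod (a i))\<^sup>2)" unfolding x_def by (rule orthonormal_norm_sum[OF onk])
  obtain i where i: "i < Suc k" "a i \<noteq> 0" using a(1) by auto
  have "0 < (\<Sum>i<Suc k. (cmod (a i))\<^sup>2)" by (rule sum_pos2[of _ i]) (use i in auto)
  then have xpos: "0 < (norm x)\<^sup>2" using nx by simp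
  have "cin (ofop \<Theta> A x) (ofop \<Theta> A x) = (\<Sum>i<Suc k. a i * (complex_of_real (\<mu> i) * cin (v i) x))"
  proof -
    have "cin (ofop \<Theta> A x) (ofop \<Theta> A x) = (\<Sum>i<Suc k. a i * cin (ofop \<Theta> A (v i)) (ofop \<Theta> A x))"
      by (subst (1) x_def) (simp only: clin_sum[OF clin_ofop[OF \<Theta> V A]] cin_sum_left cin_cs_left)
    then show ?thesis using eig x k by simp
  qed
  also have "\<dots> = (\<Sum>i<Suc k. complex_of_real (\<mu> i * (cmod (a i))\<^sup>2))"
  proof (rule sum.cong)
    fix i assume i: "i \<in> {..<Suc k}"
    have "cin (v i) x = cnj (a i)" using orthonormal_coeff[OF onk, of i a] i cin_commute[of "v i" x] by (simp add: x_def)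
    then show "a i * (complex_of_real (\<mu> i) * cin (v i) x) = complex_of_real (\<mu> i * (cmod (a i))\<^sup>2)"
      by (simp add: complex_norm_square mult_ac del: of_real_power)
  qed simp
  also have "\<dots> = complex_of_real (\<Sum>i<Suc k. \<mu> i * (cmod (a i))\<^sup>2)" by (rule of_real_sum[symmetric])
  finally have "(norm (ofop \<Theta> A x))\<^sup>2 = (\<Sum>i<Suc k. \<mu> i * (cmod (a i))\<^sup>2)" unfolding cin_self of_real_eq_iff .
  also have "\<dots> \<le> (\<Sum>i<Suc k. \<mu> k * (cmod (a i))\<^sup>2)"
    by (intro sum_mono mult_right_mono mu_mono) (use k in auto)
  also have "\<dots> = \<mu> k * (norm x)\<^sup>2" unfolding nx by (rule sum_distrib_left[symmetric])
  finally have up: "(norm (ofop \<Theta> A x))\<^sup>2 \<le> \<mu> k * (norm x)\<^sup>2" .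
  have "c * norm x \<le> norm (ofop \<Theta> A x)"
    by (rule low[OF x]) (use a(2) in \<open>simp add: x_def cin_sum_left cin_cs_left del: sum.lessThan_Suc\<close>)
  then have "(c * norm x)\<^sup>2 \<le> \<mu> k * (norm x)\<^sup>2" using up c by (meson order_trans power_mono mult_nonneg_nonneg norm_ge_zero)
  then have "c\<^sup>2 \<le> \<mu> k" using xpos by (simp add: power_mult_distrib)
  then show ?thesis using sval_eq[OF k] by (simp add: real_le_rsqrt)
qed

end

lemma singular_system_exists:
  assumes "cproj \<Theta>" "V = seq ` ran \<Theta>" "is_bop V A" "onb (ran \<Theta>) w d"
  obtains v \<mu> where "singular_system \<Theta> V A v \<mu> d"
proof -
  obtain v \<mu> where "onb (ran \<Theta>) v d"
    "\<forall>i<d. \<forall>y\<in>ran \<Theta>. cin (ofop \<Theta> A (v i)) (ofop \<Theta> A y) = complex_of_real (\<mu> i) * cin (v i) y"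
    "\<forall>i<d. \<forall>x\<in>ran \<Theta>. (\<forall>j<i. cin x (v j) = 0) \<longrightarrow> \<mu> i * (norm x)\<^sup>2 \<le> (norm (ofop \<Theta> A x))\<^sup>2"
    using singular_basis[OF csub_ran[OF cprojD(1)[OF assms(1)]] closed_ran assms(4) clin_ofop[OF assms(1-3)]] by blast
  then have "singular_system \<Theta> V A v \<mu> d"
    unfolding singular_system_def using assms by blast
  then show ?thesis by (rule that)
qed

section \<open>Multiplication by continuous functions on the circle\<close>

lemma integral_cis:
  "integral {0..2*pi} (\<lambda>t. cis (of_int k * t)) = (if k = 0 then complex_of_real (2 * pi) else 0)"
proof (cases "k = 0")
  case False
  define A where "A = \<i> * complex_of_int k"
  have A: "A \<noteq> 0" using False by (simp add: A_def)
  have cis: "cis (of_int k * t) = exp (t *\<^sub>R A)" for t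
    by (simp add: cis_conv_exp A_def scaleR_conv_of_real mult_ac)
  have "((\<lambda>t. exp (t *\<^sub>R A) / A) has_vector_derivative exp (t *\<^sub>R A)) (at t within {0..2*pi})" for t
    using has_vector_derivative_mult_left[OF exp_scaleR_has_vector_derivative_right[of A t "{0..2*pi}"], of "1 / A"] A
    by simp
  then have "((\<lambda>t. exp (t *\<^sub>R A)) has_integral (exp ((2*pi) *\<^sub>R A) / A - exp (0 *\<^sub>R A) / A)) {0..2*pi}"
    by (intro fundamental_theorem_of_calculus) auto
  moreover have "exp ((2*pi) *\<^sub>R A) = 1"
    using cis_multiple_2pi[of "of_int k"] by (simp add: cis[symmetric] mult_ac)
  ultimately have "((\<lambda>t. exp (t *\<^sub>R A)) has_integral 0) {0..2*pi}" by simp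
  then show ?thesis using False by (simp add: cis integral_unique)
qed (simp add: scaleR_conv_of_real)

definition ccont :: "(complex \<Rightarrow> complex) \<Rightarrow> bool" where
  "ccont a \<longleftrightarrow> continuous_on (sphere 0 1) a"

lemma ccont_cis: "ccont a \<Longrightarrow> continuous_on S (\<lambda>t. a (cis t))"
  unfolding ccont_def by (rule continuous_on_compose2) (auto intro!: continuous_intros)

lemma ccont_intros [intro, simp]:
  "ccont (\<lambda>z. c)" "ccont (\<lambda>z. z powi k)"
  "ccont a \<Longrightarrow> ccont b \<Longrightarrow> ccont (\<lambda>z. a z + b z)"
  "ccont a \<Longrightarrow> ccont b \<Longrightarrow> ccont (\<lambda>z. a z - b z)"
  "ccont a \<Longrightarrow> ccont b \<Longrightarrow> ccont (\<lambda>z. a z * b z)"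
  "ccont a \<Longrightarrow> ccont (\<lambda>z. cnj (a z))"
  unfolding ccont_def by (auto intro!: continuous_intros)

text \<open>The mean square of \<open>h - p\<close> is nonnegative, where \<open>p\<close> is the
  Fourier polynomial of \<open>h\<close> with frequencies in \<open>G\<close>.\<close>

lemma bessel_inequality:
  fixes h :: "real \<Rightarrow> complex"
  assumes h: "continuous_on {0..2*pi} h" and G: "finite G"
  shows "(\<Sum>m\<in>G. (cmod (integral {0..2*pi} (\<lambda>t. h t * cis (- (of_int m * t))) / complex_of_real (2*pi)))\<^sup>2)
     \<le> integral {0..2*pi} (\<lambda>t. (cmod (h t))\<^sup>2) / (2*pi)"
proof -
  define c where "c m = integral {0..2*pi} (\<lambda>t. h t * cis (- (of_int m * t))) / complex_of_real (2*pi)" for m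
  define p where "p t = (\<Sum>m\<in>G. c m * cis (of_int m * t))" for t
  define s where "s = (\<Sum>m\<in>G. (cmod (c m))\<^sup>2)"
  have p: "continuous_on {0..2*pi} p" unfolding p_def by (intro continuous_intros)
  have int: "f integrable_on {0..2*pi}" if "continuous_on {0..2*pi} f" for f :: "real \<Rightarrow> complex"
    using that by (rule integrable_continuous_interval)
  note ci = continuous_intros h p
  have hm: "integral {0..2*pi} (\<lambda>t. h t * cis (- (of_int m * t))) = complex_of_real (2*pi) * c m" for m
    by (simp add: c_def)
  have pm: "integral {0..2*pi} (\<lambda>t. p t * cis (- (of_int m * t))) = complex_of_real (2*pi) * c m" if "m \<in> G" for m
  proof -
    have "p t * cis (- (of_int m * t)) = (\<Sum>j\<in>G. c j * cis (of_int (j - m) * t))" for t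
      by (simp add: p_def sum_distrib_right mult.assoc cis_mult left_diff_distrib)
    then have "integral {0..2*pi} (\<lambda>t. p t * cis (- (of_int m * t)))
        = integral {0..2*pi} (\<lambda>t. \<Sum>j\<in>G. c j * cis (of_int (j - m) * t))" by (simp only:)
    also have "\<dots> = (\<Sum>j\<in>G. integral {0..2*pi} (\<lambda>t. c j * cis (of_int (j - m) * t)))"
      by (rule Henstock_Kurzweil_Integration.integral_sum[OF G]) (intro int ci)
    also have "\<dots> = (\<Sum>j\<in>G. if j = m then complex_of_real (2*pi) * c j else 0)"
      unfolding Henstock_Kurzweil_Integration.integral_mult_right integral_cis by (intro sum.cong) auto
    finally show ?thesis using G that by simp
  qed
  \<comment> \<open>Used both for \<open>q = h\<close> and for \<open>q = p\<close>, which have the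
    same coefficients on \<open>G\<close>.\<close>
  have hp: "integral {0..2*pi} (\<lambda>t. q t * cnj (p t)) = complex_of_real (2*pi) * complex_of_real s"
    if q: "continuous_on {0..2*pi} q" "\<And>m. m \<in> G \<Longrightarrow> integral {0..2*pi} (\<lambda>t. q t * cis (- (of_int m * t))) = complex_of_real (2*pi) * c m" for q
  proof -
    have "integral {0..2*pi} (\<lambda>t. q t * cnj (p t)) = integral {0..2*pi} (\<lambda>t. \<Sum>j\<in>G. cnj (c j) * (q t * cis (- (of_int j * t))))"
      by (simp add: p_def sum_distrib_left cis_cnj mult_ac)
    also have "\<dots> = (\<Sum>j\<in>G. integral {0..2*pi} (\<lambda>t. cnj (c j) * (q t * cis (- (of_int j * t)))))"
      by (rule Henstock_Kurzweil_Integration.integral_sum[OF G]) (intro int continuous_intros q(1))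
    also have "\<dots> = (\<Sum>j\<in>G. cnj (c j) * (complex_of_real (2*pi) * c j))"
      unfolding Henstock_Kurzweil_Integration.integral_mult_right by (intro sum.cong) (auto simp: q(2))
    also have "\<dots> = complex_of_real (2*pi) * complex_of_real s"
      by (simp add: s_def sum_distrib_left complex_norm_square mult_ac del: of_real_power)
    finally show ?thesis .
  qed
  have cnjint: "integral {0..2*pi} (\<lambda>t. cnj (q t)) = cnj (integral {0..2*pi} q)" if "continuous_on {0..2*pi} q" for q
    using integral_linear[OF int[OF that] bounded_linear_cnj] by (simp add: o_def)
  have ph: "integral {0..2*pi} (\<lambda>t. p t * cnj (h t)) = complex_of_real (2*pi) * complex_of_real s"
  proof -
    have "continuous_on {0..2*pi} (\<lambda>t. h t * cnj (p t))" by (intro ci)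
    from cnjint[OF this] show ?thesis unfolding hp[OF h hm] by (simp add: mult.commute)
  qed
  have "integral {0..2*pi} (\<lambda>t. (h t - p t) * cnj (h t - p t)) =
     integral {0..2*pi} (\<lambda>t. (h t * cnj (h t) - h t * cnj (p t)) - (p t * cnj (h t) - p t * cnj (p t)))"
    by (simp add: algebra_simps)
  also have "\<dots> = (integral {0..2*pi} (\<lambda>t. h t * cnj (h t)) - integral {0..2*pi} (\<lambda>t. h t * cnj (p t)))
     - (integral {0..2*pi} (\<lambda>t. p t * cnj (h t)) - integral {0..2*pi} (\<lambda>t. p t * cnj (p t)))"
    by (subst Henstock_Kurzweil_Integration.integral_diff; (intro int ci)?)+ simp
  also have "\<dots> = integral {0..2*pi} (\<lambda>t. h t * cnj (h t)) - complex_of_real (2 * pi * s)"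
    using hp[OF h hm] hp[OF p pm] ph by simp
  finally have eq: "integral {0..2*pi} (\<lambda>t. (h t - p t) * cnj (h t - p t)) =
     integral {0..2*pi} (\<lambda>t. h t * cnj (h t)) - complex_of_real (2 * pi * s)" .
  have sq: "integral {0..2*pi} (\<lambda>t. q t * cnj (q t)) = complex_of_real (integral {0..2*pi} (\<lambda>t. (cmod (q t))\<^sup>2))"
    if q: "continuous_on {0..2*pi} q" for q
    using integral_linear[OF integrable_continuous_interval[of 0 "2*pi" "\<lambda>t. (cmod (q t))\<^sup>2"] bounded_linear_of_real[where 'a=complex]] q
    by (simp add: o_def complex_norm_square continuous_intros del: of_real_power)
  have "integral {0..2*pi} (\<lambda>t. (cmod (h t - p t))\<^sup>2) = integral {0..2*pi} (\<lambda>t. (cmod (h t))\<^sup>2) - 2 * pi * s"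
    using eq unfolding sq[OF h] sq[OF continuous_on_diff[OF h p]] of_real_diff[symmetric] of_real_eq_iff .
  moreover have "0 \<le> integral {0..2*pi} (\<lambda>t. (cmod (h t - p t))\<^sup>2)" by (rule Henstock_Kurzweil_Integration.integral_nonneg) (auto intro!: integrable_continuous_interval ci)
  ultimately have "2 * pi * s \<le> integral {0..2*pi} (\<lambda>t. (cmod (h t))\<^sup>2)" by linarith
  then have "s \<le> integral {0..2*pi} (\<lambda>t. (cmod (h t))\<^sup>2) / (2*pi)" by (simp add: field_simps)
  then show ?thesis unfolding s_def c_def .
qed

lemma integral_trig_norm:
  assumes F: "finite F"
  shows "integral {0..2*pi} (\<lambda>t. (cmod (\<Sum>k\<in>F. f k * cis (of_int k * t)))\<^sup>2) = 2 * pi * (\<Sum>k\<in>F. (cmod (f k))\<^sup>2)"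
proof -
  define p where "p t = (\<Sum>k\<in>F. f k * cis (of_int k * t))" for t
  have p: "continuous_on {0..2*pi} p" unfolding p_def by (intro continuous_intros)
  have int: "f integrable_on {0..2*pi}" if "continuous_on {0..2*pi} f" for f :: "real \<Rightarrow> complex"
    using that by (rule integrable_continuous_interval)
  have "complex_of_real (integral {0..2*pi} (\<lambda>t. (cmod (p t))\<^sup>2)) = integral {0..2*pi} (\<lambda>t. p t * cnj (p t))"
    using integral_linear[OF integrable_continuous_interval[of 0 "2*pi" "\<lambda>t. (cmod (p t))\<^sup>2"] bounded_linear_of_real[where 'a=complex]] p
    by (simp add: o_def complex_norm_square continuous_intros del: of_real_power)
  also have "\<dots> = integral {0..2*pi} (\<lambda>t. \<Sum>k\<in>F. \<Sum>j\<in>F. f k * cnj (f j) * cis (of_int (k - j) * t))"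
    by (simp add: p_def sum_product cis_cnj mult_ac) (simp add: cis_mult algebra_simps)
  also have "\<dots> = (\<Sum>k\<in>F. \<Sum>j\<in>F. integral {0..2*pi} (\<lambda>t. f k * cnj (f j) * cis (of_int (k - j) * t)))"
    by (subst Henstock_Kurzweil_Integration.integral_sum[OF F]; (intro int continuous_intros)?) (subst Henstock_Kurzweil_Integration.integral_sum[OF F]; (intro int continuous_intros)?; simp)
  also have "\<dots> = (\<Sum>k\<in>F. \<Sum>j\<in>F. if k = j then complex_of_real (2*pi) * (f k * cnj (f k)) else 0)"
    unfolding Henstock_Kurzweil_Integration.integral_mult_right integral_cis by (intro sum.cong) auto
  also have "\<dots> = (\<Sum>k\<in>F. complex_of_real (2*pi) * (f k * cnj (f k)))" using F by simp
  also have "\<dots> = complex_of_real (2 * pi * (\<Sum>k\<in>F. (cmod (f k))\<^sup>2))"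
    by (simp add: complex_norm_square sum_distrib_left del: of_real_power)
  finally show ?thesis unfolding p_def of_real_eq_iff .
qed

lemma fourier_shift:
  "fourier (\<lambda>z. a z * z powi k) m = fourier a (m - k)"
proof -
  have "a (cis t) * cis t powi k * cis (- (of_int m * t)) = a (cis t) * cis (- (of_int (m - k) * t))" for t
    by (simp add: cis_power_int cis_mult mult.assoc) (simp add: algebra_simps)
  then show ?thesis unfolding fourier_def by (simp only:)
qed

text \<open>The inner sums are the Fourier coefficients of \<open>a\<close> times the trigonometric
  polynomial with coefficients \<open>f\<close>. Bessel's inequality for the product and Parseval's
  identity for the polynomial give the norm bound of multiplication on finitely supported
  sequences.\<close>

lemma fourier_finite_bound:
  assumes a: "ccont a" and B: "\<And>z. z \<in> sphere 0 1 \<Longrightarrow> cmod (a z) \<le> B" and F: "finite F" and G: "finite G"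
  shows "(\<Sum>m\<in>G. (cmod (\<Sum>k\<in>F. fourier a (m - k) * f k))\<^sup>2) \<le> B\<^sup>2 * (\<Sum>k\<in>F. (cmod (f k))\<^sup>2)"
proof -
  define p where "p t = (\<Sum>k\<in>F. f k * cis (of_int k * t))" for t
  define h where "h t = a (cis t) * p t" for t
  have p: "continuous_on {0..2*pi} p" unfolding p_def by (intro continuous_intros)
  have h: "continuous_on {0..2*pi} h" unfolding h_def by (intro continuous_intros ccont_cis a p)
  have coeff: "integral {0..2*pi} (\<lambda>t. h t * cis (- (of_int m * t))) / complex_of_real (2*pi) = (\<Sum>k\<in>F. fourier a (m - k) * f k)" for m
  proof -
    have "integral {0..2*pi} (\<lambda>t. h t * cis (- (of_int m * t))) =
       integral {0..2*pi} (\<lambda>t. \<Sum>k\<in>F. f k * (a (cis t) * cis (- (of_int (m - k) * t))))"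
      by (simp add: h_def p_def sum_distrib_left sum_distrib_right mult_ac) (simp add: cis_mult algebra_simps)
    also have "\<dots> = (\<Sum>k\<in>F. integral {0..2*pi} (\<lambda>t. f k * (a (cis t) * cis (- (of_int (m - k) * t)))))"
      by (rule Henstock_Kurzweil_Integration.integral_sum[OF F]) (intro integrable_continuous_interval continuous_intros ccont_cis a)
    also have "\<dots> = (\<Sum>k\<in>F. f k * integral {0..2*pi} (\<lambda>t. a (cis t) * cis (- (of_int (m - k) * t))))"
      by simp
    finally show ?thesis by (simp add: fourier_def sum_divide_distrib mult.commute)
  qed
  have "integral {0..2*pi} (\<lambda>t. (cmod (h t))\<^sup>2) \<le> integral {0..2*pi} (\<lambda>t. B\<^sup>2 * (cmod (p t))\<^sup>2)"
  proof (rule integral_le)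
    show "(\<lambda>t. (cmod (h t))\<^sup>2) integrable_on {0..2*pi}" by (intro integrable_continuous_interval continuous_intros h)
    show "(\<lambda>t. B\<^sup>2 * (cmod (p t))\<^sup>2) integrable_on {0..2*pi}" by (intro integrable_continuous_interval continuous_intros p)
    fix t :: real
    have "(cmod (a (cis t)))\<^sup>2 \<le> B\<^sup>2" using B[of "cis t"] by (intro power_mono) auto
    then show "(cmod (h t))\<^sup>2 \<le> B\<^sup>2 * (cmod (p t))\<^sup>2"
      by (simp add: h_def norm_mult power_mult_distrib mult_right_mono)
  qed
  also have "\<dots> = B\<^sup>2 * (2 * pi * (\<Sum>k\<in>F. (cmod (f k))\<^sup>2))"
    unfolding Henstock_Kurzweil_Integration.integral_mult_right p_def integral_trig_norm[OF F] ..
  finally have "integral {0..2*pi} (\<lambda>t. (cmod (h t))\<^sup>2) / (2*pi) \<le> B\<^sup>2 * (\<Sum>k\<in>F. (cmod (f k))\<^sup>2)"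
    by (simp add: field_simps)
  then show ?thesis using bessel_inequality[OF h G] unfolding coeff by linarith
qed

lemma ccont_bounded:
  assumes "ccont a" obtains B where "0 \<le> B" "\<And>z. z \<in> sphere 0 1 \<Longrightarrow> cmod (a z) \<le> B"
proof -
  have "bounded (a ` sphere 0 1)" using assms unfolding ccont_def
    by (intro compact_imp_bounded compact_continuous_image) auto
  then obtain B where B: "\<forall>x\<in>a ` sphere 0 1. cmod x \<le> B" unfolding bounded_iff by blast
  show ?thesis
  proof (rule that[of "max 0 B"])
    show "cmod (a z) \<le> max 0 B" if "z \<in> sphere 0 1" for z
      using B that by (meson imageI le_max_iff_disj)
  qed simp
qed

lemma l2_fourier: assumes "ccont a" shows "l2 (fourier a)"
proof -
  obtain B where B: "\<And>z. z \<in> sphere 0 1 \<Longrightarrow> cmod (a z) \<le> B" using ccont_bounded[OF assms] by blast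
  show ?thesis using fourier_finite_bound[OF assms B, of "{0}" _ "\<lambda>_. 1"] by (intro l2I[of _ "B\<^sup>2"]) auto
qed

lemma l2_reflect: assumes "l2 c" shows "l2 (\<lambda>k. cnj (c (m - k)))"
proof -
  have "bij_betw (\<lambda>k. m - k) UNIV (UNIV :: int set)" by (rule bij_betwI[of _ _ _ "\<lambda>k. m - k"]) auto
  from summable_on_reindex_bij_betw[OF this, of "\<lambda>n. (cmod (c n))\<^sup>2"] show ?thesis using assms by (simp add: l2_def)
qed

lemma conv_has_sum:
  assumes "l2 c" "l2 f" shows "((\<lambda>k. c (m - k) * f k) has_sum conv c f m) UNIV"
  using has_sum_infsum[OF l2_product_summable[OF assms(2) l2_reflect[OF assms(1), of m]]]
  by (simp add: conv_def mult.commute)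

definition Mul :: "(complex \<Rightarrow> complex) \<Rightarrow> ell2 \<Rightarrow>\<^sub>L ell2" where
  "Mul a = Blinfun (\<lambda>x. Ell2 (conv (fourier a) (seq x)))"

lemma conv_fourier_bound:
  assumes a: "ccont a" and B: "\<And>z. z \<in> sphere 0 1 \<Longrightarrow> cmod (a z) \<le> B" and G: "finite G"
  shows "(\<Sum>m\<in>G. (cmod (conv (fourier a) (seq x) m))\<^sup>2) \<le> (B * norm x)\<^sup>2"
proof (rule tendsto_upperbound)
  show "((\<lambda>F. \<Sum>m\<in>G. (cmod (\<Sum>k\<in>F. fourier a (m - k) * seq x k))\<^sup>2)
     \<longlongrightarrow> (\<Sum>m\<in>G. (cmod (conv (fourier a) (seq x) m))\<^sup>2)) (finite_subsets_at_top UNIV)"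
    by (intro tendsto_intros conv_has_sum[OF l2_fourier[OF a] l2_seq, unfolded has_sum_def])
  show "\<forall>\<^sub>F F in finite_subsets_at_top UNIV. (\<Sum>m\<in>G. (cmod (\<Sum>k\<in>F. fourier a (m - k) * seq x k))\<^sup>2) \<le> (B * norm x)\<^sup>2"
  proof (rule eventually_finite_subsets_at_top_weakI)
    fix F :: "int set" assume F: "finite F"
    have "(\<Sum>m\<in>G. (cmod (\<Sum>k\<in>F. fourier a (m - k) * seq x k))\<^sup>2) \<le> B\<^sup>2 * (\<Sum>k\<in>F. (cmod (seq x k))\<^sup>2)"
      by (rule fourier_finite_bound[OF a B F G])
    also have "\<dots> \<le> B\<^sup>2 * (norm x)\<^sup>2"
      using sum_le_l2norm[OF l2_seq[of x] F] by (intro mult_left_mono) auto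
    finally show "(\<Sum>m\<in>G. (cmod (\<Sum>k\<in>F. fourier a (m - k) * seq x k))\<^sup>2) \<le> (B * norm x)\<^sup>2"
      by (simp add: power_mult_distrib)
  qed
qed simp

lemma Mul_apply:
  assumes a: "ccont a"
  shows "seq (Mul a x) = conv (fourier a) (seq x)" "clin (Mul a)"
    and Mul_bound: "0 \<le> B \<Longrightarrow> (\<And>z. z \<in> sphere 0 1 \<Longrightarrow> cmod (a z) \<le> B) \<Longrightarrow> norm (Mul a) \<le> B"
proof -
  note hs = conv_has_sum[OF l2_fourier[OF a] l2_seq]
  have l2c: "l2 (conv (fourier a) (seq x))" for x
  proof -
    obtain B where B: "\<And>z. z \<in> sphere 0 1 \<Longrightarrow> cmod (a z) \<le> B" using ccont_bounded[OF a] by blast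
    show ?thesis by (rule l2I, rule conv_fourier_bound[OF a B])
  qed
  have bnd: "norm (Ell2 (conv (fourier a) (seq x))) \<le> B * norm x"
    if "0 \<le> B" "\<And>z. z \<in> sphere 0 1 \<Longrightarrow> cmod (a z) \<le> B" for B x
    unfolding l2norm_Ell2[OF l2c] by (rule l2norm_le) (use that conv_fourier_bound[OF a that(2)] in auto)
  have add: "conv (fourier a) (seq x + seq y) = conv (fourier a) (seq x) + conv (fourier a) (seq y)" for x y
  proof
    fix m
    show "conv (fourier a) (seq x + seq y) m = (conv (fourier a) (seq x) + conv (fourier a) (seq y)) m"
      using has_sum_add[OF hs[of m x] hs[of m y]] hs[of m "x + y"] by (auto simp: distrib_left dest: has_sum_unique)
  qed
  have scale: "conv (fourier a) (cscale c (seq x)) = cscale c (conv (fourier a) (seq x))" for c x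
  proof
    fix m
    show "conv (fourier a) (cscale c (seq x)) m = cscale c (conv (fourier a) (seq x)) m"
      using has_sum_cmult_right[OF hs[of m x], of c] hs[of m "cs c x"]
      by (auto simp: cscale_def mult_ac dest: has_sum_unique)
  qed
  obtain B where B: "0 \<le> B" "\<And>z. z \<in> sphere 0 1 \<Longrightarrow> cmod (a z) \<le> B" using ccont_bounded[OF a] by blast
  have "norm (Ell2 (conv (fourier a) (seq x))) \<le> norm x * B" for x
    using bnd[OF B, of x] by (simp add: mult.commute)
  then have "bounded_linear (\<lambda>x. Ell2 (conv (fourier a) (seq x)))"
    by (intro bounded_linear_intro[where K = B])
      (simp_all add: add scale Ell2_add Ell2_cscale l2c scaleR_cs)
  then have M: "Mul a x = Ell2 (conv (fourier a) (seq x))" for x by (simp add: Mul_def bounded_linear_Blinfun_apply)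
  show "seq (Mul a x) = conv (fourier a) (seq x)" by (simp add: M l2c)
  show "clin (Mul a)" by (simp add: clin_def M scale Ell2_cscale l2c)
  show "norm (Mul a) \<le> B" if "0 \<le> B" "\<And>z. z \<in> sphere 0 1 \<Longrightarrow> cmod (a z) \<le> B" for B
    by (rule norm_blinfun_bound[OF that(1)], unfold M, rule bnd[OF that])
qed

lemma Mul_ebas: assumes "ccont a" shows "seq (Mul a (ebas k)) m = fourier a (m - k)"
proof -
  have "conv (fourier a) (seq (ebas k)) m = infsum (\<lambda>j. fourier a (m - j) * seq (ebas k) j) {k}"
    unfolding conv_def by (rule infsum_cong_neutral) (auto simp: seq_ebas)
  then show ?thesis by (simp add: Mul_apply(1)[OF assms] seq_ebas)
qed

lemma fourier_add: "ccont a \<Longrightarrow> ccont b \<Longrightarrow> fourier (\<lambda>z. a z + b z) m = fourier a m + fourier b m"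
  unfolding fourier_def distrib_right
  by (subst Henstock_Kurzweil_Integration.integral_add)
    (auto intro!: integrable_continuous_interval continuous_intros ccont_cis simp: add_divide_distrib)

lemma fourier_cmult: "fourier (\<lambda>z. c * a z) m = c * fourier a m"
  by (simp add: fourier_def mult.assoc)

lemma fourier_cnj: assumes "ccont a" shows "fourier (\<lambda>z. cnj (a z)) m = cnj (fourier a (- m))"
proof -
  have "(\<lambda>t. a (cis t) * cis (- (of_int (- m) * t))) integrable_on {0..2*pi}"
    by (intro integrable_continuous_interval continuous_intros ccont_cis assms)
  from integral_linear[OF this bounded_linear_cnj]
  show ?thesis by (simp add: fourier_def o_def cis_cnj)
qed

lemma fourier_const: "fourier (\<lambda>z. c) m = (if m = 0 then c else 0)"
  using integral_cis[of "- m"] by (simp add: fourier_def)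

lemma fourier_powi: "fourier (\<lambda>z. z powi k) m = (if m = k then 1 else 0)"
  using fourier_shift[of "\<lambda>_. 1" k m] by (simp add: fourier_const)

lemma Mul_add: assumes "ccont a" "ccont b" shows "Mul (\<lambda>z. a z + b z) = Mul a + Mul b"
  by (rule clin_eqI) (simp_all add: assms Mul_apply(2) clin_add Mul_ebas fourier_add blinfun.add_left)

lemma Mul_cmult: assumes "ccont a" shows "Mul (\<lambda>z. c * a z) = Cs c o\<^sub>L Mul a"
  by (rule clin_eqI) (simp_all add: assms Mul_apply(2) clin_compose Mul_ebas fourier_cmult cscale_def)

lemma Mul_diff: assumes "ccont a" "ccont b" shows "Mul (\<lambda>z. a z - b z) = Mul a - Mul b"
proof -
  have "ccont (\<lambda>z. (-1) * b z)" using assms(2) unfolding ccont_def by (intro continuous_intros)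
  then have "Mul (\<lambda>z. a z + (-1) * b z) = Mul a + (Cs (-1) o\<^sub>L Mul b)"
    unfolding Mul_cmult[OF assms(2), symmetric] by (rule Mul_add[OF assms(1)])
  also have "\<dots> = Mul a - Mul b"
    by (rule blinfun_eqI) (simp add: blinfun.add_left blinfun.diff_left cs_minus_one)
  finally show ?thesis by simp
qed

lemma Mul_cnj: assumes "ccont a" shows "Mul (\<lambda>z. cnj (a z)) = adj (Mul a)"
  by (rule clin_eqI)
    (simp_all add: assms Mul_apply(2) clin_adj Mul_ebas fourier_cnj seq_adj_ebas)

lemma Mul_one: "Mul (\<lambda>z. 1) = id_blinfun"
  by (rule clin_eqI) (simp_all add: Mul_apply(2) Mul_ebas fourier_const seq_ebas)

lemma Mul_cong: "(\<And>z. z \<in> sphere 0 1 \<Longrightarrow> a z = b z) \<Longrightarrow> Mul a = Mul b"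
  unfolding Mul_def fourier_def by simp

text \<open>The bilateral shift by \<open>k\<close> places. Being a multiplication operator, it
  commutes with every \<open>Mul a\<close> for continuous \<open>a\<close>.\<close>

definition U :: "int \<Rightarrow> ell2 \<Rightarrow>\<^sub>L ell2" where
  "U k = Mul (\<lambda>z. z powi k)"

lemma clin_U [simp]: "clin (U k)"
  by (simp add: U_def Mul_apply(2))

lemma U_ebas: "U k (ebas j) = ebas (j + k)"
  by (rule ell2_eqI) (simp add: U_def Mul_ebas fourier_powi seq_ebas)

lemma seq_U: "seq (U k x) m = seq x (m - k)"
proof -
  have "conv (fourier (\<lambda>z. z powi k)) (seq x) m = infsum (\<lambda>j. fourier (\<lambda>z. z powi k) (m - j) * seq x j) {m - k}"
    unfolding conv_def by (rule infsum_cong_neutral) (auto simp: fourier_powi)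
  then show ?thesis by (simp add: U_def Mul_apply(1) fourier_powi)
qed

lemma adj_U: "adj (U k) = U (- k)"
  by (rule clin_eqI) (auto simp add: clin_adj seq_adj_ebas seq_U seq_ebas)

lemma Mul_powi_right: assumes "ccont a" shows "Mul (\<lambda>z. a z * z powi k) = Mul a o\<^sub>L U k"
  by (rule clin_eqI)
    (simp_all add: assms Mul_apply(2) clin_compose Mul_ebas fourier_shift U_ebas algebra_simps)

inductive trig :: "(complex \<Rightarrow> complex) \<Rightarrow> bool" where
  monom: "trig (\<lambda>z. c * z powi k)"
| add: "trig p \<Longrightarrow> trig q \<Longrightarrow> trig (\<lambda>z. p z + q z)"

lemma ccont_trig: "trig p \<Longrightarrow> ccont p"
  by (induction rule: trig.induct) auto

text \<open>Only the values on the circle count: at 0 the default value of negative powers destroys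
  the law of exponents needed for products.\<close>

definition tsph :: "(complex \<Rightarrow> complex) \<Rightarrow> bool" where
  "tsph p \<longleftrightarrow> (\<exists>q. trig q \<and> (\<forall>z\<in>sphere 0 1. p z = q z))"

lemma tsph_add: "tsph p \<Longrightarrow> tsph q \<Longrightarrow> tsph (\<lambda>z. p z + q z)"
  unfolding tsph_def by (metis trig.add)

lemma tsph_monom: "tsph (\<lambda>z. c * z powi k)"
  unfolding tsph_def using trig.monom by blast

lemma tsph_const: "tsph (\<lambda>z. c)"
  using tsph_monom[of c 0] by simp

lemma tsph_cong: "tsph p \<Longrightarrow> (\<And>z. z \<in> sphere 0 1 \<Longrightarrow> q z = p z) \<Longrightarrow> tsph q"
  unfolding tsph_def by metis

lemma tsph_mult_trig: "trig p \<Longrightarrow> trig q \<Longrightarrow> tsph (\<lambda>z. p z * q z)"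
proof (induction p rule: trig.induct)
  case (monom c k)
  then show ?case
  proof (induction q rule: trig.induct)
    case (monom d j)
    show ?case
    proof (rule tsph_cong[OF tsph_monom[of "c * d" "k + j"]])
      fix z :: complex assume "z \<in> sphere 0 1"
      then have "z \<noteq> 0" by auto
      then show "c * z powi k * (d * z powi j) = c * d * z powi (k + j)" by (simp add: power_int_add)
    qed
  next
    case (add q r)
    then show ?case using tsph_add[OF add.IH] by (simp add: distrib_left)
  qed
next
  case (add p r)
  then show ?case using tsph_add[of "\<lambda>z. p z * q z" "\<lambda>z. r z * q z"] by (simp add: distrib_right)
qed

lemma tsph_mult: assumes "tsph p" "tsph q" shows "tsph (\<lambda>z. p z * q z)"
proof -
  obtain p' q' where "trig p'" "trig q'" "\<forall>z\<in>sphere 0 1. p z = p' z" "\<forall>z\<in>sphere 0 1. q z = q' z"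
    using assms unfolding tsph_def by blast
  then show ?thesis using tsph_cong[OF tsph_mult_trig[of p' q'], of "\<lambda>z. p z * q z"] by simp
qed

lemma cnj_on_sphere: "z \<in> sphere 0 1 \<Longrightarrow> cnj z = z powi (-1)"
  using complex_norm_square[of z] inverse_unique[of z "cnj z"] by (simp add: power_int_minus)

text \<open>On the circle \<open>cnj z\<close> is the inverse of \<open>z\<close>, so real and
  imaginary part are trigonometric polynomials and real polynomials in them remain so.\<close>

lemma tsph_real_polynomial:
  assumes "real_polynomial_function f" shows "tsph (\<lambda>z. complex_of_real (f z))"
  using assms
proof (induction rule: real_polynomial_function.induct)
  case (linear f)
  interpret bounded_linear f by fact
  define c where "c = complex_of_real (f 1)"
  define d where "d = complex_of_real (f \<i>)"
  have "complex_of_real (f z) = (c / 2 - \<i> * d / 2) * z powi 1 + (c / 2 + \<i> * d / 2) * z powi (-1)"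
    if "z \<in> sphere 0 1" for z
  proof -
    have "z = Re z *\<^sub>R 1 + Im z *\<^sub>R \<i>" by (simp add: complex_eq_iff)
    then have "f z = Re z * f 1 + Im z * f \<i>" by (metis add scaleR real_scaleR_def)
    then have "complex_of_real (f z) = complex_of_real (Re z) * c + complex_of_real (Im z) * d" by (simp add: c_def d_def)
    also have "complex_of_real (Re z) = (z + cnj z) / 2" by (simp add: complex_add_cnj)
    also have "complex_of_real (Im z) = - (\<i> / 2) * (z - cnj z)" by (simp add: complex_eq_iff)
    finally show ?thesis unfolding cnj_on_sphere[OF that] by (simp add: algebra_simps add_divide_distrib diff_divide_distrib)
  qed
  then show ?case by (rule tsph_cong[OF tsph_add[OF tsph_monom tsph_monom]])
qed (simp_all add: tsph_const tsph_add tsph_mult)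

lemma trig_approximation:
  assumes "ccont a" "0 < \<epsilon>"
  obtains q where "trig q" "\<And>z. z \<in> sphere 0 1 \<Longrightarrow> cmod (a z - q z) < \<epsilon>"
proof -
  obtain g where g: "polynomial_function g" "\<And>z. z \<in> sphere 0 1 \<Longrightarrow> cmod (a z - g z) < \<epsilon>"
    using Stone_Weierstrass_polynomial_function[of "sphere 0 1" a \<epsilon>] assms by (auto simp: ccont_def)
  have "real_polynomial_function (\<lambda>z. Re (g z))" "real_polynomial_function (\<lambda>z. Im (g z))"
    using g(1) bounded_linear_Re bounded_linear_Im by (auto simp: polynomial_function_def o_def)
  then have "tsph (\<lambda>z. complex_of_real (Re (g z)) + \<i> * complex_of_real (Im (g z)))"
    by (intro tsph_add tsph_mult tsph_const tsph_real_polynomial)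
  then have "tsph g" by (simp flip: complex_eq)
  then show ?thesis using g(2) that unfolding tsph_def by metis
qed

lemma Mul_tendsto:
  assumes "ccont a" "\<And>n. ccont (q n)" "\<And>n z. z \<in> sphere 0 1 \<Longrightarrow> cmod (a z - q n z) \<le> C * inverse (real (Suc n))" "0 \<le> C"
  shows "(\<lambda>n. Mul (q n)) \<longlonglongrightarrow> Mul a"
proof -
  have "norm (Mul (q n) - Mul a) \<le> C * inverse (real (Suc n))" for n
    unfolding norm_minus_commute[of "Mul (q n)"] Mul_diff[OF assms(1,2), symmetric]
    by (rule Mul_bound) (use assms in auto)
  moreover have "(\<lambda>n. C * inverse (real (Suc n))) \<longlonglongrightarrow> C * 0"
    by (intro tendsto_intros LIMSEQ_inverse_real_of_nat)
  ultimately have "(\<lambda>n. Mul (q n) - Mul a) \<longlonglongrightarrow> 0"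
    using Lim_null_comparison[of "\<lambda>n. Mul (q n) - Mul a" "\<lambda>n. C * inverse (real (Suc n))" sequentially] by auto
  then show ?thesis by (rule LIM_zero_cancel)
qed

lemma trig_sequence:
  assumes "ccont a"
  obtains q where "\<And>n. trig (q n)" "\<And>n z. z \<in> sphere 0 1 \<Longrightarrow> cmod (a z - q n z) \<le> inverse (real (Suc n))"
proof -
  have "\<exists>q. trig q \<and> (\<forall>z\<in>sphere 0 1. cmod (a z - q z) \<le> inverse (real (Suc n)))" for n
    using trig_approximation[OF assms, of "inverse (real (Suc n))"] by (metis less_imp_le inverse_positive_iff_positive of_nat_0_less_iff zero_less_Suc)
  then show ?thesis using that by metis
qed

lemma Mul_in_closed:
  assumes "ccont a" "closed M" "\<And>q. trig q \<Longrightarrow> \<Phi> (Mul q) \<in> M" "continuous_on UNIV \<Phi>"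
  shows "\<Phi> (Mul a) \<in> M"
proof -
  obtain q where q: "\<And>n. trig (q n)" "\<And>n z. z \<in> sphere 0 1 \<Longrightarrow> cmod (a z - q n z) \<le> inverse (real (Suc n))"
    using trig_sequence[OF assms(1)] by blast
  have "(\<lambda>n. Mul (q n)) \<longlonglongrightarrow> Mul a"
    by (rule Mul_tendsto[where C = 1]) (use q assms ccont_trig in auto)
  then have "(\<lambda>n. \<Phi> (Mul (q n))) \<longlonglongrightarrow> \<Phi> (Mul a)"
    by (rule continuous_on_tendsto_compose[OF assms(4)]) auto
  then show ?thesis by (rule closed_sequentially[OF assms(2), rotated]) (intro allI assms(3) q(1))
qed

text \<open>For a trigonometric polynomial in place of \<open>b\<close> the identity comes from the
  shift rule of Fourier coefficients. In general \<open>b\<close> is approximated uniformly, and the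
  products then converge uniformly as well because \<open>a\<close> is bounded by
  \<open>B\<close>.\<close>

lemma Mul_mult: assumes a: "ccont a" and b: "ccont b" shows "Mul (\<lambda>z. a z * b z) = Mul a o\<^sub>L Mul b"
proof -
  obtain q where q: "\<And>n. trig (q n)" "\<And>n z. z \<in> sphere 0 1 \<Longrightarrow> cmod (b z - q n z) \<le> inverse (real (Suc n))"
    using trig_sequence[OF b] by blast
  obtain B where B: "0 \<le> B" "\<And>z. z \<in> sphere 0 1 \<Longrightarrow> cmod (a z) \<le> B" using ccont_bounded[OF a] by blast
  have trig: "Mul (\<lambda>z. a z * p z) = Mul a o\<^sub>L Mul p" if "trig p" for p
    using that
  proof (induction rule: trig.induct)
    case (monom c k)
    have "Mul (\<lambda>z. a z * (c * z powi k)) = Mul (\<lambda>z. c * (a z * z powi k))" by (simp add: mult.left_commute)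
    also have "\<dots> = Cs c o\<^sub>L (Mul a o\<^sub>L U k)" using a by (simp add: Mul_cmult Mul_powi_right)
    also have "\<dots> = Mul a o\<^sub>L (Cs c o\<^sub>L U k)"
      by (rule blinfun_eqI) (simp add: clin_cs[OF Mul_apply(2)[OF a]])
    finally show ?case by (simp add: Mul_cmult U_def)
  next
    case (add p q)
    then show ?case using a ccont_trig
      by (auto simp: distrib_left Mul_add blinfun.add_left blinfun.add_right intro!: blinfun_eqI)
  qed
  have 1: "(\<lambda>n. Mul (q n)) \<longlonglongrightarrow> Mul b"
    by (rule Mul_tendsto[where C = 1]) (use q b ccont_trig in auto)
  have "cmod (a z * b z - a z * q n z) \<le> B * inverse (real (Suc n))" if "z \<in> sphere 0 1" for z n
    unfolding right_diff_distrib[symmetric] norm_mult by (intro mult_mono B q that) auto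
  then have "(\<lambda>n. Mul (\<lambda>z. a z * q n z)) \<longlonglongrightarrow> Mul (\<lambda>z. a z * b z)"
    using B(1) a b q(1) ccont_trig by (intro Mul_tendsto[where C = B]) auto
  then have "(\<lambda>n. Mul a o\<^sub>L Mul (q n)) \<longlonglongrightarrow> Mul (\<lambda>z. a z * b z)" by (simp add: trig q)
  moreover have "(\<lambda>n. Mul a o\<^sub>L Mul (q n)) \<longlonglongrightarrow> (Mul a o\<^sub>L Mul b)"
    by (intro bounded_bilinear.tendsto[OF bounded_bilinear_blinfun_compose] tendsto_const 1)
  ultimately show ?thesis using LIMSEQ_unique by blast
qed

lemma Mul_commute: "ccont a \<Longrightarrow> ccont b \<Longrightarrow> Mul a o\<^sub>L Mul b = Mul b o\<^sub>L Mul a"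
  by (simp flip: Mul_mult add: mult.commute)

lemma U_add: "U j o\<^sub>L U k = U (j + k)"
  by (rule clin_eqI) (simp_all add: clin_compose U_ebas algebra_simps)

section \<open>The Hardy space\<close>

definition Ph :: "ell2 \<Rightarrow>\<^sub>L ell2" where
  "Ph = Blinfun (\<lambda>x. Ell2 (hproj (seq x)))"

lemma l2_hproj: assumes "l2 f" shows "l2 (hproj f)"
proof (rule l2I)
  fix F :: "int set" assume F: "finite F"
  have "(\<Sum>k\<in>F. (cmod (hproj f k))\<^sup>2) \<le> (\<Sum>k\<in>F. (cmod (f k))\<^sup>2)" by (intro sum_mono) (simp add: hproj_def)
  then show "(\<Sum>k\<in>F. (cmod (hproj f k))\<^sup>2) \<le> (l2norm f)\<^sup>2" using sum_le_l2norm[OF assms F] by linarith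
qed

lemma seq_Ph: "seq (Ph x) = hproj (seq x)"
proof -
  have "bounded_linear (\<lambda>x. Ell2 (hproj (seq x)))"
  proof (rule bounded_linear_intro[where K = 1])
    fix x y :: ell2 and r :: real
    show "Ell2 (hproj (seq (x + y))) = Ell2 (hproj (seq x)) + Ell2 (hproj (seq y))"
      by (rule ell2_eqI) (simp add: l2_hproj l2_add, simp add: hproj_def)
    show "Ell2 (hproj (seq (r *\<^sub>R x))) = r *\<^sub>R Ell2 (hproj (seq x))"
      by (rule ell2_eqI) (simp add: l2_hproj l2_cscale scaleR_cs, simp add: hproj_def cscale_def)
    have "l2norm (hproj (seq x)) \<le> norm x"
    proof (rule l2norm_le)
      fix F :: "int set" assume F: "finite F"
      have "(\<Sum>k\<in>F. (cmod (hproj (seq x) k))\<^sup>2) \<le> (\<Sum>k\<in>F. (cmod (seq x k))\<^sup>2)" by (intro sum_mono) (simp add: hproj_def)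
      then show "(\<Sum>k\<in>F. (cmod (hproj (seq x) k))\<^sup>2) \<le> (norm x)\<^sup>2" using sum_le_l2norm[OF l2_seq[of x] F] by simp
    qed simp
    then show "norm (Ell2 (hproj (seq x))) \<le> norm x * 1" by (simp add: l2norm_Ell2 l2_hproj)
  qed
  then show ?thesis by (simp add: Ph_def bounded_linear_Blinfun_apply l2_hproj)
qed

lemma cproj_Ph: "cproj Ph"
proof -
  have clin: "clin Ph" unfolding clin_def
    by (intro allI, rule ell2_eqI) (simp add: seq_Ph hproj_def cscale_def)
  have "Ph o\<^sub>L Ph = Ph" by (rule blinfun_eqI, rule ell2_eqI) (simp add: seq_Ph hproj_def)
  moreover have "adj Ph = Ph"
    by (rule clin_eqI) (simp_all add: clin clin_adj seq_adj_ebas seq_Ph hproj_def seq_ebas)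
  ultimately show ?thesis using clin by (simp add: cproj_def)
qed

lemma ran_Ph: "x \<in> ran Ph \<longleftrightarrow> (\<forall>n<0. seq x n = 0)"
proof -
  have "Ph x = x \<longleftrightarrow> seq (Ph x) = seq x" by (simp only: seq_inject)
  also have "\<dots> \<longleftrightarrow> (\<forall>n<0. seq x n = 0)" by (auto simp: seq_Ph hproj_def fun_eq_iff)
  finally show ?thesis by (simp add: ran_def)
qed

lemma hardy_eq: "hardy = seq ` ran Ph"
proof -
  have "f \<in> seq ` ran Ph" if "f \<in> hardy" for f
    using that by (intro image_eqI[of _ _ "Ell2 f"]) (auto simp: hardy_def ran_Ph)
  then show ?thesis by (auto simp: hardy_def ran_Ph)
qed

section \<open>Fourier coefficients of analytic functions\<close>

text \<open>Cauchy's formula for derivatives taken on the unit circle itself, which continuity up to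
  the boundary permits, and parametrized by \<open>cis\<close>.\<close>

lemma fourier_analytic_nonneg:
  assumes f: "continuous_on (cball 0 1) f" "f holomorphic_on ball 0 1"
  shows "fourier f (int k) = (deriv ^^ k) f 0 / fact k"
proof -
  have "((\<lambda>u. f u / (u - 0) ^ Suc k) has_contour_integral ((2 * pi * \<i>) / (fact k) * (deriv ^^ k) f 0)) (circlepath 0 1)"
    by (rule Cauchy_has_contour_integral_higher_derivative_circlepath[OF f]) simp
  then have "((\<lambda>t. f (0 + 1 * cis t) / (0 + 1 * cis t - 0) ^ Suc k * 1 * \<i> * cis t) has_integral
      ((2 * pi * \<i>) / (fact k) * (deriv ^^ k) f 0)) {0..2*pi}"
    unfolding circlepath_def by (subst (asm) has_contour_integral_part_circlepath_iff) auto
  moreover have "f (0 + 1 * cis t) / (0 + 1 * cis t - 0) ^ Suc k * 1 * \<i> * cis t = \<i> * (f (cis t) * cis (- (of_int (int k) * t)))" for t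
  proof -
    have "cis (- (of_int (int k) * t)) = inverse (cis t ^ k)" by (simp add: Complex.DeMoivre)
    then show ?thesis by (simp add: field_simps)
  qed
  ultimately have "((\<lambda>t. \<i> * (f (cis t) * cis (- (of_int (int k) * t)))) has_integral
      ((2 * pi * \<i>) / (fact k) * (deriv ^^ k) f 0)) {0..2*pi}" by (simp only:)
  then have "\<i> * integral {0..2*pi} (\<lambda>t. f (cis t) * cis (- (of_int (int k) * t))) = (2 * pi * \<i>) / (fact k) * (deriv ^^ k) f 0"
    by (simp only: integral_unique Henstock_Kurzweil_Integration.integral_mult_right[symmetric])
  then show ?thesis by (simp add: fourier_def field_simps)
qed

text \<open>The link between \<open>taylor\<close>, through which inner functions enter the
  statement, and \<open>fourier\<close>, on which multiplication operators are built. It applies to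
  finite Blaschke products, which are continuous on the closed disc.\<close>

lemma fourier_eq_taylor:
  assumes f: "continuous_on (cball 0 1) f" "f holomorphic_on ball 0 1"
  shows "fourier f m = taylor f m"
proof (cases "m < 0")
  case True
  define j where "j = nat (- m)"
  have j: "j > 0" "m = - int j" using True by (auto simp: j_def)
  \<comment> \<open>A negative coefficient is the mean of \<open>f z * z ^ j\<close> with
    \<open>j > 0\<close>, hence the value of that function at 0.\<close>
  have "fourier f m = fourier (\<lambda>z. f z * z powi (int j)) 0" using fourier_shift[of f "int j" 0] j by simp
  also have "\<dots> = fourier (\<lambda>z. f z * z ^ j) (int 0)" by simp
  also have "\<dots> = 0"
    by (subst fourier_analytic_nonneg) (use f j in \<open>auto intro!: continuous_intros holomorphic_intros\<close>)
  finally show ?thesis using True by (simp add: taylor_def)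
next
  case False
  then show ?thesis using fourier_analytic_nonneg[OF f, of "nat m"] by (simp add: taylor_def)
qed

lemma ccont_cball: "continuous_on (cball 0 1) f \<Longrightarrow> ccont f"
  unfolding ccont_def by (rule continuous_on_subset) auto

section \<open>Model spaces\<close>

lemma blinfun_compose_assoc: "(A o\<^sub>L B) o\<^sub>L C = A o\<^sub>L (B o\<^sub>L C)"
  by (rule blinfun_eqI) simp

text \<open>\<open>W\<close> acts as multiplication by the inner function \<open>v\<close>: an
  isometry whose matrix holds the Taylor coefficients. This form covers the infinite product, whose
  operator is only a strong limit.\<close>

definition symb :: "(ell2 \<Rightarrow>\<^sub>L ell2) \<Rightarrow> (complex \<Rightarrow> complex) \<Rightarrow> bool" where
  "symb W v \<longleftrightarrow> clin W \<and> adj W o\<^sub>L W = id_blinfun \<and> (\<forall>k m. seq (W (ebas k)) m = taylor v (m - k))"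

definition mproj :: "(ell2 \<Rightarrow>\<^sub>L ell2) \<Rightarrow> (ell2 \<Rightarrow>\<^sub>L ell2)" where
  "mproj W = Ph - (W o\<^sub>L Ph o\<^sub>L adj W)"

definition causal :: "(ell2 \<Rightarrow>\<^sub>L ell2) \<Rightarrow> bool" where
  "causal R \<longleftrightarrow> (\<forall>x. Ph (R (Ph x)) = R (Ph x))"

lemma mproj_apply: "mproj W x = Ph x - W (Ph (adj W x))"
  by (simp add: mproj_def blinfun.diff_left)

lemma Ph_ebas: "Ph (ebas k) = (if 0 \<le> k then ebas k else 0)"
  by (rule ell2_eqI) (simp add: seq_Ph hproj_def seq_ebas)

lemma causal_matrix:
  assumes "clin R" "\<And>k m. 0 \<le> k \<Longrightarrow> m < 0 \<Longrightarrow> seq (R (ebas k)) m = 0"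
  shows "causal R"
proof -
  have "Ph o\<^sub>L (R o\<^sub>L Ph) = R o\<^sub>L Ph"
    by (rule clin_eqI)
      (use assms cprojD(1)[OF cproj_Ph] in \<open>auto simp: clin_compose Ph_ebas seq_Ph hproj_def\<close>)
  then show ?thesis unfolding causal_def by (metis blinfun_apply_blinfun_compose)
qed

text \<open>Dual form of the invariance of the Hardy space: \<open>adj R\<close> preserves the
  orthogonal complement of that space.\<close>

lemma causal_adj: assumes "causal R" shows "Ph (adj R (Ph x)) = Ph (adj R x)"
proof -
  have "y \<bullet> Ph (adj R (Ph x)) = y \<bullet> Ph (adj R x)" for y
    using assms unfolding causal_def by (simp flip: cprojD(6)[OF cproj_Ph] inner_adj)
  then show ?thesis by (metis inner_commute vector_eq_rdot)
qed

context
  fixes W v assumes W: "symb W v"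
begin

lemma symb_clin: "clin W"
  using W by (simp add: symb_def)

lemma symb_isometry: "adj W (W x) = x"
  using W unfolding symb_def by (metis blinfun_apply_blinfun_compose blinfun_apply_id_blinfun)

lemma symb_causal: "causal W"
  by (rule causal_matrix) (use W in \<open>auto simp: symb_def taylor_def\<close>)

lemma model_proj_mproj: "model_proj v (seq x) = seq (mproj W x)"
proof -
  have "mult_inner_conj v (seq x) = seq (adj W x)"
    unfolding mult_inner_conj_def by (rule conv_adj) (use W in \<open>auto simp: symb_def\<close>)
  moreover have "mult_inner v (seq y) = seq (W y)" for y
    unfolding mult_inner_def by (rule conv_clin) (use W in \<open>auto simp: symb_def\<close>)
  ultimately show ?thesis by (simp add: model_proj_def mproj_apply flip: seq_Ph)
qed

lemma ran_mproj: "x \<in> ran (mproj W) \<longleftrightarrow> Ph x = x \<and> Ph (adj W x) = 0"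
proof
  assume "x \<in> ran (mproj W)"
  then have x: "Ph x - W (Ph (adj W x)) = x" by (simp add: ran_def mproj_apply)
  have "Ph x = Ph (Ph x - W (Ph (adj W x)))" using x by simp
  also have "\<dots> = Ph x - W (Ph (adj W x))"
    using symb_causal by (simp add: blinfun.diff_right cprojD(4)[OF cproj_Ph] causal_def)
  finally have Px: "Ph x = x" using x by simp
  then have "W (Ph (adj W x)) = 0" using x by simp
  then show "Ph x = x \<and> Ph (adj W x) = 0" using Px symb_isometry[of "Ph (adj W x)"] by simp
qed (simp add: ran_def mproj_apply)

lemma K2_mproj: "K2 v = seq ` ran (mproj W)"
proof -
  have mi: "mult_inner v (seq y) = seq (W y)" for y
    unfolding mult_inner_def by (rule conv_clin) (use W in \<open>auto simp: symb_def\<close>)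
  have "seq x \<in> K2 v \<longleftrightarrow> x \<in> ran (mproj W)" for x
  proof -
    have "seq x \<in> K2 v \<longleftrightarrow> x \<in> ran Ph \<and> (\<forall>y\<in>ran Ph. cin x (W y) = 0)"
      unfolding K2_def hardy_eq by (auto simp: mi l2inner_seq seq_inject)
    also have "\<dots> \<longleftrightarrow> Ph x = x \<and> (\<forall>y\<in>ran Ph. cin (adj W x) y = 0)"
      by (simp add: ran_def cin_adj'[OF symb_clin])
    also have "(\<forall>y\<in>ran Ph. cin (adj W x) y = 0) \<longleftrightarrow> Ph (adj W x) = 0"
    proof
      assume "\<forall>y\<in>ran Ph. cin (adj W x) y = 0"
      then have "cin (adj W x) (Ph (adj W x)) = 0" using cprojD(5)[OF cproj_Ph] by blast
      then have "cin (Ph (adj W x)) (Ph (adj W x)) = 0"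
        using cprojD(7)[OF cproj_Ph, of "adj W x" "Ph (adj W x)"] cprojD(4)[OF cproj_Ph] by simp
      then show "Ph (adj W x) = 0" by (simp add: cin_self)
    next
      assume 0: "Ph (adj W x) = 0"
      show "\<forall>y\<in>ran Ph. cin (adj W x) y = 0"
      proof
        fix y assume "y \<in> ran Ph"
        then have "cin (adj W x) y = cin (adj W x) (Ph y)" by (simp add: ran_def)
        also have "\<dots> = 0" using 0 cprojD(7)[OF cproj_Ph, of "adj W x" y] by simp
        finally show "cin (adj W x) y = 0" .
      qed
    qed
    finally show ?thesis by (simp add: ran_mproj)
  qed
  moreover have "f \<in> range seq" if "f \<in> K2 v" for f
    using that unfolding K2_def hardy_eq by auto
  ultimately show ?thesis by blast
qed

lemma cproj_mproj: "cproj (mproj W)"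
proof -
  have cl: "clin (mproj W)" unfolding mproj_def
    by (intro clin_diff clin_compose clin_adj symb_clin cprojD(1)[OF cproj_Ph])
  have "mproj W (mproj W x) = mproj W x" for x
  proof -
    have "mproj W x \<in> ran (mproj W)"
      unfolding ran_mproj mproj_apply using symb_causal
      by (simp add: blinfun.diff_right symb_isometry cprojD(4)[OF cproj_Ph] causal_def causal_adj[OF symb_causal])
    then show ?thesis by (simp add: ran_def)
  qed
  then have "mproj W o\<^sub>L mproj W = mproj W" by (intro blinfun_eqI) simp
  moreover have "adj (mproj W) = mproj W"
    by (simp add: mproj_def adj_diff adj_compose cprojD(3)[OF cproj_Ph] blinfun_compose_assoc)
  ultimately show ?thesis using cl by (simp add: cproj_def)
qed

lemma Ph_mproj: "Ph (mproj W x) = mproj W x" "mproj W (Ph x) = mproj W x"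
  using ran_mproj cprojD(5)[OF cproj_mproj] by (blast, simp add: mproj_apply causal_adj[OF symb_causal] cprojD(4)[OF cproj_Ph])

end

text \<open>\<open>R\<close> is the quotient of the two inner functions. Divisibility enlarges the
  model space, and the second identity is the adjoint of the first.\<close>

lemma mproj_mono:
  assumes W: "symb W v" and W': "symb W' v'" and R: "W' = W o\<^sub>L R" "causal R"
  shows "mproj W' (mproj W x) = mproj W x" "mproj W (mproj W' x) = mproj W x"
proof -
  have sub: "mproj W' (mproj W x) = mproj W x" for x
  proof -
    have x: "Ph (mproj W x) = mproj W x" "Ph (adj W (mproj W x)) = 0"
      using ran_mproj[OF W] cprojD(5)[OF cproj_mproj[OF W]] by blast+
    have "Ph (adj W' (mproj W x)) = Ph (adj R (adj W (mproj W x)))" by (simp add: R(1) adj_compose)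
    also have "\<dots> = 0" using causal_adj[OF R(2), of "adj W (mproj W x)"] x(2) by simp
    finally have "mproj W x \<in> ran (mproj W')" using x ran_mproj[OF W'] by blast
    then show ?thesis by (simp add: ran_def)
  qed
  show "mproj W' (mproj W x) = mproj W x" by (rule sub)
  have "mproj W' o\<^sub>L mproj W = mproj W" by (rule blinfun_eqI) (simp add: sub)
  then have "adj (mproj W' o\<^sub>L mproj W) = adj (mproj W)" by simp
  then have "mproj W o\<^sub>L mproj W' = mproj W"
    by (simp add: adj_compose cprojD(3)[OF cproj_mproj[OF W]] cprojD(3)[OF cproj_mproj[OF W']])
  then show "mproj W (mproj W' x) = mproj W x" by (metis blinfun_apply_blinfun_compose)
qed

lemma strong_limit:
  fixes A :: "nat \<Rightarrow> ell2 \<Rightarrow>\<^sub>L ell2"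
  assumes "\<And>x. Cauchy (\<lambda>n. A n x)" "\<And>n x. norm (A n x) \<le> norm x"
  obtains B :: "ell2 \<Rightarrow>\<^sub>L ell2" where "\<And>x. (\<lambda>n. A n x) \<longlonglongrightarrow> B x"
proof -
  have lim: "(\<lambda>n. A n x) \<longlonglongrightarrow> lim (\<lambda>n. A n x)" for x
    using assms(1) by (simp add: Cauchy_convergent_iff convergent_LIMSEQ_iff)
  have "bounded_linear (\<lambda>x. lim (\<lambda>n. A n x))"
  proof (rule bounded_linear_intro[where K = 1])
    fix x y :: ell2 and r :: real
    show "lim (\<lambda>n. A n (x + y)) = lim (\<lambda>n. A n x) + lim (\<lambda>n. A n y)"
      by (rule LIMSEQ_unique[OF lim]) (unfold blinfun.add_right, intro tendsto_add lim)
    show "lim (\<lambda>n. A n (r *\<^sub>R x)) = r *\<^sub>R lim (\<lambda>n. A n x)"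
      by (rule LIMSEQ_unique[OF lim]) (unfold blinfun.scaleR_right, intro tendsto_scaleR tendsto_const lim)
    show "norm (lim (\<lambda>n. A n x)) \<le> norm x * 1"
      by (rule LIMSEQ_le_const2[OF tendsto_norm[OF lim]]) (use assms(2) in auto)
  qed
  then show ?thesis using that[of "Blinfun (\<lambda>x. lim (\<lambda>n. A n x))"] lim by (simp add: bounded_linear_Blinfun_apply)
qed

lemma strong_compose:
  assumes "\<And>x. (\<lambda>n. blinfun_apply (A n) x) \<longlonglongrightarrow> B x" "\<And>n x. norm (A n x) \<le> norm x" "y \<longlonglongrightarrow> z"
  shows "(\<lambda>n. A n (y n)) \<longlonglongrightarrow> B z"
proof -
  have "(\<lambda>n. A n (y n - z)) \<longlonglongrightarrow> 0"
  proof (rule Lim_null_comparison)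
    show "\<forall>\<^sub>F n in sequentially. norm (A n (y n - z)) \<le> norm (y n - z)" using assms(2) by simp
    show "(\<lambda>n. norm (y n - z)) \<longlonglongrightarrow> 0" using assms(3) by (simp add: LIM_zero tendsto_norm_zero)
  qed
  from tendsto_add[OF this assms(1)[of z]] show ?thesis by (simp add: blinfun.diff_right)
qed

section \<open>Blaschke products\<close>

text \<open>The unimodular factor that makes a Blaschke factor nonnegative at 0; the value
  \<open>-1\<close> at \<open>l = 0\<close> turns \<open>- z\<close> into \<open>z\<close>.\<close>

definition bconst :: "complex \<Rightarrow> complex" where
  "bconst l = (if l = 0 then -1 else complex_of_real (cmod l) / l)"

lemma blaschke_denominator: assumes "cmod l < 1" "cmod z \<le> 1" shows "1 - cnj l * z \<noteq> 0"
proof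
  assume "1 - cnj l * z = 0"
  then have "cmod (cnj l * z) = 1" by (simp add: eq_iff_diff_eq_0[symmetric])
  moreover have "cmod (cnj l * z) \<le> cmod l * 1" unfolding norm_mult using assms by (intro mult_mono) auto
  ultimately show False using assms by simp
qed

lemma blaschke_factor_eq: "blaschke_factor l z = bconst l * ((l - z) / (1 - cnj l * z))"
  by (simp add: blaschke_factor_def bconst_def mult_ac)

lemma norm_bconst [simp]: "cmod (bconst l) = 1"
  by (simp add: bconst_def norm_divide)

lemma blaschke_factor_continuous: assumes "cmod l < 1" shows "continuous_on (cball 0 1) (blaschke_factor l)"
  unfolding blaschke_factor_eq[abs_def] using blaschke_denominator[OF assms] by (intro continuous_intros) auto

lemma blaschke_factor_holomorphic: assumes "cmod l < 1" shows "blaschke_factor l holomorphic_on ball 0 1"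
  unfolding blaschke_factor_eq[abs_def] using blaschke_denominator[OF assms] by (intro holomorphic_intros) (auto simp: less_imp_le)

lemma norm_blaschke_factor: assumes "cmod l < 1" "cmod z = 1" shows "cmod (blaschke_factor l z) = 1"
proof -
  have zz: "z * cnj z = 1" using assms(2) complex_norm_square[of z] by simp
  have "(1 - cnj l * z) = z * cnj (z - l)" using zz by (simp add: algebra_simps)
  then have "cmod (1 - cnj l * z) = cmod (z - l)" using assms(2) by (simp add: norm_mult del: complex_cnj_diff)
  moreover have "l \<noteq> z" using assms by auto
  ultimately show ?thesis unfolding blaschke_factor_eq norm_mult norm_divide by (simp add: norm_minus_commute)
qed

lemma blaschke_factor_0: "blaschke_factor l 0 = complex_of_real (cmod l)"
  by (simp add: blaschke_factor_def)

text \<open>The derivative at 0 has modulus \<open>1 - (cmod l)\<^sup>2\<close>. Its not being 0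
  makes the model spaces grow strictly (\<open>Pn_gap\<close>).\<close>

lemma fourier_blaschke_factor_1: assumes "cmod l < 1" shows "fourier (blaschke_factor l) 1 \<noteq> 0"
proof -
  have "((\<lambda>z. bconst l * ((l - z) / (1 - cnj l * z))) has_field_derivative bconst l * (l * cnj l - 1)) (at 0)"
    by (auto intro!: derivative_eq_intros simp: algebra_simps)
  then have "deriv (blaschke_factor l) 0 = bconst l * (l * cnj l - 1)"
    unfolding blaschke_factor_eq[abs_def] by (rule DERIV_imp_deriv)
  moreover have "l * cnj l \<noteq> 1"
  proof
    assume "l * cnj l = 1"
    then have "complex_of_real ((cmod l)\<^sup>2) = 1" by (simp only: complex_norm_square)
    then have "(cmod l)\<^sup>2 = 1" using of_real_eq_1_iff by blast
    then show False using assms norm_ge_zero[of l] by (auto simp: power2_eq_1_iff)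
  qed
  moreover have "bconst l \<noteq> 0" using norm_bconst[of l] by (metis norm_zero zero_neq_one)
  ultimately have "deriv (blaschke_factor l) 0 \<noteq> 0" by simp
  then show ?thesis
    using fourier_analytic_nonneg[OF blaschke_factor_continuous[OF assms] blaschke_factor_holomorphic[OF assms], of 1] by simp
qed

text \<open>For \<open>l \<noteq> 0\<close> a factor \<open>1 - cmod l\<close> splits off; on the
  disc of radius 1/2 the remaining numerator is at most \<open>3/2 * cmod l\<close> and
  \<open>cmod (1 - cnj l * z)\<close> is at least 1/2, whence the 3.\<close>

lemma norm_blaschke_factor_minus_one:
  assumes "cmod l < 1" "cmod z \<le> 1/2" shows "cmod (blaschke_factor l z - 1) \<le> 3 * (1 - cmod l)"
proof (cases "l = 0")
  case True
  have "cmod (z - 1) \<le> cmod z + 1" using norm_triangle_ineq4[of z 1] by simp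
  then show ?thesis using True assms by (simp add: blaschke_factor_def)
next
  case False
  have d: "1 - cnj l * z \<noteq> 0" using blaschke_denominator[of l z] assms by simp
  have lz: "cmod (cnj l * z) \<le> 1 / 2"
    using mult_mono[of "cmod l" 1 "cmod z" "1/2"] assms by (simp add: norm_mult)
  have ll: "l * cnj l = complex_of_real (cmod l) * complex_of_real (cmod l)"
    by (metis complex_norm_square of_real_mult power2_eq_square)
  have "blaschke_factor l z - 1 = - (1 - complex_of_real (cmod l)) * (l + complex_of_real (cmod l) * z) / (l * (1 - cnj l * z))"
  proof -
    have "(blaschke_factor l z - 1) * (l * (1 - cnj l * z)) = complex_of_real (cmod l) * (l - z) - l * (1 - cnj l * z)"
      using False d by (simp add: blaschke_factor_def field_simps)
    also have "\<dots> = - (1 - complex_of_real (cmod l)) * (l + complex_of_real (cmod l) * z)"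
      using arg_cong[OF ll, of "\<lambda>w. w * z"] by (simp add: algebra_simps)
    finally show ?thesis using False d by (simp add: eq_divide_eq)
  qed
  then have eq: "cmod (blaschke_factor l z - 1) = cmod (1 - complex_of_real (cmod l)) * cmod (l + complex_of_real (cmod l) * z) / (cmod l * cmod (1 - cnj l * z))"
    by (simp only: norm_mult norm_divide norm_minus_cancel)
  have "cmod (1 - complex_of_real (cmod l)) = 1 - cmod l"
    using assms by (metis abs_of_nonneg diff_ge_0_iff_ge less_imp_le norm_of_real of_real_1 of_real_diff)
  moreover have "cmod (l + complex_of_real (cmod l) * z) \<le> cmod l * (3/2)"
    using norm_triangle_ineq[of l "complex_of_real (cmod l) * z"] mult_left_mono[OF assms(2), of "cmod l"] by (simp add: norm_mult)
  moreover have "1/2 \<le> cmod (1 - cnj l * z)"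
    using norm_triangle_ineq2[of 1 "cnj l * z"] lz by simp
  ultimately have "cmod (blaschke_factor l z - 1) \<le> (1 - cmod l) * (cmod l * (3/2)) / (cmod l * (1/2))"
    unfolding eq using False assms by (intro frac_le mult_mono mult_left_mono) auto
  also have "\<dots> = 3 * (1 - cmod l)" using False by (simp add: field_simps)
  finally show ?thesis .
qed

section \<open>Partial products as unitary multiplications, and their strong limit\<close>

locale blaschke =
  fixes lam :: "nat \<Rightarrow> complex"
  assumes bs: "blaschke_seq lam"
begin

lemma lam_less: "cmod (lam k) < 1"
  using bs by (simp add: blaschke_seq_def)

text \<open>The quotient of the \<open>m\<close>-th by the \<open>n\<close>-th partial product,
  through which different partial products are compared.\<close>

definition seg :: "nat \<Rightarrow> nat \<Rightarrow> complex \<Rightarrow> complex" where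
  "seg n m z = (\<Prod>k\<in>{n..<m}. blaschke_factor (lam k) z)"

lemma bpartial_seg: "bpartial lam n = seg 0 n"
  by (rule ext) (simp add: bpartial_def seg_def lessThan_atLeast0)

lemma seg_cont: "continuous_on (cball 0 1) (seg n m)"
  unfolding seg_def by (intro continuous_intros blaschke_factor_continuous lam_less)

lemma seg_hol: "seg n m holomorphic_on ball 0 1"
  unfolding seg_def by (intro holomorphic_intros blaschke_factor_holomorphic lam_less)

lemma ccont_seg [simp]: "ccont (seg n m)"
  by (rule ccont_cball[OF seg_cont])

lemma seg_norm: "z \<in> sphere 0 1 \<Longrightarrow> cmod (seg n m z) = 1"
  by (simp add: seg_def prod_norm[symmetric] norm_blaschke_factor lam_less)

definition R :: "nat \<Rightarrow> nat \<Rightarrow> ell2 \<Rightarrow>\<^sub>L ell2" where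
  "R n m = Mul (seg n m)"

abbreviation V :: "nat \<Rightarrow> ell2 \<Rightarrow>\<^sub>L ell2" where
  "V n \<equiv> R 0 n"

lemma clin_R [simp]: "clin (R n m)"
  by (simp add: R_def Mul_apply(2))

lemma R_comp: "n \<le> m \<Longrightarrow> m \<le> p \<Longrightarrow> R n p = R n m o\<^sub>L R m p"
  unfolding R_def Mul_mult[OF ccont_seg ccont_seg, symmetric]
  by (rule Mul_cong) (simp add: seg_def prod.atLeastLessThan_concat)

lemma R_U: "R n m o\<^sub>L U k = U k o\<^sub>L R n m"
  unfolding R_def U_def by (rule Mul_commute) auto

lemma R_unitary: "adj (R n m) o\<^sub>L R n m = id_blinfun" "R n m o\<^sub>L adj (R n m) = id_blinfun"
proof -
  have "cnj (seg n m z) * seg n m z = 1" if "z \<in> sphere 0 1" for z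
    using seg_norm[OF that, of n m] complex_norm_square[of "seg n m z"] by (simp add: mult.commute)
  then have "Mul (\<lambda>z. cnj (seg n m z) * seg n m z) = id_blinfun"
    unfolding Mul_one[symmetric] by (rule Mul_cong)
  then show "adj (R n m) o\<^sub>L R n m = id_blinfun"
    by (simp add: R_def Mul_mult Mul_cnj)
  then show "R n m o\<^sub>L adj (R n m) = id_blinfun"
    unfolding R_def Mul_cnj[OF ccont_seg, symmetric] by (subst Mul_commute) auto
qed

lemma R_adj_R [simp]: "adj (R n m) (R n m x) = x" and R_R_adj [simp]: "R n m (adj (R n m) x) = x"
  using R_unitary[of n m] by (metis blinfun_apply_blinfun_compose blinfun_apply_id_blinfun)+

lemma R_norm [simp]: "norm (R n m x) = norm x"
proof -
  have "(norm (R n m x))\<^sup>2 = (norm x)\<^sup>2" unfolding power2_norm_eq_inner by (simp add: inner_adj)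
  then show ?thesis by (simp add: power2_eq_iff_nonneg)
qed

lemma R_adj_norm [simp]: "norm (adj (R n m) x) = norm x"
  using R_norm[of n m "adj (R n m) x"] by simp

lemma R_ebas: "seq (R n m (ebas k)) j = taylor (seg n m) (j - k)"
  by (simp add: R_def Mul_ebas fourier_eq_taylor[OF seg_cont seg_hol])

lemma causal_R: "causal (R n m)"
  by (rule causal_matrix) (auto simp: R_ebas taylor_def)

lemma symb_V: "symb (V n) (bpartial lam n)"
  unfolding symb_def bpartial_seg using R_unitary R_ebas by simp

text \<open>\<open>V n (ebas 0)\<close> is the partial product itself as an element of the Hardy
  space. The inner product of two of them is the value at 0 of their quotient; by the normalization
  of the factors this is the product of the moduli of the zeros, which is at least 1 minus the sum
  of the defects.\<close>

lemma V_diff_ebas0: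
  assumes "n \<le> m"
  shows "(norm (V m (ebas 0) - V n (ebas 0)))\<^sup>2 \<le> 2 * (\<Sum>k\<in>{n..<m}. 1 - cmod (lam k))"
proof -
  have "V m (ebas 0) = V n (R n m (ebas 0))" using R_comp[of 0 n m] assms by simp
  then have "cin (V m (ebas 0)) (V n (ebas 0)) = seq (R n m (ebas 0)) 0"
    by (simp add: cin_adj cin_ebas_right)
  also have "\<dots> = seg n m 0" by (simp add: R_ebas taylor_def)
  also have "\<dots> = complex_of_real (\<Prod>k\<in>{n..<m}. cmod (lam k))" by (simp add: seg_def blaschke_factor_0)
  finally have c: "cin (V m (ebas 0)) (V n (ebas 0)) = complex_of_real (\<Prod>k\<in>{n..<m}. cmod (lam k))" .
  have "V m (ebas 0) \<bullet> V n (ebas 0) = (\<Prod>k\<in>{n..<m}. cmod (lam k))"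
    unfolding Re_cin[symmetric] c by (rule Re_complex_of_real)
  also have "\<dots> = (\<Prod>k\<in>{n..<m}. 1 - (1 - cmod (lam k)))" by simp
  also have "\<dots> \<ge> 1 - (\<Sum>k\<in>{n..<m}. 1 - cmod (lam k))"
    by (rule Weierstrass_prod_ineq) (use lam_less in \<open>auto simp: less_imp_le\<close>)
  finally have ge: "V m (ebas 0) \<bullet> V n (ebas 0) \<ge> 1 - (\<Sum>k\<in>{n..<m}. 1 - cmod (lam k))" .
  have "(norm (V m (ebas 0) - V n (ebas 0)))\<^sup>2 = (norm (V m (ebas 0)))\<^sup>2 + (norm (V n (ebas 0)))\<^sup>2 - 2 * (V m (ebas 0) \<bullet> V n (ebas 0))"
    unfolding power2_norm_eq_inner by (simp add: inner_simps inner_commute)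
  then show ?thesis using ge by simp
qed

lemma Cauchy_V_ebas0: "Cauchy (\<lambda>n. V n (ebas 0))"
proof (rule CauchyI')
  fix \<epsilon> :: real assume \<epsilon>: "0 < \<epsilon>"
  have "summable (\<lambda>k. 1 - cmod (lam k))" using bs by (simp add: blaschke_seq_def)
  then obtain N where N: "\<And>m n. m \<ge> N \<Longrightarrow> norm (\<Sum>k\<in>{m..<n}. 1 - cmod (lam k)) < \<epsilon>\<^sup>2 / 2"
    using \<epsilon> unfolding summable_Cauchy by (meson half_gt_zero zero_less_power)
  have "dist (V m (ebas 0)) (V n (ebas 0)) < \<epsilon>" if "m \<ge> N" "m < n" for m n
  proof -
    have "(norm (V n (ebas 0) - V m (ebas 0)))\<^sup>2 < \<epsilon>\<^sup>2"
      using V_diff_ebas0[of m n] that N[of m n] by simp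
    then show ?thesis using \<epsilon> by (simp add: dist_norm norm_minus_commute power2_less_imp_less)
  qed
  then show "\<exists>M. \<forall>m\<ge>M. \<forall>n>m. dist (V m (ebas 0)) (V n (ebas 0)) < \<epsilon>" by blast
qed

text \<open>Convergence at \<open>ebas 0\<close> spreads to every basis vector, since the
  multiplications commute with the shifts, and to all \<open>x\<close> by density, since all
  \<open>V n\<close> are isometric.\<close>

lemma Cauchy_V: "Cauchy (\<lambda>n. V n x)"
proof -
  let ?S = "{x. Cauchy (\<lambda>n. V n x)}"
  have "x \<in> ?S"
  proof (rule ell2_dense)
    show "closed ?S"
    proof (rule closed_sequential_limits[THEN iffD2], intro allI impI, elim conjE)
      fix y l assume y: "\<forall>n. y n \<in> ?S" and l: "y \<longlonglongrightarrow> l"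
      have "Cauchy (\<lambda>n. V n l)"
      proof (rule CauchyI)
        fix \<epsilon> :: real assume \<epsilon>: "0 < \<epsilon>"
        obtain i where i: "norm (y i - l) < \<epsilon> / 3"
          using LIMSEQ_D[OF l, of "\<epsilon> / 3"] \<epsilon> by auto
        have "Cauchy (\<lambda>n. V n (y i))" using y by simp
        then obtain M where M: "\<And>m n. m \<ge> M \<Longrightarrow> n \<ge> M \<Longrightarrow> norm (V m (y i) - V n (y i)) < \<epsilon> / 3"
          using \<epsilon> unfolding Cauchy_iff by (meson divide_pos_pos zero_less_numeral)
        have "norm (V m l - V n l) < \<epsilon>" if "m \<ge> M" "n \<ge> M" for m n
        proof -
          have "V m l - V n l = (V m (y i) - V n (y i)) - (V m (y i - l) - V n (y i - l))"
            by (simp add: blinfun.diff_right)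
          then have "norm (V m l - V n l) \<le> norm (V m (y i) - V n (y i)) + (norm (V m (y i - l)) + norm (V n (y i - l)))"
            by (smt (verit) norm_triangle_ineq4)
          then show ?thesis using M[OF that] i by simp
        qed
        then show "\<exists>M. \<forall>m\<ge>M. \<forall>n\<ge>M. norm (V m l - V n l) < \<epsilon>" by blast
      qed
      then show "l \<in> ?S" by simp
    qed
    show "0 \<in> ?S" by (simp add: Cauchy_convergent_iff convergent_const)
    show "x + y \<in> ?S" if "x \<in> ?S" "y \<in> ?S" for x y
      using that by (simp add: blinfun.add_right Cauchy_convergent_iff convergent_add)
    show "cs c (ebas k) \<in> ?S" for c k
    proof -
      have "V n (cs c (ebas k)) = cs c (U k (V n (ebas 0)))" for n
      proof -
        have "V n (U k (ebas 0)) = U k (V n (ebas 0))" using R_U[of 0 n k] by (metis blinfun_apply_blinfun_compose)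
        then show ?thesis using U_ebas[of k 0] by (simp add: clin_cs)
      qed
      moreover have "Cauchy (\<lambda>n. cs c (U k (V n (ebas 0))))"
        by (intro bounded_linear.Cauchy[OF bounded_linear_cs] bounded_linear.Cauchy[OF blinfun.bounded_linear_right] Cauchy_V_ebas0)
      ultimately show ?thesis by simp
    qed
  qed
  then show ?thesis by simp
qed

text \<open>Multiplications commute with their adjoints, so the difference is a normal operator.
  Strong convergence thereby carries over to the adjoints, which enter the projections.\<close>

lemma V_adj_diff: "norm (adj (V m) x - adj (V n) x) = norm (V m x - V n x)"
proof -
  define T where "T = V m - V n"
  have com: "V i o\<^sub>L adj (V j) = adj (V j) o\<^sub>L V i" for i j
    unfolding R_def Mul_cnj[OF ccont_seg, symmetric] by (rule Mul_commute) auto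
  have com': "V i (adj (V j) y) = adj (V j) (V i y)" for i j y
    using com[of i j] by (metis blinfun_apply_blinfun_compose)
  have "T (adj T x) = adj T (T x)"
    by (simp add: T_def adj_diff blinfun.diff_left blinfun.diff_right com')
  then have "(norm (adj T x))\<^sup>2 = (norm (T x))\<^sup>2"
    unfolding power2_norm_eq_inner by (simp add: inner_adj inner_adj')
  then have "norm (adj T x) = norm (T x)" by (simp add: power2_eq_iff_nonneg)
  then show ?thesis by (simp add: T_def adj_diff blinfun.diff_left)
qed

lemma Cauchy_V_adj: "Cauchy (\<lambda>n. adj (V n) x)"
  using Cauchy_V[of x] unfolding Cauchy_iff V_adj_diff .

definition Vi :: "ell2 \<Rightarrow>\<^sub>L ell2" where
  "Vi = (SOME B :: ell2 \<Rightarrow>\<^sub>L ell2. \<forall>x. (\<lambda>n. V n x) \<longlonglongrightarrow> B x)"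

lemma V_limit: "(\<lambda>n. V n x) \<longlonglongrightarrow> Vi x"
proof -
  obtain B :: "ell2 \<Rightarrow>\<^sub>L ell2" where "\<And>x. (\<lambda>n. V n x) \<longlonglongrightarrow> B x"
    by (rule strong_limit[of V]) (use Cauchy_V in auto)
  then have "\<exists>B::ell2 \<Rightarrow>\<^sub>L ell2. \<forall>x. (\<lambda>n. V n x) \<longlonglongrightarrow> B x" by blast
  from someI_ex[OF this] show ?thesis unfolding Vi_def by blast
qed

lemma V_adj_limit: "(\<lambda>n. adj (V n) x) \<longlonglongrightarrow> adj Vi x"
proof -
  obtain C :: "ell2 \<Rightarrow>\<^sub>L ell2" where C: "\<And>x. (\<lambda>n. adj (V n) x) \<longlonglongrightarrow> C x"
    by (rule strong_limit[of "\<lambda>n. adj (V n)"]) (use Cauchy_V_adj in auto)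
  have "adj Vi = C"
  proof (rule adj_eqI)
    fix x y
    have "(\<lambda>n. V n x \<bullet> y) \<longlonglongrightarrow> Vi x \<bullet> y" by (intro tendsto_inner V_limit tendsto_const)
    moreover have "(\<lambda>n. V n x \<bullet> y) \<longlonglongrightarrow> x \<bullet> C y" unfolding inner_adj by (intro tendsto_inner C tendsto_const)
    ultimately show "Vi x \<bullet> y = x \<bullet> C y" using LIMSEQ_unique by blast
  qed
  then show ?thesis using C by simp
qed

lemma Vi_isometry: "adj Vi (Vi x) = x"
proof -
  have "(\<lambda>n. adj (V n) (V n x)) \<longlonglongrightarrow> adj Vi (Vi x)"
    by (rule strong_compose[OF V_adj_limit _ V_limit]) simp
  then show ?thesis by (simp add: LIMSEQ_const_iff)
qed

lemma clin_Vi: "clin Vi"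
  unfolding clin_def
proof (intro allI)
  fix c x
  have "(\<lambda>n. cs c (V n x)) \<longlonglongrightarrow> Vi (cs c x)" using V_limit[of "cs c x"] by (simp add: clin_cs)
  moreover have "(\<lambda>n. cs c (V n x)) \<longlonglongrightarrow> cs c (Vi x)" by (intro tendsto_cs V_limit)
  ultimately show "Vi (cs c x) = cs c (Vi x)" using LIMSEQ_unique by blast
qed

text \<open>Uniform convergence near 0 suffices, because derivatives at 0 of holomorphic functions
  converge with it. This identifies the strong limit \<open>Vi\<close> with multiplication by
  \<open>u\<close>.\<close>

lemma taylor_bprod_limit: "(\<lambda>n. taylor (bpartial lam n) m) \<longlonglongrightarrow> taylor (bprod lam) m"
proof -
  have su: "summable (\<lambda>k. 3 * (1 - cmod (lam k)))" using bs unfolding blaschke_seq_def by (intro summable_mult) blast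
  have bnd: "cmod (blaschke_factor (lam k) z - 1) \<le> 3 * (1 - cmod (lam k))" if "z \<in> cball 0 (1/2)" for z k
    using norm_blaschke_factor_minus_one[OF lam_less] that by simp
  have "uniformly_convergent_on (cball 0 (1/2)) (\<lambda>N z. \<Prod>k<N. blaschke_factor (lam k) z)"
  proof (rule uniformly_convergent_on_prod')
    show "continuous_on (cball 0 (1/2)) (blaschke_factor (lam k))" for k
      by (rule continuous_on_subset[OF blaschke_factor_continuous[OF lam_less]]) auto
    show "uniformly_convergent_on (cball 0 (1/2)) (\<lambda>N x. \<Sum>n<N. norm (blaschke_factor (lam n) x - 1))"
      by (rule Weierstrass_m_test'[OF _ su]) (use bnd in auto)
  qed simp
  then obtain g where g: "uniform_limit (cball 0 (1/2)) (\<lambda>N z. \<Prod>k<N. blaschke_factor (lam k) z) g sequentially"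
    by (auto simp: uniformly_convergent_on_def)
  have "g z = bprod lam z" if z: "z \<in> cball 0 (1/2)" for z
  proof -
    have "summable (\<lambda>k. norm (blaschke_factor (lam k) z - 1))"
      by (rule summable_comparison_test'[OF su, of 0]) (use bnd[OF z] in auto)
    then have "convergent_prod (\<lambda>k. blaschke_factor (lam k) z)"
      by (intro abs_convergent_prod_imp_convergent_prod summable_imp_abs_convergent_prod)
    then have "(\<lambda>N. \<Prod>k<N. blaschke_factor (lam k) z) \<longlonglongrightarrow> bprod lam z"
      unfolding bprod_def by (intro has_prod_imp_tendsto' convergent_prod_has_prod)
    then show ?thesis using tendsto_uniform_limitI[OF g z] LIMSEQ_unique by blast
  qed
  then have "uniform_limit (cball 0 (1/2)) (\<lambda>N. bpartial lam N) (bprod lam) sequentially"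
    using g unfolding bpartial_def[abs_def] by (subst uniform_limit_cong'[where g = _ and i = g]) auto
  then have ul: "uniform_limit (ball 0 (1/2)) (\<lambda>N. bpartial lam N) (bprod lam) sequentially"
    by (rule uniform_limit_on_subset) auto
  have "(\<lambda>n. (deriv ^^ k) (bpartial lam n) 0) \<longlonglongrightarrow> (deriv ^^ k) (bprod lam) 0" for k
    by (rule higher_deriv_complex_uniform_limit[OF ul])
      (use seg_hol in \<open>auto simp: bpartial_seg intro!: always_eventually holomorphic_on_subset[OF seg_hol]\<close>)
  then show ?thesis unfolding taylor_def by (auto intro!: tendsto_intros)
qed

lemma symb_Vi: "symb Vi (bprod lam)"
proof -
  have "seq (Vi (ebas k)) m = taylor (bprod lam) (m - k)" for k m
  proof -
    have "(\<lambda>n. seq (V n (ebas k)) m) \<longlonglongrightarrow> seq (Vi (ebas k)) m" by (intro tendsto_coord V_limit)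
    then have "(\<lambda>n. taylor (bpartial lam n) (m - k)) \<longlonglongrightarrow> seq (Vi (ebas k)) m" by (simp add: R_ebas bpartial_seg)
    then show ?thesis using taylor_bprod_limit LIMSEQ_unique by blast
  qed
  moreover have "adj Vi o\<^sub>L Vi = id_blinfun" by (rule blinfun_eqI) (simp add: Vi_isometry)
  ultimately show ?thesis using clin_Vi by (simp add: symb_def)
qed

section \<open>Projections onto the model spaces and their dimensions\<close>

definition Pn :: "nat \<Rightarrow> ell2 \<Rightarrow>\<^sub>L ell2" where
  "Pn n = mproj (V n)"

definition Pu :: "ell2 \<Rightarrow>\<^sub>L ell2" where
  "Pu = mproj Vi"

lemma cproj_Pn: "cproj (Pn n)" and cproj_Pu: "cproj Pu"
  unfolding Pn_def Pu_def by (rule cproj_mproj[OF symb_V] cproj_mproj[OF symb_Vi])+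

lemma K2_n: "K2 (bpartial lam n) = seq ` ran (Pn n)" and K2_u: "K2 (bprod lam) = seq ` ran Pu"
  unfolding Pn_def Pu_def by (rule K2_mproj[OF symb_V] K2_mproj[OF symb_Vi])+

lemma model_proj_n: "model_proj (bpartial lam n) (seq x) = seq (Pn n x)"
  and model_proj_u: "model_proj (bprod lam) (seq x) = seq (Pu x)"
  unfolding Pn_def Pu_def by (rule model_proj_mproj[OF symb_V] model_proj_mproj[OF symb_Vi])+

lemma Pn_Pm: assumes "n \<le> m" shows "Pn m (Pn n x) = Pn n x" "Pn n (Pn m x) = Pn n x"
  unfolding Pn_def using mproj_mono[OF symb_V symb_V _ causal_R] R_comp[of 0 n m] assms by auto

text \<open>The operator is multiplication by the quotient of \<open>u\<close> by a partial product,
  that is the strong limit of \<open>R n m\<close> in \<open>m\<close>, and invariance of the Hardy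
  space survives strong limits.\<close>

lemma causal_Rinf: "causal (adj (V n) o\<^sub>L Vi)"
  unfolding causal_def
proof
  fix x
  let ?T = "adj (V n) o\<^sub>L Vi"
  have ev: "\<forall>\<^sub>F m in sequentially. adj (V n) (V m y) = R n m y" for y
    using eventually_ge_at_top[of n]
  proof eventually_elim
    case (elim m)
    then show ?case using R_comp[of 0 n m] by simp
  qed
  have lim: "(\<lambda>m. R n m y) \<longlonglongrightarrow> ?T y" for y
  proof -
    have "(\<lambda>m. adj (V n) (V m y)) \<longlonglongrightarrow> adj (V n) (Vi y)" by (intro blinfun.tendsto tendsto_const V_limit)
    then show ?thesis using Lim_transform_eventually[OF _ ev] by simp
  qed
  have "(\<lambda>m. Ph (R n m (Ph x))) \<longlonglongrightarrow> Ph (?T (Ph x))" by (intro blinfun.tendsto tendsto_const lim)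
  then have "(\<lambda>m. R n m (Ph x)) \<longlonglongrightarrow> Ph (?T (Ph x))" using causal_R by (simp add: causal_def)
  then show "Ph (?T (Ph x)) = ?T (Ph x)" using lim LIMSEQ_unique by blast
qed

lemma Pn_Pu: "Pu (Pn n x) = Pn n x" "Pn n (Pu x) = Pn n x"
proof -
  have "Vi = V n o\<^sub>L (adj (V n) o\<^sub>L Vi)" by (rule blinfun_eqI) simp
  from mproj_mono[OF symb_V symb_Vi this causal_Rinf]
  show "Pu (Pn n x) = Pn n x" "Pn n (Pu x) = Pn n x" by (simp_all add: Pn_def Pu_def)
qed

lemma Pn_limit: "(\<lambda>n. Pn n x) \<longlonglongrightarrow> Pu x"
  unfolding Pn_def Pu_def mproj_apply
  by (intro tendsto_diff tendsto_const strong_compose[OF V_limit] blinfun.tendsto V_adj_limit) simp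

lemma ran_PnD: "x \<in> ran (Pn n) \<Longrightarrow> Ph x = x" "x \<in> ran (Pn n) \<Longrightarrow> Ph (adj (V n) x) = 0"
  using ran_mproj[OF symb_V] by (auto simp: Pn_def)

text \<open>The \<open>m\<close>-th partial product is orthogonal to its own model space. If its
  projection to the next model space were 0, the adjoint of the new factor applied to
  \<open>ebas 0\<close> would have no coefficient at index \<open>-1\<close>, and the first Taylor
  coefficient of that factor would vanish.\<close>

lemma Pn_gap: "\<exists>y. norm y = 1 \<and> Pn (Suc m) y = y \<and> Pn m y = 0"
proof -
  define y where "y = Pn (Suc m) (V m (ebas 0))"
  have Phe: "Ph (ebas 0) = ebas 0" by (simp add: Ph_ebas)
  have PV: "Ph (V m (ebas 0)) = V m (ebas 0)" using causal_R[of 0 m] Phe unfolding causal_def by metis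
  have "Pn m (V m (ebas 0)) = 0" by (simp add: Pn_def mproj_apply PV Phe)
  then have y1: "Pn m y = 0" by (simp add: y_def Pn_Pm)
  have y2: "Pn (Suc m) y = y" by (simp add: y_def cprojD(4)[OF cproj_Pn])
  have "y \<noteq> 0"
  proof
    assume "y = 0"
    let ?b = "R m (Suc m)"
    have V: "V (Suc m) x = V m (?b x)" for x using R_comp[of 0 m "Suc m"] by simp
    have Va: "adj (V (Suc m)) x = adj ?b (adj (V m) x)" for x using R_comp[of 0 m "Suc m"] by (simp add: adj_compose)
    have "V m (ebas 0) = V m (?b (Ph (adj ?b (ebas 0))))"
      using \<open>y = 0\<close> by (simp add: y_def Pn_def mproj_apply PV Va V[of "Ph _"])
    then have "ebas 0 = ?b (Ph (adj ?b (ebas 0)))" by (metis R_adj_R)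
    then have "adj ?b (ebas 0) = Ph (adj ?b (ebas 0))" by (metis R_adj_R)
    then have "seq (adj ?b (ebas 0)) (-1) = seq (Ph (adj ?b (ebas 0))) (-1)" by simp
    then have "cnj (seq (?b (ebas (-1))) 0) = 0" by (simp add: seq_Ph hproj_def seq_adj_ebas)
    then have "fourier (seg m (Suc m)) 1 = 0" by (simp add: R_def Mul_ebas)
    moreover have "seg m (Suc m) = blaschke_factor (lam m)" by (rule ext) (simp add: seg_def)
    ultimately show False using fourier_blaschke_factor_1[OF lam_less] by simp
  qed
  then show ?thesis using y1 y2
    by (intro exI[of _ "inverse (norm y) *\<^sub>R y"]) (simp add: blinfun.scaleR_right)
qed

text \<open>This is the model space of a single Blaschke factor, spanned by the kernel function with
  coefficients \<open>cnj (lam m) ^ j\<close>. Clearing the denominator of the factor gives an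
  operator identity whose adjoint yields a first-order recursion for the coefficients of
  \<open>w\<close>, so that \<open>w\<close> is determined by its coefficient at 0.\<close>

lemma kernel_one_dim:
  "\<exists>g. \<forall>w. Ph w = w \<and> Ph (adj (R m (Suc m)) w) = 0 \<longrightarrow> (\<exists>c. w = cs c g)"
proof -
  let ?l = "lam m" and ?b = "R m (Suc m)"
  have rec: "seq w (j + 1) = cnj ?l * seq w j" if w: "Ph w = w" "Ph (adj ?b w) = 0" and j: "0 \<le> j" for w j
  proof -
    have "Mul (\<lambda>z. seg m (Suc m) z * (1 - cnj ?l * z powi 1)) = Mul (\<lambda>z. bconst ?l * (?l - z powi 1))"
    proof (rule Mul_cong)
      fix z :: complex assume "z \<in> sphere 0 1"
      then have "1 - cnj ?l * z \<noteq> 0" using blaschke_denominator[OF lam_less] by simp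
      then show "seg m (Suc m) z * (1 - cnj ?l * z powi 1) = bconst ?l * (?l - z powi 1)"
        by (simp add: seg_def blaschke_factor_eq)
    qed
    moreover have "Mul (\<lambda>z. c - d * z powi 1) = Cs c - (Cs d o\<^sub>L U 1)" for c d
    proof -
      have cc: "ccont (\<lambda>z. d * z powi 1)" by (intro ccont_intros)
      have "Mul (\<lambda>z. c * 1) = Cs c o\<^sub>L Mul (\<lambda>z. 1)" by (rule Mul_cmult) simp
      then have "Mul (\<lambda>z. c) = Cs c" by (auto simp: Mul_one intro: blinfun_eqI)
      then show ?thesis unfolding Mul_diff[OF ccont_intros(1) cc] U_def by (simp add: Mul_cmult del: power_int_1_right)
    qed
    note MC = this
    have cc: "ccont (\<lambda>z. 1 - cnj ?l * z powi 1)" "ccont (\<lambda>z. ?l - z powi 1)" by (intro ccont_intros)+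
    have "?b o\<^sub>L (Cs 1 - (Cs (cnj ?l) o\<^sub>L U 1)) = Cs (bconst ?l) o\<^sub>L (Cs ?l - (Cs 1 o\<^sub>L U 1))"
      using calculation unfolding Mul_mult[OF ccont_seg cc(1)] Mul_cmult[OF cc(2)] MC
      using MC[of ?l 1] by (simp add: R_def)
    then have "(Cs 1 - (Cs (cnj ?l) o\<^sub>L U 1)) o\<^sub>L ?b = Cs (bconst ?l) o\<^sub>L (Cs ?l - (Cs 1 o\<^sub>L U 1))"
      unfolding R_def MC[symmetric] using Mul_commute[OF ccont_seg cc(1)] by simp
    from arg_cong[OF this, of adj]
    have ad: "adj ?b o\<^sub>L (Cs 1 - (U (-1) o\<^sub>L Cs ?l)) = (Cs (cnj ?l) - (U (-1) o\<^sub>L Cs 1)) o\<^sub>L Cs (cnj (bconst ?l))"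
      by (simp add: adj_compose adj_diff adj_U)
    have swap: "adj ?b (U (-1) x) = U (-1) (adj ?b x)" for x
    proof -
      have "adj (U 1 o\<^sub>L ?b) = adj (?b o\<^sub>L U 1)" by (simp add: R_U)
      then have "adj ?b o\<^sub>L U (-1) = U (-1) o\<^sub>L adj ?b" by (simp add: adj_compose adj_U)
      then show ?thesis by (metis blinfun_apply_blinfun_compose)
    qed
    \<comment> \<open>\<open>q\<close> has only negative indices by hypothesis; comparing
      coefficients at \<open>j \<ge> 0\<close> therefore annihilates one side of the identity and
      leaves the recursion.\<close>
    define q where "q = adj ?b w"
    have q: "seq q i = 0" if "0 \<le> i" for i
    proof -
      have "seq (Ph q) i = 0" using w(2) by (simp add: q_def)
      then show ?thesis using that by (simp add: seq_Ph hproj_def)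
    qed
    from arg_cong[OF ad, of "\<lambda>A. blinfun_apply A w"] have "adj ?b (w - U (-1) (cs ?l w)) = cs (cnj ?l) (cs (cnj (bconst ?l)) w) - U (-1) (cs (cnj (bconst ?l)) w)"
      by (simp add: blinfun.diff_left)
    then have "q - cs ?l (U (-1) q) = cs (cnj (bconst ?l)) (cs (cnj ?l) w - U (-1) w)"
      by (simp add: blinfun.diff_right swap q_def clin_cs clin_adj cs_diff_right mult.commute)
    from arg_cong[OF this, of "\<lambda>x. seq x j"]
    have "seq q j - ?l * seq q (j + 1) = cnj (bconst ?l) * (cnj ?l * seq w j - seq w (j + 1))"
      by (simp add: cscale_def seq_U)
    then have "cnj (bconst ?l) * (cnj ?l * seq w j - seq w (j + 1)) = 0" using q j by simp
    moreover have "cnj (bconst ?l) \<noteq> 0" using norm_bconst[of ?l] by (metis complex_cnj_zero_iff norm_zero zero_neq_one)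
    ultimately show ?thesis by simp
  qed
  have det: "w = cs (seq w 0 / seq g 0) g"
    if w: "Ph w = w" "Ph (adj ?b w) = 0" and g: "Ph g = g" "Ph (adj ?b g) = 0" "seq g 0 \<noteq> 0" for w g
  proof (rule ell2_eqI)
    fix k :: int
    have pw: "seq v (int i) = cnj ?l ^ i * seq v 0" if "Ph v = v" "Ph (adj ?b v) = 0" for v i
    proof (induction i)
      case (Suc i)
      then show ?case using rec[OF that, of "int i"] by (simp add: add.commute)
    qed simp
    show "seq w k = seq (cs (seq w 0 / seq g 0) g) k"
    proof (cases "0 \<le> k")
      case True
      then show ?thesis using pw[OF w, of "nat k"] pw[OF g(1,2), of "nat k"] g(3) by (simp add: cscale_def)
    next
      case False
      then have "seq w k = 0" "seq g k = 0" using w(1) g(1) ran_Ph[of w] ran_Ph[of g] by (auto simp: ran_def)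
      then show ?thesis by (simp add: cscale_def)
    qed
  qed
  have zero: "w = 0" if w: "Ph w = w" "Ph (adj ?b w) = 0" and "seq w 0 = 0" for w
  proof (rule ell2_eqI)
    fix k :: int
    have pw: "seq w (int i) = 0" for i
    proof (induction i)
      case 0
      show ?case using that(3) by simp
    next
      case (Suc i)
      then show ?case using rec[OF w, of "int i"] by (simp add: add.commute)
    qed
    show "seq w k = seq 0 k"
    proof (cases "0 \<le> k")
      case True
      then show ?thesis using pw[of "nat k"] by simp
    next
      case False
      then show ?thesis using w(1) ran_Ph[of w] by (auto simp: ran_def)
    qed
  qed
  show ?thesis
  proof (cases "\<exists>g. Ph g = g \<and> Ph (adj ?b g) = 0 \<and> seq g 0 \<noteq> 0")
    case True
    then show ?thesis using det by blast
  next
    case False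
    then show ?thesis using zero by (intro exI[of _ 0]) auto
  qed
qed

text \<open>\<open>x\<close> minus its projection to the smaller model space is \<open>V m\<close>
  applied to an element of the model space of the new factor, so each step adds at most one
  dimension.\<close>

lemma findim_Pn: "findim (seq ` ran (Pn n))"
proof (induction n)
  case 0
  have "V 0 = id_blinfun" unfolding R_def Mul_one[symmetric] by (rule Mul_cong) (simp add: seg_def)
  moreover have "adj id_blinfun = (id_blinfun :: ell2 \<Rightarrow>\<^sub>L ell2)" by (rule adj_eqI) simp
  ultimately have "ran (Pn 0) = {0}" by (auto simp: ran_def Pn_def mproj_apply cprojD(4)[OF cproj_Ph])
  then show ?case unfolding findim_def by (intro exI[of _ "{}"]) auto
next
  case (Suc m)
  then obtain B where B: "finite B" "seq ` ran (Pn m) \<subseteq> cv.span B" by (auto simp: findim_def)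
  obtain g where g: "\<And>w. Ph w = w \<Longrightarrow> Ph (adj (R m (Suc m)) w) = 0 \<Longrightarrow> \<exists>c. w = cs c g"
    using kernel_one_dim[of m] by blast
  have "seq x \<in> cv.span (insert (seq (V m g)) B)" if x: "x \<in> ran (Pn (Suc m))" for x
  proof -
    define w where "w = Ph (adj (V m) x)"
    have "Ph (adj (R m (Suc m)) w) = Ph (adj (R m (Suc m)) (adj (V m) x))"
      by (simp add: w_def causal_adj[OF causal_R])
    also have "\<dots> = Ph (adj (V (Suc m)) x)" using R_comp[of 0 m "Suc m"] by (simp add: adj_compose)
    also have "\<dots> = 0" using ran_PnD(2)[OF x] .
    finally obtain c where c: "w = cs c g" using g[of w] by (auto simp: w_def cprojD(4)[OF cproj_Ph])
    have "x = Pn m x + V m w" using ran_PnD(1)[OF x] by (simp add: Pn_def mproj_apply w_def)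
    then have "seq x = seq (Pn m x + cs c (V m g))" unfolding c by (simp only: clin_cs[OF clin_R])
    moreover have "seq (Pn m x) \<in> cv.span (insert (seq (V m g)) B)"
      using B(2) cprojD(5)[OF cproj_Pn] cv.span_mono[of B "insert (seq (V m g)) B"] by blast
    ultimately show ?thesis by (auto intro!: cv.span_add cv.span_scale intro: cv.span_base)
  qed
  then show ?case unfolding findim_def using B(1) by (intro exI[of _ "insert (seq (V m g)) B"]) auto
qed

lemma onb_Pn: "\<exists>v d. onb (ran (Pn n)) v d"
  using findim_Pn findim_iff_onb[OF csub_ran[OF cprojD(1)[OF cproj_Pn]]] by blast

section \<open>The compressed shift and the compressed multiplication operators\<close>

definition S :: "ell2 \<Rightarrow>\<^sub>L ell2" where
  "S = Pu o\<^sub>L (U 1 o\<^sub>L Pu)"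

lemma adj_S: "adj S = Pu o\<^sub>L (U (-1) o\<^sub>L Pu)"
  by (simp add: S_def adj_compose adj_U cprojD(3)[OF cproj_Pu] blinfun_compose_assoc)

lemma Ph_Pu: "Ph (Pu x) = Pu x" "Pu (Ph x) = Pu x" and Ph_Pn: "Ph (Pn n x) = Pn n x" "Pn n (Ph x) = Pn n x"
  unfolding Pu_def Pn_def using Ph_mproj[OF symb_Vi] Ph_mproj[OF symb_V] by auto

lemma V_adj_U: "adj (V n) (U k x) = U k (adj (V n) x)"
proof -
  have "adj (U (-k) o\<^sub>L V n) = adj (V n o\<^sub>L U (-k))" by (simp add: R_U)
  then have "adj (V n) o\<^sub>L U k = U k o\<^sub>L adj (V n)" by (simp add: adj_compose adj_U)
  then show ?thesis by (metis blinfun_apply_blinfun_compose)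
qed

lemma adj_S_Pn: "Pn n (adj S (Pn n x)) = adj S (Pn n x)"
proof -
  define y where "y = Ph (U (-1) (Pn n x))"
  define z where "z = adj (V n) (Pn n x)"
  have "Ph z = 0" unfolding z_def by (rule ran_PnD(2)[OF cprojD(5)[OF cproj_Pn]])
  then have z: "seq z i = 0" if "0 \<le> i" for i
  proof -
    have "seq (Ph z) i = 0" using \<open>Ph z = 0\<close> by simp
    then show ?thesis using that by (simp add: seq_Ph hproj_def)
  qed
  have "Ph (adj (V n) y) = Ph (U (-1) z)" by (simp add: y_def causal_adj[OF causal_R] V_adj_U z_def)
  also have "\<dots> = 0" by (rule ell2_eqI) (simp add: seq_Ph hproj_def seq_U z)
  finally have "y \<in> ran (Pn n)" unfolding Pn_def ran_mproj[OF symb_V] by (simp add: y_def cprojD(4)[OF cproj_Ph])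
  then have y: "Pn n y = y" by (simp add: ran_def)
  have "adj S (Pn n x) = Pu y" by (simp add: adj_S Pn_Pu y_def Ph_Pu)
  also have "\<dots> = y" using y Pn_Pu(1) by metis
  finally show ?thesis using y by simp
qed

text \<open>Dividing \<open>Pn n x\<close> by the partial product leaves only negative indices,
  collected in \<open>z\<close>. After the shift at most index 0 survives the Hardy projection, so
  what leaves the model space is the partial product times the coefficient
  \<open>seq z (-1)\<close>.\<close>

lemma S_Pn_defect: "norm (S (Pn n x) - Pn n (S (Pn n x))) \<le> norm (Pu (V n (ebas 0))) * norm x"
proof -
  define y where "y = U 1 (Pn n x)"
  define z where "z = adj (V n) (Pn n x)"
  have "Ph z = 0" unfolding z_def by (rule ran_PnD(2)[OF cprojD(5)[OF cproj_Pn]])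
  then have z: "seq z i = 0" if "0 \<le> i" for i
  proof -
    have "seq (Ph z) i = 0" using \<open>Ph z = 0\<close> by simp
    then show ?thesis using that by (simp add: seq_Ph hproj_def)
  qed
  have Phx: "Ph (Pn n x) = Pn n x" by (rule Ph_Pn)
  then have "Pn n x \<in> ran Ph" by (simp add: ran_def)
  then have "y \<in> ran Ph" unfolding ran_Ph y_def by (simp add: seq_U)
  then have y: "Ph y = y" by (simp add: ran_def)
  have "Ph (adj (V n) y) = cs (seq z (-1)) (ebas 0)"
  proof (rule ell2_eqI)
    fix k
    show "seq (Ph (adj (V n) y)) k = seq (cs (seq z (-1)) (ebas 0)) k"
      using z[of "k - 1"] by (auto simp: y_def V_adj_U z_def[symmetric] seq_Ph hproj_def seq_U cscale_def seq_ebas)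
  qed
  then have "y - Pn n y = cs (seq z (-1)) (V n (ebas 0))"
    by (simp add: Pn_def mproj_apply y clin_cs)
  then have "Pu (y - Pn n y) = cs (seq z (-1)) (Pu (V n (ebas 0)))" by (simp add: clin_cs cprojD(1)[OF cproj_Pu])
  moreover have "S (Pn n x) - Pn n (S (Pn n x)) = Pu (y - Pn n y)"
    by (simp add: S_def Pn_Pu y_def blinfun.diff_right)
  ultimately have "norm (S (Pn n x) - Pn n (S (Pn n x))) = cmod (seq z (-1)) * norm (Pu (V n (ebas 0)))" by simp
  also have "\<dots> \<le> norm x * norm (Pu (V n (ebas 0)))"
  proof (rule mult_right_mono)
    have "cmod (seq z (-1)) \<le> norm z" by (rule norm_coord_le)
    also have "norm z = norm (Pn n x)" by (simp add: z_def)
    also have "\<dots> \<le> norm x" by (rule cproj_norm_le[OF cproj_Pn])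
    finally show "cmod (seq z (-1)) \<le> norm x" .
  qed simp
  finally show ?thesis by (simp add: mult.commute)
qed

lemma Pu_V_ebas0_limit: "(\<lambda>n. norm (Pu (V n (ebas 0)))) \<longlonglongrightarrow> 0"
proof -
  have "Ph (Vi (ebas 0)) = Vi (ebas 0)"
    using symb_causal[OF symb_Vi] Ph_ebas[of 0] unfolding causal_def by (metis order_refl)
  then have "Pu (Vi (ebas 0)) = 0" by (simp add: Pu_def mproj_apply Vi_isometry Ph_ebas)
  moreover have "(\<lambda>n. norm (Pu (V n (ebas 0)))) \<longlonglongrightarrow> norm (Pu (Vi (ebas 0)))"
    by (intro tendsto_norm blinfun.tendsto tendsto_const V_limit)
  ultimately show ?thesis by simp
qed

lemma Vi_U: "Vi (U k x) = U k (Vi x)"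
proof -
  have "(\<lambda>n. V n (U k x)) \<longlonglongrightarrow> Vi (U k x)" by (rule V_limit)
  moreover have "V n (U k x) = U k (V n x)" for n using R_U[of 0 n k] by (metis blinfun_apply_blinfun_compose)
  moreover have "(\<lambda>n. U k (V n x)) \<longlonglongrightarrow> U k (Vi x)" by (intro blinfun.tendsto tendsto_const V_limit)
  ultimately show ?thesis using LIMSEQ_unique by simp
qed

text \<open>Multiples of \<open>u\<close> in the Hardy space stay such under the shift, so the
  component of \<open>y\<close> lost by \<open>Pu\<close> would not return after another shift.
  Hence compressions of powers are powers of \<open>S\<close>.\<close>

lemma compress_U_Suc: "Pu o\<^sub>L (U (int (Suc k)) o\<^sub>L Pu) = S o\<^sub>L (Pu o\<^sub>L (U (int k) o\<^sub>L Pu))"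
proof (rule blinfun_eqI)
  fix x
  define y where "y = U (int k) (Pu x)"
  have "Pu x \<in> ran Ph" using Ph_Pu(1) by (simp add: ran_def)
  then have "y \<in> ran Ph" unfolding ran_Ph y_def by (simp add: seq_U)
  then have y: "Ph y = y" by (simp add: ran_def)
  have y2: "y = Pu y + Vi (Ph (adj Vi y))" by (simp add: Pu_def mproj_apply y)
  have "Pu (U 1 (Vi (Ph z))) = 0" for z
  proof -
    have "Ph z \<in> ran Ph" using cprojD(5)[OF cproj_Ph] .
    then have "U 1 (Ph z) \<in> ran Ph" unfolding ran_Ph by (simp add: seq_U)
    then have 1: "Ph (U 1 (Ph z)) = U 1 (Ph z)" by (simp add: ran_def)
    have 2: "Ph (Vi (U 1 (Ph z))) = Vi (U 1 (Ph z))"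
      using symb_causal[OF symb_Vi] 1 unfolding causal_def by metis
    show ?thesis unfolding Vi_U[symmetric] Pu_def mproj_apply Vi_isometry 1 2 by simp
  qed
  then have "Pu (U 1 y) = Pu (U 1 (Pu y))"
    by (subst y2) (simp add: blinfun.add_right)
  moreover have "U 1 y = U (int (Suc k)) (Pu x)"
    using U_add[of 1 "int k"] by (simp add: y_def) (metis blinfun_apply_blinfun_compose)
  ultimately show "(Pu o\<^sub>L (U (int (Suc k)) o\<^sub>L Pu)) x = (S o\<^sub>L (Pu o\<^sub>L (U (int k) o\<^sub>L Pu))) x"
    by (simp add: S_def y_def cprojD(4)[OF cproj_Pu])
qed

definition Top :: "(complex \<Rightarrow> complex) \<Rightarrow> ell2 \<Rightarrow>\<^sub>L ell2" where
  "Top a = Pu o\<^sub>L (Mul a o\<^sub>L Pu)"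

lemma toeplitz_Top:
  assumes "ccont a" "x \<in> ran Pu" shows "toeplitz (bprod lam) a (seq x) = seq (Top a x)"
  using assms by (simp add: toeplitz_def mult_op_def Mul_apply(1)[symmetric] model_proj_u Top_def ran_def)

text \<open>Nonnegative powers of \<open>z\<close> compress to powers of \<open>S\<close>, negative
  ones to adjoints of these, and trigonometric polynomials are uniformly dense among the continuous
  symbols.\<close>

lemma Top_in_closed_algebra:
  assumes M: "closed M" "\<And>A B. A \<in> M \<Longrightarrow> B \<in> M \<Longrightarrow> A + B \<in> M" "\<And>A B. A \<in> M \<Longrightarrow> B \<in> M \<Longrightarrow> A o\<^sub>L B \<in> M"
      "\<And>c A. A \<in> M \<Longrightarrow> Cs c o\<^sub>L A \<in> M" "Pu \<in> M" "S \<in> M" "adj S \<in> M"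
    and a: "ccont a"
  shows "Top a \<in> M"
proof -
  have pos: "Pu o\<^sub>L (U (int k) o\<^sub>L Pu) \<in> M \<and> adj (Pu o\<^sub>L (U (int k) o\<^sub>L Pu)) \<in> M" for k
  proof (induction k)
    case 0
    have "U 0 = id_blinfun" by (simp add: U_def Mul_one)
    then have "Pu o\<^sub>L (U (int 0) o\<^sub>L Pu) = Pu" by (intro blinfun_eqI) (simp add: cprojD(4)[OF cproj_Pu])
    then show ?case using M(5) cprojD(3)[OF cproj_Pu] by simp
  next
    case (Suc k)
    then show ?case unfolding compress_U_Suc adj_compose[of S] using M(3,6,7) by blast
  qed
  have "Pu o\<^sub>L (U k o\<^sub>L Pu) \<in> M" for k
  proof (cases "0 \<le> k")
    case True
    then show ?thesis using pos[of "nat k"] by simp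
  next
    case False
    have "adj (Pu o\<^sub>L (U (int (nat (-k))) o\<^sub>L Pu)) = Pu o\<^sub>L (U k o\<^sub>L Pu)"
      using False by (simp add: adj_compose adj_U cprojD(3)[OF cproj_Pu] blinfun_compose_assoc)
    then show ?thesis using pos[of "nat (-k)"] by simp
  qed
  then have U: "Pu o\<^sub>L (U k o\<^sub>L Pu) \<in> M" for k .
  have "Pu o\<^sub>L (Mul a o\<^sub>L Pu) \<in> M"
  proof (rule Mul_in_closed[OF a M(1), where \<Phi> = "\<lambda>A. Pu o\<^sub>L (A o\<^sub>L Pu)"])
    fix q assume "trig q"
    then show "Pu o\<^sub>L (Mul q o\<^sub>L Pu) \<in> M"
    proof (induction rule: trig.induct)
      case (monom c k)
      have "Pu o\<^sub>L (Mul (\<lambda>z. c * z powi k) o\<^sub>L Pu) = Cs c o\<^sub>L (Pu o\<^sub>L (U k o\<^sub>L Pu))"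
        by (rule blinfun_eqI) (simp add: Mul_cmult U_def[symmetric] clin_cs cprojD(1)[OF cproj_Pu])
      then show ?case using M(4)[OF U[of k]] by simp
    next
      case (add p q)
      then have "Pu o\<^sub>L (Mul (\<lambda>z. p z + q z) o\<^sub>L Pu) = (Pu o\<^sub>L (Mul p o\<^sub>L Pu)) + (Pu o\<^sub>L (Mul q o\<^sub>L Pu))"
        by (intro blinfun_eqI) (simp add: Mul_add ccont_trig blinfun.add_left blinfun.add_right)
      then show ?case using M(2)[OF add.IH] by simp
    qed
  qed (intro continuous_intros bounded_bilinear.continuous_on[OF bounded_bilinear_blinfun_compose])
  then show ?thesis by (simp add: Top_def)
qed

end

section \<open>Fredholm operators on the range of a projection\<close>

instance ell2 :: banach ..

definition tens :: "ell2 \<Rightarrow> ell2 \<Rightarrow> ell2 \<Rightarrow>\<^sub>L ell2" where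
  "tens x y = Blinfun (\<lambda>z. cs (cin z y) x)"

lemma tens_apply [simp]: "tens x y z = cs (cin z y) x"
proof -
  have "bounded_linear (\<lambda>z. cs (cin z y) x)"
    by (rule bounded_linear_intro[where K = "norm y * norm x"])
      (auto simp: cin_simps scaleR_cs cs_add_left mult.assoc[symmetric] intro!: mult_right_mono norm_cin_le)
  then show ?thesis by (simp add: tens_def bounded_linear_Blinfun_apply)
qed

lemma clin_tens [simp]: "clin (tens x y)"
  by (simp add: clin_def cin_simps)

lemma clin_sum_op: "(\<And>i. i \<in> I \<Longrightarrow> clin (f i)) \<Longrightarrow> clin (\<Sum>i\<in>I. f i)"
  by (induction I rule: infinite_finite_induct) (auto intro: clin_add)

lemma onb_projection:
  assumes N: "csub N" and v: "onb N v n"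
  obtains Q where "cproj Q" "ran Q = N" "cpt Q"
proof -
  define Q where "Q = (\<Sum>i<n. tens (v i) (v i))"
  have Q: "Q x = (\<Sum>i<n. cs (cin x (v i)) (v i))" for x
    by (simp add: Q_def blinfun.sum_left)
  have clin: "clin Q" unfolding Q_def by (rule clin_sum_op) simp
  have in_N: "Q x \<in> N" for x unfolding Q by (rule csub_sum[OF N]) (use onbD(2)[OF v] in auto)
  have fx: "Q x = x" if "x \<in> N" for x unfolding Q by (rule onbD(3)[OF v that])
  have "Q o\<^sub>L Q = Q" by (rule blinfun_eqI) (simp add: fx in_N)
  moreover have "adj Q = Q"
  proof (rule adj_eqI)
    fix x y
    have "cin (Q x) y = cin x (Q y)"
      by (simp add: Q cin_simps cin_commute[of "v _" y] mult.commute)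
    then show "Q x \<bullet> y = x \<bullet> Q y" by (simp flip: Re_cin)
  qed
  ultimately have "cproj Q" using clin by (simp add: cproj_def)
  moreover have "ran Q = N" using in_N fx by (auto simp: ran_def) metis
  moreover have "cpt Q" by (rule cpt_finite_rank[OF v in_N])
  ultimately show ?thesis by (rule that)
qed

text \<open>The extensions by 0 of operators on \<open>ran P\<close>. \<open>P\<close> is the unit
  of this algebra and takes the place of the identity in all Fredholm conditions.\<close>

definition corner :: "(ell2 \<Rightarrow>\<^sub>L ell2) \<Rightarrow> (ell2 \<Rightarrow>\<^sub>L ell2) \<Rightarrow> bool" where
  "corner P A \<longleftrightarrow> clin A \<and> P o\<^sub>L A = A \<and> A o\<^sub>L P = A"

lemma cornerD:
  assumes "corner P A"
  shows "clin A" "P o\<^sub>L A = A" "A o\<^sub>L P = A" "P (A x) = A x" "A (P x) = A x" "A x \<in> ran P"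
proof -
  show *: "clin A" "P o\<^sub>L A = A" "A o\<^sub>L P = A" using assms by (auto simp: corner_def)
  show "P (A x) = A x" "A (P x) = A x" using *(2,3) by (metis blinfun_apply_blinfun_compose)+
  then show "A x \<in> ran P" by (simp add: ran_def)
qed

lemma cornerI:
  fixes P A :: "ell2 \<Rightarrow>\<^sub>L ell2"
  shows "clin A \<Longrightarrow> (\<And>x. P (A x) = A x) \<Longrightarrow> (\<And>x. A (P x) = A x) \<Longrightarrow> corner P A"
  unfolding corner_def by (auto intro!: blinfun_eqI)

lemma corner_add: "corner P A \<Longrightarrow> corner P B \<Longrightarrow> corner P (A + B)"
  by (rule cornerI) (simp_all add: cornerD clin_add blinfun.add_left blinfun.add_right)

lemma corner_diff: "corner P A \<Longrightarrow> corner P B \<Longrightarrow> corner P (A - B)"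
  by (rule cornerI) (simp_all add: cornerD clin_diff blinfun.diff_left blinfun.diff_right)

lemma corner_zero [simp]: "corner P 0"
  by (rule cornerI) simp_all

lemma corner_compose: "corner P A \<Longrightarrow> corner P B \<Longrightarrow> corner P (A o\<^sub>L B)"
  by (rule cornerI) (simp_all add: cornerD clin_compose)

lemma corner_Cs: "cproj P \<Longrightarrow> corner P A \<Longrightarrow> corner P (Cs c o\<^sub>L A)"
  by (rule cornerI) (simp_all add: cornerD clin_compose clin_cs[OF cprojD(1)])

lemma corner_proj: "cproj P \<Longrightarrow> corner P P"
  by (rule cornerI) (simp_all add: cprojD)

lemma corner_adj: "cproj P \<Longrightarrow> corner P A \<Longrightarrow> corner P (adj A)"
  unfolding corner_def using clin_adj cprojD(3)[of P] adj_compose[of A P] adj_compose[of P A] by auto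

lemma corner_of_sub:
  assumes "cproj P" "cproj Q" "ran Q \<subseteq> ran P" shows "corner P Q"
proof (rule cornerI)
  show PQ: "P (Q x) = Q x" for x using cprojD(5)[OF assms(2), of x] assms(3) by (auto simp: ran_def)
  have "P o\<^sub>L Q = Q" by (rule blinfun_eqI) (simp add: PQ)
  then have "adj (P o\<^sub>L Q) = adj Q" by simp
  then have "Q o\<^sub>L P = Q" using assms by (simp add: adj_compose cprojD(3))
  then show "Q (P x) = Q x" for x by (metis blinfun_apply_blinfun_compose)
qed (rule cprojD(1)[OF assms(2)])

definition kerP :: "(ell2 \<Rightarrow>\<^sub>L ell2) \<Rightarrow> (ell2 \<Rightarrow>\<^sub>L ell2) \<Rightarrow> ell2 set" where
  "kerP P A = {x \<in> ran P. A x = 0}"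

definition cokerP :: "(ell2 \<Rightarrow>\<^sub>L ell2) \<Rightarrow> (ell2 \<Rightarrow>\<^sub>L ell2) \<Rightarrow> ell2 set" where
  "cokerP P A = {y \<in> ran P. \<forall>x\<in>ran P. cin (A x) y = 0}"

definition fred :: "(ell2 \<Rightarrow>\<^sub>L ell2) \<Rightarrow> (ell2 \<Rightarrow>\<^sub>L ell2) \<Rightarrow> bool" where
  "fred P A \<longleftrightarrow> (\<exists>v n. onb (kerP P A) v n) \<and> closed (blinfun_apply A ` ran P) \<and> (\<exists>v n. onb (cokerP P A) v n)"

context
  fixes P :: "ell2 \<Rightarrow>\<^sub>L ell2" assumes P: "cproj P"
begin

lemma csub_ranP: "csub (ran P)"
  by (rule csub_ran[OF cprojD(1)[OF P]])

lemma csub_kerP: "corner P A \<Longrightarrow> csub (kerP P A)"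
  using csub_ranP by (auto simp: csub_def kerP_def blinfun.add_right clin_cs cornerD(1))

lemma csub_cokerP: "csub (cokerP P A)"
  using csub_ranP by (auto simp: csub_def cokerP_def cin_simps)

lemma cokerP_adj: assumes "corner P A" shows "y \<in> cokerP P A \<longleftrightarrow> y \<in> ran P \<and> adj A y = 0"
proof
  assume y: "y \<in> cokerP P A"
  have "adj A y \<in> ran P" by (rule cornerD(6)[OF corner_adj[OF P assms]])
  then have "cin (A (adj A y)) y = 0" using y by (simp add: cokerP_def)
  then have "cin (adj A y) (adj A y) = 0" by (simp add: cin_adj[OF cornerD(1)[OF assms]])
  then show "y \<in> ran P \<and> adj A y = 0" using y by (simp add: cin_self cokerP_def)
qed (simp add: cokerP_def cin_adj[OF cornerD(1)[OF assms]])

text \<open>Otherwise unit vectors orthogonal to the kernel have images under \<open>A\<close>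
  tending to 0. Each is \<open>B (A x)\<close> minus a compact image, so a subsequence converges,
  and the limit is a unit vector both in the kernel and orthogonal to it.\<close>

lemma bounded_below_off_kernel:
  assumes A: "corner P A" and B: "corner P B" and K: "cpt ((B o\<^sub>L A) - P)"
    and Q: "cproj Q" "ran Q = kerP P A"
  shows "\<exists>c>0. \<forall>x\<in>ran P. Q x = 0 \<longrightarrow> c * norm x \<le> norm (A x)"
proof (rule ccontr)
  assume neg: "\<not> ?thesis"
  have "\<exists>x. x \<in> ran P \<and> Q x = 0 \<and> norm x = 1 \<and> norm (A x) \<le> inverse (real (Suc n))" for n
  proof -
    have "\<not> (\<forall>x\<in>ran P. Q x = 0 \<longrightarrow> inverse (real (Suc n)) * norm x \<le> norm (A x))"
      using neg by (metis inverse_positive_iff_positive of_nat_0_less_iff zero_less_Suc)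
    then obtain x where x: "x \<in> ran P" "Q x = 0" "norm (A x) < inverse (real (Suc n)) * norm x" by (auto simp: not_le)
    then have x0: "norm x > 0" by (metis blinfun.zero_right mult_zero_right norm_zero norm_eq_zero less_irrefl zero_less_norm_iff)
    let ?y = "inverse (norm x) *\<^sub>R x"
    have "?y \<in> ran P" using x(1) by (simp add: ran_def blinfun.scaleR_right)
    moreover have "Q ?y = 0" "norm ?y = 1" using x x0 by (simp_all add: blinfun.scaleR_right)
    moreover have "norm (A ?y) \<le> inverse (real (Suc n))" using x(3) x0
      by (simp add: blinfun.scaleR_right field_simps)
    ultimately show ?thesis by blast
  qed
  then obtain x where x: "\<And>n. x n \<in> ran P" "\<And>n. Q (x n) = 0" "\<And>n. norm (x n) = 1"
      "\<And>n. norm (A (x n)) \<le> inverse (real (Suc n))" by metis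
  have nle: "norm (x n) \<le> 1" for n by (simp add: x(3))
  obtain r l where r: "strict_mono r" "(\<lambda>n. ((B o\<^sub>L A) - P) (x (r n))) \<longlonglongrightarrow> l"
    by (rule cptE[OF K nle])
  have A0: "(\<lambda>n. A (x (r n))) \<longlonglongrightarrow> 0"
  proof (rule Lim_null_comparison)
    show "\<forall>\<^sub>F n in sequentially. norm (A (x (r n))) \<le> inverse (real (Suc (r n)))" using x(4) by simp
    show "(\<lambda>n. inverse (real (Suc (r n)))) \<longlonglongrightarrow> 0"
      using LIMSEQ_subseq_LIMSEQ[OF LIMSEQ_inverse_real_of_nat r(1)] by (simp add: o_def)
  qed
  have "(\<lambda>n. B (A (x (r n))) - ((B o\<^sub>L A) - P) (x (r n))) \<longlonglongrightarrow> B 0 - l"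
    by (intro tendsto_diff blinfun.tendsto tendsto_const A0 r(2))
  moreover have "B (A (x (r n))) - ((B o\<^sub>L A) - P) (x (r n)) = x (r n)" for n
    using x(1)[of "r n"] by (simp add: blinfun.diff_left ran_def)
  ultimately have lim: "(\<lambda>n. x (r n)) \<longlonglongrightarrow> - l" by simp
  have "(\<lambda>n. norm (x (r n))) \<longlonglongrightarrow> norm (- l)" by (intro tendsto_norm lim)
  then have n1: "norm (- l) = 1" using x(3) LIMSEQ_unique[OF _ tendsto_const] by simp
  have "- l \<in> ran P" by (rule closed_sequentially[OF closed_ran _ lim]) (use x(1) in auto)
  moreover have "(\<lambda>n. A (x (r n))) \<longlonglongrightarrow> A (- l)" by (intro blinfun.tendsto tendsto_const lim)
  then have "A (- l) = 0" using A0 LIMSEQ_unique by blast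
  ultimately have "- l \<in> ran Q" using Q(2) by (simp add: kerP_def)
  moreover have "(\<lambda>n. Q (x (r n))) \<longlonglongrightarrow> Q (- l)" by (intro blinfun.tendsto tendsto_const lim)
  then have "Q (- l) = 0" using x(2) by (simp add: LIMSEQ_const_iff)
  ultimately have "- l = 0" unfolding ran_def by simp
  then show False using n1 by simp
qed

text \<open>On the kernel \<open>(B o\<^sub>L A) - P\<close> acts as minus the identity, and on the
  cokernel the form of \<open>(A o\<^sub>L B) - P\<close> is minus the inner product. An infinite
  orthonormal sequence there would have images at mutual distance at least 1 under a compact
  operator. Closed range follows from the lower bound off the kernel.\<close>

lemma atkinson_sufficient:
  assumes A: "corner P A" and B: "corner P B" and K1: "cpt ((A o\<^sub>L B) - P)" and K2: "cpt ((B o\<^sub>L A) - P)"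
  shows "fred P A"
  unfolding fred_def
proof (intro conjI)
  show ker: "\<exists>v n. onb (kerP P A) v n"
  proof (rule onb_or_infinite[OF csub_kerP[OF A]])
    fix v assume v: "\<And>n. orthonormal v n" "\<And>i. v i \<in> kerP P A"
    have K: "((B o\<^sub>L A) - P) (v i) = - v i" for i
      using v(2)[of i] by (simp add: kerP_def blinfun.diff_left ran_def)
    have "False"
    proof (rule cpt_not_separated[OF K2, of v])
      show "norm (v i) \<le> 1" for i using orthonormal_norm[OF v(1)[of "Suc i"], of i] by simp
      fix i j :: nat assume ij: "i \<noteq> j"
      have nj: "norm (v j) = 1" using orthonormal_norm[OF v(1)[of "Suc j"], of j] by simp
      have "cin (v j - v i) (v j) = 1"
        using orthonormalD[OF v(1)[of "Suc (max i j)"], of j j] orthonormalD[OF v(1)[of "Suc (max i j)"], of i j] ij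
        by (simp add: cin_diff_left)
      then show "1 \<le> norm (((B o\<^sub>L A) - P) (v i) - ((B o\<^sub>L A) - P) (v j))"
        unfolding K using norm_cin_le[of "v j - v i" "v j"] nj by simp
    qed
    then show ?thesis ..
  qed blast
  show "\<exists>v n. onb (cokerP P A) v n"
  proof (rule onb_or_infinite[OF csub_cokerP])
    fix v assume v: "\<And>n. orthonormal v n" "\<And>i. v i \<in> cokerP P A"
    have K: "cin (((A o\<^sub>L B) - P) (v i)) (v j) = - cin (v i) (v j)" for i j
    proof -
      have "cin (A (B (v i))) (v j) = 0" using v(2)[of j] cornerD(6)[OF B] by (simp add: cokerP_def)
      moreover have "P (v i) = v i" using v(2)[of i] by (simp add: cokerP_def ran_def)
      ultimately show ?thesis by (simp add: blinfun.diff_left cin_diff_left)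
    qed
    have "False"
    proof (rule cpt_not_separated[OF K1, of v])
      show "norm (v i) \<le> 1" for i using orthonormal_norm[OF v(1)[of "Suc i"], of i] by simp
      fix i j :: nat assume ij: "i \<noteq> j"
      have nj: "norm (v j) = 1" using orthonormal_norm[OF v(1)[of "Suc j"], of j] by simp
      have "cin (((A o\<^sub>L B) - P) (v i) - ((A o\<^sub>L B) - P) (v j)) (v j) = 1"
        unfolding cin_diff_left K
        using orthonormalD[OF v(1)[of "Suc (max i j)"], of j j] orthonormalD[OF v(1)[of "Suc (max i j)"], of i j] ij
        by simp
      then show "1 \<le> norm (((A o\<^sub>L B) - P) (v i) - ((A o\<^sub>L B) - P) (v j))"
        using norm_cin_le[of "((A o\<^sub>L B) - P) (v i) - ((A o\<^sub>L B) - P) (v j)" "v j"] nj by simp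
    qed
    then show ?thesis ..
  qed blast
  show "closed (blinfun_apply A ` ran P)"
  proof -
    obtain v n where "onb (kerP P A) v n" using ker by blast
    then obtain Q where Q: "cproj Q" "ran Q = kerP P A" using onb_projection[OF csub_kerP[OF A]] by blast
    obtain c where c: "c > 0" "\<And>x. x \<in> ran P \<Longrightarrow> Q x = 0 \<Longrightarrow> c * norm x \<le> norm (A x)"
      using bounded_below_off_kernel[OF A B K2 Q] by blast
    show ?thesis
    proof (rule closed_sequential_limits[THEN iffD2], intro allI impI, elim conjE)
      fix y l assume y: "\<forall>n. y n \<in> blinfun_apply A ` ran P" and l: "y \<longlonglongrightarrow> l"
      have "\<forall>n. \<exists>x. x \<in> ran P \<and> Q x = 0 \<and> A x = y n"
      proof
        fix n
        obtain z where z: "z \<in> ran P" "y n = A z" using y by blast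
        have "Q z \<in> kerP P A" using cprojD(5)[OF Q(1)] Q(2) by blast
        then have "z - Q z \<in> ran P" "A (z - Q z) = y n"
          using z csubD(4)[OF csub_ranP] by (auto simp: kerP_def blinfun.diff_right)
        then show "\<exists>x. x \<in> ran P \<and> Q x = 0 \<and> A x = y n"
          using cprojD(4)[OF Q(1)] by (intro exI[of _ "z - Q z"]) (simp add: blinfun.diff_right)
      qed
      then obtain x where x: "\<And>n. x n \<in> ran P" "\<And>n. Q (x n) = 0" "\<And>n. A (x n) = y n" by metis
      have "Cauchy x"
      proof (rule CauchyI)
        fix \<epsilon> :: real assume e: "0 < \<epsilon>"
        have "Cauchy y" using l LIMSEQ_imp_Cauchy by blast
        then obtain M where M: "\<And>m n. m \<ge> M \<Longrightarrow> n \<ge> M \<Longrightarrow> norm (y m - y n) < c * \<epsilon>"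
          using e c(1) unfolding Cauchy_iff by (meson mult_pos_pos)
        have "norm (x m - x n) < \<epsilon>" if "m \<ge> M" "n \<ge> M" for m n
        proof -
          have "c * norm (x m - x n) \<le> norm (A (x m - x n))"
            by (rule c(2)) (use x csubD(4)[OF csub_ranP] in \<open>auto simp: blinfun.diff_right\<close>)
          also have "\<dots> < c * \<epsilon>" using M[OF that] by (simp add: blinfun.diff_right x(3))
          finally show ?thesis using c(1) by simp
        qed
        then show "\<exists>M. \<forall>m\<ge>M. \<forall>n\<ge>M. norm (x m - x n) < \<epsilon>" by blast
      qed
      then obtain z where z: "x \<longlonglongrightarrow> z" using Cauchy_convergent_iff convergent_def by blast
      have "z \<in> ran P" by (rule closed_sequentially[OF closed_ran _ z]) (use x(1) in auto)
      moreover have "(\<lambda>n. A (x n)) \<longlonglongrightarrow> A z" by (intro blinfun.tendsto tendsto_const z)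
      then have "A z = l" using l LIMSEQ_unique unfolding x(3) by blast
      ultimately show "l \<in> blinfun_apply A ` ran P" by blast
    qed
  qed
qed

lemma range_decomposition:
  assumes A: "corner P A" and cl: "closed (blinfun_apply A ` ran P)" and w: "w \<in> ran P"
  obtains z m where "z \<in> ran P" "m \<in> cokerP P A" "w = A z + m"
proof -
  have "csub (blinfun_apply A ` ran P)"
    unfolding csub_def
  proof (intro conjI ballI allI)
    show "0 \<in> blinfun_apply A ` ran P" by (rule image_eqI[of _ _ 0]) (simp_all add: ran_def)
    fix a assume "a \<in> blinfun_apply A ` ran P"
    then obtain x where x: "x \<in> ran P" "a = A x" by blast
    show "a + b \<in> blinfun_apply A ` ran P" if b: "b \<in> blinfun_apply A ` ran P" for b
    proof -
      obtain y where "y \<in> ran P" "b = A y" using b by blast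
      then show ?thesis using x csubD(2)[OF csub_ranP] by (intro image_eqI[of _ _ "x + y"]) (auto simp: blinfun.add_right)
    qed
    show "cs c a \<in> blinfun_apply A ` ran P" for c
      using x csubD(3)[OF csub_ranP] by (intro image_eqI[of _ _ "cs c x"]) (auto simp: clin_cs cornerD(1)[OF A])
  qed
  then have "subspace (blinfun_apply A ` ran P)" by (rule csub_subspace)
  then obtain r where r: "r \<in> blinfun_apply A ` ran P" "\<And>z. z \<in> blinfun_apply A ` ran P \<Longrightarrow> (w - r) \<bullet> z = 0"
    using orthogonal_projection_exists[OF cl] by metis
  then obtain z where z: "z \<in> ran P" "r = A z" by blast
  have "w - r \<in> ran P" using w r(1) csubD(4)[OF csub_ranP] cornerD(6)[OF A] by auto
  \<comment> \<open>The projection is orthogonal for the real inner product only; invariance of the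
    range under \<open>cs\<close> adds the imaginary part.\<close>
  moreover have "cin (A x) (w - r) = 0" if x: "x \<in> ran P" for x
  proof -
    have "A x \<bullet> (w - r) = 0" using r(2)[of "A x"] x by (simp add: inner_commute)
    moreover have "A x \<bullet> cs \<i> (w - r) = A (cs (cnj \<i>) x) \<bullet> (w - r)"
      by (simp add: inner_cs_right clin_cs[OF cornerD(1)[OF A]])
    moreover have "\<dots> = 0" using r(2)[of "A (cs (cnj \<i>) x)"] csubD(3)[OF csub_ranP x] by (simp add: inner_commute)
    ultimately show ?thesis by (simp add: cin_eq_inner complex_eq_iff)
  qed
  ultimately have "w - r \<in> cokerP P A" by (simp add: cokerP_def)
  then show ?thesis using that[of z "w - r"] z by simp
qed

text \<open>The uniform boundedness principle applied to the functionals \<open>\<langle>w, \<sqdot>\<rangle>\<close> with \<open>w\<close> in the range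
  of \<open>A\<close> and \<open>\<parallel>A\<^sup>* w\<parallel> \<le> 1\<close> replaces the open mapping theorem.\<close>

lemma adj_bounded_below_on_range:
  assumes A: "corner P A" and cl: "closed (blinfun_apply A ` ran P)"
  shows "\<exists>C\<ge>0. \<forall>w\<in>blinfun_apply A ` ran P. norm w \<le> C * norm (adj A w)"
proof -
  define I where "I = {w \<in> blinfun_apply A ` ran P. norm (adj A w) \<le> 1}"
  \<comment> \<open>The value 0 outside \<open>I\<close> lets the family be indexed by all
    vectors.\<close>
  define \<phi> where "\<phi> w = (if w \<in> I then blinfun_inner_right w else 0)" for w
  have "\<exists>C. \<forall>w. norm (\<phi> w x) \<le> C" for x
  proof -
    obtain z m where zm: "z \<in> ran P" "m \<in> cokerP P A" "P x = A z + m"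
      using range_decomposition[OF A cl cprojD(5)[OF P]] by metis
    have "norm (\<phi> w x) \<le> norm z" for w
    proof (cases "w \<in> I")
      case True
      then obtain u where u: "u \<in> ran P" "w = A u" by (auto simp: I_def)
      have "w \<bullet> x = w \<bullet> P x" using cprojD(6)[OF P, of w x] cornerD(4)[OF A, of u] u(2) by simp
      also have "\<dots> = w \<bullet> A z + w \<bullet> m" by (simp add: zm(3) inner_add_right)
      also have "w \<bullet> m = 0" using zm(2) u by (simp add: cokerP_def Re_cin[symmetric])
      also have "w \<bullet> A z = adj A w \<bullet> z" by (simp add: inner_adj')
      finally have "\<bar>w \<bullet> x\<bar> \<le> norm (adj A w) * norm z" using Cauchy_Schwarz_ineq2[of "adj A w" z] by simp
      also have "\<dots> \<le> 1 * norm z" using True by (intro mult_right_mono) (auto simp: I_def)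
      finally show ?thesis using True by (simp add: \<phi>_def blinfun_inner_right.rep_eq)
    qed (simp add: \<phi>_def)
    then show ?thesis by blast
  qed
  then obtain C where C: "\<And>w. norm (\<phi> w) \<le> C" using uniform_boundedness[of \<phi>] by blast
  have C0: "0 \<le> C" using C[of 0] norm_ge_zero order_trans by blast
  have bI: "norm w \<le> C" if w: "w \<in> I" for w
  proof (rule order_trans[OF _ C[of w]])
    have "norm w * norm w = norm (\<phi> w w)"
      using w by (simp add: \<phi>_def blinfun_inner_right.rep_eq power2_norm_eq_inner[symmetric] power2_eq_square)
    also have "\<dots> \<le> norm (\<phi> w) * norm w" by (rule norm_blinfun)
    finally show "norm w \<le> norm (\<phi> w)" by (cases "w = 0") auto
  qed
  have "norm w \<le> C * norm (adj A w)" if w: "w \<in> blinfun_apply A ` ran P" for w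
  proof (rule field_le_epsilon)
    fix \<epsilon> :: real assume \<epsilon>: "0 < \<epsilon>"
    \<comment> \<open>The extra term keeps \<open>t\<close> positive when
      \<open>adj A w = 0\<close>; it costs at most \<open>\<epsilon>\<close> after multiplication by
      \<open>C\<close>.\<close>
    define t where "t = norm (adj A w) + \<epsilon> / (C + 1)"
    have t: "t > 0" using \<epsilon> C0 by (simp add: t_def add_nonneg_pos)
    obtain u where u: "u \<in> ran P" "w = A u" using w by blast
    have "inverse t *\<^sub>R w \<in> blinfun_apply A ` ran P"
      using u by (intro image_eqI[of _ _ "inverse t *\<^sub>R u"]) (auto simp: ran_def blinfun.scaleR_right)
    moreover have "norm (adj A (inverse t *\<^sub>R w)) \<le> 1"
      using t \<epsilon> C0 by (simp add: blinfun.scaleR_right field_simps) (simp add: t_def)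
    ultimately have "norm (inverse t *\<^sub>R w) \<le> C" by (intro bI) (simp add: I_def)
    then have "norm w \<le> C * t" using t by (simp add: field_simps)
    also have "\<dots> = C * norm (adj A w) + C / (C + 1) * \<epsilon>" by (simp add: t_def distrib_left)
    also have "C / (C + 1) * \<epsilon> \<le> 1 * \<epsilon>" using C0 \<epsilon> by (intro mult_right_mono) auto
    finally show "norm w \<le> C * norm (adj A w) + \<epsilon>" by simp
  qed
  then show ?thesis using C0 by blast
qed

text \<open>With \<open>Q\<close> the projection onto the cokernel, \<open>G = A A* + Q\<close> is
  bounded below on \<open>ran P\<close>, and the regularizer is \<open>adj A\<close> times its
  inverse. The inverse is a fixed point in the closed set \<open>T\<close>, so it remains in the
  algebra. From \<open>A B = P - Q\<close> and \<open>Q A = 0\<close> one gets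
  \<open>A (B A - P) = 0\<close>: hence \<open>B A - P\<close> maps into the finite-dimensional
  kernel.\<close>

lemma atkinson_necessary:
  assumes T: "closed T" "\<And>A B. A \<in> T \<Longrightarrow> B \<in> T \<Longrightarrow> A + B \<in> T" "\<And>A B. A \<in> T \<Longrightarrow> B \<in> T \<Longrightarrow> A o\<^sub>L B \<in> T"
      "\<And>c A. A \<in> T \<Longrightarrow> Cs c o\<^sub>L A \<in> T" "P \<in> T" "\<And>A. A \<in> T \<Longrightarrow> adj A \<in> T" "\<And>A. A \<in> T \<Longrightarrow> corner P A"
      "\<And>K. corner P K \<Longrightarrow> cpt K \<Longrightarrow> K \<in> T"
    and A: "A \<in> T" and f: "fred P A"
  shows "\<exists>B\<in>T. cpt ((A o\<^sub>L B) - P) \<and> cpt ((B o\<^sub>L A) - P) \<and> A o\<^sub>L ((B o\<^sub>L A) - P) = 0"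
proof -
  have Ac: "corner P A" by (rule T(7)[OF A])
  have cl: "closed (blinfun_apply A ` ran P)" using f by (simp add: fred_def)
  obtain v n where "onb (cokerP P A) v n" using f by (auto simp: fred_def)
  then obtain Q where Q: "cproj Q" "ran Q = cokerP P A" "cpt Q" using onb_projection[OF csub_cokerP] by blast
  have Qc: "corner P Q" by (rule corner_of_sub[OF P Q(1)]) (auto simp: Q(2) cokerP_def)
  have QT: "Q \<in> T" by (rule T(8)[OF Qc Q(3)])
  have AQ: "adj A (Q x) = 0" for x
    using cprojD(5)[OF Q(1), of x] unfolding Q(2) cokerP_adj[OF Ac] by simp
  have "adj A o\<^sub>L Q = 0" by (rule blinfun_eqI) (simp add: AQ)
  then have "adj (adj A o\<^sub>L Q) = 0" by simp
  then have "Q o\<^sub>L A = 0" by (simp add: adj_compose cprojD(3)[OF Q(1)])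
  then have QA: "Q (A x) = 0" for x by (metis blinfun_apply_blinfun_compose blinfun.zero_left)
  obtain C where C: "0 \<le> C" "\<And>w. w \<in> blinfun_apply A ` ran P \<Longrightarrow> norm w \<le> C * norm (adj A w)"
    using adj_bounded_below_on_range[OF Ac cl] by blast
  define G where "G = (A o\<^sub>L adj A) + Q"
  have Gap: "G x = A (adj A x) + Q x" for x by (simp add: G_def blinfun.add_left)
  have GT: "G \<in> T" unfolding G_def by (intro T(2,3,6) A QT)
  \<comment> \<open>\<open>s\<close> is the quadratic form of \<open>G\<close>. \<open>D\<close>
    will bound the squared norm of \<open>w\<close> in \<open>ran P\<close>, and \<open>E\<close>
    the squared norm of \<open>G w\<close>, in terms of \<open>s w\<close>.\<close>
  define s where "s w = (norm (adj A w))\<^sup>2 + (norm (Q w))\<^sup>2" for w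
  define D where "D = C\<^sup>2 + 1"
  define E where "E = (norm A)\<^sup>2 + 1"
  have D: "D \<ge> 1" and E: "E \<ge> 1" by (simp_all add: D_def E_def)
  have s0: "0 \<le> s w" for w by (simp add: s_def)
  have low: "(norm w)\<^sup>2 \<le> D * s w" if w: "w \<in> ran P" for w
  proof -
    obtain z m where zm: "z \<in> ran P" "m \<in> cokerP P A" "w = A z + m"
      using range_decomposition[OF Ac cl w] by blast
    have "Q m = m" using zm(2) Q(2) by (auto simp: ran_def)
    then have Qw: "Q w = m" by (simp add: zm(3) blinfun.add_right QA)
    have Aw: "adj A w = adj A (A z)" using zm(2) unfolding cokerP_adj[OF Ac] by (simp add: zm(3) blinfun.add_right)
    have "A z \<bullet> m = 0" using zm by (simp add: cokerP_def Re_cin[symmetric])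
    then have "(norm w)\<^sup>2 = (norm (A z))\<^sup>2 + (norm m)\<^sup>2"
      unfolding zm(3) power2_norm_eq_inner by (simp add: inner_simps inner_commute)
    also have "(norm (A z))\<^sup>2 \<le> (C * norm (adj A w))\<^sup>2"
      unfolding Aw by (rule power_mono[OF C(2)]) (use zm(1) in auto)
    finally have "(norm w)\<^sup>2 \<le> C\<^sup>2 * (norm (adj A w))\<^sup>2 + (norm (Q w))\<^sup>2" by (simp add: power_mult_distrib Qw)
    also have "\<dots> \<le> D * (norm (adj A w))\<^sup>2 + D * (norm (Q w))\<^sup>2"
      using D mult_right_mono[of 1 D "(norm (Q w))\<^sup>2"] by (intro add_mono mult_right_mono) (auto simp: D_def)
    finally show ?thesis by (simp add: s_def distrib_left)
  qed
  have Gw: "G w \<bullet> w = s w" for w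
  proof -
    have "A (adj A w) \<bullet> w = (norm (adj A w))\<^sup>2" by (simp add: inner_adj power2_norm_eq_inner)
    moreover have "Q w \<bullet> w = (norm (Q w))\<^sup>2"
      unfolding power2_norm_eq_inner using cprojD(6)[OF Q(1), of "Q w" w] cprojD(4)[OF Q(1)] by simp
    ultimately show ?thesis by (simp add: Gap inner_add_left s_def)
  qed
  have GG: "(norm (G w))\<^sup>2 \<le> E * s w" for w
  proof -
    have "A (adj A w) \<bullet> Q w = 0" using cprojD(6)[OF Q(1), of "A (adj A w)" w] QA by simp
    then have "(norm (G w))\<^sup>2 = (norm (A (adj A w)))\<^sup>2 + (norm (Q w))\<^sup>2"
      unfolding Gap power2_norm_eq_inner by (simp add: inner_simps inner_commute)
    also have "(norm (A (adj A w)))\<^sup>2 \<le> (norm A * norm (adj A w))\<^sup>2" by (rule power_mono[OF norm_blinfun]) simp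
    finally have "(norm (G w))\<^sup>2 \<le> (norm A)\<^sup>2 * (norm (adj A w))\<^sup>2 + (norm (Q w))\<^sup>2" by (simp add: power_mult_distrib)
    also have "\<dots> \<le> E * (norm (adj A w))\<^sup>2 + E * (norm (Q w))\<^sup>2"
      using E mult_right_mono[of 1 E "(norm (Q w))\<^sup>2"] by (intro add_mono mult_right_mono) (auto simp: E_def)
    finally show ?thesis by (simp add: s_def distrib_left)
  qed
  \<comment> \<open>With \<open>t * E = 1\<close> the quadratic term of the squared norm of
    \<open>w - t G w\<close> is at most \<open>t * s w\<close>; one \<open>- t * s w\<close>
    remains, and it is at most \<open>- t / D\<close> times the squared norm of
    \<open>w\<close>.\<close>
  define t where "t = inverse E"
  have t: "t > 0" "t * E = 1" using E by (auto simp: t_def)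
  define q where "q = sqrt (1 - t / D)"
  have tD: "t / D \<le> 1" using D E by (simp add: t_def divide_le_eq inverse_le_1_iff) (meson inverse_le_1_iff order_trans)
  have q: "0 \<le> q" "q < 1" "q\<^sup>2 = 1 - t / D" using tD t(1) D by (auto simp: q_def real_sqrt_less_iff[of _ 1, simplified])
  have contr: "norm ((P - t *\<^sub>R G) x) \<le> q * norm x" for x
  proof -
    define w where "w = P x"
    have w: "w \<in> ran P" unfolding w_def by (rule cprojD(5)[OF P])
    have "(P - t *\<^sub>R G) x = w - t *\<^sub>R G w"
      by (simp add: w_def blinfun.diff_left blinfun.scaleR_left cornerD(5)[OF T(7)[OF GT]])
    moreover have "(norm (w - t *\<^sub>R G w))\<^sup>2 = (norm w)\<^sup>2 - 2 * t * s w + t\<^sup>2 * (norm (G w))\<^sup>2"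
      using norm_add_scaleR_squared[of w "-t" "G w"] Gw[of w] by (simp add: inner_commute)
    moreover have "t\<^sup>2 * (norm (G w))\<^sup>2 \<le> t\<^sup>2 * (E * s w)" by (intro mult_left_mono GG) simp
    moreover have "t\<^sup>2 * (E * s w) = (t * E) * (t * s w)" by (simp add: power2_eq_square)
    moreover have "(norm w)\<^sup>2 / D \<le> s w" using low[OF w] D by (simp add: divide_le_eq mult.commute)
    then have "t * ((norm w)\<^sup>2 / D) \<le> t * s w" using t by (intro mult_left_mono) auto
    ultimately have "(norm ((P - t *\<^sub>R G) x))\<^sup>2 \<le> (norm w)\<^sup>2 - t * ((norm w)\<^sup>2 / D)" using t(2) by simp
    also have "\<dots> = (q * norm w)\<^sup>2" unfolding power_mult_distrib q(3) by (simp add: left_diff_distrib)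
    finally have "norm ((P - t *\<^sub>R G) x) \<le> q * norm w" using q(1) by (simp add: power2_le_iff_abs_le)
    also have "\<dots> \<le> q * norm x" unfolding w_def using q(1) by (intro mult_left_mono cproj_norm_le[OF P])
    finally show ?thesis .
  qed
  have nq: "norm (P - t *\<^sub>R G) \<le> q" by (rule norm_blinfun_bound[OF q(1) contr])
  have scaleT: "r *\<^sub>R X \<in> T" if "X \<in> T" for r X
  proof -
    have "r *\<^sub>R X = Cs (complex_of_real r) o\<^sub>L X" by (rule blinfun_eqI) (simp add: blinfun.scaleR_left scaleR_cs)
    then show ?thesis using T(4)[OF that] by simp
  qed
  \<comment> \<open>On corners this is \<open>X \<mapsto> X - t (G X - P)\<close>, so its fixed
    points are the right inverses of \<open>G\<close>.\<close>
  define f where "f X = ((P - t *\<^sub>R G) o\<^sub>L X) + t *\<^sub>R P" for X :: "ell2 \<Rightarrow>\<^sub>L ell2"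
  have PtG: "P - t *\<^sub>R G \<in> T" using T(2)[OF T(5) scaleT[OF GT, of "- t"]] by simp
  have "\<exists>!X. X \<in> T \<and> f X = X"
  proof (rule Banach_fix)
    show "complete T" using T(1) by (simp add: complete_eq_closed)
    show "T \<noteq> {}" using T(5) by blast
    show "f ` T \<subseteq> T" unfolding f_def using T(2,3) PtG scaleT[OF T(5)] by blast
    show "dist (f X) (f Y) \<le> q * dist X Y" if "X \<in> T" "Y \<in> T" for X Y
    proof -
      have "f X - f Y = (P - t *\<^sub>R G) o\<^sub>L (X - Y)"
        by (rule blinfun_eqI) (simp add: f_def blinfun.add_left blinfun.diff_left blinfun.diff_right)
      then have "norm (f X - f Y) \<le> norm (P - t *\<^sub>R G) * norm (X - Y)" by (simp add: norm_blinfun_compose)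
      also have "\<dots> \<le> q * norm (X - Y)" by (intro mult_right_mono nq) simp
      finally show ?thesis by (simp add: dist_norm)
    qed
  qed (use q in auto)
  then obtain X where X: "X \<in> T" "f X = X" by blast
  have GX: "G (X x) = P x" for x
  proof -
    have "f X x = X x" using X(2) by simp
    then have "X x - t *\<^sub>R G (X x) + t *\<^sub>R P x = X x"
      by (simp add: f_def blinfun.add_left blinfun.diff_left blinfun.scaleR_left cornerD(4)[OF T(7)[OF X(1)]])
    then have "t *\<^sub>R (P x - G (X x)) = 0" by (simp add: scaleR_diff_right)
    then show ?thesis using t(1) by simp
  qed
  define B where "B = adj A o\<^sub>L X"
  have BT: "B \<in> T" unfolding B_def by (intro T(3,6) A X(1))
  \<comment> \<open>Apply \<open>Q\<close> to \<open>G X = P\<close>: since \<open>Q A = 0\<close>,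
    only \<open>Q X\<close> survives. Subtracting it from \<open>G X\<close> leaves
    \<open>A B = P - Q\<close>.\<close>
  have QX: "Q (X x) = Q x" for x
  proof -
    have "Q (G (X x)) = Q (X x)" by (simp add: Gap blinfun.add_right QA cprojD(4)[OF Q(1)])
    then show ?thesis by (simp add: GX cornerD(5)[OF Qc])
  qed
  have AB: "A (B x) = P x - Q x" for x
    using GX[of x] QX[of x] by (simp add: B_def Gap) (metis add_diff_cancel_right')
  have "(A o\<^sub>L B) - P = - Q" by (rule blinfun_eqI) (simp add: AB blinfun.diff_left blinfun.minus_left)
  moreover have "- Q = Cs (-1) o\<^sub>L Q" by (rule blinfun_eqI) (simp add: blinfun.minus_left cs_minus_one)
  moreover have "cpt (Cs (-1) o\<^sub>L Q)"
    unfolding cpt_def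
  proof (intro allI impI)
    fix x :: "nat \<Rightarrow> ell2" assume "\<exists>B. \<forall>n. norm (x n) \<le> B"
    then obtain B where B: "\<And>n. norm (x n) \<le> B" by blast
    obtain r l where r: "strict_mono r" "(\<lambda>n. Q (x (r n))) \<longlonglongrightarrow> l" by (rule cptE[OF Q(3) B])
    have "(\<lambda>n. (Cs (-1) o\<^sub>L Q) (x (r n))) \<longlonglongrightarrow> cs (-1) l" by (simp, intro tendsto_cs r(2))
    then show "\<exists>r. strict_mono r \<and> convergent (\<lambda>n. (Cs (-1) o\<^sub>L Q) (x (r n)))" using r(1) convergent_def by blast
  qed
  ultimately have c1: "cpt ((A o\<^sub>L B) - P)" by simp
  have ABA: "A (((B o\<^sub>L A) - P) x) = 0" for x
    by (simp add: blinfun.diff_left blinfun.diff_right AB cornerD[OF Ac] QA)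
  obtain v' n' where onb: "onb (kerP P A) v' n'" using \<open>fred P A\<close> by (auto simp: fred_def)
  have "((B o\<^sub>L A) - P) x \<in> kerP P A" for x
  proof -
    have "corner P ((B o\<^sub>L A) - P)" by (intro corner_diff corner_compose corner_proj P T(7) BT A)
    then show ?thesis using ABA cornerD(6) by (simp add: kerP_def)
  qed
  then have c2: "cpt ((B o\<^sub>L A) - P)" by (rule cpt_finite_rank[OF onb])
  have "A o\<^sub>L ((B o\<^sub>L A) - P) = 0" by (rule blinfun_eqI) (use ABA in simp)
  then show ?thesis using BT c1 c2 by blast
qed

end

section \<open>Quasidiagonal operators and the algebra of sequences\<close>

lemma null_compose_left:
  fixes X Y :: "nat \<Rightarrow> ell2 \<Rightarrow>\<^sub>L ell2"
  assumes "X \<longlonglongrightarrow> 0" "\<And>n. norm (Y n) \<le> C"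
  shows "(\<lambda>n. X n o\<^sub>L Y n) \<longlonglongrightarrow> 0" "(\<lambda>n. Y n o\<^sub>L X n) \<longlonglongrightarrow> 0"
proof -
  have lim: "(\<lambda>n. norm (X n) * C) \<longlonglongrightarrow> 0"
    using tendsto_mult_right[OF tendsto_norm_zero[OF assms(1)], of C] by simp
  show "(\<lambda>n. X n o\<^sub>L Y n) \<longlonglongrightarrow> 0"
    by (rule Lim_null_comparison[OF _ lim])
      (auto intro!: always_eventually order_trans[OF norm_blinfun_compose] mult_left_mono assms(2))
  show "(\<lambda>n. Y n o\<^sub>L X n) \<longlonglongrightarrow> 0"
    by (rule Lim_null_comparison[OF _ lim])
      (auto intro!: always_eventually order_trans[OF norm_blinfun_compose] simp: mult.commute[of _ C] intro: mult_right_mono assms(2))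
qed

lemma cpt_tens: "cpt (tens x y)"
  unfolding cpt_def
proof (intro allI impI)
  fix z :: "nat \<Rightarrow> ell2" assume "\<exists>B. \<forall>n. norm (z n) \<le> B"
  then obtain B where B: "\<And>n. norm (z n) \<le> B" by blast
  have "cmod (cin (z k) y) \<le> B * norm y" for k
    by (rule order_trans[OF norm_cin_le]) (simp add: B mult_right_mono)
  then obtain r where r: "strict_mono r" "convergent (\<lambda>k. cin (z (r k)) y)"
    using common_convergent_subsequence[of "Suc 0" "\<lambda>k i. cin (z k) y" "B * norm y"] by auto
  then obtain l where l: "(\<lambda>k. cin (z (r k)) y) \<longlonglongrightarrow> l" by (auto simp: convergent_def)
  have bl: "bounded_linear (\<lambda>c. cs c x)"
    by (rule bounded_linear_intro[where K = "norm x"]) (simp_all add: cs_add_left scaleR_cs scaleR_conv_of_real)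
  have "(\<lambda>k. tens x y (z (r k))) \<longlonglongrightarrow> cs l x"
    unfolding tens_apply by (rule bounded_linear.tendsto[OF bl l])
  then show "\<exists>r. strict_mono r \<and> convergent (\<lambda>n. tens x y (z (r n)))" using r(1) convergent_def by blast
qed

lemma cpt_zero: "cpt 0"
  unfolding cpt_def by (auto intro!: exI[of _ id] simp: convergent_const strict_mono_def)

lemma corner_tens: "cproj P \<Longrightarrow> P x = x \<Longrightarrow> P y = y \<Longrightarrow> corner P (tens x y)"
  by (rule cornerI) (simp_all add: clin_cs[OF cprojD(1)] cprojD(7))

lemma closed_corner: "closed {A. corner P A}"
proof (rule closed_sequential_limits[THEN iffD2], intro allI impI, elim conjE)
  fix A B assume A: "\<forall>n. A n \<in> {A. corner P A}" and lim: "A \<longlonglongrightarrow> B"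
  have *: "(\<lambda>n. A n y) \<longlonglongrightarrow> B y" for y by (intro blinfun.tendsto lim tendsto_const)
  have "corner P B"
  proof (rule cornerI)
    show "clin B" by (rule clin_limit[OF _ lim]) (use A cornerD in auto)
    fix x
    have "(\<lambda>n. P (A n x)) \<longlonglongrightarrow> P (B x)" by (intro blinfun.tendsto tendsto_const *)
    then have "(\<lambda>n. A n x) \<longlonglongrightarrow> P (B x)" using A cornerD(4) by auto
    then show "P (B x) = B x" using * LIMSEQ_unique by blast
    have "(\<lambda>n. A n (P x)) \<longlonglongrightarrow> B (P x)" by (rule *)
    then have "(\<lambda>n. A n x) \<longlonglongrightarrow> B (P x)" using A cornerD(5) by auto
    then show "B (P x) = B x" using * LIMSEQ_unique by blast
  qed
  then show "B \<in> {A. corner P A}" by simp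
qed

lemma l2conv_closed_iff:
  "(\<forall>x y. (\<forall>n. x n \<in> seq ` T) \<and> l2conv x y \<longrightarrow> y \<in> seq ` T) \<longleftrightarrow> closed T"
proof
  assume L: "\<forall>x y. (\<forall>n. x n \<in> seq ` T) \<and> l2conv x y \<longrightarrow> y \<in> seq ` T"
  show "closed T"
  proof (rule closed_sequential_limits[THEN iffD2], intro allI impI, elim conjE)
    fix x l assume x: "\<forall>n. x n \<in> T" "x \<longlonglongrightarrow> l"
    have "l2conv (\<lambda>n. seq (x n)) (seq l)" using x(2) by (simp add: l2conv_seq)
    then have "seq l \<in> seq ` T" using L[rule_format, of "\<lambda>n. seq (x n)" "seq l"] x(1) by blast
    then show "l \<in> T" by (auto simp: seq_inject)
  qed
next
  assume cl: "closed T"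
  show "\<forall>x y. (\<forall>n. x n \<in> seq ` T) \<and> l2conv x y \<longrightarrow> y \<in> seq ` T"
  proof (intro allI impI, elim conjE)
    fix x y assume x: "\<forall>n. x n \<in> seq ` T" and c: "l2conv x y"
    have "\<forall>n. \<exists>z. z \<in> T \<and> x n = seq z" using x by blast
    then obtain z where z: "\<And>n. z n \<in> T" "\<And>n. x n = seq (z n)" by metis
    have y: "y = seq (Ell2 y)" using c by (simp add: l2conv_def)
    have "x = (\<lambda>n. seq (z n))" using z(2) by blast
    moreover have "l2conv x (seq (Ell2 y))" using c y by metis
    ultimately have "l2conv (\<lambda>n. seq (z n)) (seq (Ell2 y))" by simp
    then have "z \<longlonglongrightarrow> Ell2 y" by (simp only: l2conv_seq)
    then have "Ell2 y \<in> T" using closed_sequentially[OF cl] z(1) by blast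
    then show "y \<in> seq ` T" using y by blast
  qed
qed

context blaschke
begin

section \<open>Operator sequences represented by their extensions by 0\<close>

definition bops :: "opseq \<Rightarrow> bool" where
  "bops As \<longleftrightarrow> (\<forall>n. is_bop (K2 (bpartial lam n)) (As n))"

definition OP :: "opseq \<Rightarrow> nat \<Rightarrow> ell2 \<Rightarrow>\<^sub>L ell2" where
  "OP As n = ofop (Pn n) (As n)"

lemma corner_OP: "bops As \<Longrightarrow> corner (Pn n) (OP As n)"
  unfolding OP_def bops_def corner_def
  using clin_ofop[OF cproj_Pn K2_n] ofop_corner[OF cproj_Pn K2_n] by blast

lemma OP_apply: "bops As \<Longrightarrow> As n (seq (Pn n x)) = seq (OP As n x)"
  unfolding OP_def bops_def using ofop_apply(1)[OF cproj_Pn K2_n] by metis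

lemma OP_apply': "bops As \<Longrightarrow> Pn n x = x \<Longrightarrow> As n (seq x) = seq (OP As n x)"
  using OP_apply[of As n x] by simp

text \<open>Recognises the extensions of a sequence from candidates \<open>B n\<close>; the
  algebraic operations on sequences are all transferred in this way.\<close>

lemma bopsI:
  assumes "\<And>n. corner (Pn n) (B n)" "\<And>n x. Pn n x = x \<Longrightarrow> As n (seq x) = seq (B n x)"
  shows "bops As" "OP As n = B n"
proof -
  have bop: "is_bop (K2 (bpartial lam n)) (As n)" for n
  proof (rule is_bop_toop[OF cproj_Pn K2_n, of "B n"])
    fix f assume "f \<in> K2 (bpartial lam n)"
    then obtain x where x: "f = seq x" "Pn n x = x" by (auto simp: K2_n ran_def)
    then show "As n f = toop (B n) f" using assms(2) by simp
  qed (use cornerD[OF assms(1)] in auto)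
  then show "bops As" by (simp add: bops_def)
  show "OP As n = B n" unfolding OP_def
    by (rule ofop_eqI[OF cproj_Pn K2_n bop cornerD(3)[OF assms(1)] assms(2)])
qed

lemma OP_sadd:
  assumes "bops As" "bops Bs" shows "bops (sadd As Bs)" "OP (sadd As Bs) n = OP As n + OP Bs n"
  using bopsI[of "\<lambda>n. OP As n + OP Bs n" "sadd As Bs"] assms
  by (auto simp: corner_add corner_OP sadd_def OP_apply' blinfun.add_left)

lemma OP_sminus:
  assumes "bops As" "bops Bs" shows "bops (sminus As Bs)" "OP (sminus As Bs) n = OP As n - OP Bs n"
  using bopsI[of "\<lambda>n. OP As n - OP Bs n" "sminus As Bs"] assms
  by (auto simp: corner_diff corner_OP sminus_def OP_apply' blinfun.diff_left)

lemma OP_scomp: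
  assumes "bops As" "bops Bs" shows "bops (scomp As Bs)" "OP (scomp As Bs) n = OP As n o\<^sub>L OP Bs n"
  using bopsI[of "\<lambda>n. OP As n o\<^sub>L OP Bs n" "scomp As Bs"] assms
  by (auto simp: corner_compose corner_OP scomp_def OP_apply' cornerD(4)[OF corner_OP])

lemma OP_ssmult:
  assumes "bops As" shows "bops (ssmult c As)" "OP (ssmult c As) n = Cs c o\<^sub>L OP As n"
  using bopsI[of "\<lambda>n. Cs c o\<^sub>L OP As n" "ssmult c As"] assms
  by (auto simp: corner_Cs cproj_Pn corner_OP ssmult_def OP_apply')

lemma OP_sid: "bops sid" "OP sid n = Pn n"
  using bopsI[of Pn sid] by (auto simp: corner_proj cproj_Pn sid_def)

lemma OP_toop:
  assumes "\<And>n. corner (Pn n) (G n)" shows "bops (\<lambda>n. toop (G n))" "OP (\<lambda>n. toop (G n)) n = G n"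
  using bopsI[of G "\<lambda>n. toop (G n)"] assms by auto

lemma seqdist_OP:
  assumes "bops As" "bops Bs" shows "seqdist lam As Bs = (SUP n. norm (OP As n - OP Bs n))"
proof -
  have "opnorm (K2 (bpartial lam n)) (\<lambda>x. As n x - Bs n x) = norm (OP As n - OP Bs n)" for n
  proof -
    have "is_bop (K2 (bpartial lam n)) (sminus As Bs n)" using OP_sminus(1)[OF assms] by (simp add: bops_def)
    from opnorm_ofop[OF cproj_Pn K2_n this]
    have "opnorm (K2 (bpartial lam n)) (sminus As Bs n) = norm (OP (sminus As Bs) n)" by (simp add: OP_def)
    then show ?thesis unfolding OP_sminus(2)[OF assms] by (simp add: sminus_def)
  qed
  then show ?thesis by (simp add: seqdist_def)
qed

section \<open>Compressions, commutators with the projections, and quasidiagonal operators\<close>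

definition compr :: "(ell2 \<Rightarrow>\<^sub>L ell2) \<Rightarrow> nat \<Rightarrow> ell2 \<Rightarrow>\<^sub>L ell2" where
  "compr A n = Pn n o\<^sub>L (A o\<^sub>L Pn n)"

lemma compr_apply [simp]: "compr A n x = Pn n (A (Pn n x))"
  by (simp add: compr_def)

lemma corner_comp: "clin A \<Longrightarrow> corner (Pn n) (compr A n)"
  by (rule cornerI) (simp_all add: cprojD[OF cproj_Pn] compr_def clin_compose)

lemma compr_add: "compr (A + B) n = compr A n + compr B n"
  by (rule blinfun_eqI) (simp add: blinfun.add_left blinfun.add_right)

lemma compr_diff: "compr (A - B) n = compr A n - compr B n"
  by (rule blinfun_eqI) (simp add: blinfun.diff_left blinfun.diff_right)

lemma compr_Cs: "compr (Cs c o\<^sub>L A) n = Cs c o\<^sub>L compr A n"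
  by (rule blinfun_eqI) (simp add: clin_cs[OF cprojD(1)[OF cproj_Pn]])

lemma compr_Pu: "compr Pu n = Pn n"
  by (rule blinfun_eqI) (simp add: Pn_Pu cprojD(4)[OF cproj_Pn])

lemma compr_zero [simp]: "compr 0 n = 0"
  by (rule blinfun_eqI) simp

lemma adj_comp: "adj (compr A n) = compr (adj A) n"
  by (simp add: compr_def adj_compose cprojD(3)[OF cproj_Pn] blinfun_compose_assoc)

lemma norm_comp: "norm (compr A n) \<le> norm A"
proof (rule norm_blinfun_bound)
  fix x
  have "norm (compr A n x) \<le> norm (A (Pn n x))" by (simp add: cproj_norm_le[OF cproj_Pn])
  also have "\<dots> \<le> norm A * norm (Pn n x)" by (rule norm_blinfun)
  also have "\<dots> \<le> norm A * norm x" by (intro mult_left_mono cproj_norm_le[OF cproj_Pn]) auto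
  finally show "norm (compr A n x) \<le> norm A * norm x" .
qed simp

definition cm :: "(ell2 \<Rightarrow>\<^sub>L ell2) \<Rightarrow> nat \<Rightarrow> ell2 \<Rightarrow>\<^sub>L ell2" where
  "cm A n = (A o\<^sub>L Pn n) - (Pn n o\<^sub>L A)"

lemma cm_apply: "cm A n x = A (Pn n x) - Pn n (A x)"
  by (simp add: cm_def blinfun.diff_left)

lemma norm_cm: "norm (cm A n) \<le> 2 * norm A"
proof (rule norm_blinfun_bound)
  fix x
  have "norm (A (Pn n x)) \<le> norm A * norm (Pn n x)" by (rule norm_blinfun)
  also have "\<dots> \<le> norm A * norm x" by (intro mult_left_mono cproj_norm_le[OF cproj_Pn]) auto
  finally have "norm (A (Pn n x)) \<le> norm A * norm x" .
  moreover have "norm (Pn n (A x)) \<le> norm A * norm x"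
    by (rule order_trans[OF cproj_norm_le[OF cproj_Pn] norm_blinfun])
  ultimately show "norm (cm A n x) \<le> 2 * norm A * norm x"
    unfolding cm_apply using norm_triangle_ineq4[of "A (Pn n x)" "Pn n (A x)"] by linarith
qed simp

definition QD :: "(ell2 \<Rightarrow>\<^sub>L ell2) set" where
  "QD = {A. corner Pu A \<and> cm A \<longlonglongrightarrow> 0}"

lemma QD_add: assumes "A \<in> QD" "B \<in> QD" shows "A + B \<in> QD"
proof -
  have "cm (A + B) n = cm A n + cm B n" for n
    by (rule blinfun_eqI) (simp add: cm_apply blinfun.add_left blinfun.add_right)
  then have "cm (A + B) = (\<lambda>n. cm A n + cm B n)" by blast
  then show ?thesis using assms tendsto_add[of "cm A" 0 sequentially "cm B" 0] by (simp add: QD_def corner_add)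
qed

lemma QD_compose: assumes "A \<in> QD" "B \<in> QD" shows "A o\<^sub>L B \<in> QD"
proof -
  have "cm (A o\<^sub>L B) n = (A o\<^sub>L cm B n) + (cm A n o\<^sub>L B)" for n
    by (rule blinfun_eqI) (simp add: cm_apply blinfun.add_left blinfun.diff_right)
  then have eq: "cm (A o\<^sub>L B) = (\<lambda>n. (A o\<^sub>L cm B n) + (cm A n o\<^sub>L B))" by blast
  have "(\<lambda>n. (A o\<^sub>L cm B n) + (cm A n o\<^sub>L B)) \<longlonglongrightarrow> 0 + 0"
    by (intro tendsto_add null_compose_left[where C = "norm A"] null_compose_left[where C = "norm B"])
      (use assms in \<open>auto simp: QD_def\<close>)
  then show ?thesis using assms by (simp add: QD_def eq corner_compose)
qed

lemma QD_Cs: assumes "A \<in> QD" shows "Cs c o\<^sub>L A \<in> QD"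
proof -
  have "cm (Cs c o\<^sub>L A) n = Cs c o\<^sub>L cm A n" for n
    by (rule blinfun_eqI) (simp add: cm_apply clin_cs[OF cprojD(1)[OF cproj_Pn]] cs_diff_right)
  then have "cm (Cs c o\<^sub>L A) = (\<lambda>n. Cs c o\<^sub>L cm A n)" by blast
  moreover have "(\<lambda>n. Cs c o\<^sub>L cm A n) \<longlonglongrightarrow> 0"
    by (rule null_compose_left(2)[where C = "norm (Cs c)"]) (use assms in \<open>auto simp: QD_def\<close>)
  ultimately show ?thesis using assms by (simp add: QD_def corner_Cs cproj_Pu)
qed

lemma QD_adj: assumes "A \<in> QD" shows "adj A \<in> QD"
proof -
  have "cm (adj A) n = - adj (cm A n)" for n
    by (simp add: cm_def adj_diff adj_compose cprojD(3)[OF cproj_Pn])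
  then have eq: "cm (adj A) = (\<lambda>n. - adj (cm A n))" by blast
  have "(\<lambda>n. - adj (cm A n)) \<longlonglongrightarrow> - adj 0"
    by (intro tendsto_minus tendsto_adj) (use assms in \<open>simp add: QD_def\<close>)
  then show ?thesis using assms by (simp add: QD_def eq corner_adj cproj_Pu)
qed

lemma QD_closed: "closed QD"
proof (rule closed_sequential_limits[THEN iffD2], intro allI impI, elim conjE)
  fix A B assume A: "\<forall>j. A j \<in> QD" and lim: "A \<longlonglongrightarrow> B"
  have "B \<in> {A. corner Pu A}"
    by (rule closed_sequentially[OF closed_corner _ lim]) (use A in \<open>simp add: QD_def\<close>)
  moreover have "cm B \<longlonglongrightarrow> 0"
  proof (rule LIMSEQ_I)
    fix \<epsilon> :: real assume e: "0 < \<epsilon>"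
    obtain j where j: "norm (A j - B) < \<epsilon> / 4" using LIMSEQ_D[OF lim, of "\<epsilon> / 4"] e by auto
    have "cm (A j) \<longlonglongrightarrow> 0" using A by (simp add: QD_def)
    then obtain N where N: "\<And>n. n \<ge> N \<Longrightarrow> norm (cm (A j) n) < \<epsilon> / 2" using LIMSEQ_D[of _ 0 "\<epsilon> / 2"] e by force
    have "norm (cm B n - 0) < \<epsilon>" if "n \<ge> N" for n
    proof -
      have "cm B n = cm (A j) n - cm (A j - B) n"
        by (rule blinfun_eqI) (simp add: cm_apply blinfun.diff_left blinfun.diff_right)
      then have "norm (cm B n) \<le> norm (cm (A j) n) + norm (cm (A j - B) n)" by (simp add: norm_triangle_ineq4)
      then show ?thesis using N[OF that] j norm_cm[of "A j - B" n] by simp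
    qed
    then show "\<exists>N. \<forall>n\<ge>N. norm (cm B n - 0) < \<epsilon>" by blast
  qed
  ultimately show "B \<in> QD" by (simp add: QD_def)
qed

lemma QD_Pu: "Pu \<in> QD"
proof -
  have "cm Pu n = 0" for n by (rule blinfun_eqI) (simp add: cm_apply Pn_Pu)
  then have "cm Pu = (\<lambda>n. 0)" by blast
  then show ?thesis by (simp add: QD_def corner_proj cproj_Pu)
qed

lemma corner_S: "corner Pu S"
  unfolding S_def
  by (rule cornerI) (simp_all add: cprojD[OF cproj_Pu] clin_compose)

text \<open>The adjoint of \<open>adj_S_Pn\<close> says that \<open>Pn n\<close> may be inserted to
  the right of \<open>S\<close> in \<open>Pn n o\<^sub>L S\<close>, so the commutator is precisely
  the defect estimated in \<open>S_Pn_defect\<close>.\<close>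

lemma QD_S: "S \<in> QD"
proof -
  have "Pn n o\<^sub>L (adj S o\<^sub>L Pn n) = adj S o\<^sub>L Pn n" for n
    by (rule blinfun_eqI) (simp add: adj_S_Pn)
  then have "adj (Pn n o\<^sub>L (adj S o\<^sub>L Pn n)) = adj (adj S o\<^sub>L Pn n)" for n by simp
  then have "(Pn n o\<^sub>L S) o\<^sub>L Pn n = Pn n o\<^sub>L S" for n
    by (simp add: adj_compose cprojD(3)[OF cproj_Pn])
  then have PS: "Pn n (S (Pn n x)) = Pn n (S x)" for n x by (metis blinfun_apply_blinfun_compose)
  have "norm (cm S n) \<le> norm (Pu (V n (ebas 0)))" for n
    by (rule norm_blinfun_bound) (use S_Pn_defect[of n] in \<open>simp_all add: cm_apply PS\<close>)
  then have "cm S \<longlonglongrightarrow> 0"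
    by (intro Lim_null_comparison[OF _ Pu_V_ebas0_limit]) simp
  then show ?thesis by (simp add: QD_def corner_S)
qed

text \<open>Strong convergence of contractions is uniform on relatively compact sets. Otherwise
  vectors \<open>x N\<close> of norm at most 1 keep a gap of \<open>\<epsilon> / 2\<close> at
  indices \<open>m N \<ge> N\<close>; along a convergent subsequence of their images the gap would
  persist at the limit \<open>l\<close>, although \<open>Pu l = l\<close>.\<close>

lemma compact_left_null:
  assumes K: "corner Pu K" "cpt K" shows "(\<lambda>n. K - (Pn n o\<^sub>L K)) \<longlonglongrightarrow> 0"
proof (rule ccontr)
  assume "\<not> ?thesis"
  then obtain \<epsilon> where e: "\<epsilon> > 0" "\<And>N. \<exists>n\<ge>N. norm (K - (Pn n o\<^sub>L K)) \<ge> \<epsilon>"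
    unfolding LIMSEQ_iff by (auto simp: not_less)
  have "\<exists>n\<ge>N. \<exists>x. norm x \<le> 1 \<and> norm (K x - Pn n (K x)) \<ge> \<epsilon> / 2" for N
  proof -
    obtain n where n: "n \<ge> N" "norm (K - (Pn n o\<^sub>L K)) \<ge> \<epsilon>" using e(2) by blast
    have "\<exists>x. norm ((K - (Pn n o\<^sub>L K)) x) > (\<epsilon> / 2) * norm x"
    proof (rule ccontr)
      assume "\<not> ?thesis"
      then have "norm (K - (Pn n o\<^sub>L K)) \<le> \<epsilon> / 2" using e(1) by (intro norm_blinfun_bound) (auto simp: not_less)
      then show False using n(2) e(1) by linarith
    qed
    then obtain x where x: "norm ((K - (Pn n o\<^sub>L K)) x) > (\<epsilon> / 2) * norm x" by blast
    then have x0: "norm x > 0" by auto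
    let ?y = "inverse (norm x) *\<^sub>R x"
    have "norm ((K - (Pn n o\<^sub>L K)) ?y) \<ge> \<epsilon> / 2"
      using x x0 by (simp add: blinfun.scaleR_right field_simps)
    moreover have "norm ?y \<le> 1" using x0 by simp
    ultimately show ?thesis using n(1) by (intro exI[of _ n] conjI exI[of _ ?y]) (simp_all add: blinfun.diff_left)
  qed
  then obtain m x where mx: "\<And>N. m N \<ge> N" "\<And>N. norm (x N) \<le> 1" "\<And>N::nat. norm (K (x N) - Pn (m N) (K (x N))) \<ge> \<epsilon> / 2"
    by metis
  obtain r l where r: "strict_mono r" "(\<lambda>N. K (x (r N))) \<longlonglongrightarrow> l" by (rule cptE[OF K(2) mx(2)])
  have Pul: "Pu l = l"
  proof -
    have "(\<lambda>N. Pu (K (x (r N)))) \<longlonglongrightarrow> Pu l" by (intro blinfun.tendsto tendsto_const r(2))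
    then have "(\<lambda>N. K (x (r N))) \<longlonglongrightarrow> Pu l" by (simp add: cornerD(4)[OF K(1)])
    then show ?thesis using r(2) LIMSEQ_unique by blast
  qed
  have fl: "filterlim (\<lambda>N. m (r N)) at_top sequentially"
    using order_trans[OF seq_suble[OF r(1)] mx(1)] by (intro filterlim_at_top_mono[OF filterlim_ident]) auto
  have PP: "(\<lambda>N. Pn (m (r N)) y) \<longlonglongrightarrow> Pu y" for y
    by (rule filterlim_compose[OF Pn_limit fl])
  have "(\<lambda>N. Pn (m (r N)) (K (x (r N)))) \<longlonglongrightarrow> Pu l"
    by (rule strong_compose[OF PP cproj_norm_le[OF cproj_Pn] r(2)])
  then have "(\<lambda>N. norm (K (x (r N)) - Pn (m (r N)) (K (x (r N))))) \<longlonglongrightarrow> norm (l - Pu l)"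
    by (intro tendsto_norm tendsto_diff r(2))
  then have "\<epsilon> / 2 \<le> norm (l - Pu l)" by (rule LIMSEQ_le_const) (use mx(3) in auto)
  then show False using Pul e(1) by simp
qed

lemma QD_compact: assumes K: "corner Pu K" "cpt K" shows "K \<in> QD"
proof -
  have 1: "(\<lambda>n. K - (Pn n o\<^sub>L K)) \<longlonglongrightarrow> 0" by (rule compact_left_null[OF K])
  have "(\<lambda>n. adj (adj K - (Pn n o\<^sub>L adj K))) \<longlonglongrightarrow> adj 0"
    by (intro tendsto_adj compact_left_null corner_adj cproj_Pu K cpt_adj)
  then have 2: "(\<lambda>n. K - (K o\<^sub>L Pn n)) \<longlonglongrightarrow> 0" by (simp add: adj_diff adj_compose cprojD(3)[OF cproj_Pn])
  have "cm K n = (K - (Pn n o\<^sub>L K)) - (K - (K o\<^sub>L Pn n))" for n by (simp add: cm_def)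
  then have "cm K = (\<lambda>n. (K - (Pn n o\<^sub>L K)) - (K - (K o\<^sub>L Pn n)))" by blast
  then have "cm K \<longlonglongrightarrow> 0 - 0" using tendsto_diff[OF 1 2] by simp
  then show ?thesis using K(1) by (simp add: QD_def)
qed

lemma QD_Top: "ccont a \<Longrightarrow> Top a \<in> QD"
  by (rule Top_in_closed_algebra[OF QD_closed QD_add QD_compose QD_Cs QD_Pu QD_S QD_adj[OF QD_S]])

text \<open>The defect of multiplicativity is the commutator of \<open>B\<close> with
  \<open>Pn n\<close>, multiplied from the left by \<open>- (Pn n o\<^sub>L A)\<close> and from the
  right by \<open>Pn n\<close>.\<close>

lemma compr_mult_null: assumes "B \<in> QD" shows "(\<lambda>n. (compr A n o\<^sub>L compr B n) - compr (A o\<^sub>L B) n) \<longlonglongrightarrow> 0"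
proof -
  have eq: "(compr A n o\<^sub>L compr B n) - compr (A o\<^sub>L B) n = ((- (Pn n o\<^sub>L A)) o\<^sub>L cm B n) o\<^sub>L Pn n" for n
    by (rule blinfun_eqI)
      (simp add: blinfun.diff_left blinfun.diff_right blinfun.minus_left cm_apply cprojD(4)[OF cproj_Pn])
  have nP: "norm (Pn n) \<le> 1" for n by (rule cproj_norm[OF cproj_Pn])
  have nA: "norm (- (Pn n o\<^sub>L A)) \<le> norm A" for n
    using order_trans[OF norm_blinfun_compose mult_right_mono[OF nP norm_ge_zero]] by simp
  show ?thesis unfolding eq
    by (rule null_compose_left(1)[OF null_compose_left(2)[OF _ nA] nP]) (use assms in \<open>simp add: QD_def\<close>)
qed

section \<open>Sequences asymptotic to the compressions of one operator\<close>

definition rel :: "opseq \<Rightarrow> (ell2 \<Rightarrow>\<^sub>L ell2) \<Rightarrow> bool" where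
  "rel As A \<longleftrightarrow> A \<in> QD \<and> bops As \<and> (\<lambda>n. OP As n - compr A n) \<longlonglongrightarrow> 0"

lemma strong_of_comp:
  assumes "(\<lambda>n. G n - compr A n) \<longlonglongrightarrow> 0" "corner Pu A" shows "(\<lambda>n. G n x) \<longlonglongrightarrow> A x"
proof -
  have "(\<lambda>n. Pn n (A (Pn n x))) \<longlonglongrightarrow> Pu (A (Pu x))"
    by (intro strong_compose[OF Pn_limit cproj_norm_le[OF cproj_Pn]] blinfun.tendsto tendsto_const Pn_limit)
  then have "(\<lambda>n. compr A n x) \<longlonglongrightarrow> A x" by (simp add: cornerD[OF assms(2)])
  moreover have "(\<lambda>n. (G n - compr A n) x) \<longlonglongrightarrow> blinfun_apply 0 x" by (intro blinfun.tendsto tendsto_const assms(1))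
  ultimately have "(\<lambda>n. (G n - compr A n) x + compr A n x) \<longlonglongrightarrow> blinfun_apply 0 x + A x" by (intro tendsto_add)
  then show ?thesis by (simp add: blinfun.diff_left)
qed

lemma QD_corner: "A \<in> QD \<Longrightarrow> corner Pu A"
  by (simp add: QD_def)

text \<open>\<open>A\<close> is recovered as a strong limit, so it is unique. Being also compatible
  with sums and products, \<open>rel\<close> is the graph of a homomorphism from sequences to
  operators.\<close>

lemma rel_strong: "rel As A \<Longrightarrow> (\<lambda>n. OP As n x) \<longlonglongrightarrow> A x"
  using strong_of_comp QD_corner by (auto simp: rel_def)

lemma rel_unique: "rel As A \<Longrightarrow> rel As B \<Longrightarrow> A = B"
  using rel_strong LIMSEQ_unique by (intro blinfun_eqI) blast

lemma rel_add: assumes "rel As A" "rel Bs B" shows "rel (sadd As Bs) (A + B)"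
proof -
  have b: "bops As" "bops Bs" using assms by (auto simp: rel_def)
  have eq: "OP (sadd As Bs) n - compr (A + B) n = (OP As n - compr A n) + (OP Bs n - compr B n)" for n
    by (simp add: OP_sadd[OF b] compr_add)
  have "(\<lambda>n. (OP As n - compr A n) + (OP Bs n - compr B n)) \<longlonglongrightarrow> 0 + 0"
    by (rule tendsto_add) (use assms in \<open>simp_all add: rel_def\<close>)
  then show ?thesis using assms OP_sadd(1)[OF b] unfolding rel_def eq by (simp add: QD_add)
qed

lemma rel_Cs: assumes "rel As A" shows "rel (ssmult c As) (Cs c o\<^sub>L A)"
proof -
  have b: "bops As" using assms by (auto simp: rel_def)
  have eq: "OP (ssmult c As) n - compr (Cs c o\<^sub>L A) n = Cs c o\<^sub>L (OP As n - compr A n)" for n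
    by (rule blinfun_eqI) (simp add: OP_ssmult[OF b] compr_Cs blinfun.diff_left cs_diff_right del: compr_apply)
  have "(\<lambda>n. Cs c o\<^sub>L (OP As n - compr A n)) \<longlonglongrightarrow> 0"
    by (rule null_compose_left(2)[where C = "norm (Cs c)"]) (use assms in \<open>auto simp: rel_def\<close>)
  then show ?thesis using assms OP_ssmult[OF b] unfolding rel_def eq by (simp add: QD_Cs)
qed

lemma rel_compose: assumes "rel As A" "rel Bs B" shows "rel (scomp As Bs) (A o\<^sub>L B)"
proof -
  have b: "bops As" "bops Bs" using assms by (auto simp: rel_def)
  define X where "X n = OP As n - compr A n" for n
  define Y where "Y n = OP Bs n - compr B n" for n
  have X: "X \<longlonglongrightarrow> 0" and Y: "Y \<longlonglongrightarrow> 0" using assms by (simp_all add: X_def[abs_def] Y_def[abs_def] rel_def)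
  have eq: "OP (scomp As Bs) n - compr (A o\<^sub>L B) n = (X n o\<^sub>L Y n) + (X n o\<^sub>L compr B n) + (compr A n o\<^sub>L Y n) + ((compr A n o\<^sub>L compr B n) - compr (A o\<^sub>L B) n)" for n
    by (rule blinfun_eqI)
      (simp add: OP_scomp[OF b] X_def Y_def blinfun.diff_left blinfun.diff_right blinfun.add_left del: compr_apply)
  have 1: "(\<lambda>n. X n o\<^sub>L Y n) \<longlonglongrightarrow> 0"
    using bounded_bilinear.tendsto[OF bounded_bilinear_blinfun_compose X Y] by simp
  have "(\<lambda>n. (X n o\<^sub>L Y n) + (X n o\<^sub>L compr B n) + (compr A n o\<^sub>L Y n) + ((compr A n o\<^sub>L compr B n) - compr (A o\<^sub>L B) n)) \<longlonglongrightarrow> 0 + 0 + 0 + 0"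
    by (intro tendsto_add 1 null_compose_left(1)[OF X norm_comp] null_compose_left(2)[OF Y norm_comp] compr_mult_null)
      (use assms in \<open>simp add: rel_def\<close>)
  then show ?thesis using assms OP_scomp[OF b] unfolding rel_def eq by (simp add: QD_compose)
qed

lemma rel_minus: assumes "rel As A" "rel Bs B" shows "rel (sminus As Bs) (A - B)"
proof -
  have b: "bops As" "bops Bs" using assms by (auto simp: rel_def)
  have AB: "A - B = A + (Cs (-1) o\<^sub>L B)"
    by (rule blinfun_eqI) (simp add: blinfun.add_left blinfun.diff_left cs_minus_one)
  have q: "A - B \<in> QD" unfolding AB by (intro QD_add QD_Cs) (use assms in \<open>auto simp: rel_def\<close>)
  have eq: "OP (sminus As Bs) n - compr (A - B) n = (OP As n - compr A n) - (OP Bs n - compr B n)" for n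
    by (simp add: OP_sminus[OF b] compr_diff)
  have "(\<lambda>n. (OP As n - compr A n) - (OP Bs n - compr B n)) \<longlonglongrightarrow> 0 - 0"
    by (rule tendsto_diff) (use assms in \<open>simp_all add: rel_def\<close>)
  then show ?thesis using q OP_sminus(1)[OF b] unfolding rel_def eq by simp
qed

lemma rel_sid: "rel sid Pu"
  by (simp add: rel_def QD_Pu OP_sid compr_Pu)

lemma rel_Fseq: assumes "rel As A" shows "As \<in> Fseq lam"
proof -
  have b: "bops As" and A: "corner Pu A" using assms QD_corner by (auto simp: rel_def)
  have adj: "(\<lambda>n. adj (OP As n) x) \<longlonglongrightarrow> adj A x" for x
  proof (rule strong_of_comp)
    have "(\<lambda>n. adj (OP As n - compr A n)) \<longlonglongrightarrow> adj 0" by (rule tendsto_adj) (use assms in \<open>simp add: rel_def\<close>)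
    then show "(\<lambda>n. adj (OP As n) - compr (adj A) n) \<longlonglongrightarrow> 0" by (simp add: adj_diff adj_comp)
    show "corner Pu (adj A)" by (rule corner_adj[OF cproj_Pu A])
  qed
  have "\<exists>y. l2conv (\<lambda>n. As n (model_proj (bpartial lam n) f)) y" if f: "f \<in> K2 (bprod lam)" for f
  proof -
    obtain x where x: "f = seq x" using f by (auto simp: K2_u)
    have "l2conv (\<lambda>n. As n (model_proj (bpartial lam n) f)) (seq (A x))"
      unfolding x model_proj_n OP_apply[OF b] l2conv_seq by (rule rel_strong[OF assms])
    then show ?thesis by blast
  qed
  moreover have "\<exists>y. l2conv (\<lambda>n. adjoint (K2 (bpartial lam n)) (As n) (model_proj (bpartial lam n) f)) y"
    if f: "f \<in> K2 (bprod lam)" for f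
  proof -
    obtain x where x: "f = seq x" using f by (auto simp: K2_u)
    have "adjoint (K2 (bpartial lam n)) (As n) (seq (Pn n x)) = seq (adj (OP As n) x)" for n
      using adjoint_ofop[OF cproj_Pn K2_n, where A = "As n" and y = "Pn n x"] b cprojD(4)[OF cproj_Pn]
        cornerD(5)[OF corner_adj[OF cproj_Pn corner_OP[OF b]]]
      by (simp add: OP_def bops_def)
    then have "l2conv (\<lambda>n. adjoint (K2 (bpartial lam n)) (As n) (model_proj (bpartial lam n) f)) (seq (adj A x))"
      unfolding x model_proj_n by (simp add: l2conv_seq adj)
    then show ?thesis by blast
  qed
  ultimately show ?thesis using b by (simp add: Fseq_def bops_def)
qed

lemma Fseq_bops: "As \<in> Fseq lam \<Longrightarrow> bops As"
  by (simp add: Fseq_def bops_def)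

text \<open>\<open>Fseq\<close> asks for strong convergence, and \<open>seqdist\<close> is a
  supremum of reals, informative only for bounded sets; uniform boundedness closes the gap. Vectors
  outside the model space of \<open>u\<close> are covered because \<open>Pn n\<close> absorbs
  \<open>Pu\<close>.\<close>

lemma Fseq_bounded: assumes "As \<in> Fseq lam" shows "\<exists>C. \<forall>n. norm (OP As n) \<le> C"
proof (rule uniform_boundedness)
  fix x
  have b: "bops As" by (rule Fseq_bops[OF assms])
  have "seq (Pu x) \<in> K2 (bprod lam)" unfolding K2_u using cprojD(5)[OF cproj_Pu] by blast
  then obtain y where y: "l2conv (\<lambda>n. As n (model_proj (bpartial lam n) (seq (Pu x)))) y"
    using assms unfolding Fseq_def by blast
  then have "l2 y" by (simp add: l2conv_def)
  have "OP As n (Pu x) = OP As n x" for n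
    using cornerD(5)[OF corner_OP[OF b]] Pn_Pu(2) by metis
  then have "l2conv (\<lambda>n. seq (OP As n x)) (seq (Ell2 y))"
    using y \<open>l2 y\<close> by (simp add: model_proj_n OP_apply[OF b])
  then have "(\<lambda>n. OP As n x) \<longlonglongrightarrow> Ell2 y" by (simp only: l2conv_seq)
  then have "Bseq (\<lambda>n. OP As n x)" by (intro convergent_imp_Bseq) (auto simp: convergent_def)
  then show "\<exists>C. \<forall>n. norm (OP As n x) \<le> C" by (auto simp: Bseq_def)
qed

lemma seqdist_bound:
  assumes "As \<in> Fseq lam" "Bs \<in> Fseq lam" shows "norm (OP As n - OP Bs n) \<le> seqdist lam As Bs"
proof -
  obtain C D where C: "\<And>n. norm (OP As n) \<le> C" "\<And>n. norm (OP Bs n) \<le> D" using assms Fseq_bounded by metis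
  have "norm (OP As n - OP Bs n) \<le> C + D" for n
    using norm_triangle_ineq4[of "OP As n" "OP Bs n"] C(1)[of n] C(2)[of n] by linarith
  then have "bdd_above (range (\<lambda>n. norm (OP As n - OP Bs n)))" by (intro bdd_aboveI[of _ "C + D"]) auto
  then show ?thesis unfolding seqdist_OP[OF Fseq_bops[OF assms(1)] Fseq_bops[OF assms(2)]]
    by (intro cSUP_upper) auto
qed

lemma seqdist_le:
  assumes "bops As" "bops Bs" "\<And>n. norm (OP As n - OP Bs n) \<le> \<epsilon>" shows "seqdist lam As Bs \<le> \<epsilon>"
  unfolding seqdist_OP[OF assms(1,2)] by (rule cSUP_least) (use assms(3) in auto)

section \<open>Closed subalgebras of sequences obtained from closed algebras of operators\<close>

definition Xs :: "(ell2 \<Rightarrow>\<^sub>L ell2) set \<Rightarrow> opseq set" where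
  "Xs M = {As. \<exists>A\<in>M. rel As A}"

text \<open>Strong limits do not increase norms, so \<open>norm (B i - B j)\<close> is controlled by
  the distances of the sequences and the operators \<open>B j\<close> converge. Compressions are
  contractive in the operator, which allows a three-epsilon argument for the limit.\<close>

lemma rel_limit:
  assumes As: "As \<in> Fseq lam" and rel: "\<And>j. rel (Bs j) (B j)" and B: "\<And>j. B j \<in> M" and M: "closed M" "M \<subseteq> QD"
    and d: "\<And>j n. norm (OP As n - OP (Bs j) n) \<le> inverse (real (Suc j))"
  shows "\<exists>A\<in>M. rel As A"
proof -
  have BB: "norm (B i - B j) \<le> inverse (real (Suc i)) + inverse (real (Suc j))" for i j
  proof (rule norm_blinfun_bound)
    fix x
    have "(\<lambda>n. norm (OP (Bs i) n x - OP (Bs j) n x)) \<longlonglongrightarrow> norm (B i x - B j x)"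
      by (intro tendsto_norm tendsto_diff rel_strong rel)
    moreover have "norm (OP (Bs i) n x - OP (Bs j) n x) \<le> (inverse (real (Suc i)) + inverse (real (Suc j))) * norm x" for n
    proof -
      have "norm (OP (Bs i) n - OP (Bs j) n) \<le> inverse (real (Suc i)) + inverse (real (Suc j))"
        using norm_triangle_ineq4[of "OP As n - OP (Bs j) n" "OP As n - OP (Bs i) n"] d[of n i] d[of n j] by simp
      then have "norm ((OP (Bs i) n - OP (Bs j) n) x) \<le> (inverse (real (Suc i)) + inverse (real (Suc j))) * norm x"
        by (intro order_trans[OF norm_blinfun] mult_right_mono) auto
      then show ?thesis by (simp add: blinfun.diff_left)
    qed
    ultimately show "norm ((B i - B j) x) \<le> (inverse (real (Suc i)) + inverse (real (Suc j))) * norm x"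
      unfolding blinfun.diff_left by (intro LIMSEQ_le_const2) auto
  qed simp
  have "Cauchy B"
  proof (rule CauchyI)
    fix \<epsilon> :: real assume e: "0 < \<epsilon>"
    obtain N where N: "inverse (real (Suc N)) < \<epsilon> / 2" using reals_Archimedean[of "\<epsilon> / 2"] e by auto
    have "norm (B m - B n) < \<epsilon>" if "m \<ge> N" "n \<ge> N" for m n
    proof -
      have "inverse (real (Suc m)) \<le> inverse (real (Suc N))" "inverse (real (Suc n)) \<le> inverse (real (Suc N))"
        using that by (auto simp: le_imp_inverse_le)
      then show ?thesis using BB[of m n] N by linarith
    qed
    then show "\<exists>M. \<forall>m\<ge>M. \<forall>n\<ge>M. norm (B m - B n) < \<epsilon>" by blast
  qed
  then obtain A where A: "B \<longlonglongrightarrow> A" using Cauchy_convergent_iff convergent_def by blast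
  have AM: "A \<in> M" by (rule closed_sequentially[OF M(1) _ A]) (use B in auto)
  have BA: "norm (B j - A) \<le> inverse (real (Suc j))" for j
  proof -
    have "(\<lambda>i. norm (B i - B j)) \<longlonglongrightarrow> norm (A - B j)" by (intro tendsto_intros A)
    moreover have "(\<lambda>i. inverse (real (Suc i)) + inverse (real (Suc j))) \<longlonglongrightarrow> 0 + inverse (real (Suc j))"
      by (intro tendsto_intros LIMSEQ_inverse_real_of_nat)
    ultimately have "norm (A - B j) \<le> 0 + inverse (real (Suc j))"
      by (rule LIMSEQ_le) (use BB in blast)
    then show ?thesis by (simp add: norm_minus_commute)
  qed
  have "(\<lambda>n. OP As n - compr A n) \<longlonglongrightarrow> 0"
  proof (rule LIMSEQ_I)
    fix \<epsilon> :: real assume e: "0 < \<epsilon>"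
    obtain j where j: "inverse (real (Suc j)) < \<epsilon> / 3" using reals_Archimedean[of "\<epsilon> / 3"] e by auto
    have "(\<lambda>n. OP (Bs j) n - compr (B j) n) \<longlonglongrightarrow> 0" using rel by (simp add: rel_def)
    then obtain N where N: "\<And>n. n \<ge> N \<Longrightarrow> norm (OP (Bs j) n - compr (B j) n) < \<epsilon> / 3"
      using LIMSEQ_D[of _ 0 "\<epsilon> / 3"] e by force
    have "norm (OP As n - compr A n - 0) < \<epsilon>" if "n \<ge> N" for n
    proof -
      have "OP As n - compr A n = (OP As n - OP (Bs j) n) + (OP (Bs j) n - compr (B j) n) + compr (B j - A) n"
        by (simp add: compr_diff)
      then have "norm (OP As n - compr A n) \<le> norm (OP As n - OP (Bs j) n) + norm (OP (Bs j) n - compr (B j) n) + norm (compr (B j - A) n)"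
        by (metis norm_triangle_ineq norm_triangle_mono order_refl)
      then show ?thesis using d[of n j] N[OF that] norm_comp[of "B j - A" n] BA[of j] j by simp
    qed
    then show "\<exists>N. \<forall>n\<ge>N. norm (OP As n - compr A n - 0) < \<epsilon>" by blast
  qed
  then show ?thesis using AM M(2) Fseq_bops[OF As] by (auto simp: rel_def)
qed

lemma closed_subalg_Xs:
  assumes M: "closed M" "M \<subseteq> QD" "\<And>A B. A \<in> M \<Longrightarrow> B \<in> M \<Longrightarrow> A + B \<in> M"
    "\<And>A B. A \<in> M \<Longrightarrow> B \<in> M \<Longrightarrow> A o\<^sub>L B \<in> M" "\<And>c A. A \<in> M \<Longrightarrow> Cs c o\<^sub>L A \<in> M"
  shows "closed_subalg lam (Xs M)"
  unfolding closed_subalg_def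
proof (intro conjI ballI allI impI)
  show "Xs M \<subseteq> Fseq lam" using rel_Fseq by (auto simp: Xs_def)
next
  fix As Bs assume "As \<in> Xs M" "Bs \<in> Xs M"
  then show "sadd As Bs \<in> Xs M" "scomp As Bs \<in> Xs M"
    using rel_add rel_compose M(3,4) unfolding Xs_def by blast+
next
  fix c As assume "As \<in> Xs M"
  then show "ssmult c As \<in> Xs M" using rel_Cs M(5) unfolding Xs_def by blast
next
  fix As assume As: "As \<in> Fseq lam" and appr: "\<forall>e>0. \<exists>Bs\<in>Xs M. seqdist lam As Bs < e"
  have "\<forall>j. \<exists>Bs B. B \<in> M \<and> rel Bs B \<and> seqdist lam As Bs < inverse (real (Suc j))"
  proof
    fix j
    have "0 < inverse (real (Suc j))" by simp
    then obtain Bs where "Bs \<in> Xs M" "seqdist lam As Bs < inverse (real (Suc j))" using appr by blast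
    then show "\<exists>Bs B. B \<in> M \<and> rel Bs B \<and> seqdist lam As Bs < inverse (real (Suc j))"
      unfolding Xs_def by blast
  qed
  then obtain Bs B where B: "\<And>j. B j \<in> M" "\<And>j. rel (Bs j) (B j)" "\<And>j. seqdist lam As (Bs j) < inverse (real (Suc j))"
    by metis
  have "norm (OP As n - OP (Bs j) n) \<le> inverse (real (Suc j))" for j n
    using seqdist_bound[OF As rel_Fseq[OF B(2)], of n j] B(3)[of j] by linarith
  then have "\<exists>A\<in>M. rel As A" by (rule rel_limit[OF As B(2) B(1) M(1,2)])
  then show "As \<in> Xs M" by (simp add: Xs_def)
qed

lemma compact_opD:
  assumes "compact_op (K2 (bprod lam)) K"
  shows "is_bop (K2 (bprod lam)) K" "cpt (ofop Pu K)" "corner Pu (ofop Pu K)"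
proof -
  show b: "is_bop (K2 (bprod lam)) K" and "cpt (ofop Pu K)"
    using assms compact_op_ofop[OF cproj_Pu K2_u] by auto
  show "corner Pu (ofop Pu K)"
    unfolding corner_def using clin_ofop[OF cproj_Pu K2_u b] ofop_corner[OF cproj_Pu K2_u b] by blast
qed

lemma compact_op_toop:
  assumes "corner Pu K" "cpt K"
  shows "compact_op (K2 (bprod lam)) (toop K)" "ofop Pu (toop K) = K"
proof -
  have bop: "is_bop (K2 (bprod lam)) (toop K)"
    by (rule is_bop_toop[OF cproj_Pu K2_u cornerD(1)[OF assms(1)]]) (auto simp: cornerD(4)[OF assms(1)])
  show of: "ofop Pu (toop K) = K"
    by (rule ofop_eqI[OF cproj_Pu K2_u bop cornerD(3)[OF assms(1)]]) simp
  then show "compact_op (K2 (bprod lam)) (toop K)"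
    using compact_op_ofop[OF cproj_Pu K2_u] bop assms(2) by simp
qed

lemma generator_rel:
  assumes a: "ccont a" and K: "compact_op (K2 (bprod lam)) K"
    and As: "As = (\<lambda>n x. model_proj (bpartial lam n) (toeplitz (bprod lam) a x + K x))"
  shows "rel As (Top a + ofop Pu K)" "OP As n = compr (Top a + ofop Pu K) n"
proof -
  note bK = compact_opD(1)[OF K] and cK = compact_opD(2)[OF K] and Kc = compact_opD(3)[OF K]
  have Q: "Top a + ofop Pu K \<in> QD" by (intro QD_add QD_Top a QD_compact Kc cK)
  have app: "As n (seq x) = seq (compr (Top a + ofop Pu K) n x)" if "Pn n x = x" for n x
  proof -
    have x: "x \<in> ran Pu" using that Pn_Pu(1)[of n x] by (simp add: ran_def)
    have "toeplitz (bprod lam) a (seq x) + K (seq x) = seq ((Top a + ofop Pu K) x)"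
      by (simp add: toeplitz_Top[OF a x] ofop_seq[OF cproj_Pu K2_u bK x] blinfun.add_left)
    then show ?thesis unfolding As by (simp add: model_proj_n that)
  qed
  have cl: "clin (Top a + ofop Pu K)" by (rule cornerD(1)[OF QD_corner[OF Q]])
  show OP: "OP As n = compr (Top a + ofop Pu K) n" for n
    by (rule bopsI(2)[OF corner_comp[OF cl] app])
  have "bops As" by (rule bopsI(1)[OF corner_comp[OF cl] app])
  then show "rel As (Top a + ofop Pu K)" using Q OP by (simp add: rel_def)
qed

lemma gens_Xs:
  assumes "\<And>a K. ccont a \<Longrightarrow> corner Pu K \<Longrightarrow> cpt K \<Longrightarrow> Top a + K \<in> M"
  shows "gens lam \<subseteq> Xs M"
proof
  fix As assume "As \<in> gens lam"
  then obtain a K where a: "ccont a" and K: "compact_op (K2 (bprod lam)) K"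
    and As: "As = (\<lambda>n x. model_proj (bpartial lam n) (toeplitz (bprod lam) a x + K x))"
    by (auto simp: gens_def ccont_def)
  show "As \<in> Xs M"
    using generator_rel(1)[OF a K As] assms[OF a compact_opD(3,2)[OF K]] by (auto simp: Xs_def)
qed

lemma Salg_subset: "closed_subalg lam X \<Longrightarrow> gens lam \<subseteq> X \<Longrightarrow> Salg lam \<subseteq> X"
  unfolding Salg_def by blast

lemma gens_Salg: "gens lam \<subseteq> Salg lam"
  unfolding Salg_def by blast

text \<open>The intersection defining \<open>Salg\<close> is contained in \<open>Fseq\<close> once
  some closed subalgebra contains the generators; \<open>Xs QD\<close> is such a one.\<close>

lemma Salg_Fseq: "Salg lam \<subseteq> Fseq lam"
proof -
  have X: "closed_subalg lam (Xs QD)"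
    by (rule closed_subalg_Xs[OF QD_closed order_refl QD_add QD_compose QD_Cs])
  have "gens lam \<subseteq> Xs QD" by (rule gens_Xs) (intro QD_add QD_Top QD_compact)
  then show ?thesis using Salg_subset[OF X] X unfolding closed_subalg_def by blast
qed

lemma Salg_closed:
  "As \<in> Salg lam \<Longrightarrow> Bs \<in> Salg lam \<Longrightarrow> sadd As Bs \<in> Salg lam"
  "As \<in> Salg lam \<Longrightarrow> Bs \<in> Salg lam \<Longrightarrow> scomp As Bs \<in> Salg lam"
  "As \<in> Salg lam \<Longrightarrow> ssmult c As \<in> Salg lam"
  "As \<in> Fseq lam \<Longrightarrow> (\<And>\<epsilon>. \<epsilon> > 0 \<Longrightarrow> \<exists>Bs\<in>Salg lam. seqdist lam As Bs < \<epsilon>) \<Longrightarrow> As \<in> Salg lam"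
proof -
  show "As \<in> Salg lam" if As: "As \<in> Fseq lam" "\<And>\<epsilon>. \<epsilon> > 0 \<Longrightarrow> \<exists>Bs\<in>Salg lam. seqdist lam As Bs < \<epsilon>"
    unfolding Salg_def
  proof
    fix X assume "X \<in> {X. closed_subalg lam X \<and> gens lam \<subseteq> X}"
    then have X: "closed_subalg lam X" "gens lam \<subseteq> X" by auto
    have "\<forall>\<epsilon>>0. \<exists>Bs\<in>X. seqdist lam As Bs < \<epsilon>" using As(2) Salg_subset[OF X] by blast
    then show "As \<in> X" using X(1) As(1) unfolding closed_subalg_def by blast
  qed
qed (unfold Salg_def closed_subalg_def, blast+)

lemma Salg_bops: "As \<in> Salg lam \<Longrightarrow> bops As"
  using Salg_Fseq Fseq_bops by blast

text \<open>Values of a sequence off the model spaces are arbitrary; this notion speaks only of the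
  extensions by 0, for which operator identities hold literally.\<close>

definition realizable :: "(nat \<Rightarrow> ell2 \<Rightarrow>\<^sub>L ell2) \<Rightarrow> bool" where
  "realizable G \<longleftrightarrow> (\<exists>As\<in>Salg lam. \<forall>n. OP As n = G n)"

lemma realizable_add: "realizable G \<Longrightarrow> realizable H \<Longrightarrow> realizable (\<lambda>n. G n + H n)"
  unfolding realizable_def using Salg_closed(1) OP_sadd(2) Salg_bops by metis

lemma realizable_compose: "realizable G \<Longrightarrow> realizable H \<Longrightarrow> realizable (\<lambda>n. G n o\<^sub>L H n)"
  unfolding realizable_def using Salg_closed(2) OP_scomp(2) Salg_bops by metis

lemma realizable_Cs: "realizable G \<Longrightarrow> realizable (\<lambda>n. Cs c o\<^sub>L G n)"
  unfolding realizable_def using Salg_closed(3) OP_ssmult(2) Salg_bops by metis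

lemma realizable_diff: assumes "realizable G" "realizable H" shows "realizable (\<lambda>n. G n - H n)"
proof -
  have "G n + (Cs (-1) o\<^sub>L H n) = G n - H n" for n
    by (rule blinfun_eqI) (simp add: blinfun.add_left blinfun.diff_left cs_minus_one)
  then show ?thesis using realizable_add[OF assms(1) realizable_Cs[OF assms(2), of "-1"]] by simp
qed

lemma realizable_generator:
  assumes a: "ccont a" and K: "corner Pu K" "cpt K" shows "realizable (compr (Top a + K))"
proof -
  note cop = compact_op_toop(1)[OF K] and of = compact_op_toop(2)[OF K]
  define As where "As = (\<lambda>n x. model_proj (bpartial lam n) (toeplitz (bprod lam) a x + toop K x))"
  have "As \<in> gens lam" unfolding gens_def As_def using a cop by (auto simp: ccont_def)
  then have "As \<in> Salg lam" using gens_Salg by blast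
  moreover have "OP As n = compr (Top a + K) n" for n
    using generator_rel(2)[OF a cop As_def] of by simp
  ultimately show ?thesis unfolding realizable_def by blast
qed

lemma Top_zero: "Top (\<lambda>z. 0) = 0"
proof -
  have "Mul (\<lambda>z. 0 * 1) = Cs 0 o\<^sub>L Mul (\<lambda>z. 1)" by (rule Mul_cmult) simp
  then have "Mul (\<lambda>z. 0) = 0" by (auto intro!: blinfun_eqI)
  then show ?thesis by (simp add: Top_def)
qed

lemma realizable_compact: "corner Pu K \<Longrightarrow> cpt K \<Longrightarrow> realizable (compr K)"
  using realizable_generator[of "\<lambda>z. 0" K] by (simp add: Top_zero)

lemma realizable_zero: "realizable (\<lambda>n. 0)"
proof -
  have "realizable (compr 0)" by (intro realizable_compact cpt_zero corner_zero)
  moreover have "compr 0 = (\<lambda>n. 0)" by (rule ext) simp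
  ultimately show ?thesis by simp
qed

lemma realizable_sum: "(\<And>i. i \<in> I \<Longrightarrow> realizable (G i)) \<Longrightarrow> realizable (\<lambda>n. \<Sum>i\<in>I. G i n)"
  by (induction I rule: infinite_finite_induct) (auto simp: realizable_zero intro: realizable_add)

text \<open>For a unit vector \<open>y\<close> in the range of \<open>P\<^sub>m\<^sub>+\<^sub>1 - P\<^sub>m\<close> the number \<open>\<langle>P\<^sub>n y, y\<rangle>\<close> jumps from
  0 to 1 at \<open>n = m + 1\<close>, so the failure of multiplicativity of \<open>K \<mapsto> (P\<^sub>n K P\<^sub>n)\<close> on
  \<open>(x \<otimes> y)(y \<otimes> z)\<close> cuts a sequence off after position \<open>m\<close>.\<close>

lemma realizable_tens_cutoff:
  assumes x: "Pu x = x" and z: "Pu z = z"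
  shows "realizable (\<lambda>n. if n \<le> m then compr (tens x z) n else 0)"
proof -
  obtain y where y: "norm y = 1" "Pn (Suc m) y = y" "Pn m y = 0" using Pn_gap by blast
  have yu: "Pu y = y" using Pn_Pu(1)[of "Suc m" y] y(2) by simp
  have low: "Pn n y = 0" if "n \<le> m" for n using Pn_Pm(2)[OF that, of y] y(3) by simp
  have high: "Pn n y = y" if "\<not> n \<le> m" for n using Pn_Pm(1)[of "Suc m" n y] y(2) that by simp
  have yy: "cin y y = 1" using y(1) by (simp add: cin_self)
  have "tens x y o\<^sub>L tens y z = tens x z" by (rule blinfun_eqI) (simp add: cin_cs_left yy)
  moreover have "compr (tens x y) n o\<^sub>L compr (tens y z) n = (if n \<le> m then 0 else compr (tens x z) n)" for n
  proof (cases "n \<le> m")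
    case True
    then show ?thesis
      by (intro blinfun_eqI) (simp add: clin_cs[OF cprojD(1)[OF cproj_Pn]] low)
  next
    case False
    then show ?thesis
      by (intro blinfun_eqI) (simp add: clin_cs[OF cprojD(1)[OF cproj_Pn]] high cin_cs_left yy)
  qed
  moreover have "realizable (\<lambda>n. compr (tens x z) n - (compr (tens x y) n o\<^sub>L compr (tens y z) n))"
    by (intro realizable_diff realizable_compose realizable_compact corner_tens cproj_Pu cpt_tens x z yu)
  moreover have "(\<lambda>n. compr (tens x z) n - (if n \<le> m then 0 else compr (tens x z) n)) = (\<lambda>n. if n \<le> m then compr (tens x z) n else 0)"
    by auto
  ultimately show ?thesis by simp
qed

text \<open>In an orthonormal basis of the finite-dimensional model space \<open>G\<close> is a sum
  of rank-one operators, and the difference of two consecutive cutoffs of each isolates the index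
  \<open>i\<close>.\<close>

lemma realizable_single:
  assumes G: "corner (Pn i) G" shows "realizable (\<lambda>n. if n = i then G else 0)"
proof -
  obtain v d where v: "onb (ran (Pn i)) v d" using onb_Pn by blast
  have vP: "Pn i (v k) = v k" if "k < d" for k using onbD(2)[OF v that] by (simp add: ran_def)
  have vu: "Pu (v k) = v k" if "k < d" for k using Pn_Pu(1)[of i "v k"] vP[OF that] by simp
  have Gu: "Pu (G w) = G w" for w using Pn_Pu(1)[of i "G w"] cornerD(4)[OF G] by simp
  have Gsum: "G = (\<Sum>k<d. tens (G (v k)) (v k))"
  proof (rule blinfun_eqI)
    fix w
    have "G w = G (Pn i w)" using cornerD(5)[OF G] by simp
    also have "Pn i w = (\<Sum>k<d. cs (cin (Pn i w) (v k)) (v k))"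
      using onbD(3)[OF v cprojD(5)[OF cproj_Pn]] by simp
    also have "G \<dots> = (\<Sum>k<d. cs (cin (Pn i w) (v k)) (G (v k)))" by (rule clin_sum[OF cornerD(1)[OF G]])
    also have "\<dots> = (\<Sum>k<d. cs (cin w (v k)) (G (v k)))"
      by (rule sum.cong) (simp_all add: cprojD(7)[OF cproj_Pn] vP)
    finally show "G w = (\<Sum>k<d. tens (G (v k)) (v k)) w" by (simp add: blinfun.sum_left)
  qed
  have ct: "compr (tens (G (v k)) (v k)) i = tens (G (v k)) (v k)" if "k < d" for k
    by (rule blinfun_eqI)
      (simp add: clin_cs[OF cprojD(1)[OF cproj_Pn]] cprojD(7)[OF cproj_Pn] vP[OF that] cornerD(4)[OF G])
  \<comment> \<open>Here the cutoff is strict, so \<open>E (Suc i) k\<close> and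
    \<open>E i k\<close> differ at index \<open>i\<close> only; \<open>E 0 k\<close> is the zero
    sequence.\<close>
  define E where "E m k = (\<lambda>n. if n < m then compr (tens (G (v k)) (v k)) n else 0)" for m k :: nat
  have E: "realizable (E m k)" if k: "k < d" for m k
  proof (cases m)
    case 0
    then have "E m k = (\<lambda>n. 0)" by (auto simp: E_def)
    then show ?thesis using realizable_zero by simp
  next
    case (Suc j)
    then have "E m k = (\<lambda>n. if n \<le> j then compr (tens (G (v k)) (v k)) n else 0)" by (auto simp: E_def less_Suc_eq_le)
    then show ?thesis using realizable_tens_cutoff[OF Gu vu[OF k]] by simp
  qed
  have "realizable (\<lambda>n. \<Sum>k\<in>{..<d}. E (Suc i) k n - E i k n)"
    by (rule realizable_sum, rule realizable_diff; rule E) auto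
  moreover have "(\<Sum>k<d. E (Suc i) k n - E i k n) = (if n = i then G else 0)" for n
  proof (cases "n = i")
    case True
    then have "(\<Sum>k<d. E (Suc i) k n - E i k n) = (\<Sum>k<d. tens (G (v k)) (v k))"
      by (intro sum.cong) (auto simp: E_def ct)
    then show ?thesis using True Gsum by simp
  next
    case False
    then show ?thesis by (auto simp: E_def intro!: sum.neutral)
  qed
  ultimately show ?thesis by simp
qed

lemma Salg_limit:
  assumes rel: "rel Bs B" and appr: "\<And>\<epsilon>. \<epsilon> > 0 \<Longrightarrow> \<exists>G. realizable G \<and> (\<forall>n. norm (OP Bs n - G n) \<le> \<epsilon>)"
  shows "Bs \<in> Salg lam"
proof (rule Salg_closed(4)[OF rel_Fseq[OF rel]])
  fix \<epsilon> :: real assume e: "\<epsilon> > 0"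
  then obtain G where G: "realizable G" "\<And>n. norm (OP Bs n - G n) \<le> \<epsilon> / 2" using appr[of "\<epsilon> / 2"] by auto
  then obtain As where As: "As \<in> Salg lam" "\<And>n. OP As n = G n" unfolding realizable_def by blast
  have "seqdist lam Bs As \<le> \<epsilon> / 2"
    by (rule seqdist_le) (use rel Salg_bops[OF As(1)] As(2) G(2) in \<open>auto simp: rel_def\<close>)
  then show "\<exists>As\<in>Salg lam. seqdist lam Bs As < \<epsilon>" using As(1) e by (intro bexI[of _ As]) auto
qed

text \<open>Truncations are finite sums of sequences supported at one index, and they approximate a
  null sequence uniformly.\<close>

lemma realizable_null:
  assumes G: "\<And>n. corner (Pn n) (G n)" "G \<longlonglongrightarrow> 0" shows "realizable G"
proof -
  have "rel (\<lambda>n. toop (G n)) 0"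
    unfolding rel_def using OP_toop[OF G(1)] G(2) by (auto intro: QD_compact cpt_zero)
  then have "(\<lambda>n. toop (G n)) \<in> Salg lam"
  proof (rule Salg_limit)
    fix \<epsilon> :: real assume e: "\<epsilon> > 0"
    then obtain N where N: "\<And>n. n \<ge> N \<Longrightarrow> norm (G n) < \<epsilon>" using LIMSEQ_D[OF G(2), of \<epsilon>] by auto
    have "realizable (\<lambda>n. \<Sum>i\<in>{..<N}. if n = i then G i else 0)"
      by (rule realizable_sum) (rule realizable_single[OF G(1)])
    moreover have "(\<Sum>i<N. if n = i then G i else 0) = (if n < N then G n else 0)" for n
      by (simp add: sum.delta)
    ultimately have "realizable (\<lambda>n. if n < N then G n else 0)" by simp
    moreover have "norm (OP (\<lambda>n. toop (G n)) n - (if n < N then G n else 0)) \<le> \<epsilon>" for n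
      using N[of n] e by (simp add: OP_toop[OF G(1)] less_imp_le)
    ultimately show "\<exists>H. realizable H \<and> (\<forall>n. norm (OP (\<lambda>n. toop (G n)) n - H n) \<le> \<epsilon>)" by blast
  qed
  then show ?thesis unfolding realizable_def using OP_toop[OF G(1)] by blast
qed

section \<open>The operators whose compressions belong to the algebra\<close>

definition TT :: "(ell2 \<Rightarrow>\<^sub>L ell2) set" where
  "TT = {A \<in> QD. realizable (compr A)}"

lemma TT_add: assumes "A \<in> TT" "B \<in> TT" shows "A + B \<in> TT"
proof -
  have "compr (A + B) = (\<lambda>n. compr A n + compr B n)" by (rule ext) (rule compr_add)
  then show ?thesis using assms realizable_add[of "compr A" "compr B"] by (simp add: TT_def QD_add)
qed

lemma TT_Cs: assumes "A \<in> TT" shows "Cs c o\<^sub>L A \<in> TT"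
proof -
  have "compr (Cs c o\<^sub>L A) = (\<lambda>n. Cs c o\<^sub>L compr A n)" by (rule ext) (rule compr_Cs)
  then show ?thesis using assms realizable_Cs[of "compr A" c] by (simp add: TT_def QD_Cs)
qed

text \<open>The product of the compressions lies in the algebra and differs from the compression of
  the product by a null sequence, which lies there too.\<close>

lemma TT_compose: assumes "A \<in> TT" "B \<in> TT" shows "A o\<^sub>L B \<in> TT"
proof -
  have Q: "A \<in> QD" "B \<in> QD" using assms by (auto simp: TT_def)
  have cl: "clin A" "clin B" using Q QD_corner cornerD(1) by blast+
  have null: "realizable (\<lambda>n. (compr A n o\<^sub>L compr B n) - compr (A o\<^sub>L B) n)"
    by (rule realizable_null)
      (intro corner_diff corner_compose corner_comp cl clin_compose, rule compr_mult_null[OF Q(2)])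
  have "realizable (\<lambda>n. compr A n o\<^sub>L compr B n)"
    using assms by (intro realizable_compose) (auto simp: TT_def)
  from realizable_diff[OF this null] have "realizable (compr (A o\<^sub>L B))" by simp
  then show ?thesis using Q by (simp add: TT_def QD_compose)
qed

lemma rel_toop_comp: assumes "A \<in> QD" shows "rel (\<lambda>n. toop (compr A n)) A" "OP (\<lambda>n. toop (compr A n)) n = compr A n"
  using OP_toop[OF corner_comp[OF cornerD(1)[OF QD_corner[OF assms]]]] assms by (auto simp: rel_def)

text \<open>The extensions of \<open>As\<close> are compressions plus a null sequence, hence
  realizable. \<open>seqdist\<close> does not see values off the model spaces, so closedness of
  \<open>Salg\<close> in \<open>Fseq\<close> admits \<open>As\<close> itself at distance 0 from a
  realizing sequence.\<close>

lemma TT_Salg: assumes "A \<in> TT" "rel As A" shows "As \<in> Salg lam"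
proof (rule Salg_limit[OF assms(2)])
  fix \<epsilon> :: real assume e: "\<epsilon> > 0"
  have b: "bops As" and Q: "A \<in> QD" using assms(2) by (auto simp: rel_def)
  have "realizable (\<lambda>n. OP As n - compr A n)"
    by (rule realizable_null)
      (intro corner_diff corner_OP b corner_comp cornerD(1)[OF QD_corner[OF Q]], use assms(2) in \<open>simp add: rel_def\<close>)
  then have "realizable (\<lambda>n. compr A n + (OP As n - compr A n))"
    using assms(1) by (intro realizable_add) (auto simp: TT_def)
  then show "\<exists>G. realizable G \<and> (\<forall>n. norm (OP As n - G n) \<le> \<epsilon>)" using e by (intro exI[of _ "OP As"]) simp
qed

lemma TT_closed: "closed TT"
proof (rule closed_sequential_limits[THEN iffD2], intro allI impI, elim conjE)
  fix A B assume A: "\<forall>j. A j \<in> TT" and lim: "A \<longlonglongrightarrow> B"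
  have Q: "B \<in> QD" by (rule closed_sequentially[OF QD_closed _ lim]) (use A in \<open>simp add: TT_def\<close>)
  have "(\<lambda>n. toop (compr B n)) \<in> Salg lam"
  proof (rule Salg_limit[OF rel_toop_comp(1)[OF Q]])
    fix \<epsilon> :: real assume e: "\<epsilon> > 0"
    obtain j where j: "norm (A j - B) < \<epsilon>" using LIMSEQ_D[OF lim e] by auto
    have "norm (compr B n - compr (A j) n) \<le> \<epsilon>" for n
      using norm_comp[of "B - A j" n] j by (simp add: compr_diff norm_minus_commute)
    then show "\<exists>G. realizable G \<and> (\<forall>n. norm (OP (\<lambda>n. toop (compr B n)) n - G n) \<le> \<epsilon>)"
      using A by (intro exI[of _ "compr (A j)"]) (auto simp: TT_def rel_toop_comp(2)[OF Q])
  qed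
  then show "B \<in> TT" unfolding TT_def realizable_def using Q rel_toop_comp(2)[OF Q] by blast
qed

text \<open>Adjoints are imposed here because the regularizer contains \<open>adj A\<close>. Nothing
  is lost: the adjoint of \<open>Top a\<close> is \<open>Top\<close> of the conjugate symbol, and
  adjoints of compact operators are compact.\<close>

definition TTs :: "(ell2 \<Rightarrow>\<^sub>L ell2) set" where
  "TTs = {A. A \<in> TT \<and> adj A \<in> TT}"

lemma TTs_closed: "closed TTs"
proof (rule closed_sequential_limits[THEN iffD2], intro allI impI, elim conjE)
  fix A B assume A: "\<forall>j. A j \<in> TTs" and lim: "A \<longlonglongrightarrow> B"
  have "B \<in> TT" by (rule closed_sequentially[OF TT_closed _ lim]) (use A in \<open>simp add: TTs_def\<close>)
  moreover have "adj B \<in> TT"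
    by (rule closed_sequentially[OF TT_closed _ tendsto_adj[OF lim]]) (use A in \<open>simp add: TTs_def\<close>)
  ultimately show "B \<in> TTs" by (simp add: TTs_def)
qed

lemma TTs_adj: "A \<in> TTs \<Longrightarrow> adj A \<in> TTs"
  by (simp add: TTs_def)

lemma TTs_add: "A \<in> TTs \<Longrightarrow> B \<in> TTs \<Longrightarrow> A + B \<in> TTs"
  by (simp add: TTs_def TT_add adj_add)

lemma TTs_compose: "A \<in> TTs \<Longrightarrow> B \<in> TTs \<Longrightarrow> A o\<^sub>L B \<in> TTs"
  by (simp add: TTs_def TT_compose adj_compose)

lemma TTs_Cs: assumes "A \<in> TTs" shows "Cs c o\<^sub>L A \<in> TTs"
proof -
  have "clin (adj A)" using assms cornerD(1)[OF QD_corner] by (auto simp: TTs_def TT_def)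
  then have "adj (Cs c o\<^sub>L A) = Cs (cnj c) o\<^sub>L adj A"
    by (intro blinfun_eqI) (simp add: adj_compose clin_cs)
  then show ?thesis using assms by (simp add: TTs_def TT_Cs)
qed

lemma TTs_compact: "corner Pu K \<Longrightarrow> cpt K \<Longrightarrow> K \<in> TTs"
  by (simp add: TTs_def TT_def QD_compact realizable_compact corner_adj cproj_Pu cpt_adj)

lemma TT_Top: assumes "ccont a" shows "Top a \<in> TT"
proof -
  have "realizable (compr (Top a + 0))" by (intro realizable_generator assms cpt_zero corner_zero)
  then show ?thesis using QD_Top[OF assms] by (simp add: TT_def)
qed

lemma adj_Top: "ccont a \<Longrightarrow> adj (Top a) = Top (\<lambda>z. cnj (a z))"
  by (simp add: Top_def adj_compose cprojD(3)[OF cproj_Pu] Mul_cnj blinfun_compose_assoc)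

lemma TTs_Top: "ccont a \<Longrightarrow> Top a \<in> TTs"
  by (simp add: TTs_def TT_Top adj_Top)

lemma TTs_Pu: "Pu \<in> TTs"
proof -
  have "Top (\<lambda>z. 1) = Pu" by (simp add: Top_def Mul_one) (rule blinfun_eqI, simp add: cprojD(4)[OF cproj_Pu])
  then show ?thesis using TTs_Top[of "\<lambda>z. 1"] by simp
qed

lemma TTs_corner: "A \<in> TTs \<Longrightarrow> corner Pu A"
  by (simp add: TTs_def TT_def QD_corner)

text \<open>\<open>Xs TTs\<close> is a closed subalgebra containing the generators, so it is one of
  the sets intersected in \<open>Salg\<close>.\<close>

lemma Salg_rel: assumes "As \<in> Salg lam" obtains A where "A \<in> TTs" "rel As A"
proof -
  have "closed_subalg lam (Xs TTs)"
    by (rule closed_subalg_Xs[OF TTs_closed _ TTs_add TTs_compose TTs_Cs]) (auto simp: TTs_def TT_def)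
  moreover have "gens lam \<subseteq> Xs TTs" by (rule gens_Xs) (intro TTs_add TTs_Top TTs_compact)
  ultimately have "Salg lam \<subseteq> Xs TTs" by (rule Salg_subset)
  then show ?thesis using assms that by (auto simp: Xs_def)
qed

section \<open>Fredholm sequences and Fredholm operators\<close>

lemma Jideal_iff: "Ds \<in> Jideal lam \<longleftrightarrow> (\<exists>K. corner Pu K \<and> cpt K \<and> rel Ds K)"
proof
  assume "Ds \<in> Jideal lam"
  then obtain K G where K: "compact_op (K2 (bprod lam)) K" and G: "bops G"
      "(\<lambda>n. opnorm (K2 (bpartial lam n)) (G n)) \<longlonglongrightarrow> 0"
      "\<And>n x. x \<in> K2 (bpartial lam n) \<Longrightarrow> Ds n x = model_proj (bpartial lam n) (K x) + G n x"
    by (auto simp: Jideal_def bops_def)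
  note bK = compact_opD(1)[OF K] and cK = compact_opD(2)[OF K] and Kc = compact_opD(3)[OF K]
  have cc: "corner (Pn n) (compr (ofop Pu K) n + OP G n)" for n
    by (intro corner_add corner_comp cornerD(1)[OF Kc] corner_OP G)
  have app: "Ds n (seq x) = seq ((compr (ofop Pu K) n + OP G n) x)" if "Pn n x = x" for n x
  proof -
    have "seq x \<in> K2 (bpartial lam n)" unfolding K2_n using that by (intro imageI) (simp add: ran_def)
    moreover have "x \<in> ran Pu" using that Pn_Pu(1)[of n x] by (simp add: ran_def)
    ultimately show ?thesis using G(3) that
      by (simp add: ofop_seq[OF cproj_Pu K2_u bK] model_proj_n OP_apply'[OF G(1)] blinfun.add_left)
  qed
  have b: "bops Ds" and OP: "OP Ds n = compr (ofop Pu K) n + OP G n" for n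
    using bopsI[OF cc app] by auto
  have "opnorm (K2 (bpartial lam n)) (G n) = norm (OP G n)" for n
    using opnorm_ofop[OF cproj_Pn K2_n] G(1) by (simp add: OP_def bops_def)
  then have "OP G \<longlonglongrightarrow> 0" using G(2) tendsto_norm_zero_iff by auto
  then have "rel Ds (ofop Pu K)" using b OP QD_compact[OF Kc cK] by (simp add: rel_def)
  then show "\<exists>K. corner Pu K \<and> cpt K \<and> rel Ds K" using Kc cK by blast
next
  assume "\<exists>K. corner Pu K \<and> cpt K \<and> rel Ds K"
  then obtain K where K: "corner Pu K" "cpt K" and rel: "rel Ds K" by blast
  note cop = compact_op_toop(1)[OF K] and of = compact_op_toop(2)[OF K]
  have b: "bops Ds" using rel by (simp add: rel_def)
  define H where "H n = OP Ds n - compr K n" for n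
  have Hc: "corner (Pn n) (H n)" for n
    unfolding H_def by (intro corner_diff corner_OP b corner_comp cornerD(1)[OF K(1)])
  note OPH = OP_toop[OF Hc]
  have "opnorm (K2 (bpartial lam n)) (toop (H n)) = norm (H n)" for n
    using opnorm_ofop[OF cproj_Pn K2_n, of n "toop (H n)"] OPH by (simp add: OP_def bops_def)
  moreover have "(\<lambda>n. norm (H n)) \<longlonglongrightarrow> 0" using rel by (simp add: rel_def H_def tendsto_norm_zero)
  moreover have "Ds n f = model_proj (bpartial lam n) (toop K f) + toop (H n) f" if f: "f \<in> K2 (bpartial lam n)" for n f
  proof -
    obtain x where x: "f = seq x" "Pn n x = x" using f by (auto simp: K2_n ran_def)
    show ?thesis unfolding x(1)
      by (simp add: OP_apply'[OF b x(2)] model_proj_n H_def blinfun.diff_left x(2))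
  qed
  ultimately show "Ds \<in> Jideal lam"
    unfolding Jideal_def using cop OPH(1)
    by (intro CollectI exI[of _ "toop K"] exI[of _ "\<lambda>n. toop (H n)"] conjI allI ballI) (simp_all add: bops_def)
qed

lemma slim_eq: assumes "rel As A" shows "slim lam As (seq x) = seq (A x)"
  unfolding slim_def
proof (rule the_equality)
  have b: "bops As" using assms by (simp add: rel_def)
  have lim: "(\<lambda>n. OP As n x) \<longlonglongrightarrow> A x" by (rule rel_strong[OF assms])
  then show "l2conv (\<lambda>n. As n (model_proj (bpartial lam n) (seq x))) (seq (A x))"
    by (simp add: model_proj_n OP_apply[OF b] l2conv_seq)
  fix y assume y: "l2conv (\<lambda>n. As n (model_proj (bpartial lam n) (seq x))) y"
  then have y2: "y = seq (Ell2 y)" by (simp add: l2conv_def)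
  have "l2conv (\<lambda>n. seq (OP As n x)) y" using y by (simp add: model_proj_n OP_apply[OF b])
  then have "l2conv (\<lambda>n. seq (OP As n x)) (seq (Ell2 y))" using y2 by metis
  then have "(\<lambda>n. OP As n x) \<longlonglongrightarrow> Ell2 y" by (simp only: l2conv_seq)
  then have "Ell2 y = A x" using lim LIMSEQ_unique by blast
  then show "y = seq (A x)" using y2 by simp
qed

lemma slim_kernel:
  assumes "rel As A" shows "{x \<in> K2 (bprod lam). slim lam As x = 0} = seq ` kerP Pu A"
proof -
  have "slim lam As (seq x) = 0 \<longleftrightarrow> A x = 0" for x
    unfolding slim_eq[OF assms] by (metis seq_inject seq_zero)
  then show ?thesis by (auto simp: K2_u kerP_def)
qed

lemma fredholm_iff: assumes rel: "rel As A" shows "fredholm_op (K2 (bprod lam)) (slim lam As) \<longleftrightarrow> fred Pu A"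
proof -
  have A: "corner Pu A" using rel QD_corner by (auto simp: rel_def)
  have "is_bop (K2 (bprod lam)) (slim lam As)"
  proof (rule is_bop_toop[OF cproj_Pu K2_u cornerD(1)[OF A]])
    fix f assume "f \<in> K2 (bprod lam)"
    then obtain x where "f = seq x" by (auto simp: K2_u)
    then show "slim lam As f = toop A f" by (simp add: slim_eq[OF rel])
  qed (simp add: cornerD(4)[OF A])
  moreover have "findim {x \<in> K2 (bprod lam). slim lam As x = 0} \<longleftrightarrow> (\<exists>v n. onb (kerP Pu A) v n)"
    unfolding slim_kernel[OF rel] by (rule findim_iff_onb[OF csub_kerP[OF cproj_Pu A]])
  moreover have "slim lam As ` K2 (bprod lam) = seq ` (blinfun_apply A ` ran Pu)"
    by (simp add: K2_u image_image slim_eq[OF rel])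
  then have "(\<forall>x y. (\<forall>n. x n \<in> slim lam As ` K2 (bprod lam)) \<and> l2conv x y \<longrightarrow> y \<in> slim lam As ` K2 (bprod lam))
      \<longleftrightarrow> closed (blinfun_apply A ` ran Pu)"
    by (simp only: l2conv_closed_iff)
  moreover have "{y \<in> K2 (bprod lam). \<forall>x\<in>K2 (bprod lam). l2inner (slim lam As x) y = 0} = seq ` cokerP Pu A"
    by (auto simp: K2_u cokerP_def slim_eq[OF rel] l2inner_seq)
  then have "findim {y \<in> K2 (bprod lam). \<forall>x\<in>K2 (bprod lam). l2inner (slim lam As x) y = 0} \<longleftrightarrow> (\<exists>v n. onb (cokerP Pu A) v n)"
    using findim_iff_onb[OF csub_cokerP[OF cproj_Pu]] by simp
  ultimately show ?thesis unfolding fredholm_op_def fred_def by blast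
qed

text \<open>The last identity makes \<open>(B o\<^sub>L A) - Pu\<close> map into the kernel of
  \<open>A\<close>; the lower bound for the singular values uses it.\<close>

lemma regularizer:
  assumes A: "A \<in> TTs" and f: "fred Pu A"
  shows "\<exists>B\<in>TTs. cpt ((A o\<^sub>L B) - Pu) \<and> cpt ((B o\<^sub>L A) - Pu) \<and> A o\<^sub>L ((B o\<^sub>L A) - Pu) = 0"
  by (rule atkinson_necessary[OF cproj_Pu TTs_closed TTs_add TTs_compose TTs_Cs TTs_Pu TTs_adj TTs_corner TTs_compact A f])

theorem fred_seq_iff:
  assumes As: "As \<in> Salg lam" shows "fred_seq lam As \<longleftrightarrow> fredholm_op (K2 (bprod lam)) (slim lam As)"
proof -
  obtain A where A: "A \<in> TTs" "rel As A" using Salg_rel[OF As] by blast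
  show ?thesis unfolding fredholm_iff[OF A(2)]
  proof
    assume "fred_seq lam As"
    then obtain Bs where Bs: "Bs \<in> Salg lam" "sminus (scomp As Bs) sid \<in> Jideal lam" "sminus (scomp Bs As) sid \<in> Jideal lam"
      by (auto simp: fred_seq_def)
    obtain B where B: "B \<in> TTs" "rel Bs B" using Salg_rel[OF Bs(1)] by blast
    obtain K1 where K1: "cpt K1" "rel (sminus (scomp As Bs) sid) K1" using Bs(2) Jideal_iff by blast
    obtain K2 where K2: "cpt K2" "rel (sminus (scomp Bs As) sid) K2" using Bs(3) Jideal_iff by blast
    \<comment> \<open>Products and differences of sequences pass to their operators, and the
      operator of a sequence is unique; so membership in the ideal becomes compactness of this
      defect.\<close>
    have "K1 = (A o\<^sub>L B) - Pu" by (rule rel_unique[OF K1(2) rel_minus[OF rel_compose[OF A(2) B(2)] rel_sid]])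
    moreover have "K2 = (B o\<^sub>L A) - Pu" by (rule rel_unique[OF K2(2) rel_minus[OF rel_compose[OF B(2) A(2)] rel_sid]])
    ultimately show "fred Pu A"
      using K1(1) K2(1) by (intro atkinson_sufficient[OF cproj_Pu TTs_corner[OF A(1)] TTs_corner[OF B(1)]]) auto
  next
    assume "fred Pu A"
    then obtain B where B: "B \<in> TTs" "cpt ((A o\<^sub>L B) - Pu)" "cpt ((B o\<^sub>L A) - Pu)" using regularizer[OF A(1)] by blast
    have BQ: "B \<in> QD" using B(1) by (simp add: TTs_def TT_def)
    define Bs where "Bs = (\<lambda>n. toop (compr B n))"
    have rB: "rel Bs B" unfolding Bs_def by (rule rel_toop_comp(1)[OF BQ])
    have "Bs \<in> Salg lam" by (rule TT_Salg[OF _ rB]) (use B(1) in \<open>simp add: TTs_def\<close>)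
    moreover have "sminus (scomp As Bs) sid \<in> Jideal lam"
      unfolding Jideal_iff using rel_minus[OF rel_compose[OF A(2) rB] rel_sid] B(2)
      by (intro exI[of _ "(A o\<^sub>L B) - Pu"] conjI corner_diff corner_compose corner_proj cproj_Pu TTs_corner A(1) B(1))
    moreover have "sminus (scomp Bs As) sid \<in> Jideal lam"
      unfolding Jideal_iff using rel_minus[OF rel_compose[OF rB A(2)] rel_sid] B(3)
      by (intro exI[of _ "(B o\<^sub>L A) - Pu"] conjI corner_diff corner_compose corner_proj cproj_Pu TTs_corner A(1) B(1))
    ultimately show "fred_seq lam As" using As unfolding fred_seq_def by blast
  qed
qed

section \<open>Asymptotics of the singular values\<close>

lemma onb_Pn_dim: assumes "onb (ran (Pn n)) v d" shows "n \<le> d"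
proof -
  \<comment> \<open>One unit vector from each gap between consecutive model spaces; these are
    orthonormal. The bound ensures that the singular value number \<open>k + 1\<close> exists for
    \<open>n > k\<close>.\<close>
  have "\<exists>y. norm y = 1 \<and> Pn (Suc i) y = y \<and> Pn i y = 0" for i by (rule Pn_gap)
  then obtain y where y: "\<And>i. norm (y i) = 1" "\<And>i. Pn (Suc i) (y i) = y i" "\<And>i. Pn i (y i) = 0" by metis
  have up: "Pn j (y i) = y i" if "i < j" for i j using Pn_Pm(1)[of "Suc i" j "y i"] y(2) that by simp
  have 0: "cin (y i) (y j) = 0" if "i < j" for i j
    using cprojD(7)[OF cproj_Pn, of j "y i" "y j"] up[OF that] y(3) by simp
  have "orthonormal y n"
    unfolding orthonormal_def
  proof (intro allI impI)
    fix i j assume "i < n" "j < n"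
    consider "i < j" | "i = j" | "j < i" by linarith
    then show "cin (y i) (y j) = (if i = j then 1 else 0)"
    proof cases
      case 3
      then show ?thesis using 0[of j i] cin_commute[of "y i" "y j"] by simp
    qed (use 0 y(1) in \<open>auto simp: cin_self\<close>)
  qed
  then have on: "orthonormal y n" .
  have "card ((\<lambda>i. seq (y i)) ` {..<n}) \<le> card ((\<lambda>i. seq (v i)) ` {..<d})"
    by (rule cv.independent_span_bound[THEN conjunct2])
      (use orthonormal_independent[OF on] onb_span[OF csub_ran[OF cprojD(1)[OF cproj_Pn]] assms] up in \<open>auto simp: ran_def\<close>)
  then show ?thesis
    using card_image[OF orthonormal_inj[OF on]] card_image_le[of "{..<d}" "\<lambda>i. seq (v i)"] by simp
qed

text \<open>The min-max bound is used with the \<open>k\<close> kernel vectors themselves as the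
  conditions: a vector of \<open>ran (Pn n)\<close> orthogonal to them is a vector of
  \<open>ran Pu\<close> off the kernel of \<open>A\<close>, where \<open>A\<close> is bounded below,
  and \<open>OP As n\<close> is close to \<open>A\<close> there.\<close>

lemma sval_liminf:
  assumes A: "A \<in> TTs" "rel As A" and f: "fred Pu A" and v: "onb (kerP Pu A) v k"
  shows "liminf (\<lambda>n. ereal (sval (K2 (bpartial lam n)) (As n) (k + 1))) > 0"
proof -
  have Ac: "corner Pu A" by (rule TTs_corner[OF A(1)])
  have b: "bops As" and AQ: "cm A \<longlonglongrightarrow> 0" using A(2) by (auto simp: rel_def QD_def)
  obtain B where B: "B \<in> TTs" "A o\<^sub>L ((B o\<^sub>L A) - Pu) = 0" using regularizer[OF A(1) f] by blast
  \<comment> \<open>For \<open>x\<close> orthogonal to the kernel \<open>norm x\<close> is at most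
    \<open>norm (B (A x))\<close>, because \<open>B (A x) - x\<close> lies in the kernel; the
    summand 1 keeps the constant meaningful for \<open>B = 0\<close>.\<close>
  define c where "c = inverse (norm B + 1)"
  have c: "c > 0" by (simp add: c_def add_nonneg_pos)
  have low: "c * norm x \<le> norm (A x)" if x: "x \<in> ran Pu" "\<And>i. i < k \<Longrightarrow> cin x (v i) = 0" for x
  proof -
    have "((B o\<^sub>L A) - Pu) x \<in> kerP Pu A"
    proof -
      have "corner Pu ((B o\<^sub>L A) - Pu)" by (intro corner_diff corner_compose corner_proj cproj_Pu TTs_corner B(1) A(1))
      moreover have "A (((B o\<^sub>L A) - Pu) x) = 0" using B(2) by (metis blinfun_apply_blinfun_compose blinfun.zero_left)
      ultimately show ?thesis using cornerD(6) by (simp add: kerP_def)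
    qed
    then have F: "B (A x) - x \<in> kerP Pu A" using x(1) by (simp add: blinfun.diff_left ran_def)
    have "cin (B (A x) - x) x = cin (\<Sum>i<k. cs (cin (B (A x) - x) (v i)) (v i)) x" using onbD(3)[OF v F] by simp
    also have "\<dots> = 0" using x(2) cin_commute[of "v _" x] by (simp add: cin_sum_left cin_cs_left)
    finally have "cin x x = cin (B (A x)) x" by (simp add: cin_diff_left)
    then have "x \<bullet> x = B (A x) \<bullet> x" by (metis Re_cin)
    also have "\<dots> \<le> norm (B (A x)) * norm x" by (rule norm_cauchy_schwarz)
    finally have "norm x \<le> norm (B (A x))" by (intro norm_le_of_inner_le) auto
    also have "\<dots> \<le> norm B * norm (A x)" by (rule norm_blinfun)
    also have "\<dots> \<le> (norm B + 1) * norm (A x)" by (intro mult_right_mono) auto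
    finally show ?thesis unfolding c_def
      by (metis add_nonneg_pos divide_inverse_commute less_numeral_extra(1) mult.commute norm_ge_zero pos_divide_le_eq)
  qed
  \<comment> \<open>The commutator and the null part may each cost \<open>c / 4\<close>, so half of
    \<open>c\<close> is left.\<close>
  have ev1: "\<forall>\<^sub>F n in sequentially. norm (cm A n) < c / 4"
    using tendsto_norm_zero[OF AQ] c by (intro order_tendstoD(2)[of _ 0]) auto
  have ev2: "\<forall>\<^sub>F n in sequentially. norm (OP As n - compr A n) < c / 4"
    using A(2) c unfolding rel_def by (intro order_tendstoD(2)[of _ 0] tendsto_norm_zero) auto
  have "\<forall>\<^sub>F n in sequentially. ereal (c / 2) \<le> ereal (sval (K2 (bpartial lam n)) (As n) (k + 1))"
    using ev1 ev2 eventually_gt_at_top[of k]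
  proof eventually_elim
    case (elim n)
    obtain w d where w: "onb (ran (Pn n)) w d" using onb_Pn by blast
    have "is_bop (K2 (bpartial lam n)) (As n)" using b by (simp add: bops_def)
    then obtain v' \<mu> where ss: "singular_system (Pn n) (K2 (bpartial lam n)) (As n) v' \<mu> d"
      using singular_system_exists[OF cproj_Pn K2_n _ w] by blast
    interpret ss: singular_system "Pn n" "K2 (bpartial lam n)" "As n" v' \<mu> d by (rule ss)
    have kd: "k < d" using elim(3) onb_Pn_dim[OF w] by simp
    have "c / 2 \<le> sval (K2 (bpartial lam n)) (As n) (Suc k)"
    proof (rule ss.sval_ge[OF kd])
      fix x assume x: "x \<in> ran (Pn n)" "\<And>i. i < k \<Longrightarrow> cin x (v i) = 0"
      have Px: "Pn n x = x" using x(1) by (simp add: ran_def)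
      have "x \<in> ran Pu" using Pn_Pu(1)[of n x] Px by (simp add: ran_def)
      then have 1: "c * norm x \<le> norm (A x)" using low x(2) by blast
      have "A x = OP As n x - (OP As n - compr A n) x + cm A n x"
        by (simp add: blinfun.diff_left cm_apply Px)
      then have "norm (A x) \<le> norm (OP As n x) + norm ((OP As n - compr A n) x) + norm (cm A n x)"
        by (metis add_right_mono norm_triangle_ineq norm_triangle_ineq4 order_trans)
      moreover have "norm ((OP As n - compr A n) x) \<le> c / 4 * norm x"
        using elim(2) by (intro order_trans[OF norm_blinfun] mult_right_mono) auto
      moreover have "norm (cm A n x) \<le> c / 4 * norm x"
        using elim(1) by (intro order_trans[OF norm_blinfun] mult_right_mono) auto
      ultimately show "c / 2 * norm x \<le> norm (ofop (Pn n) (As n) x)" using 1 by (simp add: OP_def)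
    qed (use c in simp)
    then show ?case by simp
  qed
  then have "ereal (c / 2) \<le> liminf (\<lambda>n. ereal (sval (K2 (bpartial lam n)) (As n) (k + 1)))"
    by (rule Liminf_bounded)
  moreover have "0 < ereal (c / 2)" using c by simp
  ultimately show ?thesis by (rule less_le_trans[rotated])
qed

text \<open>The \<open>k\<close> kernel vectors, projected by \<open>Pn n\<close>, remain almost
  orthonormal while their images under \<open>As n\<close> tend to 0, so they are test vectors for
  the min-max bound. That bound is indexed from 0, hence \<open>k = Suc j\<close>.\<close>

lemma sval_limit_zero:
  assumes rel: "rel As A" and v: "onb (kerP Pu A) v k" and k: "k \<ge> 1"
  shows "(\<lambda>n. sval (K2 (bpartial lam n)) (As n) k) \<longlonglongrightarrow> 0"
proof -
  have b: "bops As" using rel by (auto simp: rel_def)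
  obtain j where j: "k = Suc j" using k by (cases k) auto
  have on: "orthonormal v k" by (rule onbD(1)[OF v])
  have vk: "A (v i) = 0" "Pu (v i) = v i" if "i < k" for i
    using onbD(2)[OF v that] by (auto simp: kerP_def ran_def)
  \<comment> \<open>\<open>\<eta>\<close> measures the loss by projecting, \<open>\<theta>\<close>
    the size of the images. Once \<open>\<eta> n < 1 / 2\<close>, a combination keeps at least half
    its norm, which gives the constant 1/4 for squares and the final bound
    \<open>2 * \<theta> n\<close>.\<close>
  define \<eta> where "\<eta> n = (\<Sum>i\<le>j. norm (v i - Pn n (v i)))" for n
  define \<theta> where "\<theta> n = (\<Sum>i\<le>j. norm (OP As n (v i)))" for n
  have "\<eta> \<longlonglongrightarrow> (\<Sum>i\<le>j. norm (v i - Pu (v i)))" unfolding \<eta>_def by (intro tendsto_intros Pn_limit)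
  then have \<eta>: "\<eta> \<longlonglongrightarrow> 0" using vk(2) by (simp add: j)
  have "\<theta> \<longlonglongrightarrow> (\<Sum>i\<le>j. norm (A (v i)))" unfolding \<theta>_def by (intro tendsto_intros rel_strong rel)
  then have \<theta>: "\<theta> \<longlonglongrightarrow> 0" using vk(1) by (simp add: j)
  have ev: "\<forall>\<^sub>F n in sequentially. \<eta> n < 1 / 2" by (rule order_tendstoD(2)[OF \<eta>]) simp
  have bnd: "\<forall>\<^sub>F n in sequentially. norm (sval (K2 (bpartial lam n)) (As n) k) \<le> 2 * \<theta> n"
    using ev eventually_gt_at_top[of k]
  proof eventually_elim
    case (elim n)
    obtain w d where w: "onb (ran (Pn n)) w d" using onb_Pn by blast
    have "is_bop (K2 (bpartial lam n)) (As n)" using b by (simp add: bops_def)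
    then obtain v' \<mu> where ss: "singular_system (Pn n) (K2 (bpartial lam n)) (As n) v' \<mu> d"
      using singular_system_exists[OF cproj_Pn K2_n _ w] by blast
    interpret ss: singular_system "Pn n" "K2 (bpartial lam n)" "As n" v' \<mu> d by (rule ss)
    have jd: "j < d" using elim(2) onb_Pn_dim[OF w] j by simp
    define s where "s c = sqrt (\<Sum>i\<le>j. (cmod (c i))\<^sup>2)" for c :: "nat \<Rightarrow> complex"
    have s2: "(s c)\<^sup>2 = (\<Sum>i\<le>j. (cmod (c i))\<^sup>2)" for c by (simp add: s_def sum_nonneg)
    have s0: "0 \<le> s c" for c by (simp add: s_def sum_nonneg)
    have cs: "cmod (c i) \<le> s c" if "i \<le> j" for c i
    proof -
      have "(cmod (c i))\<^sup>2 \<le> (s c)\<^sup>2" unfolding s2 using that by (intro member_le_sum) auto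
      then show ?thesis using s0[of c] by (simp add: power2_le_iff_abs_le)
    qed
    have comb: "norm (\<Sum>i\<le>j. cs (c i) (g i)) \<le> s c * (\<Sum>i\<le>j. norm (g i))" for c g
    proof -
      have "norm (\<Sum>i\<le>j. cs (c i) (g i)) \<le> (\<Sum>i\<le>j. cmod (c i) * norm (g i))"
        by (rule order_trans[OF norm_sum]) simp
      also have "\<dots> \<le> (\<Sum>i\<le>j. s c * norm (g i))" by (intro sum_mono mult_right_mono cs) auto
      finally show ?thesis by (simp add: sum_distrib_left)
    qed
    have "sval (K2 (bpartial lam n)) (As n) (Suc j) \<le> sqrt ((\<theta> n)\<^sup>2 / (1 / 4))"
    proof (rule ss.sval_le[OF jd, of "\<lambda>i. Pn n (v i)"])
      show "Pn n (v i) \<in> ran (Pn n)" for i by (rule cprojD(5)[OF cproj_Pn])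
      fix c :: "nat \<Rightarrow> complex"
      let ?x = "\<Sum>i\<le>j. cs (c i) (v i)" and ?y = "\<Sum>i\<le>j. cs (c i) (Pn n (v i))"
      have "norm ?x = s c"
      proof -
        have "(norm ?x)\<^sup>2 = (s c)\<^sup>2"
          using orthonormal_norm_sum[OF on, of c] unfolding s2 j by (simp add: lessThan_Suc_atMost)
        then show ?thesis using s0 by (simp add: power2_eq_iff_nonneg)
      qed
      moreover have "?x - ?y = (\<Sum>i\<le>j. cs (c i) (v i - Pn n (v i)))" by (simp add: cs_diff_right sum_subtractf)
      then have "norm (?x - ?y) \<le> s c * \<eta> n" unfolding \<eta>_def using comb by simp
      moreover have "s c * \<eta> n \<le> s c * (1 / 2)" using elim(1) s0 by (intro mult_left_mono) auto
      ultimately have "s c / 2 \<le> norm ?y" using norm_triangle_ineq2[of ?x ?y] norm_triangle_sub[of ?x ?y] by linarith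
      then have "(s c / 2)\<^sup>2 \<le> (norm ?y)\<^sup>2" using s0 by (intro power_mono) auto
      then show "1 / 4 * (\<Sum>i\<le>j. (cmod (c i))\<^sup>2) \<le> (norm ?y)\<^sup>2" unfolding s2[symmetric] by (simp add: power_divide)
      have "ofop (Pn n) (As n) ?y = (\<Sum>i\<le>j. cs (c i) (OP As n (v i)))"
        using clin_sum[OF cornerD(1)[OF corner_OP[OF b, of n]], where I = "{..j}" and c = c and f = "\<lambda>i. Pn n (v i)"] cornerD(5)[OF corner_OP[OF b, of n]]
        by (simp add: OP_def)
      then have "norm (ofop (Pn n) (As n) ?y) \<le> s c * \<theta> n" unfolding \<theta>_def using comb by simp
      then have "(norm (ofop (Pn n) (As n) ?y))\<^sup>2 \<le> (s c * \<theta> n)\<^sup>2" by (intro power_mono) auto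
      then show "(norm (ofop (Pn n) (As n) ?y))\<^sup>2 \<le> (\<theta> n)\<^sup>2 * (\<Sum>i\<le>j. (cmod (c i))\<^sup>2)"
        unfolding s2[symmetric] by (simp add: power_mult_distrib mult.commute)
    qed simp
    moreover have "sqrt ((\<theta> n)\<^sup>2 / (1 / 4)) = 2 * \<theta> n"
    proof (rule real_sqrt_unique)
      show "(2 * \<theta> n)\<^sup>2 = (\<theta> n)\<^sup>2 / (1 / 4)" by (simp add: power_mult_distrib)
      show "0 \<le> 2 * \<theta> n" by (simp add: \<theta>_def sum_nonneg)
    qed
    moreover have "0 \<le> sval (K2 (bpartial lam n)) (As n) (Suc j)"
      unfolding ss.sval_eq[OF jd] using ss.mu_eq[OF jd] by simp
    ultimately show ?case by (simp add: j)
  qed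
  have "(\<lambda>n. 2 * \<theta> n) \<longlonglongrightarrow> 0" using tendsto_mult_left[OF \<theta>, of 2] by simp
  then show ?thesis by (rule Lim_null_comparison[OF bnd])
qed

end

theorem theorem4p6:
  fixes lam :: "nat \<Rightarrow> complex" and As :: "nat \<Rightarrow> seqv \<Rightarrow> seqv"
  assumes "blaschke_seq lam"
    and "As \<in> Salg lam"
  shows "(fred_seq lam As \<longleftrightarrow> fredholm_op (K2 (bprod lam)) (slim lam As))
    \<and> (\<forall>k::nat. fredholm_op (K2 (bprod lam)) (slim lam As)
          \<and> cdim {x \<in> K2 (bprod lam). slim lam As x = 0} = k \<longrightarrow>
        liminf (\<lambda>n. ereal (sval (K2 (bpartial lam n)) (As n) (k + 1))) > 0
        \<and> (k \<ge> 1 \<longrightarrow> (\<lambda>n. sval (K2 (bpartial lam n)) (As n) k) \<longlonglongrightarrow> 0))"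
proof -
  interpret blaschke lam using assms(1) by unfold_locales
  obtain A where A: "A \<in> TTs" "rel As A" using Salg_rel[OF assms(2)] by blast
  show ?thesis
  proof (intro conjI allI impI; (elim conjE)?)
    show "fred_seq lam As \<longleftrightarrow> fredholm_op (K2 (bprod lam)) (slim lam As)" by (rule fred_seq_iff[OF assms(2)])
  next
    fix k
    assume F: "fredholm_op (K2 (bprod lam)) (slim lam As)"
      and dim: "cdim {x \<in> K2 (bprod lam). slim lam As x = 0} = k"
    have f: "fred Pu A" using F fredholm_iff[OF A(2)] by simp
    obtain v m where v: "onb (kerP Pu A) v m" using f by (auto simp: fred_def)
    have "m = k" using dim cdim_onb[OF csub_kerP[OF cproj_Pu TTs_corner[OF A(1)]] v] unfolding slim_kernel[OF A(2)] by simp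
    with v have v: "onb (kerP Pu A) v k" by simp
    show "liminf (\<lambda>n. ereal (sval (K2 (bpartial lam n)) (As n) (k + 1))) > 0"
      by (rule sval_liminf[OF A f v])
    show "(\<lambda>n. sval (K2 (bpartial lam n)) (As n) k) \<longlonglongrightarrow> 0" if "k \<ge> 1"
      by (rule sval_limit_zero[OF A(2) v that])
  qed
qed

end
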